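(* Let $\alpha\approx 1.763\ldots$ denote the root of $\alpha=\exp(1/\alpha)$. For all $\epsilon>0$ there exists $d_0$ such that for all $d>d_0$ and all integers $k\geq(\alpha+\epsilon)d$ the following holds: with probability $1-o(1)$ (as $n\to\infty$) over the choice of $G\sim G(n,d/n)$, the mixing time of the Glauber dynamics for proper $k$-colorings of $G$ is $O\left(n^{2+1/(\log d)}\right)$.
   Context: $G(n,d/n)$ is the Erdős–Rényi random graph on $n$ vertices in which each pair is an edge independently with probability $d/n$; $d$ is a constant independent of $n$. For a graph $G=(V,E)$, $\Omega$ is the set of proper vertex $k$-colorings of $G$ and $\pi$ the uniform distribution on $\Omega$. The (heat-bath) Glauber dynamics is the Markov chain $(X_t)$ on $\Omega$ which, from $X_t$, chooses a uniformly random vertex $v$ and a uniformly random color $c\in[k]\setminus X_t(N(v))$ (where $N(v)$ is the set of neighbors of $v$), sets $X_{t+1}(v)=c$ and $X_{t+1}(w)=X_t(w)$ for all $w\neq v$. The mixing time is the minimum number of steps $T$ such that, from the worst initial state $X_0$, the distribution of $X_T$ is within total variation distance $1/4$ of $\pi$. *)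

theory Defs
  imports "HOL-Analysis.Analysis" "HOL-Library.Extended_Nat"
begin

definition vertex_pairs :: "nat \<Rightarrow> nat set set" where
  "vertex_pairs n = {e. \<exists>u v. u < v \<and> v < n \<and> e = {u, v}}"

definition gnp_prob :: "nat \<Rightarrow> real \<Rightarrow> (nat set set \<Rightarrow> bool) \<Rightarrow> real" where
  "gnp_prob n p A =
     (\<Sum>E\<in>{E. E \<subseteq> vertex_pairs n \<and> A E}.
        p ^ card E * (1 - p) ^ (card (vertex_pairs n) - card E))"

definition nbrs :: "nat \<Rightarrow> nat set set \<Rightarrow> nat \<Rightarrow> nat set" where
  "nbrs n E v = {u. u < n \<and> u \<noteq> v \<and> {u, v} \<in> E}"

text \<open>Proper k-colorings with colors [k] = {0..<k}, as functions that are 0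
outside the vertex set (so that the state space is finite).\<close>

definition colorings :: "nat \<Rightarrow> nat set set \<Rightarrow> nat \<Rightarrow> (nat \<Rightarrow> nat) set" where
  "colorings n E k = {\<sigma>. (\<forall>v<n. \<sigma> v < k) \<and> (\<forall>v\<ge>n. \<sigma> v = 0) \<and>
       (\<forall>u<n. \<forall>v<n. u \<noteq> v \<and> {u, v} \<in> E \<longrightarrow> \<sigma> u \<noteq> \<sigma> v)}"

definition avail_colors :: "nat \<Rightarrow> nat set set \<Rightarrow> nat \<Rightarrow> (nat \<Rightarrow> nat) \<Rightarrow> nat \<Rightarrow> nat set" where
  "avail_colors n E k \<sigma> v = {c. c < k} - \<sigma> ` nbrs n E v"

definition glauber_P :: "nat \<Rightarrow> nat set set \<Rightarrow> nat \<Rightarrow> (nat \<Rightarrow> nat) \<Rightarrow> (nat \<Rightarrow> nat) \<Rightarrow> real" where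
  "glauber_P n E k \<sigma> \<tau> =
     (1 / real n) * (\<Sum>v<n.
        if (\<forall>w. w \<noteq> v \<longrightarrow> \<tau> w = \<sigma> w) \<and> \<tau> v \<in> avail_colors n E k \<sigma> v
        then 1 / real (card (avail_colors n E k \<sigma> v)) else 0)"

primrec glauber_dist ::
  "nat \<Rightarrow> nat set set \<Rightarrow> nat \<Rightarrow> nat \<Rightarrow> (nat \<Rightarrow> nat) \<Rightarrow> (nat \<Rightarrow> nat) \<Rightarrow> real" where
  "glauber_dist n E k 0 x0 \<tau> = (if \<tau> = x0 then 1 else 0)"
| "glauber_dist n E k (Suc t) x0 \<tau> =
     (\<Sum>\<sigma>\<in>colorings n E k. glauber_dist n E k t x0 \<sigma> * glauber_P n E k \<sigma> \<tau>)"

definition tv_to_uniform :: "nat \<Rightarrow> nat set set \<Rightarrow> nat \<Rightarrow> nat \<Rightarrow> (nat \<Rightarrow> nat) \<Rightarrow> real" where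
  "tv_to_uniform n E k T x0 =
     (1/2) * (\<Sum>\<tau>\<in>colorings n E k.
        \<bar>glauber_dist n E k T x0 \<tau> - 1 / real (card (colorings n E k))\<bar>)"

definition mixes_by :: "nat \<Rightarrow> nat set set \<Rightarrow> nat \<Rightarrow> nat \<Rightarrow> bool" where
  "mixes_by n E k T = (\<forall>x0\<in>colorings n E k. tv_to_uniform n E k T x0 \<le> 1/4)"

definition mixing_time :: "nat \<Rightarrow> nat set set \<Rightarrow> nat \<Rightarrow> enat" where
  "mixing_time n E k =
     (if \<exists>T. mixes_by n E k T then enat (LEAST T. mixes_by n E k T) else \<infinity>)"

end

theory Submission
  imports Defs "HOL-Real_Asymp.Real_Asymp"
begin


text \<open>
Call a vertex light if its degree is at most \<open>(1 + \<delta>) d\<close> with a small \<open>\<delta>\<close>, and big otherwise. Revealing colors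
one cluster of big vertices or one light vertex at a time bounds the total influence of a light vertex
by \<open>O(1)\<close> plus a weight that counts the degrees of the big vertices and discounts the light vertices of
a connected set. A first moment computation over rooted trees shows that this weight is at most
\<open>O(ln n / d)\<close> on all connected sets of \<open>G(n, d/n)\<close>, and that connected sets of non-negligible weight are
at most unicyclic. The influence bound gives spectral independence in the form of a decay of variance
when light vertices are frozen one after the other. Freezing all but a fraction \<open>exp (- sqrt d)\<close> of them
costs a factor \<open>n powr O(1 / sqrt d)\<close> and leaves components with \<open>O(ln n / sqrt d)\<close> light vertices, on
which a Poincare inequality follows by eliminating vertices one at a time. Altogether the Poincare constant is
\<open>n powr o(1 / ln d)\<close> and the Markov chain mixes in time \<open>n\<^sup>2\<close> times this factor.
\<close>

section \<open>Connected sets and superadditive weights\<close>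

text \<open>The obstacle is the unbounded maximum degree: a big vertex can have more than
  \<open>k\<close> neighbours, so neither its list nor its marginals can be controlled on their own.
  Big vertices therefore act only through the clusters they form, and their effect is charged to the
  degree weight \<open>gg\<close>, which the discounts of the light vertices offset. Cycles threaten
  this account, since one vertex might be charged along several paths. Relevant sets have at most
  one cycle, so at most two paths matter, and a factor 2 in \<open>val\<close> covers them. The
  constant \<alpha> comes from a single light vertex: a colour has probability at most about exp (D
  / k) / k, and D times this is below 1 exactly if k / D > \<alpha>. The scale \<open>sqrt d\<close>
  balances two costs: freezing with rate O(ln n / d) per logarithmic unit over exp (- sqrt d) loses
  an exponent O(1 / sqrt d), and each vertex of a remaining component costs a power of d, hence an
  exponent O(ln d / sqrt d). Both are below 1 / ln d. The factor \<open>n\<^sup>2\<close> is one n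
  for the update rate and one for the exponential size of the state space.\<close>

lemma sum_UN_le:
  fixes f :: "'b \<Rightarrow> real"
  assumes "finite I" "\<And>i. i \<in> I \<Longrightarrow> finite (A i)" "\<And>x. 0 \<le> f x"
  shows "sum f (\<Union>i\<in>I. A i) \<le> (\<Sum>i\<in>I. sum f (A i))"
  using assms(1,2)
proof (induction I rule: finite_induct)
  case (insert i I)
  have "sum f (A i \<union> (\<Union>i\<in>I. A i)) \<le> sum f (A i) + sum f (\<Union>i\<in>I. A i)"
    using insert assms(3) by (subst sum_Un) (auto intro!: sum_nonneg)
  then show ?case using insert by simp
qed simp

section \<open>Connected vertex sets and their number of independent cycles\<close>

locale sgraph =
  fixes V :: "'a set" and adj :: "'a \<Rightarrow> 'a \<Rightarrow> bool"
  assumes finV: "finite V"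
    and adj_sym: "adj u v \<Longrightarrow> adj v u"
    and adj_irrefl: "\<not> adj u u"
    and adj_V: "adj u v \<Longrightarrow> u \<in> V"
begin

definition Nb :: "'a \<Rightarrow> 'a set" where "Nb v = {u. adj v u}"

text \<open>Connectivity is phrased by cuts instead of paths: growing a set along a crossing edge,
  the induction used throughout, then needs only one instance of the definition.\<close>

definition conn :: "'a set \<Rightarrow> bool" where
  "conn W \<longleftrightarrow> W \<noteq> {} \<and> (\<forall>P. P \<subset> W \<longrightarrow> P \<noteq> {} \<longrightarrow> (\<exists>x\<in>P. \<exists>y\<in>W - P. adj x y))"

text \<open>Every edge inside \<open>W\<close> is counted twice, so \<open>excess\<close> is twice edges minus vertices.\<close>

definition double_edges :: "'a set \<Rightarrow> nat" where
  "double_edges W = card {p \<in> W \<times> W. adj (fst p) (snd p)}"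

definition excess :: "'a set \<Rightarrow> int" where
  "excess W = int (double_edges W) - 2 * int (card W)"

lemma adj_V2: "adj u v \<Longrightarrow> v \<in> V"
  using adj_V adj_sym by blast

lemma adj_commute: "adj u v \<longleftrightarrow> adj v u"
  using adj_sym by blast

lemma Nb_V: "Nb v \<subseteq> V"
  by (auto simp: Nb_def adj_V2)

lemma finite_Nb [simp]: "finite (Nb v)"
  using Nb_V finV finite_subset by blast

lemma in_Nb: "u \<in> Nb v \<longleftrightarrow> adj v u"
  by (simp add: Nb_def)

lemma conn_ne: "conn W \<Longrightarrow> W \<noteq> {}"
  by (simp add: conn_def)

lemma conn_edge:
  assumes "conn W" "P \<subseteq> W" "P \<noteq> {}" "P \<noteq> W"
  obtains x y where "x \<in> P" "y \<in> W" "y \<notin> P" "adj x y"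
  using assms unfolding conn_def by blast

lemma conn_single [simp]: "conn {v}"
  unfolding conn_def by blast

lemma conn_Un:
  assumes A: "conn A" and B: "conn B" and AB: "A \<inter> B \<noteq> {}"
  shows "conn (A \<union> B)"
  unfolding conn_def
proof (intro conjI allI impI)
  show "A \<union> B \<noteq> {}" using AB by blast
  fix P assume P: "P \<subset> A \<union> B" "P \<noteq> {}"
  show "\<exists>x\<in>P. \<exists>y\<in>A \<union> B - P. adj x y"
  proof (cases "P \<inter> A \<noteq> {} \<and> P \<inter> A \<noteq> A")
    case True
    then obtain x y where "x \<in> P \<inter> A" "y \<in> A" "y \<notin> P \<inter> A" "adj x y"
      using conn_edge[OF A, of "P \<inter> A"] by blast
    then show ?thesis by blast
  next
    case nA: False
    show ?thesis
    proof (cases "P \<inter> B \<noteq> {} \<and> P \<inter> B \<noteq> B")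
      case True
      then obtain x y where "x \<in> P \<inter> B" "y \<in> B" "y \<notin> P \<inter> B" "adj x y"
        using conn_edge[OF B, of "P \<inter> B"] by blast
      then show ?thesis by blast
    next
      case False
      with nA AB P show ?thesis by blast
    qed
  qed
qed

lemma conn_edge_pair: "adj x y \<Longrightarrow> conn {x, y}"
  unfolding conn_def
proof (intro conjI allI impI)
  assume a: "adj x y"
  fix P assume "P \<subset> {x, y}" "P \<noteq> {}"
  then have "P = {x} \<or> P = {y}" by blast
  then show "\<exists>u\<in>P. \<exists>v\<in>{x, y} - P. adj u v"
    using a adj_sym adj_irrefl by blast
qed auto

lemma conn_Un_edge:
  assumes "conn A" "conn B" "x \<in> A" "y \<in> B" "adj x y"
  shows "conn (A \<union> B)"
proof -
  have "conn (A \<union> {x, y})" by (rule conn_Un) (use assms conn_edge_pair in auto)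
  then have "conn ((A \<union> {x, y}) \<union> B)" by (rule conn_Un) (use assms in auto)
  then show ?thesis using assms by (simp add: insert_absorb)
qed

lemma conn_insert: "conn A \<Longrightarrow> x \<in> A \<Longrightarrow> adj x y \<Longrightarrow> conn (insert y A)"
  using conn_Un_edge[of A "{y}" x y] by simp

lemma double_edges_Un:
  assumes "finite A" "finite B" "A \<inter> B = {}"
  shows "double_edges (A \<union> B) = double_edges A + double_edges B + 2 * card {p \<in> A \<times> B. adj (fst p) (snd p)}"
proof -
  let ?S = "\<lambda>A B. {p \<in> A \<times> B. adj (fst p) (snd p)}"
  have f: "finite (?S C D)" if "finite C" "finite D" for C D using that by simp
  have sw: "card (?S B A) = card (?S A B)"
  proof -
    have "?S B A = prod.swap ` ?S A B" using adj_sym by force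
    then show ?thesis by (simp add: card_image)
  qed
  have "?S (A \<union> B) (A \<union> B) = (?S A A \<union> ?S B B) \<union> (?S A B \<union> ?S B A)" by auto
  moreover have "card ((?S A A \<union> ?S B B) \<union> (?S A B \<union> ?S B A))
      = card (?S A A \<union> ?S B B) + card (?S A B \<union> ?S B A)"
    by (rule card_Un_disjoint) (use assms f in auto)
  moreover have "card (?S A A \<union> ?S B B) = card (?S A A) + card (?S B B)"
    by (rule card_Un_disjoint) (use assms f in auto)
  moreover have "card (?S A B \<union> ?S B A) = card (?S A B) + card (?S B A)"
    by (rule card_Un_disjoint) (use assms f in auto)
  ultimately show ?thesis unfolding double_edges_def using sw by simp
qed

lemma double_edges_single [simp]: "double_edges {v} = 0"
  by (simp add: double_edges_def adj_irrefl)

lemma excess_single [simp]: "excess {v} = -2"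
  by (simp add: excess_def)

lemma excess_Un:
  assumes "finite A" "finite B" "A \<inter> B = {}"
  shows "excess (A \<union> B) = excess A + excess B + 2 * int (card {p \<in> A \<times> B. adj (fst p) (snd p)})"
  using double_edges_Un[OF assms] card_Un_disjoint[OF assms] by (simp add: excess_def)

text \<open>A connected superset is reached by adding one vertex at a time along an edge. Each
  addition costs 2 for the vertex and gains at least 2 for the edge, which is counted in both
  orders.\<close>

lemma excess_mono:
  assumes "conn W" "finite W" "P \<subseteq> W" "P \<noteq> {}"
  shows "excess P \<le> excess W"
  using assms(3,4)
proof (induction "card (W - P)" arbitrary: P)
  case 0
  then have "W - P = {}" using assms(2) by simp
  then show ?case using 0 by simp
next
  case (Suc m)
  then have "P \<noteq> W" by auto
  then obtain x y where xy: "x \<in> P" "y \<in> W" "y \<notin> P" "adj x y"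
    using conn_edge[OF assms(1)] Suc by metis
  have fP: "finite P" using Suc assms(2) finite_subset by blast
  have "W - insert y P = (W - P) - {y}" by blast
  then have "card (W - insert y P) = m" using Suc xy assms(2) by simp
  then have IH: "excess (insert y P) \<le> excess W" using Suc xy by blast
  have "(x, y) \<in> {p \<in> P \<times> {y}. adj (fst p) (snd p)}" using xy by simp
  then have "card {p \<in> P \<times> {y}. adj (fst p) (snd p)} \<noteq> 0" using fP by auto
  then have "excess P \<le> excess (P \<union> {y})"
    using excess_Un[OF fP, of "{y}"] xy by simp
  then show ?case using IH by simp
qed

text \<open>The chain of \<open>excess_mono\<close> starts at a single vertex. For connected sets
  the value -2 means a tree, 0 one cycle, and a positive value at least two independent
  cycles.\<close>

lemma excess_ge: "conn W \<Longrightarrow> finite W \<Longrightarrow> -2 \<le> excess W"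
  using excess_mono[of W "{SOME x. x \<in> W}"] conn_ne[of W] by (simp add: some_in_eq)

lemma conn_UN:
  assumes "finite I" "conn K"
    and "\<And>i. i \<in> I \<Longrightarrow> conn (T i)"
    and "\<And>i. i \<in> I \<Longrightarrow> fst (e i) \<in> K \<and> snd (e i) \<in> T i \<and> adj (fst (e i)) (snd (e i))"
  shows "conn (K \<union> (\<Union>i\<in>I. T i))"
  using assms
proof (induction I rule: finite_induct)
  case (insert i I)
  have "conn ((K \<union> (\<Union>i\<in>I. T i)) \<union> T i)"
    by (rule conn_Un_edge[of _ _ "fst (e i)" "snd (e i)"]) (use insert in auto)
  then show ?case by (simp add: Un_ac)
qed simp

text \<open>Each connecting edge adds 2 to the excess; injectivity of \<open>e\<close> guarantees
  that the edges are distinct.\<close>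

lemma excess_connect:
  assumes "conn K" "finite K" "finite I" "I \<noteq> {}" "K \<inter> Y = {}" "conn Y" "finite Y"
    and e: "\<And>i. i \<in> I \<Longrightarrow> fst (e i) \<in> K \<and> snd (e i) \<in> Y \<and> adj (fst (e i)) (snd (e i))"
    and inj: "inj_on e I"
  shows "excess (K \<union> Y) \<ge> excess K + excess Y + 2 * int (card I)"
proof -
  let ?S = "{p \<in> K \<times> Y. adj (fst p) (snd p)}"
  have "e ` I \<subseteq> ?S" using e by (auto simp: mem_Times_iff)
  then have "card (e ` I) \<le> card ?S" using assms by (intro card_mono) auto
  then have "card I \<le> card ?S" by (simp add: card_image inj)
  then show ?thesis using excess_Un[of K Y] assms by simp
qed

end

section \<open>Superadditivity of the weight that charges degrees against light vertices\<close>

locale scored_graph = sgraph +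
  fixes gg ll :: "'a \<Rightarrow> real"
  assumes gg_nonneg: "0 \<le> gg v" and ll_nonneg: "0 \<le> ll v"
    and few_cycles: "W \<subseteq> V \<Longrightarrow> conn W \<Longrightarrow> -10 \<le> 4 * sum gg W - sum ll W \<Longrightarrow> excess W \<le> 0"
begin

text \<open>Doubling \<open>gg\<close> on components with a cycle pays for gluing along several edges, which makes
\<open>val\<close> superadditive.\<close>

definition val :: "'a set \<Rightarrow> real" where
  "val W = (if 0 \<le> excess W then 2 else 1) * sum gg W - sum ll W"

lemma val_le_score: "val W \<le> 4 * sum gg W - sum ll W"
proof -
  have "sum gg W \<ge> 0" by (simp add: sum_nonneg gg_nonneg)
  then show ?thesis by (simp add: val_def)
qed

lemma val_le_double: "val W \<le> 2 * sum gg W - sum ll W"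
proof -
  have "sum gg W \<ge> 0" by (simp add: sum_nonneg gg_nonneg)
  then show ?thesis by (simp add: val_def)
qed

lemma val_ge: "sum gg W - sum ll W \<le> val W"
proof -
  have "sum gg W \<ge> 0" by (simp add: sum_nonneg gg_nonneg)
  then show ?thesis by (simp add: val_def)
qed

text \<open>The sets \<open>T i\<close> may overlap, so the weight of a vertex can be counted
  several times on the left. All sets through a vertex \<open>x\<close> unite to a connected
  \<open>Y\<close> that is joined to \<open>K\<close> by as many edges as there are such sets, and
  every edge beyond the first closes a cycle. As the union has at most one cycle, the multiplicity
  is at most 2, and in that case the factor of the union has itself become 2. The discounts
  \<open>ll\<close> only help, since a vertex is discounted once in the union and at least once in
  the parts.\<close>

lemma val_superadditive:
  assumes K: "conn K" "K \<subseteq> V" "-1 \<le> sum gg K - sum ll K"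
    and I: "finite I"
    and T: "\<And>i. i \<in> I \<Longrightarrow> conn (T i) \<and> T i \<subseteq> V \<and> T i \<inter> K = {} \<and> 0 \<le> val (T i)"
    and e: "\<And>i. i \<in> I \<Longrightarrow> fst (e i) \<in> K \<and> snd (e i) \<in> T i \<and> adj (fst (e i)) (snd (e i))"
    and inj: "inj_on e I"
  shows "sum gg K - sum ll K + (\<Sum>i\<in>I. val (T i)) \<le> val (K \<union> (\<Union>i\<in>I. T i))"
  using I T e inj
proof (induction I rule: finite_induct)
  case empty
  show ?case by (simp add: val_ge)
next
  case (insert j I)
  define T0 where "T0 = K \<union> (\<Union>i\<in>I. T i)"
  define TT where "TT = K \<union> (\<Union>i\<in>insert j I. T i)"
  let ?I = "insert j I"
  have fK: "finite K" using K(2) finV finite_subset by blast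
  have fT: "finite (T i)" if "i \<in> ?I" for i using insert.prems(1)[OF that] finV finite_subset by blast
  have TTeq: "TT = T0 \<union> T j" by (auto simp: TT_def T0_def)
  have fI: "finite ?I" using insert by simp
  have cTT: "conn TT" unfolding TT_def
    by (rule conn_UN[OF fI K(1), of T e]) (use insert.prems in auto)
  have TTV: "TT \<subseteq> V" unfolding TT_def using K insert.prems by blast
  have fTT: "finite TT" using TTV finV finite_subset by blast
  \<comment> \<open>The induction serves only to show that the whole union still has score at least
    -10, so that \<open>few_cycles\<close> applies to it. The inequality is then proved for all
    indices at once.\<close>
  have IH: "sum gg K - sum ll K + (\<Sum>i\<in>I. val (T i)) \<le> val T0"
    unfolding T0_def by (rule insert.IH) (use insert.prems in \<open>auto simp: inj_on_def\<close>)
  have fT0: "finite T0" using TTeq fTT by simp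
  have sumI: "0 \<le> (\<Sum>i\<in>I. val (T i))" using insert.prems by (intro sum_nonneg) auto
  have gT0: "sum gg T0 \<le> sum gg TT" and gTj: "sum gg (T j) \<le> sum gg TT"
    using fTT TTeq gg_nonneg by (auto intro!: sum_mono2)
  have "sum ll TT + sum ll (T0 \<inter> T j) = sum ll T0 + sum ll (T j)"
    unfolding TTeq using sum.union_inter[OF fT0 fT[of j]] by simp
  moreover have "sum ll (T0 \<inter> T j) \<ge> 0" by (simp add: sum_nonneg ll_nonneg)
  ultimately have lTT: "sum ll TT \<le> sum ll T0 + sum ll (T j)" by linarith
  have vj: "0 \<le> val (T j)" using insert.prems by auto
  have "-1 \<le> val T0" using IH sumI K(3) by linarith
  then have "-10 \<le> 4 * sum gg TT - sum ll TT"
    using val_le_double[of T0] val_le_double[of "T j"] vj gT0 gTj lTT by linarith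
  then have exTT: "excess TT \<le> 0" using few_cycles[OF TTV cTT] by blast
  define m where "m W = (if 0 \<le> excess W then 2 else 1::real)" for W
  have key: "(\<Sum>i\<in>{i\<in>?I. x \<in> T i}. m (T i)) \<le> m TT" if xK: "x \<in> TT - K" for x
  proof -
    define Ix where "Ix = {i\<in>?I. x \<in> T i}"
    define Y where "Y = (\<Union>i\<in>Ix. T i)"
    have fIx: "finite Ix" using fI by (simp add: Ix_def)
    have Ixne: "Ix \<noteq> {}" using xK by (auto simp: Ix_def TT_def)
    then obtain i0 where i0: "i0 \<in> Ix" by blast
    have i0T: "i0 \<in> ?I" "x \<in> T i0" using i0 by (auto simp: Ix_def)
    have cY: "conn Y"
    proof -
      have cI: "conn (T i) \<and> x \<in> T i" if "i \<in> Ix" for i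
        using that insert.prems(1) by (auto simp: Ix_def)
      have "J \<subseteq> Ix \<longrightarrow> conn (T i0 \<union> (\<Union>i\<in>J. T i))" if "finite J" for J using that
      proof (induction J rule: finite_induct)
        case empty then show ?case using cI[OF i0] by simp
      next
        case (insert i J)
        show ?case
        proof
          assume "insert i J \<subseteq> Ix"
          then have "conn ((T i0 \<union> (\<Union>i\<in>J. T i)) \<union> T i)"
            using insert.IH cI[of i] cI[OF i0] conn_Un[of "T i0 \<union> (\<Union>i\<in>J. T i)" "T i"] by blast
          then show "conn (T i0 \<union> (\<Union>i\<in>insert i J. T i))" by (simp add: Un_ac)
        qed
      qed
      from this[OF fIx] have "conn (T i0 \<union> Y)" by (simp add: Y_def)
      moreover have "T i0 \<union> Y = Y" using i0 by (auto simp: Y_def)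
      ultimately show ?thesis by simp
    qed
    have YV: "Y \<subseteq> V" and YK: "K \<inter> Y = {}" and YTT: "Y \<subseteq> TT"
      using insert.prems(1) by (auto simp: Y_def Ix_def TT_def)
    have fY: "finite Y" using YV finV finite_subset by blast
    have exKY: "excess (K \<union> Y) \<ge> excess K + excess Y + 2 * int (card Ix)"
      by (rule excess_connect[OF K(1) fK fIx Ixne YK cY fY, of e])
         (use insert.prems(2,3) in \<open>auto simp: Y_def Ix_def inj_on_def\<close>)
    have "excess (K \<union> Y) \<le> excess TT"
      by (rule excess_mono[OF cTT fTT]) (use YTT K conn_ne in \<open>auto simp: TT_def\<close>)
    \<comment> \<open>Since \<open>K\<close> has excess at least -2, this bounds the number of sets
      through \<open>x\<close>: one if the union is a tree, at most two otherwise, and two only if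
      \<open>Y\<close> is a tree.\<close>
    with exKY excess_ge[OF K(1) fK] have A: "excess Y + 2 * int (card Ix) - 2 \<le> excess TT" by linarith
    have B: "excess (T i) \<le> excess Y" if "i \<in> Ix" for i
      by (rule excess_mono[OF cY fY]) (use that in \<open>auto simp: Y_def Ix_def\<close>)
    have C: "-2 \<le> excess Y" using excess_ge[OF cY fY] .
    have c1: "card Ix \<ge> 1" using fIx Ixne by (simp add: Suc_leI card_gt_0_iff)
    have "(\<Sum>i\<in>Ix. m (T i)) \<le> m TT"
    proof (cases "excess TT < 0")
      case True
      then have "card Ix = 1" using A C c1 by linarith
      then obtain i where i: "Ix = {i}" by (auto simp: card_1_singleton_iff)
      then have "excess (T i) < 0" using A B[of i] True \<open>card Ix = 1\<close> by simp
      then show ?thesis using i True by (simp add: m_def)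
    next
      case False
      have "card Ix \<le> 2" using A C exTT by linarith
      then consider "card Ix = 1" | "card Ix = 2" using c1 by linarith
      then show ?thesis
      proof cases
        case 1
        then obtain i where i: "Ix = {i}" by (auto simp: card_1_singleton_iff)
        then show ?thesis using False by (simp add: m_def)
      next
        case 2
        then have "m (T i) = 1" if "i \<in> Ix" for i using A B[OF that] exTT by (simp add: m_def)
        then show ?thesis using 2 False by (simp add: m_def)
      qed
    qed
    then show ?thesis by (simp add: Ix_def)
  qed
  have m1: "1 \<le> m W" for W by (simp add: m_def)
  have "sum gg K + (\<Sum>i\<in>?I. m (T i) * sum gg (T i)) \<le> m TT * sum gg TT"
  proof -
    \<comment> \<open>Exchange of summation: each vertex outside \<open>K\<close> is charged by the
      sets that contain it, and \<open>key\<close> bounds this charge.\<close>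
    have "(\<Sum>i\<in>?I. m (T i) * sum gg (T i)) = (\<Sum>i\<in>?I. \<Sum>x\<in>TT - K. if x \<in> T i then m (T i) * gg x else 0)"
    proof (rule sum.cong[OF refl])
      fix i assume i: "i \<in> ?I"
      have "(TT - K) \<inter> T i = T i" using insert.prems(1)[OF i] i by (auto simp: TT_def)
      then show "m (T i) * sum gg (T i) = (\<Sum>x\<in>TT - K. if x \<in> T i then m (T i) * gg x else 0)"
        using fTT by (simp add: sum_distrib_left sum.If_cases Int_def)
    qed
    also have "\<dots> = (\<Sum>x\<in>TT - K. \<Sum>i\<in>?I. if x \<in> T i then m (T i) * gg x else 0)"
      by (rule sum.swap)
    also have "\<dots> = (\<Sum>x\<in>TT - K. (\<Sum>i\<in>{i\<in>?I. x \<in> T i}. m (T i)) * gg x)"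
      using fI by (intro sum.cong refl) (simp add: sum.inter_filter[symmetric] sum_distrib_right del: sum.insert)
    also have "\<dots> \<le> (\<Sum>x\<in>TT - K. m TT * gg x)"
      by (intro sum_mono mult_right_mono key gg_nonneg) auto
    finally have "(\<Sum>i\<in>?I. m (T i) * sum gg (T i)) \<le> m TT * sum gg (TT - K)"
      by (simp add: sum_distrib_left)
    moreover have "sum gg TT = sum gg (TT - K) + sum gg K"
      using fTT by (subst sum.subset_diff[of K TT]) (auto simp: TT_def)
    moreover have "sum gg K \<le> m TT * sum gg K"
      using mult_right_mono[OF m1[of TT], of "sum gg K"] by (simp add: sum_nonneg gg_nonneg)
    ultimately show ?thesis by (simp add: distrib_left)
  qed
  moreover have "sum ll TT \<le> sum ll K + (\<Sum>i\<in>?I. sum ll (T i))"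
  proof -
    have "sum ll (\<Union>i\<in>?I. T i) \<le> (\<Sum>i\<in>?I. sum ll (T i))"
      using fI fT ll_nonneg by (intro sum_UN_le) auto
    moreover have "sum ll TT \<le> sum ll K + sum ll (\<Union>i\<in>?I. T i)"
      unfolding TT_def using fK fI fT ll_nonneg
      by (subst sum_Un) (auto intro!: sum_nonneg)
    ultimately show ?thesis by linarith
  qed
  ultimately have "sum gg K - sum ll K + (\<Sum>i\<in>?I. val (T i)) \<le> val TT"
    unfolding val_def m_def by (simp only: sum_subtractf)
  then show ?case by (simp only: TT_def)
qed

end

section \<open>List colorings\<close>

definition merge :: "'a set \<Rightarrow> ('a \<Rightarrow> nat) \<Rightarrow> ('a \<Rightarrow> nat) \<Rightarrow> 'a \<Rightarrow> nat" where
  "merge K \<kappa> \<sigma> = (\<lambda>v. if v \<in> K then \<kappa> v else \<sigma> v)"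

definition restr :: "'a set \<Rightarrow> ('a \<Rightarrow> nat) \<Rightarrow> 'a \<Rightarrow> nat" where
  "restr K \<sigma> = (\<lambda>v. if v \<in> K then \<sigma> v else 0)"

text \<open>From \<open>1 / (1 - x) \<le> exp (x / (1 - x))\<close>. The bound on \<open>x\<close>
  turns the exponent into \<open>(1 + 1 / a) * x\<close>, so the error against exp (- x) vanishes as
  \<open>a\<close> grows.\<close>

lemma one_minus_ge_exp:
  assumes "(x::real) \<ge> 0" "x \<le> 1 / (real a + 1)" "a \<ge> 1"
  shows "exp (- (1 + 1 / real a) * x) \<le> 1 - x"
proof -
  have "1 / (real a + 1) \<le> 1 / 2" using assms(3) by (intro divide_left_mono) auto
  then have x1: "x < 1" using assms(2) by linarith
  have "1 / (1 - x) = 1 + x / (1 - x)" using x1 by (simp add: field_simps)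
  also have "\<dots> \<le> exp (x / (1 - x))" by (rule exp_ge_add_one_self)
  finally have "1 / (1 - x) \<le> exp (x / (1 - x))" .
  then have "exp (- (x / (1 - x))) \<le> 1 - x"
    using x1 by (subst exp_minus, subst inverse_eq_divide) (simp add: pos_divide_le_eq mult.commute)
  moreover have le: "x / (1 - x) \<le> (1 + 1 / real a) * x"
  proof -
    have "x * (real a + 1) \<le> 1" using assms(2) by (simp add: pos_le_divide_eq)
    then have "1 \<le> (1 + 1 / real a) * (1 - x)" using assms(3) by (simp add: field_simps)
    then have "x * 1 \<le> x * ((1 + 1 / real a) * (1 - x))" using assms(1) by (intro mult_left_mono)
    then show ?thesis using x1 by (simp add: pos_divide_le_eq mult_ac)
  qed
  have "exp (- (1 + 1 / real a) * x) \<le> exp (- (x / (1 - x)))" using le by (simp only: exp_le_cancel_iff mult_minus_left neg_le_iff_le)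
  ultimately show ?thesis by linarith
qed

text \<open>Jensen's inequality, obtained from the tangent line of the exponential at the mean
  \<open>t\<close>.\<close>

lemma sum_exp_ge:
  assumes "finite C" "C \<noteq> {}"
  shows "real (card C) * exp (- (sum S C / real (card C))) \<le> (\<Sum>c\<in>C. exp (- (S c :: real)))"
proof -
  define t where "t = sum S C / real (card C)"
  have c: "real (card C) > 0" using assms by (simp add: card_gt_0_iff)
  have "exp (- t) * (1 - (S c - t)) \<le> exp (- S c)" for c
  proof -
    have "1 + (t - S c) \<le> exp (t - S c)" by (rule exp_ge_add_one_self)
    then have "exp (-t) * (1 + (t - S c)) \<le> exp (-t) * exp (t - S c)" by (intro mult_left_mono) auto
    moreover have "exp (-t) * exp (t - S c) = exp (- S c)" by (simp flip: exp_add)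
    moreover have "1 + (t - S c) = 1 - (S c - t)" by simp
    ultimately show ?thesis by metis
  qed
  then have "(\<Sum>c\<in>C. exp (- t) * (1 - (S c - t))) \<le> (\<Sum>c\<in>C. exp (- S c))" by (intro sum_mono)
  moreover have "(\<Sum>c\<in>C. exp (- t) * (1 - (S c - t))) = exp (-t) * (real (card C) - (sum S C - real (card C) * t))"
    by (subst sum_distrib_left[symmetric]) (simp add: sum_subtractf)
  moreover have tc: "sum S C = real (card C) * t" using c by (simp add: t_def)
  ultimately have "exp (-t) * real (card C) \<le> (\<Sum>c\<in>C. exp (- S c))" by simp
  then show ?thesis by (simp add: t_def mult.commute)
qed

context sgraph
begin

definition lcol :: "'a set \<Rightarrow> ('a \<Rightarrow> nat set) \<Rightarrow> ('a \<Rightarrow> nat) set" where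
  "lcol X L = {\<sigma>. (\<forall>v\<in>X. \<sigma> v \<in> L v) \<and> (\<forall>v. v \<notin> X \<longrightarrow> \<sigma> v = 0) \<and>
     (\<forall>u\<in>X. \<forall>v\<in>X. adj u v \<longrightarrow> \<sigma> u \<noteq> \<sigma> v)}"

definition cut :: "('a \<Rightarrow> nat set) \<Rightarrow> ('a \<Rightarrow> nat) \<Rightarrow> 'a set \<Rightarrow> 'a \<Rightarrow> nat set" where
  "cut L \<kappa> K = (\<lambda>u. L u - \<kappa> ` (Nb u \<inter> K))"

lemma finite_lcol:
  assumes "finite X" "\<And>v. v \<in> X \<Longrightarrow> finite (L v)"
  shows "finite (lcol X L)"
proof (rule finite_subset)
  show "finite {f. \<forall>x. (x \<in> X \<longrightarrow> f x \<in> (\<Union>v\<in>X. L v)) \<and> (x \<notin> X \<longrightarrow> f x = (0::nat))}"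
    by (rule finite_set_of_finite_funs) (use assms in auto)
qed (auto simp: lcol_def)

lemma lcol_cong: "(\<And>v. v \<in> X \<Longrightarrow> L v = L' v) \<Longrightarrow> lcol X L = lcol X L'"
  by (auto simp: lcol_def)

text \<open>Revealing \<open>K\<close> leaves an instance of the same kind with shorter lists. This
  chain rule is behind all conditioning arguments.\<close>

lemma lcol_split:
  assumes "K \<subseteq> X"
  shows "bij_betw (\<lambda>p. merge K (fst p) (snd p))
    (SIGMA \<kappa>:lcol K L. lcol (X - K) (cut L \<kappa> K)) (lcol X L)"
proof (rule bij_betwI[where g = "\<lambda>\<sigma>. (restr K \<sigma>, restr (X - K) \<sigma>)"])
  show "(\<lambda>p. merge K (fst p) (snd p)) \<in> (SIGMA \<kappa>:lcol K L. lcol (X - K) (cut L \<kappa> K)) \<rightarrow> lcol X L"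
  proof
    fix p assume p: "p \<in> (SIGMA \<kappa>:lcol K L. lcol (X - K) (cut L \<kappa> K))"
    obtain \<kappa> \<sigma> where pp: "p = (\<kappa>, \<sigma>)" by (cases p)
    have k: "\<kappa> \<in> lcol K L" and s: "\<sigma> \<in> lcol (X - K) (cut L \<kappa> K)" using p pp by auto
    have d: "\<kappa> u \<noteq> \<sigma> v" if "u \<in> K" "v \<in> X - K" "adj u v" for u v
    proof -
      have "\<sigma> v \<in> L v - \<kappa> ` (Nb v \<inter> K)" using s that by (simp add: lcol_def cut_def)
      moreover have "u \<in> Nb v \<inter> K" using that adj_sym by (simp add: in_Nb)
      ultimately show ?thesis by (metis DiffD2 imageI)
    qed
    have "merge K \<kappa> \<sigma> u \<noteq> merge K \<kappa> \<sigma> v" if uv: "u \<in> X" "v \<in> X" "adj u v" for u v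
    proof (cases "u \<in> K"; cases "v \<in> K")
      assume "u \<in> K" "v \<in> K" then show ?thesis using k uv by (simp add: lcol_def merge_def)
    next
      assume "u \<in> K" "v \<notin> K" then show ?thesis using d[of u v] uv by (simp add: merge_def)
    next
      assume "u \<notin> K" "v \<in> K" then show ?thesis using d[of v u] uv adj_sym[of u v] by (auto simp: merge_def)
    next
      assume "u \<notin> K" "v \<notin> K" then show ?thesis using s uv by (simp add: lcol_def merge_def)
    qed
    moreover have "merge K \<kappa> \<sigma> v \<in> L v" if "v \<in> X" for v
      using k s that by (auto simp: lcol_def merge_def cut_def)
    moreover have "merge K \<kappa> \<sigma> v = 0" if "v \<notin> X" for v
      using k s that assms by (auto simp: lcol_def merge_def)
    ultimately show "merge K (fst p) (snd p) \<in> lcol X L" using pp by (simp add: lcol_def)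
  qed
  show "(\<lambda>\<sigma>. (restr K \<sigma>, restr (X - K) \<sigma>)) \<in> lcol X L \<rightarrow> (SIGMA \<kappa>:lcol K L. lcol (X - K) (cut L \<kappa> K))"
  proof
    fix \<sigma> assume s: "\<sigma> \<in> lcol X L"
    then have "restr K \<sigma> \<in> lcol K L" using assms subsetD[OF assms] by (simp add: lcol_def restr_def)
    moreover have "\<sigma> v \<notin> restr K \<sigma> ` (Nb v \<inter> K)" if "v \<in> X - K" for v
      using s assms that by (fastforce simp: lcol_def restr_def in_Nb)
    then have "restr (X - K) \<sigma> \<in> lcol (X - K) (cut L (restr K \<sigma>) K)"
      using s by (simp add: lcol_def restr_def cut_def)
    ultimately show "(restr K \<sigma>, restr (X - K) \<sigma>) \<in> (SIGMA \<kappa>:lcol K L. lcol (X - K) (cut L \<kappa> K))" by simp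
  qed
  show "(restr K (merge K (fst p) (snd p)), restr (X - K) (merge K (fst p) (snd p))) = p"
    if "p \<in> (SIGMA \<kappa>:lcol K L. lcol (X - K) (cut L \<kappa> K))" for p
    using that by (cases p) (auto simp: lcol_def restr_def merge_def fun_eq_iff)
  show "merge K (fst (restr K \<sigma>, restr (X - K) \<sigma>)) (snd (restr K \<sigma>, restr (X - K) \<sigma>)) = \<sigma>"
    if "\<sigma> \<in> lcol X L" for \<sigma>
    using that assms by (auto simp: lcol_def restr_def merge_def fun_eq_iff)
qed

lemma sum_lcol_split:
  fixes H :: "('a \<Rightarrow> nat) \<Rightarrow> 'b::comm_monoid_add"
  assumes "K \<subseteq> X" "finite X" "\<And>v. v \<in> X \<Longrightarrow> finite (L v)"
  shows "(\<Sum>\<sigma>\<in>lcol X L. H \<sigma>) = (\<Sum>\<kappa>\<in>lcol K L. \<Sum>\<sigma>\<in>lcol (X - K) (cut L \<kappa> K). H (merge K \<kappa> \<sigma>))"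
proof -
  have f: "finite (lcol K L)" "\<And>\<kappa>. finite (lcol (X - K) (cut L \<kappa> K))"
    using assms by (auto intro!: finite_lcol simp: cut_def intro: finite_subset)
  have "(\<Sum>\<sigma>\<in>lcol X L. H \<sigma>) = (\<Sum>p\<in>(SIGMA \<kappa>:lcol K L. lcol (X - K) (cut L \<kappa> K)). H (merge K (fst p) (snd p)))"
    by (rule sum.reindex_bij_betw[OF lcol_split[OF assms(1)], symmetric])
  also have "\<dots> = (\<Sum>\<kappa>\<in>lcol K L. \<Sum>\<sigma>\<in>lcol (X - K) (cut L \<kappa> K). H (merge K \<kappa> \<sigma>))"
    using f by (subst sum.Sigma) (auto simp: case_prod_unfold)
  finally show ?thesis .
qed

lemma card_lcol_split:
  assumes "K \<subseteq> X" "finite X" "\<And>v. v \<in> X \<Longrightarrow> finite (L v)"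
  shows "card (lcol X L) = (\<Sum>\<kappa>\<in>lcol K L. card (lcol (X - K) (cut L \<kappa> K)))"
  using sum_lcol_split[OF assms, where H = "\<lambda>_. 1::nat"] by simp

section \<open>Marginals at one vertex\<close>

lemma card_lcol_indep:
  assumes "finite X" "\<And>u v. u \<in> X \<Longrightarrow> v \<in> X \<Longrightarrow> \<not> adj u v"
  shows "card (lcol X L) = (\<Prod>u\<in>X. card (L u))"
proof -
  have "bij_betw (\<lambda>f. restrict f X) (lcol X L) (PiE X L)"
    by (rule bij_betwI[where g = "restr X"])
       (auto simp: lcol_def restr_def assms(2) fun_eq_iff PiE_def extensional_def)
  then show ?thesis using card_PiE[OF assms(1), of L] bij_betw_same_card by metis
qed

lemma lcol_singleton: "bij_betw (\<lambda>c. (\<lambda>v. if v = w then c else 0)) (L w) (lcol {w} L)"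
  by (rule bij_betwI[where g = "\<lambda>f. f w"]) (auto simp: lcol_def adj_irrefl fun_eq_iff)

text \<open>Fixing the colour \<open>c\<close> of \<open>w\<close> leaves a product of list sizes,
  each shortened by at most one. Relative to the full product it is at least exp (- S c), and every
  neighbour contributes at most \<open>1 + 1 / a\<close> to the sum of \<open>S\<close> over the
  colours. Jensen's inequality thus bounds the number of all colorings from below by the full
  product times \<open>l * exp (- (1 + 1 / a) * card N / l)\<close>, while the colorings with one
  prescribed colour at \<open>w\<close> number at most the full product.\<close>

lemma star_marginal:
  assumes fN: "finite N" and w: "w \<notin> N" and wN: "\<And>u. u \<in> N \<Longrightarrow> adj w u"
    and ind: "\<And>u v. u \<in> N \<Longrightarrow> v \<in> N \<Longrightarrow> \<not> adj u v"
    and fL: "finite (L w)" and L: "\<And>u. u \<in> N \<Longrightarrow> finite (L u) \<and> card (L u) \<ge> a + 1"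
    and a: "a \<ge> 1" and l: "0 < l" "l \<le> real (card (L w))"
  shows "real (card {\<sigma> \<in> lcol (insert w N) L. \<sigma> w = c})
    \<le> exp ((1 + 1 / real a) * real (card N) / l) / l * real (card (lcol (insert w N) L))"
proof -
  define Z where "Z = insert w N"
  define A where "A c = (\<Prod>u\<in>N. real (card (L u - {c})))" for c
  define P0 where "P0 = (\<Prod>u\<in>N. real (card (L u)))"
  have fZ: "finite Z" using fN by (simp add: Z_def)
  have fin: "finite (L v)" if "v \<in> Z" for v using that fL L by (auto simp: Z_def)
  have ZN: "Z - {w} = N" using w by (auto simp: Z_def)
  have cutw: "real (card (lcol N (cut L (\<lambda>v. if v = w then c else 0) {w}))) = A c" for c
  proof -
    have "Nb u \<inter> {w} = {w}" if "u \<in> N" for u using wN[OF that] adj_sym by (auto simp: Nb_def)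
    then have "lcol N (cut L (\<lambda>v. if v = w then c else 0) {w}) = lcol N (\<lambda>u. L u - {c})"
      by (intro lcol_cong) (auto simp: cut_def)
    then show ?thesis using card_lcol_indep[OF fN ind] by (simp add: A_def)
  qed
  have tot: "(\<Sum>\<sigma>\<in>lcol Z L. H \<sigma>) = (\<Sum>c\<in>L w. \<Sum>\<sigma>\<in>lcol N (cut L (\<lambda>v. if v = w then c else 0) {w}).
       H (merge {w} (\<lambda>v. if v = w then c else 0) \<sigma>))" for H :: "_ \<Rightarrow> real"
  proof -
    have "(\<Sum>\<sigma>\<in>lcol Z L. H \<sigma>) = (\<Sum>\<kappa>\<in>lcol {w} L. \<Sum>\<sigma>\<in>lcol (Z - {w}) (cut L \<kappa> {w}). H (merge {w} \<kappa> \<sigma>))"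
      by (rule sum_lcol_split) (use fZ fin in \<open>auto simp: Z_def\<close>)
    also have "\<dots> = (\<Sum>c\<in>L w. \<Sum>\<sigma>\<in>lcol N (cut L (\<lambda>v. if v = w then c else 0) {w}).
       H (merge {w} (\<lambda>v. if v = w then c else 0) \<sigma>))"
      unfolding ZN by (rule sum.reindex_bij_betw[OF lcol_singleton, symmetric])
    finally show ?thesis .
  qed
  have T: "real (card (lcol Z L)) = (\<Sum>c\<in>L w. A c)"
    using tot[of "\<lambda>_. 1"] by (simp add: cutw)
  have "real (card {\<sigma> \<in> lcol Z L. \<sigma> w = c}) = (\<Sum>\<sigma>\<in>lcol Z L. if \<sigma> w = c then 1 else 0)"
    using finite_lcol[OF fZ fin] by (simp add: sum.If_cases Int_def)
  also have "\<dots> = (\<Sum>c'\<in>L w. if c' = c then A c else 0)"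
    unfolding tot by (intro sum.cong refl) (auto simp: merge_def cutw)
  also have "\<dots> \<le> A c" using fL by (simp add: sum.delta A_def prod_nonneg)
  also have "A c \<le> P0" unfolding A_def P0_def
    by (intro prod_mono) (use L in \<open>auto intro!: card_mono\<close>)
  finally have up: "real (card {\<sigma> \<in> lcol Z L. \<sigma> w = c}) \<le> P0" .
  define b where "b = 1 + 1 / real a"
  have b: "b \<ge> 0" by (simp add: b_def)
  define S where "S c' = b * (\<Sum>u\<in>N. if c' \<in> L u then 1 / real (card (L u)) else 0)" for c'
  have lowA: "P0 * exp (- S c') \<le> A c'" for c'
  proof -
    have "real (card (L u)) * exp (- (b * (if c' \<in> L u then 1 / real (card (L u)) else 0)))
        \<le> real (card (L u - {c'}))" if u: "u \<in> N" for u
    proof (cases "c' \<in> L u")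
      case True
      have cL: "real (card (L u)) \<ge> real a + 1" using L[OF u] by (simp add: of_nat_mono flip: of_nat_Suc)
      then have cp: "real (card (L u)) > 0" by (smt (verit) of_nat_0_le_iff)
      have "exp (- b * (1 / real (card (L u)))) \<le> 1 - 1 / real (card (L u))"
        unfolding b_def by (rule one_minus_ge_exp) (use cL a in \<open>auto simp: frac_le\<close>)
      then have "real (card (L u)) * exp (- b * (1 / real (card (L u)))) \<le> real (card (L u)) * (1 - 1 / real (card (L u)))"
        by (intro mult_left_mono) auto
      also have "\<dots> = real (card (L u)) - 1" using cp by (simp add: right_diff_distrib)
      also have "\<dots> = real (card (L u - {c'}))" using True L[OF u] cp
        by (subst card_Diff_singleton) (auto simp: of_nat_diff Suc_leI)
      finally show ?thesis using True by simp
    qed simp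
    then have "(\<Prod>u\<in>N. real (card (L u)) * exp (- (b * (if c' \<in> L u then 1 / real (card (L u)) else 0))))
       \<le> A c'" unfolding A_def by (intro prod_mono) auto
    moreover have "(\<Prod>u\<in>N. exp (- (b * (if c' \<in> L u then 1 / real (card (L u)) else 0)))) = exp (- S c')"
      using fN by (simp add: S_def exp_sum[symmetric] sum_negf sum_distrib_left)
    ultimately show ?thesis by (simp add: prod.distrib P0_def)
  qed
  define l' where "l' = real (card (L w))"
  have l': "l' \<ge> l" "l' > 0" using l by (auto simp: l'_def)
  have Lne: "L w \<noteq> {}" using l' by (auto simp: l'_def)
  have "sum S (L w) \<le> b * real (card N)"
  proof -
    have "sum S (L w) = b * (\<Sum>c\<in>L w. \<Sum>u\<in>N. if c \<in> L u then 1 / real (card (L u)) else 0)"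
      by (simp add: S_def sum_distrib_left)
    also have "(\<Sum>c\<in>L w. \<Sum>u\<in>N. if c \<in> L u then 1 / real (card (L u)) else 0)
      = (\<Sum>u\<in>N. \<Sum>c\<in>L w. if c \<in> L u then 1 / real (card (L u)) else 0)" by (rule sum.swap)
    also have "\<dots> \<le> (\<Sum>u\<in>N. 1)"
    proof (rule sum_mono)
      fix u assume u: "u \<in> N"
      have "(\<Sum>c\<in>L w. if c \<in> L u then 1 / real (card (L u)) else 0) = real (card (L w \<inter> L u)) / real (card (L u))"
        using fL by (simp add: sum.If_cases Int_def)
      also have "\<dots> \<le> 1" using L[OF u] by (simp add: divide_le_eq_1 card_mono card_gt_0_iff)
      finally show "(\<Sum>c\<in>L w. if c \<in> L u then 1 / real (card (L u)) else 0) \<le> 1" .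
    qed
    finally show ?thesis using b by (simp add: mult_left_mono)
  qed
  \<comment> \<open>Both the number of colours and the exponential grow with the list of
    \<open>w\<close>, so its true size \<open>l'\<close> may be replaced by the lower bound
    \<open>l\<close>.\<close>
  then have "sum S (L w) / l' \<le> b * real (card N) / l"
    using l l' b by (intro frac_le) auto
  then have "l * exp (- (b * real (card N) / l)) \<le> l' * exp (- (sum S (L w) / l'))"
    using l l' by (intro mult_mono) auto
  also have "\<dots> \<le> (\<Sum>c\<in>L w. exp (- S c))" unfolding l'_def by (rule sum_exp_ge) (use fL Lne in auto)
  finally have "P0 * (l * exp (- (b * real (card N) / l))) \<le> P0 * (\<Sum>c\<in>L w. exp (- S c))"
    by (intro mult_left_mono) (auto simp: P0_def prod_nonneg)
  also have "\<dots> \<le> real (card (lcol Z L))" unfolding T sum_distrib_left by (intro sum_mono lowA)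
  finally have "P0 \<le> exp (b * real (card N) / l) / l * real (card (lcol Z L))"
    using l by (simp add: exp_minus field_simps)
  with up show ?thesis by (simp add: Z_def b_def)
qed

text \<open>Conditioning on everything outside the star of \<open>w\<close> and \<open>N\<close>.
  Neighbours of \<open>w\<close> outside \<open>N\<close> may remove one colour each from its list,
  hence the condition on \<open>l\<close>. A vertex of \<open>N\<close> keeps one colour more than
  \<open>a\<close>, because \<open>w\<close> itself is not revealed.\<close>

lemma marginal_bound:
  assumes fX: "finite X" and w: "w \<in> X" and N: "N \<subseteq> Nb w \<inter> X"
    and ind: "\<And>u v. u \<in> N \<Longrightarrow> v \<in> N \<Longrightarrow> \<not> adj u v"
    and fL: "\<And>v. v \<in> X \<Longrightarrow> finite (L v)"
    and L: "\<And>u. u \<in> N \<Longrightarrow> card (L u) \<ge> a + card (Nb u \<inter> X)"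
    and a: "a \<ge> 1" and l: "0 < l" "l + real (card (Nb w \<inter> X - N)) \<le> real (card (L w))"
  shows "real (card {\<sigma> \<in> lcol X L. \<sigma> w = c})
    \<le> exp ((1 + 1 / real a) * real (card N) / l) / l * real (card (lcol X L))"
proof -
  define Z where "Z = insert w N"
  define D where "D = X - Z"
  define p where "p = exp ((1 + 1 / real a) * real (card N) / l) / l"
  have wN: "w \<notin> N" using N adj_irrefl by (auto simp: Nb_def)
  have ZX: "Z \<subseteq> X" and XD: "X - D = Z" "D \<subseteq> X" using w N by (auto simp: Z_def D_def)
  have fN: "finite N" using N finite_subset fX by blast
  have each: "real (card {\<sigma> \<in> lcol Z (cut L \<kappa> D). \<sigma> w = c}) \<le> p * real (card (lcol Z (cut L \<kappa> D)))" for \<kappa>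
    unfolding Z_def p_def
  proof (rule star_marginal[OF fN wN])
    show "adj w u" if "u \<in> N" for u using N that by (auto simp: Nb_def)
    show "finite (cut L \<kappa> D w)" using fL w by (simp add: cut_def)
    show "finite (cut L \<kappa> D u) \<and> a + 1 \<le> card (cut L \<kappa> D u)" if u: "u \<in> N" for u
    proof -
      have uX: "u \<in> X" using u N by auto
      have "card (\<kappa> ` (Nb u \<inter> D)) \<le> card (Nb u \<inter> D)" by (intro card_image_le) simp
      moreover have "card (Nb u \<inter> D) < card (Nb u \<inter> X)"
      proof (rule psubset_card_mono)
        have "w \<in> Nb u \<inter> X" using u N w adj_sym by (auto simp: Nb_def)
        then show "Nb u \<inter> D \<subset> Nb u \<inter> X" by (auto simp: D_def Z_def)
      qed simp
      moreover have "card (L u) - card (\<kappa> ` (Nb u \<inter> D)) \<le> card (cut L \<kappa> D u)"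
        unfolding cut_def by (rule diff_card_le_card_Diff) simp
      ultimately show ?thesis using L[OF u] fL[OF uX] by (simp add: cut_def)
    qed
    have "Nb w \<inter> D = Nb w \<inter> X - N" using adj_irrefl by (auto simp: D_def Z_def Nb_def)
    then have "card (\<kappa> ` (Nb w \<inter> D)) \<le> card (Nb w \<inter> X - N)" by (metis card_image_le finite_Diff finite_Int finite_Nb)
    moreover have "card (L w) - card (\<kappa> ` (Nb w \<inter> D)) \<le> card (cut L \<kappa> D w)"
      unfolding cut_def by (rule diff_card_le_card_Diff) simp
    ultimately show "l \<le> real (card (cut L \<kappa> D w))" using l(2) by linarith
  qed (use ind a l in auto)
  have fin: "finite (lcol X L)" "\<And>\<kappa>. finite (lcol Z (cut L \<kappa> D))"
    using fX fL ZX by (auto intro!: finite_lcol simp: cut_def intro: finite_subset)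
  have wD: "w \<notin> D" by (simp add: D_def Z_def)
  have "real (card {\<sigma> \<in> lcol X L. \<sigma> w = c}) = (\<Sum>\<sigma>\<in>lcol X L. if \<sigma> w = c then 1 else 0)"
    using fin by (simp add: sum.If_cases Int_def)
  also have "\<dots> = (\<Sum>\<kappa>\<in>lcol D L. \<Sum>\<sigma>\<in>lcol Z (cut L \<kappa> D). if \<sigma> w = c then 1 else 0)"
    using sum_lcol_split[OF XD(2) fX fL, where H = "\<lambda>\<sigma>. if \<sigma> w = c then 1::real else 0"] wD
    by (simp add: merge_def XD(1))
  also have "\<dots> = (\<Sum>\<kappa>\<in>lcol D L. real (card {\<sigma> \<in> lcol Z (cut L \<kappa> D). \<sigma> w = c}))"
    using fin by (simp add: sum.If_cases Int_def)
  also have "\<dots> \<le> (\<Sum>\<kappa>\<in>lcol D L. p * real (card (lcol Z (cut L \<kappa> D))))"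
    by (intro sum_mono each)
  also have "\<dots> = p * real (card (lcol X L))"
    using card_lcol_split[OF XD(2) fX fL] by (simp add: XD(1) sum_distrib_left)
  finally show ?thesis by (simp add: p_def)
qed

text \<open>Greedy coloring, started from a given coloring \<open>\<kappa>\<close> of a part on
  which the lists may be short.\<close>

lemma lcol_greedy:
  assumes fX: "finite X" and D: "D \<subseteq> X" and k: "\<kappa> \<in> lcol D L"
    and L: "\<And>u. u \<in> X - D \<Longrightarrow> finite (L u) \<and> card (L u) > card (Nb u \<inter> X)"
  shows "lcol X L \<noteq> {}"
proof -
  have "Y \<subseteq> X - D \<longrightarrow> lcol (D \<union> Y) L \<noteq> {}" if "finite Y" for Y using that
  proof (induction Y rule: finite_induct)
    case empty
    then show ?case using k by auto
  next
    case (insert u Y)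
    show ?case
    proof
      assume uY: "insert u Y \<subseteq> X - D"
      then obtain \<sigma> where s: "\<sigma> \<in> lcol (D \<union> Y) L" using insert by auto
      have "card (\<sigma> ` (Nb u \<inter> (D \<union> Y))) \<le> card (Nb u \<inter> (D \<union> Y))" by (intro card_image_le) simp
      also have "\<dots> \<le> card (Nb u \<inter> X)" using uY D by (intro card_mono) auto
      also have "\<dots> < card (L u)" using L uY by auto
      finally have "\<not> L u \<subseteq> \<sigma> ` (Nb u \<inter> (D \<union> Y))" by (metis card_mono finite_Int finite_Nb finite_imageI leD)
      then obtain c where c: "c \<in> L u" "c \<notin> \<sigma> ` (Nb u \<inter> (D \<union> Y))" by blast
      have "\<sigma>(u := c) \<in> lcol (D \<union> insert u Y) L"
        using s c insert.hyps uY adj_irrefl adj_sym by (auto simp: lcol_def in_Nb image_iff)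
      then show "lcol (D \<union> insert u Y) L \<noteq> {}" by blast
    qed
  qed
  from this[of "X - D"] show ?thesis using fX D by (simp add: Un_absorb1)
qed

end

section \<open>Influences\<close>

lemma weighted_avg_diff:
  fixes c \<phi> :: "'b \<Rightarrow> real"
  assumes A: "finite A" "\<And>u. u \<in> A \<Longrightarrow> 0 \<le> c u" "0 < sum c A"
    and z: "\<And>u. u \<in> A \<Longrightarrow> 0 < c u \<Longrightarrow> \<bar>\<phi> u - z\<bar> \<le> r"
  shows "\<bar>(\<Sum>u\<in>A. c u * \<phi> u) / sum c A - z\<bar> \<le> r"
proof -
  have "\<bar>\<Sum>u\<in>A. c u * (\<phi> u - z)\<bar> \<le> (\<Sum>u\<in>A. c u * r)"
  proof (rule order_trans[OF sum_abs], rule sum_mono)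
    fix u assume u: "u \<in> A"
    show "\<bar>c u * (\<phi> u - z)\<bar> \<le> c u * r"
      using A(2)[OF u] z[OF u] by (cases "c u = 0") (auto simp: abs_mult intro!: mult_left_mono)
  qed
  moreover have "(\<Sum>u\<in>A. c u * (\<phi> u - z)) = (\<Sum>u\<in>A. c u * \<phi> u) - sum c A * z"
    by (simp add: right_diff_distrib sum_subtractf sum_distrib_right)
  moreover have "(\<Sum>u\<in>A. c u * r) = sum c A * r" by (simp add: sum_distrib_right)
  ultimately have "\<bar>(\<Sum>u\<in>A. c u * \<phi> u) - sum c A * z\<bar> \<le> sum c A * r" by simp
  moreover have "(\<Sum>u\<in>A. c u * \<phi> u) / sum c A - z = ((\<Sum>u\<in>A. c u * \<phi> u) - sum c A * z) / sum c A"
    using A(3) by (simp add: diff_divide_distrib)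
  ultimately show ?thesis using A(3) by (simp add: pos_divide_le_eq mult.commute)
qed

text \<open>Conditioning one probability vector on avoiding \<open>x\<close> or \<open>y\<close> changes expectations only
through the mass of one colour.\<close>

lemma avoid_diff:
  fixes c \<phi> :: "'b \<Rightarrow> real"
  assumes U: "finite U" "\<And>u. u \<in> U \<Longrightarrow> 0 \<le> c u"
    and pos: "0 < sum c (U - {x})" "0 < sum c (U - {y})"
    and r: "\<And>u v. u \<in> U \<Longrightarrow> v \<in> U \<Longrightarrow> 0 < c u \<Longrightarrow> 0 < c v \<Longrightarrow> \<bar>\<phi> u - \<phi> v\<bar> \<le> r"
    and px: "\<And>u. u \<in> U - {x} \<Longrightarrow> c u \<le> p * sum c (U - {x})"
    and py: "\<And>u. u \<in> U - {y} \<Longrightarrow> c u \<le> p * sum c (U - {y})"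
    and p: "0 \<le> p" "0 \<le> r"
  shows "\<bar>(\<Sum>u\<in>U - {x}. c u * \<phi> u) / sum c (U - {x}) - (\<Sum>u\<in>U - {y}. c u * \<phi> u) / sum c (U - {y})\<bar> \<le> p * r"
proof -
  define C where "C u = (if u \<in> U then c u else 0)" for u
  have C0: "0 \<le> C u" for u using U(2) by (simp add: C_def)
  have S: "(\<Sum>u\<in>U - {x}. c u * f u) = (\<Sum>u\<in>U. c u * f u) - C x * f x" for x and f :: "'b \<Rightarrow> real"
    using U(1) by (cases "x \<in> U") (auto simp: C_def sum_diff1)
  have S1: "sum c (U - {x}) = sum c U - C x" for x
    using S[where x = x and f = "\<lambda>_. 1"] by simp
  \<comment> \<open>By symmetry the excluded value \<open>x\<close> may be taken as the heavier one.
    Values outside \<open>U\<close> have weight 0 in \<open>C\<close>.\<close>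
  have main: "\<bar>(\<Sum>u\<in>U - {x}. c u * \<phi> u) / sum c (U - {x}) - (\<Sum>u\<in>U - {y}. c u * \<phi> u) / sum c (U - {y})\<bar> \<le> p * r"
    if xy: "C y \<le> C x" "x \<noteq> y" and pos: "0 < sum c (U - {x})" "0 < sum c (U - {y})"
      and py: "\<And>u. u \<in> U - {y} \<Longrightarrow> c u \<le> p * sum c (U - {y})" for x y
  proof (cases "C x = 0")
    case True
    then have "C y = 0" using xy C0[of y] by linarith
    then show ?thesis using True mult_nonneg_nonneg[OF p] by (simp only: S S1) simp
  next
    case False
    then have x: "x \<in> U" "c x > 0" "C x = c x" using C0[of x] by (auto simp: C_def split: if_splits)
    define WB where "WB = sum c (U - {y})"
    define EA where "EA = (\<Sum>u\<in>U - {x}. c u * \<phi> u) / sum c (U - {x})"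
    define EB where "EB = (\<Sum>u\<in>U - {y}. c u * \<phi> u) / WB"
    have a: "\<bar>EA - \<phi> x\<bar> \<le> r" unfolding EA_def
      by (rule weighted_avg_diff) (use U pos r x in auto)
    have "sum c (U - {x}) * EA = (\<Sum>u\<in>U. c u * \<phi> u) - C x * \<phi> x"
      using pos(1) by (simp add: EA_def S)
    moreover have "WB * EB = (\<Sum>u\<in>U. c u * \<phi> u) - C y * \<phi> y"
      using pos(2) by (simp add: EB_def WB_def S)
    moreover have "sum c (U - {x}) = WB + C y - C x" using S1 by (simp add: WB_def)
    ultimately have "(WB + C y - C x) * EA + C x * \<phi> x = WB * EB + C y * \<phi> y" by simp
    \<comment> \<open>The two weighted sums differ only in the terms at \<open>x\<close> and
      \<open>y\<close>. The coefficients on the right add up to \<open>C x\<close>, the weight of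
      \<open>x\<close> where \<open>y\<close> is excluded, which is at most
      \<open>p * WB\<close>.\<close>
    then have "WB * (EB - EA) = (C x - C y) * (\<phi> x - EA) + C y * (\<phi> x - \<phi> y)"
      by (simp add: algebra_simps)
    moreover have "WB * \<bar>EB - EA\<bar> = \<bar>WB * (EB - EA)\<bar>" using pos(2) by (simp add: abs_mult WB_def)
    ultimately have "WB * \<bar>EB - EA\<bar> = \<bar>(C x - C y) * (\<phi> x - EA) + C y * (\<phi> x - \<phi> y)\<bar>" by simp
    also have "\<dots> \<le> (C x - C y) * r + C y * r"
    proof (rule order_trans[OF abs_triangle_ineq], rule add_mono)
      show "\<bar>(C x - C y) * (\<phi> x - EA)\<bar> \<le> (C x - C y) * r"
        using a xy by (simp add: abs_mult abs_minus_commute mult_left_mono)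
      show "\<bar>C y * (\<phi> x - \<phi> y)\<bar> \<le> C y * r"
      proof (cases "C y = 0")
        case False
        then have "y \<in> U" "c y > 0" "C y = c y" using C0[of y] by (auto simp: C_def split: if_splits)
        then show ?thesis using r[of x y] x by (simp add: abs_mult mult_left_mono)
      qed simp
    qed
    also have "\<dots> = c x * r" using x by (simp add: algebra_simps)
    also have "\<dots> \<le> (p * WB) * r" using py[of x] x xy p by (intro mult_right_mono) (auto simp: WB_def)
    finally have "WB * \<bar>EB - EA\<bar> \<le> WB * (p * r)" by (simp add: mult_ac)
    then have "\<bar>EB - EA\<bar> \<le> p * r" using pos(2) by (simp add: WB_def)
    then show ?thesis by (simp add: EA_def EB_def WB_def abs_minus_commute)
  qed
  show ?thesis
  proof (cases "x = y")
    case True then show ?thesis using p by simp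
  next
    case False
    show ?thesis
    proof (cases "C y \<le> C x")
      case True then show ?thesis using main[of y x] False pos py by blast
    next
      case F: False
      then have "\<bar>(\<Sum>u\<in>U - {y}. c u * \<phi> u) / sum c (U - {y}) - (\<Sum>u\<in>U - {x}. c u * \<phi> u) / sum c (U - {x})\<bar> \<le> p * r"
        using main[of x y] False pos px by simp
      then show ?thesis by (simp add: abs_minus_commute)
    qed
  qed
qed

context sgraph
begin

definition EL :: "'a set \<Rightarrow> ('a \<Rightarrow> nat set) \<Rightarrow> (('a \<Rightarrow> nat) \<Rightarrow> real) \<Rightarrow> real" where
  "EL X L H = (\<Sum>\<sigma>\<in>lcol X L. H \<sigma>) / real (card (lcol X L))"

lemma EL_cong: "(\<And>v. v \<in> X \<Longrightarrow> L v = L' v) \<Longrightarrow> EL X L H = EL X L' H"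
  unfolding EL_def using lcol_cong[of X L L'] by simp

lemma excess_insert:
  assumes "finite P" "x \<notin> P"
  shows "excess (insert x P) = excess P - 2 + 2 * int (card (Nb x \<inter> P))"
proof -
  have "{p \<in> P \<times> {x}. adj (fst p) (snd p)} = (\<lambda>u. (u, x)) ` (Nb x \<inter> P)"
    using adj_sym by (auto simp: Nb_def)
  then have "card {p \<in> P \<times> {x}. adj (fst p) (snd p)} = card (Nb x \<inter> P)"
    by (simp add: card_image inj_on_def)
  then show ?thesis using excess_Un[OF assms(1), of "{x}"] assms(2) by simp
qed

end

text \<open>There are \<open>a + D\<close> colors, so a light vertex always has \<open>a\<close> spare ones. The weight \<open>gg\<close> of a big
vertex outweighs the total influence \<open>B\<close> per neighbour, and \<open>strong\<close> is the contraction behind the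
threshold \<open>\<alpha> = exp (1 / \<alpha>)\<close>.\<close>

locale light_graph = scored_graph V adj gg ll
  for V :: "'a set" and adj and gg ll :: "'a \<Rightarrow> real" +
  fixes light :: "'a \<Rightarrow> bool" and a D :: nat and B \<delta> :: real
  assumes light_deg: "light v \<Longrightarrow> card (Nb v) \<le> D"
    and a4: "4 \<le> a"
    and ll_eq: "ll v = (if light v then 1 else 0)"
    and gg_light: "light v \<Longrightarrow> gg v = 0"
    and gg_big: "v \<in> V \<Longrightarrow> \<not> light v \<Longrightarrow> 2 \<le> gg v \<and> B * real (card (Nb v)) \<le> gg v"
    and B0: "0 \<le> B" and \<delta>0: "0 < \<delta>" "\<delta> \<le> 1"
    and aB: "1 / real a \<le> \<delta> * B / 2" and DB: "(1 + real D * B) / real a \<le> 1 / 2"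
    and strong: "(real D / real (a + D) + 1 / real a) * exp ((1 + 1 / real a) * (real D / real (a + D))) \<le> 1 - \<delta>"
begin

section \<open>Clusters of big vertices\<close>

definition bigrel :: "('a \<times> 'a) set" where
  "bigrel = {(x, y). adj x y \<and> \<not> light x \<and> \<not> light y}"

definition cluster :: "'a \<Rightarrow> 'a set" where
  "cluster v = (if light v then {v} else {u. (v, u) \<in> bigrel\<^sup>*})"

text \<open>The sets considered are unions of whole clusters: a big vertex may have no spare colour
  and has to be recoloured together with its cluster.\<close>

definition closed :: "'a set \<Rightarrow> bool" where
  "closed X \<longleftrightarrow> (\<forall>v\<in>X. cluster v \<subseteq> X)"

lemma self_cl: "v \<in> cluster v" by (simp add: cluster_def)

lemma cluster_light [simp]: "light v \<Longrightarrow> cluster v = {v}" by (simp add: cluster_def)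

lemma cluster_big_sub: "\<not> light v \<Longrightarrow> u \<in> cluster v \<Longrightarrow> \<not> light u"
proof -
  assume "\<not> light v" "u \<in> cluster v"
  then have "(v, u) \<in> bigrel\<^sup>*" by (simp add: cluster_def)
  then show ?thesis using \<open>\<not> light v\<close> by (induction rule: rtrancl_induct) (auto simp: bigrel_def)
qed

lemma cluster_sym_rel: "sym (bigrel\<^sup>*)"
  by (rule sym_rtrancl) (auto simp: sym_def bigrel_def adj_sym)

lemma cluster_eq: "u \<in> cluster v \<Longrightarrow> cluster u = cluster v"
proof (cases "light v")
  case False
  assume u: "u \<in> cluster v"
  then have "\<not> light u" using cluster_big_sub False by blast
  moreover have vu: "(v, u) \<in> bigrel\<^sup>*" using u False by (simp add: cluster_def)
  moreover have "(u, v) \<in> bigrel\<^sup>*"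
    by (rule symD[OF cluster_sym_rel vu])
  ultimately show ?thesis using False by (auto simp: cluster_def intro: rtrancl_trans)
qed simp

lemma cluster_adj: "adj u v \<Longrightarrow> \<not> light u \<Longrightarrow> \<not> light v \<Longrightarrow> cluster u = cluster v"
  by (rule cluster_eq) (auto simp: cluster_def bigrel_def adj_sym)

lemma conn_cl: "conn (cluster v)"
proof (cases "light v")
  case False
  show ?thesis unfolding conn_def
  proof (intro conjI allI impI)
    show "cluster v \<noteq> {}" using self_cl by blast
    fix P assume P: "P \<subset> cluster v" "P \<noteq> {}"
    then obtain p q where p: "p \<in> P" and q: "q \<in> cluster v" "q \<notin> P" by blast
    have clp: "cluster p = cluster v" using P p cluster_eq by blast
    have "\<not> light p" using P p cluster_big_sub False by blast
    then have "(p, q) \<in> bigrel\<^sup>*" using clp q by (auto simp: cluster_def)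
    then show "\<exists>x\<in>P. \<exists>y\<in>cluster v - P. adj x y" using p q(2)
    proof (induction rule: converse_rtrancl_induct)
      case (step y z)
      have yz: "adj y z" "(y, z) \<in> bigrel" "\<not> light y" using step by (auto simp: bigrel_def)
      show ?case
      proof (cases "z \<in> P")
        case False
        have "z \<in> cluster y" using yz by (auto simp: cluster_def)
        moreover have "cluster y = cluster v" using step.prems(1) P cluster_eq by blast
        ultimately have "z \<in> cluster v - P" using False by simp
        then show ?thesis using step.prems(1) yz by blast
      qed (use step in blast)
    qed simp
  qed
qed simp

lemma cluster_V: "v \<in> V \<Longrightarrow> cluster v \<subseteq> V"
proof (cases "light v")
  case False
  assume v: "v \<in> V"
  show ?thesis
  proof
    fix u assume "u \<in> cluster v"
    then have "(v, u) \<in> bigrel\<^sup>*" using False by (simp add: cluster_def)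
    then show "u \<in> V" using v by (induction rule: rtrancl_induct) (auto simp: bigrel_def adj_V2)
  qed
qed simp

lemma closed_Diff: "closed X \<Longrightarrow> closed (X - cluster v)"
  unfolding closed_def
proof
  fix u assume X: "\<forall>v\<in>X. cluster v \<subseteq> X" and u: "u \<in> X - cluster v"
  have "cluster u \<inter> cluster v = {}"
  proof (rule ccontr)
    assume "cluster u \<inter> cluster v \<noteq> {}"
    then obtain x where "x \<in> cluster u" "x \<in> cluster v" by blast
    then have "cluster u = cluster v" using cluster_eq by blast
    then show False using u self_cl by blast
  qed
  then show "cluster u \<subseteq> X - cluster v" using X u by blast
qed

text \<open>The existence of a coloring is a requirement of its own because the lists of big
  vertices carry no size bound.\<close>

definition admissible :: "'a set \<Rightarrow> ('a \<Rightarrow> nat set) \<Rightarrow> bool" where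
  "admissible X L \<longleftrightarrow> (\<forall>u\<in>X. finite (L u)) \<and> (\<forall>u\<in>X. light u \<longrightarrow> a + card (Nb u \<inter> X) \<le> card (L u)) \<and> lcol X L \<noteq> {}"

text \<open>Coloring a vertex with \<open>x\<close> removes \<open>x\<close> from the lists of its neighbours \<open>S\<close>; \<open>influence_le\<close>
bounds the effect of exchanging this color for another one.\<close>

definition remove_color :: "('a \<Rightarrow> nat set) \<Rightarrow> nat \<Rightarrow> 'a set \<Rightarrow> 'a \<Rightarrow> nat set" where
  "remove_color L x S = (\<lambda>u. if u \<in> S then L u - {x} else L u)"

definition light_stat :: "('a \<Rightarrow> nat \<Rightarrow> real) \<Rightarrow> 'a set \<Rightarrow> ('a \<Rightarrow> nat) \<Rightarrow> real" where
  "light_stat g X \<sigma> = (\<Sum>w\<in>{w\<in>X. light w}. g w (\<sigma> w))"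

definition unit_valued :: "('a \<Rightarrow> nat \<Rightarrow> real) \<Rightarrow> bool" where
  "unit_valued g \<longleftrightarrow> (\<forall>w c. 0 \<le> g w c \<and> g w c \<le> 1)"

definition influence_le :: "'a set \<Rightarrow> 'a set \<Rightarrow> real \<Rightarrow> bool" where
  "influence_le X J r \<longleftrightarrow> (\<forall>L x y S g. S \<subseteq> J \<longrightarrow> admissible X (remove_color L x S) \<longrightarrow> admissible X (remove_color L y S) \<longrightarrow> unit_valued g \<longrightarrow>
     \<bar>EL X (remove_color L x S) (light_stat g X) - EL X (remove_color L y S) (light_stat g X)\<bar> \<le> r)"

lemma influence_le_mono: "influence_le X J r \<Longrightarrow> r \<le> r' \<Longrightarrow> influence_le X J r'"
  unfolding influence_le_def by (meson order_trans)

definition revealed_mean :: "('a \<Rightarrow> nat \<Rightarrow> real) \<Rightarrow> 'a set \<Rightarrow> 'a set \<Rightarrow> ('a \<Rightarrow> nat set) \<Rightarrow> ('a \<Rightarrow> nat) \<Rightarrow> real" where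
  "revealed_mean g X K L \<kappa> = light_stat g K \<kappa> + EL (X - K) (cut L \<kappa> K) (light_stat g (X - K))"

lemma light_stat_merge:
  assumes "finite X" "K \<subseteq> X"
  shows "light_stat g X (merge K \<kappa> \<sigma>) = light_stat g K \<kappa> + light_stat g (X - K) \<sigma>"
proof -
  have "{w\<in>X. light w} = {w\<in>K. light w} \<union> {w\<in>X - K. light w}" using assms by auto
  moreover have "{w\<in>K. light w} \<inter> {w\<in>X - K. light w} = {}" by auto
  moreover have "finite {w\<in>K. light w}" using assms finite_subset[of K X] by simp
  ultimately show ?thesis using assms unfolding light_stat_def
    by (simp add: sum.union_disjoint merge_def)
qed

text \<open>Law of total expectation as a weighted average; colorings of \<open>K\<close> that do
  not extend enter with weight 0.\<close>

lemma EL_reveal: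
  assumes X: "finite X" "K \<subseteq> X" and L: "\<And>v. v \<in> X \<Longrightarrow> finite (L v)"
  shows "EL X L (light_stat g X) = (\<Sum>\<kappa>\<in>lcol K L. real (card (lcol (X - K) (cut L \<kappa> K))) * revealed_mean g X K L \<kappa>)
     / (\<Sum>\<kappa>\<in>lcol K L. real (card (lcol (X - K) (cut L \<kappa> K))))"
proof -
  have "(\<Sum>\<sigma>\<in>lcol (X - K) (cut L \<kappa> K). light_stat g X (merge K \<kappa> \<sigma>))
     = real (card (lcol (X - K) (cut L \<kappa> K))) * revealed_mean g X K L \<kappa>" for \<kappa>
  proof (cases "lcol (X - K) (cut L \<kappa> K) = {}")
    case False
    moreover have "finite (lcol (X - K) (cut L \<kappa> K))" using X L by (intro finite_lcol) (auto simp: cut_def)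
    ultimately have "real (card (lcol (X - K) (cut L \<kappa> K))) > 0" by (simp add: card_gt_0_iff)
    then show ?thesis using X
      by (simp add: light_stat_merge sum.distrib revealed_mean_def EL_def distrib_left)
  qed simp
  then show ?thesis unfolding EL_def
    using sum_lcol_split[OF X(2) X(1) L, where H = "light_stat g X"] card_lcol_split[OF X(2) X(1) L] by simp
qed

text \<open>The pairs \<open>(h, J)\<close> are processed one at a time; clusters of big vertices are always switched
as a whole, so that every intermediate instance stays feasible.\<close>

definition pairs :: "'a set \<Rightarrow> 'a set \<Rightarrow> ('a \<times> 'a set) set" where
  "pairs X K = {(h, J). h \<in> K \<and> (\<exists>u\<in>X - K. J = cluster u \<and> J \<inter> Nb h \<noteq> {})}"

lemma finite_pairs: "finite X \<Longrightarrow> finite K \<Longrightarrow> finite (pairs X K)"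
  by (rule finite_subset[of _ "K \<times> cluster ` X"]) (auto simp: pairs_def)

text \<open>The two conditional laws are joined by a chain of instances in which one pair
  \<open>(h, J)\<close> at a time changes from \<open>\<kappa>\<close> to \<open>\<kappa>'\<close>.
  In one step only the colour that \<open>h\<close> forbids inside \<open>J\<close> changes, which
  is exactly the exchange measured by \<open>influence_le\<close>, and the steps add up.\<close>

lemma hybrid:
  assumes X: "finite X" "X \<subseteq> V" "closed X" and v: "v \<in> X" and K: "K = cluster v"
    and L: "\<And>u. u \<in> X - K \<Longrightarrow> finite (L u)"
    and La: "\<And>u. u \<in> X - K \<Longrightarrow> light u \<Longrightarrow> a + card (Nb u \<inter> X) \<le> card (L u)"
    and ne: "lcol (X - K) (cut L \<kappa> K) \<noteq> {}" "lcol (X - K) (cut L \<kappa>' K) \<noteq> {}"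
    and r: "\<And>h J. (h, J) \<in> pairs X K \<Longrightarrow> influence_le (X - K) J (r J)"
    and g: "unit_valued g"
  shows "\<bar>EL (X - K) (cut L \<kappa> K) (light_stat g (X - K)) - EL (X - K) (cut L \<kappa>' K) (light_stat g (X - K))\<bar>
     \<le> (\<Sum>p\<in>pairs X K. r (snd p))"
proof -
  \<comment> \<open>In \<open>M Q R\<close> the pairs of \<open>Q\<close> have switched to
    \<open>\<kappa>'\<close>, and those of \<open>R\<close> forbid nothing. The second argument
    isolates the colour exchanged in one step; the instances that are compared have
    \<open>R = {}\<close>.\<close>
  define M where "M Q R u = L u - (\<lambda>h. if (h, cluster u) \<in> Q then \<kappa>' h else \<kappa> h) ` {h \<in> Nb u \<inter> K. (h, cluster u) \<notin> R}" for Q R u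
  have KX: "K \<subseteq> X" using X v K by (auto simp: closed_def)
  have fK: "finite K" using KX X finite_subset by blast
  have clX: "closed (X - K)" using closed_Diff X K by blast
  obtain \<sigma> \<sigma>' where s: "\<sigma> \<in> lcol (X - K) (cut L \<kappa> K)" "\<sigma>' \<in> lcol (X - K) (cut L \<kappa>' K)" using ne by blast
  have M0: "M Q {} u = L u - (\<lambda>h. if (h, cluster u) \<in> Q then \<kappa>' h else \<kappa> h) ` (Nb u \<inter> K)" for Q u
    by (simp only: M_def empty_iff not_False_eq_True simp_thms Collect_mem_eq)
  have admissible: "admissible (X - K) (M Q {})" for Q
  proof -
    have c1: "a + card (Nb u \<inter> (X - K)) \<le> card (M Q {} u)" if u: "u \<in> X - K" "light u" for u
    proof -
      have "card (L u) - card ((\<lambda>h. if (h, cluster u) \<in> Q then \<kappa>' h else \<kappa> h) ` (Nb u \<inter> K)) \<le> card (M Q {} u)"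
        unfolding M0 by (rule diff_card_le_card_Diff) simp
      moreover have "card ((\<lambda>h. if (h, cluster u) \<in> Q then \<kappa>' h else \<kappa> h) ` (Nb u \<inter> K)) \<le> card (Nb u \<inter> K)"
        by (intro card_image_le) simp
      moreover have "card (Nb u \<inter> X) = card (Nb u \<inter> K) + card (Nb u \<inter> (X - K))"
        using KX by (subst card_Un_disjoint[symmetric]) (auto intro!: arg_cong[of _ _ card])
      ultimately show ?thesis using La[OF u] by linarith
    qed
    have c2: "finite (M Q {} u)" if "u \<in> X - K" for u using L[OF that] by (simp add: M_def)
    \<comment> \<open>If \<open>v\<close> is light, \<open>K\<close> is a single vertex, and every
      big cluster outside copies \<open>\<sigma>\<close> or \<open>\<sigma>'\<close> according to
      the one pair that concerns it. If \<open>v\<close> is big, no other big vertex touches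
      \<open>K\<close>, so both colorings respect the lists. The light vertices are then coloured
      greedily.\<close>
    have c3: "lcol (X - K) (M Q {}) \<noteq> {}"
    proof (rule lcol_greedy)
      define DD where "DD = {u \<in> X - K. \<not> light u}"
      define flag where "flag u \<longleftrightarrow> (\<exists>h\<in>K. (h, cluster u) \<in> Q)" for u
      show "DD \<subseteq> X - K" by (auto simp: DD_def)
      show "finite (X - K)" using X by simp
      show "restr DD (\<lambda>u. if flag u then \<sigma>' u else \<sigma> u) \<in> lcol DD (M Q {})"
      proof -
        have "(if flag u then \<sigma>' u else \<sigma> u) \<in> M Q {} u" if u: "u \<in> DD" for u
        proof (cases "light v")
          case True
          then have "K = {v}" by (simp add: K)
          then have f: "flag u \<longleftrightarrow> (v, cluster u) \<in> Q" by (auto simp: flag_def)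
          have "\<sigma> u \<in> cut L \<kappa> K u" "\<sigma>' u \<in> cut L \<kappa>' K u" using u s by (auto simp: lcol_def DD_def)
          then show ?thesis using \<open>K = {v}\<close> f by (auto simp: cut_def M0)
        next
          case False
          have "Nb u \<inter> K = {}"
          proof (rule ccontr)
            assume "Nb u \<inter> K \<noteq> {}"
            then obtain h where h: "h \<in> K" "adj u h" by (auto simp: Nb_def)
            then have "cluster u = cluster h" using u cluster_adj[of u h] cluster_big_sub[OF False, of h] K by (auto simp: DD_def)
            then have "u \<in> K" using h K cluster_eq self_cl by blast
            then show False using u by (simp add: DD_def)
          qed
          moreover have "\<sigma> u \<in> cut L \<kappa> K u" "\<sigma>' u \<in> cut L \<kappa>' K u" using u s by (auto simp: lcol_def DD_def)
          ultimately show ?thesis by (simp add: cut_def M0)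
        qed
        moreover have "(if flag u then \<sigma>' u else \<sigma> u) \<noteq> (if flag w then \<sigma>' w else \<sigma> w)"
          if "u \<in> DD" "w \<in> DD" "adj u w" for u w
        proof -
          have "flag u = flag w" using cluster_adj[of u w] that by (simp add: DD_def flag_def)
          then show ?thesis using that s by (auto simp: lcol_def DD_def)
        qed
        ultimately show ?thesis by (simp add: lcol_def restr_def)
      qed
      show "finite (M Q {} u) \<and> card (Nb u \<inter> (X - K)) < card (M Q {} u)" if "u \<in> X - K - DD" for u
      proof -
        have u: "u \<in> X - K" "light u" using that by (auto simp: DD_def)
        show ?thesis using c1[OF u] c2[OF u(1)] a4 by linarith
      qed
    qed
    show ?thesis using c1 c2 c3 by (simp add: admissible_def)
  qed
  have fP: "finite (pairs X K)" using finite_pairs X fK by blast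
  have tele: "Q \<subseteq> pairs X K \<longrightarrow> \<bar>EL (X - K) (M {} {}) (light_stat g (X - K)) - EL (X - K) (M Q {}) (light_stat g (X - K))\<bar>
     \<le> (\<Sum>p\<in>Q. r (snd p))" if "finite Q" for Q using that
  proof (induction Q rule: finite_induct)
    case (insert p Q)
    show ?case
    proof
      assume pQ: "insert p Q \<subseteq> pairs X K"
      obtain h J where p: "p = (h, J)" by (cases p)
      obtain u0 where u0: "u0 \<in> X - K" "J = cluster u0" and h: "h \<in> K" using pQ p by (auto simp: pairs_def)
      define S where "S = J \<inter> Nb h"
      have Jc: "cluster u = J \<longleftrightarrow> u \<in> J" for u using u0 cluster_eq self_cl by blast
      have Su: "u \<in> S \<longleftrightarrow> h \<in> Nb u \<inter> K \<and> cluster u = J" for u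
        using h adj_commute by (auto simp: S_def Jc in_Nb)
      have e1: "M Q {} u = remove_color (M Q {p}) (\<kappa> h) S u" for u
      proof (cases "u \<in> S")
        case True
        then have "{h' \<in> Nb u \<inter> K. (h', cluster u) \<notin> {}} = insert h {h' \<in> Nb u \<inter> K. (h', cluster u) \<notin> {p}}"
          using Su p by auto
        then show ?thesis using True Su insert.hyps p by (auto simp: M_def remove_color_def)
      next
        case False
        then have "{h' \<in> Nb u \<inter> K. (h', cluster u) \<notin> {}} = {h' \<in> Nb u \<inter> K. (h', cluster u) \<notin> {p}}"
          using Su p by auto
        then show ?thesis using False by (simp add: M_def remove_color_def)
      qed
      have e2: "M (insert p Q) {} u = remove_color (M Q {p}) (\<kappa>' h) S u" for u
      proof (cases "u \<in> S")
        case True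
        then have a: "{h' \<in> Nb u \<inter> K. (h', cluster u) \<notin> {}} = insert h {h' \<in> Nb u \<inter> K. (h', cluster u) \<notin> {p}}"
          using Su p by auto
        have "(\<lambda>h. if (h, cluster u) \<in> insert p Q then \<kappa>' h else \<kappa> h) ` {h' \<in> Nb u \<inter> K. (h', cluster u) \<notin> {p}}
           = (\<lambda>h. if (h, cluster u) \<in> Q then \<kappa>' h else \<kappa> h) ` {h' \<in> Nb u \<inter> K. (h', cluster u) \<notin> {p}}"
          by (rule image_cong) auto
        then show ?thesis using True Su p unfolding M_def a remove_color_def by auto
      next
        case False
        then have a: "{h' \<in> Nb u \<inter> K. (h', cluster u) \<notin> {}} = {h' \<in> Nb u \<inter> K. (h', cluster u) \<notin> {p}}"
          using Su p by auto
        have "(\<lambda>h. if (h, cluster u) \<in> insert p Q then \<kappa>' h else \<kappa> h) ` {h' \<in> Nb u \<inter> K. (h', cluster u) \<notin> {p}}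
           = (\<lambda>h. if (h, cluster u) \<in> Q then \<kappa>' h else \<kappa> h) ` {h' \<in> Nb u \<inter> K. (h', cluster u) \<notin> {p}}"
          by (rule image_cong) auto
        then show ?thesis using False unfolding M_def a remove_color_def by simp
      qed
      have m1: "M Q {} = remove_color (M Q {p}) (\<kappa> h) S" and m2: "M (insert p Q) {} = remove_color (M Q {p}) (\<kappa>' h) S"
        using e1 e2 by auto
      have "influence_le (X - K) J (r J)" using r pQ p by auto
      then have "\<bar>EL (X - K) (M Q {}) (light_stat g (X - K)) - EL (X - K) (M (insert p Q) {}) (light_stat g (X - K))\<bar> \<le> r J"
        unfolding influence_le_def using admissible[of Q] admissible[of "insert p Q"] g unfolding m1 m2 by (auto simp: S_def)
      then show "\<bar>EL (X - K) (M {} {}) (light_stat g (X - K)) - EL (X - K) (M (insert p Q) {}) (light_stat g (X - K))\<bar>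
        \<le> (\<Sum>p\<in>insert p Q. r (snd p))"
        using insert pQ p by auto
    qed
  qed simp
  have "EL (X - K) (M {} {}) H = EL (X - K) (cut L \<kappa> K) H" for H
    by (rule EL_cong) (auto simp: M_def cut_def)
  moreover have "EL (X - K) (M (pairs X K) {}) H = EL (X - K) (cut L \<kappa>' K) H" for H
  proof (rule EL_cong)
    fix u assume u: "u \<in> X - K"
    have "(h, cluster u) \<in> pairs X K" if "h \<in> Nb u \<inter> K" for h
      using that u self_cl[of u] adj_sym by (fastforce simp: pairs_def in_Nb)
    then have "(\<lambda>h. if (h, cluster u) \<in> pairs X K then \<kappa>' h else \<kappa> h) ` (Nb u \<inter> K) = \<kappa>' ` (Nb u \<inter> K)"
      by (intro image_cong) auto
    then show "M (pairs X K) {} u = cut L \<kappa>' K u" by (simp only: M0 cut_def)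
  qed
  ultimately show ?thesis using tele[OF fP] by simp
qed

end

context light_graph
begin

section \<open>Marginals of light vertices and single reveal steps\<close>

text \<open>Provides the score condition on \<open>K\<close> in \<open>val_superadditive\<close>;
  the value -1 is attained by a light vertex.\<close>

lemma conn_unit_score: "-1 \<le> sum gg (cluster v) - sum ll (cluster v)"
proof (cases "light v")
  case False
  then have "sum ll (cluster v) = 0" using cluster_big_sub by (intro sum.neutral) (auto simp: ll_eq)
  moreover have "0 \<le> sum gg (cluster v)" by (simp add: sum_nonneg gg_nonneg)
  ultimately show ?thesis by linarith
qed (simp add: gg_light ll_eq)

text \<open>An edge among the neighbours that survives the removal of \<open>u1\<close> forms a
  triangle with \<open>w\<close>, and \<open>u1\<close>, adjacent to both \<open>w\<close> and
  \<open>u2\<close>, adds a further cycle. These are at most five vertices, so their score is at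
  least -5 and \<open>few_cycles\<close> excludes them.\<close>

lemma one_edge_in_Nb:
  assumes "X \<subseteq> V" "w \<in> X"
  obtains N where "N \<subseteq> Nb w \<inter> X" "\<And>u v. u \<in> N \<Longrightarrow> v \<in> N \<Longrightarrow> \<not> adj u v" "card (Nb w \<inter> X - N) \<le> 1"
proof (cases "\<exists>u1\<in>Nb w \<inter> X. \<exists>u2\<in>Nb w \<inter> X. adj u1 u2")
  case False
  then show ?thesis using that[of "Nb w \<inter> X"] by auto
next
  case True
  then obtain u1 u2 where u: "u1 \<in> Nb w \<inter> X" "u2 \<in> Nb w \<inter> X" "adj u1 u2" by blast
  define N where "N = Nb w \<inter> X - {u1}"
  have "\<not> adj u3 u4" if n: "u3 \<in> N" "u4 \<in> N" for u3 u4
  proof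
    assume e: "adj u3 u4"
    define W where "W = insert u2 {u3, u4, w}"
    have wadj: "adj w u1" "adj w u2" "adj w u3" "adj w u4" using u n by (auto simp: N_def in_Nb)
    have "excess {u4, w} \<ge> -2" using excess_insert[of "{w}" u4] wadj adj_irrefl adj_sym
      by (cases "u4 = w") (auto simp: Nb_def)
    moreover have "u3 \<notin> {u4, w}" using e wadj adj_irrefl by auto
    moreover have "Nb u3 \<inter> {u4, w} = {u4, w}" using e wadj adj_sym by (auto simp: in_Nb)
    moreover have "u4 \<noteq> w" using wadj(4) adj_irrefl by metis
    then have "card {u4, w} = 2" by simp
    ultimately have e3: "excess {u3, u4, w} \<ge> 0" using excess_insert[of "{u4, w}" u3] by simp
    have cW: "conn {u3, u4, w}"
    proof -
      have "conn {u4, w}" using conn_edge_pair wadj adj_sym by blast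
      then show ?thesis by (rule conn_insert[of _ w]) (use wadj in auto)
    qed
    have cW2: "conn W" unfolding W_def by (rule conn_insert[OF cW, of w]) (use wadj in auto)
    have e2: "excess W \<ge> 0"
      using excess_mono[OF cW2, of "{u3, u4, w}"] e3 by (auto simp: W_def)
    have u1W: "u1 \<notin> W" using n u(3) wadj adj_irrefl by (auto simp: W_def N_def)
    have sub: "{w, u2} \<subseteq> Nb u1 \<inter> W" using u(3) wadj adj_sym by (auto simp: W_def in_Nb)
    have "w \<noteq> u2" using wadj(2) adj_irrefl by metis
    then have "card {w, u2} = 2" by simp
    then have "card (Nb u1 \<inter> W) \<ge> 2" using card_mono[OF _ sub] by simp
    then have big: "excess (insert u1 W) > 0" using excess_insert[of W u1] u1W e2 by (simp add: W_def)
    have cc: "conn (insert u1 W)" by (rule conn_insert[OF cW2, of w]) (use wadj in \<open>auto simp: W_def\<close>)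
    have sV: "insert u1 W \<subseteq> V" using assms u n by (auto simp: W_def N_def)
    have "sum ll (insert u1 W) \<le> (\<Sum>x\<in>insert u1 W. 1)" by (intro sum_mono) (simp add: ll_eq)
    also have "\<dots> \<le> 5" using card_insert_le_m1 by (simp add: W_def card_insert_if)
    finally have "-10 \<le> 4 * sum gg (insert u1 W) - sum ll (insert u1 W)"
      using sum_nonneg[of "insert u1 W" gg] gg_nonneg by simp
    then show False using few_cycles[OF sV cc] big by simp
  qed
  moreover have "Nb w \<inter> X - N \<subseteq> {u1}" by (auto simp: N_def)
  then have "card (Nb w \<inter> X - N) \<le> 1" using card_mono[of "{u1}"] by simp
  ultimately show ?thesis using that[of N] by (auto simp: N_def)
qed

text \<open>The case \<open>N = {}\<close> of \<open>marginal_bound\<close>: all neighbours are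
  revealed, and at least \<open>a\<close> colours remain.\<close>

lemma light_marginal_weak:
  assumes X: "finite X" "w \<in> X" and L: "admissible X L" and w: "light w"
  shows "real (card {\<sigma> \<in> lcol X L. \<sigma> w = c}) \<le> 1 / real a * real (card (lcol X L))"
proof -
  have "real (card {\<sigma> \<in> lcol X L. \<sigma> w = c})
    \<le> exp ((1 + 1 / real a) * real (card ({}::'a set)) / real a) / real a * real (card (lcol X L))"
    by (rule marginal_bound) (use assms a4 in \<open>auto simp: admissible_def\<close>)
  then show ?thesis by simp
qed

text \<open>This is the contraction for which k / D has to exceed \<alpha>: with m neighbours and l
  = a + m colours, \<open>marginal_bound\<close> gives about (m / l) * exp (m / l), which increases
  with m up to \<open>D\<close>. The neighbour dropped in \<open>one_edge_in_Nb\<close> still counts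
  in the product, and the term \<open>1 / a\<close> in \<open>strong\<close> pays for it.\<close>

lemma light_marginal_strong:
  assumes X: "X \<subseteq> V" "w \<in> X" and L: "admissible X L" and w: "light w"
    and nb: "\<And>u. u \<in> Nb w \<inter> X \<Longrightarrow> light u"
  shows "real (card (Nb w \<inter> X)) * real (card {\<sigma> \<in> lcol X L. \<sigma> w = c}) \<le> (1 - \<delta>) * real (card (lcol X L))"
proof -
  obtain N where N: "N \<subseteq> Nb w \<inter> X" "\<And>u v. u \<in> N \<Longrightarrow> v \<in> N \<Longrightarrow> \<not> adj u v" "card (Nb w \<inter> X - N) \<le> 1"
    using one_edge_in_Nb[OF X] by blast
  have fX: "finite X" using X finV finite_subset by blast
  define m where "m = card N"
  define l where "l = real (a + m)"
  have cs: "card (Nb w \<inter> X) = m + card (Nb w \<inter> X - N)"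
    using N(1) card_Un_disjoint[of N "Nb w \<inter> X - N"] finite_subset[OF N(1)] by (simp add: m_def Un_absorb1)
  have mD: "m \<le> D"
    using light_deg[OF w] N(1) card_mono[of "Nb w" N] by (simp add: m_def)
  have l0: "l > 0" using a4 by (simp add: l_def)
  define p where "p = exp ((1 + 1 / real a) * real m / l) / l"
  have "real (card {\<sigma> \<in> lcol X L. \<sigma> w = c}) \<le> p * real (card (lcol X L))"
    unfolding p_def m_def
  proof (rule marginal_bound[OF fX X(2) N(1) N(2)])
    show "l + real (card (Nb w \<inter> X - N)) \<le> real (card (L w))"
      using L X(2) w cs unfolding admissible_def l_def by fastforce
    show "a + card (Nb u \<inter> X) \<le> card (L u)" if "u \<in> N" for u
    proof -
      have "u \<in> Nb w \<inter> X" using that N(1) by blast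
      then show ?thesis using nb[of u] L by (simp add: admissible_def)
    qed
  qed (use L a4 l0 in \<open>auto simp: admissible_def\<close>)
  moreover have "real (card (Nb w \<inter> X)) * p \<le> 1 - \<delta>"
  proof -
    define q where "q = real D / real (a + D)"
    have ml: "real m / l \<le> q"
    proof -
      have "real m * real (a + D) \<le> real D * real (a + m)" using mD mult_right_mono[of "real m" "real D" "real a"] by (simp add: algebra_simps)
      then show ?thesis using a4 by (simp add: q_def l_def divide_le_eq pos_le_divide_eq mult.commute)
    qed
    have "real (card (Nb w \<inter> X)) / l \<le> real (m + 1) / l"
      using cs N(3) l0 by (intro divide_right_mono) auto
    also have "\<dots> \<le> q + 1 / real a"
    proof -
      have "1 / l \<le> 1 / real a" using a4 by (simp add: l_def frac_le)
      then show ?thesis using ml by (simp add: add_divide_distrib)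
    qed
    finally have 1: "real (card (Nb w \<inter> X)) / l \<le> q + 1 / real a" .
    have "(1 + 1 / real a) * real m / l \<le> (1 + 1 / real a) * q"
      using mult_left_mono[OF ml, of "1 + 1 / real a"] by simp
    then have 2: "exp ((1 + 1 / real a) * real m / l) \<le> exp ((1 + 1 / real a) * q)" by simp
    have "real (card (Nb w \<inter> X)) * p = real (card (Nb w \<inter> X)) / l * exp ((1 + 1 / real a) * real m / l)"
      by (simp add: p_def)
    also have "\<dots> \<le> (q + 1 / real a) * exp ((1 + 1 / real a) * q)"
      using 1 2 by (intro mult_mono) (auto simp: q_def)
    also have "\<dots> \<le> 1 - \<delta>" using strong by (simp add: q_def)
    finally show ?thesis .
  qed
  ultimately have "real (card (Nb w \<inter> X)) * real (card {\<sigma> \<in> lcol X L. \<sigma> w = c})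
     \<le> real (card (Nb w \<inter> X)) * (p * real (card (lcol X L)))" by (intro mult_left_mono) auto
  also have "\<dots> \<le> (1 - \<delta>) * real (card (lcol X L))"
    using mult_right_mono[OF \<open>real (card (Nb w \<inter> X)) * p \<le> 1 - \<delta>\<close>, of "real (card (lcol X L))"] by (simp add: mult_ac)
  finally show ?thesis .
qed

lemma light_stat_cluster: "\<not> light v \<Longrightarrow> light_stat g (cluster v) \<kappa> = 0"
  using cluster_big_sub by (auto simp: light_stat_def intro!: sum.neutral)

lemma light_stat_light: "light w \<Longrightarrow> light_stat g {w} \<kappa> = g w (\<kappa> w)"
  by (simp add: light_stat_def Collect_conv_if)

lemma cut_rem: "S \<subseteq> K \<Longrightarrow> u \<notin> K \<Longrightarrow> cut (remove_color L x S) \<kappa> K u = cut L \<kappa> K u"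
  by (auto simp: cut_def remove_color_def)

lemma admissible_cut_pos:
  assumes "finite X" "\<And>u. u \<in> X \<Longrightarrow> finite (L u)"
  shows "0 < real (card (lcol (X - K) (cut L \<kappa> K))) \<longleftrightarrow> lcol (X - K) (cut L \<kappa> K) \<noteq> {}"
proof -
  have "finite (lcol (X - K) (cut L \<kappa> K))" using assms by (intro finite_lcol) (auto simp: cut_def)
  then show ?thesis by (simp add: card_gt_0_iff)
qed

text \<open>Changing lists inside the cluster affects only the law of its own coloring, and any two
  colorings of the cluster give means within the hybrid bound. Big vertices do not enter
  \<open>light_stat\<close>, so the cluster adds nothing of its own.\<close>

lemma influence_le_cluster:
  assumes X: "finite X" "X \<subseteq> V" "closed X" and v: "v \<in> X" "\<not> light v"
    and r: "\<And>h J. (h, J) \<in> pairs X (cluster v) \<Longrightarrow> influence_le (X - cluster v) J (r J)"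
  shows "influence_le X (cluster v) (\<Sum>p\<in>pairs X (cluster v). r (snd p))"
  unfolding influence_le_def
proof (intro allI impI)
  fix L x y S g
  define K where "K = cluster v"
  assume S: "S \<subseteq> cluster v" and ax: "admissible X (remove_color L x S)" and ay: "admissible X (remove_color L y S)" and g: "unit_valued g"
  have KX: "K \<subseteq> X" using X v by (auto simp: closed_def K_def)
  have SK: "S \<subseteq> K" using S by (simp add: K_def)
  have fin: "finite (remove_color L x S u)" "finite (remove_color L y S u)" if "u \<in> X" for u using ax ay that by (auto simp: admissible_def)
  have finL: "finite (L u)" if "u \<in> X" for u using fin[OF that] by (auto simp: remove_color_def split: if_splits)
  define c where "c \<kappa> = real (card (lcol (X - K) (cut L \<kappa> K)))" for \<kappa>
  define f where "f \<kappa> = revealed_mean g X K L \<kappa>" for \<kappa>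
  have cx: "real (card (lcol (X - K) (cut (remove_color L z S) \<kappa> K))) = c \<kappa>" for z \<kappa>
    unfolding c_def using lcol_cong[of "X - K" "cut (remove_color L z S) \<kappa> K" "cut L \<kappa> K"] cut_rem[OF SK] by simp
  have fx: "revealed_mean g X K (remove_color L z S) \<kappa> = f \<kappa>" for z \<kappa>
    unfolding f_def revealed_mean_def using EL_cong[of "X - K" "cut (remove_color L z S) \<kappa> K" "cut L \<kappa> K"] cut_rem[OF SK] by simp
  have E: "EL X (remove_color L z S) (light_stat g X) = (\<Sum>\<kappa>\<in>lcol K (remove_color L z S). c \<kappa> * f \<kappa>) / (\<Sum>\<kappa>\<in>lcol K (remove_color L z S). c \<kappa>)"
    if "admissible X (remove_color L z S)" for z
    by (subst EL_reveal[OF X(1) KX]) (use that in \<open>auto simp: cx fx admissible_def\<close>)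
  have P: "0 < (\<Sum>\<kappa>\<in>lcol K (remove_color L z S). c \<kappa>)" if "admissible X (remove_color L z S)" for z
  proof -
    have ff: "\<And>u. u \<in> X \<Longrightarrow> finite (remove_color L z S u)" and ne: "lcol X (remove_color L z S) \<noteq> {}" using that by (auto simp: admissible_def)
    have "real (card (lcol X (remove_color L z S))) = (\<Sum>\<kappa>\<in>lcol K (remove_color L z S). c \<kappa>)"
      using card_lcol_split[OF KX X(1) ff] cx by simp
    moreover have "finite (lcol X (remove_color L z S))" by (rule finite_lcol[OF X(1) ff])
    ultimately show ?thesis using ne by (metis card_gt_0_iff of_nat_0_less_iff)
  qed
  have fK: "finite K" using KX X(1) finite_subset by blast
  have fl: "finite (lcol K (remove_color L z S))" if "admissible X (remove_color L z S)" for z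
    by (rule finite_lcol[OF fK]) (use that KX in \<open>auto simp: admissible_def\<close>)
  define R where "R = (\<Sum>p\<in>pairs X (cluster v). r (snd p))"
  have d: "\<bar>f \<kappa> - f \<kappa>'\<bar> \<le> R" if "0 < c \<kappa>" "0 < c \<kappa>'" for \<kappa> \<kappa>'
  proof -
    have lu: "a + card (Nb u \<inter> X) \<le> card (L u)" if "u \<in> X - K" "light u" for u
    proof -
      have "remove_color L x S u = L u" using that SK by (auto simp: remove_color_def)
      then show ?thesis using ax that by (metis Diff_iff admissible_def)
    qed
    have "\<bar>EL (X - K) (cut L \<kappa> K) (light_stat g (X - K)) - EL (X - K) (cut L \<kappa>' K) (light_stat g (X - K))\<bar> \<le> R"
      unfolding R_def K_def[symmetric]
      by (rule hybrid[OF X v(1) K_def])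
         (use lu finL that admissible_cut_pos[OF X(1) finL] r g in \<open>auto simp: c_def K_def\<close>)
    then show ?thesis using v by (simp add: f_def revealed_mean_def K_def light_stat_cluster)
  qed
  show "\<bar>EL X (remove_color L x S) (light_stat g X) - EL X (remove_color L y S) (light_stat g X)\<bar> \<le> (\<Sum>p\<in>pairs X (cluster v). r (snd p))"
    unfolding E[OF ax] R_def[symmetric]
  proof (rule weighted_avg_diff[OF fl[OF ax] _ P[OF ax]])
    fix \<kappa> assume k: "\<kappa> \<in> lcol K (remove_color L x S)" "0 < c \<kappa>"
    have "\<bar>EL X (remove_color L y S) (light_stat g X) - f \<kappa>\<bar> \<le> R"
      unfolding E[OF ay] by (rule weighted_avg_diff[OF fl[OF ay] _ P[OF ay]]) (use d k in \<open>auto simp: c_def\<close>)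
    then show "\<bar>f \<kappa> - EL X (remove_color L y S) (light_stat g X)\<bar> \<le> R" by (simp add: abs_minus_commute)
  qed (simp add: c_def)
qed

lemma light_osc:
  assumes X: "finite X" "X \<subseteq> V" "closed X" and w: "w \<in> X" "light w"
    and L: "\<And>u. u \<in> X \<Longrightarrow> finite (L u)" "\<And>u. u \<in> X - {w} \<Longrightarrow> light u \<Longrightarrow> a + card (Nb u \<inter> X) \<le> card (L u)"
    and r: "\<And>h J. (h, J) \<in> pairs X {w} \<Longrightarrow> influence_le (X - {w}) J (r J)"
    and ne: "lcol (X - {w}) (cut L \<kappa> {w}) \<noteq> {}" "lcol (X - {w}) (cut L \<kappa>' {w}) \<noteq> {}" and g: "unit_valued g"
  shows "\<bar>EL (X - {w}) (cut L \<kappa> {w}) (light_stat g (X - {w})) - EL (X - {w}) (cut L \<kappa>' {w}) (light_stat g (X - {w}))\<bar>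
     \<le> (\<Sum>p\<in>pairs X {w}. r (snd p))"
  by (rule hybrid[OF X w(1)]) (use assms in auto)

text \<open>Exchanging the excluded colour at \<open>w\<close> moves probability at most
  \<open>p\<close>. Such a move changes the mean by at most 1 for \<open>w\<close> itself and by the
  hybrid bound for the rest; \<open>avoid_diff\<close> combines the two.\<close>

lemma influence_le_light:
  assumes X: "finite X" "X \<subseteq> V" "closed X" and w: "w \<in> X" "light w"
    and r: "\<And>h J. (h, J) \<in> pairs X {w} \<Longrightarrow> influence_le (X - {w}) J (r J)"
    and p: "0 \<le> p" "\<And>L c. admissible X L \<Longrightarrow> real (card {\<sigma> \<in> lcol X L. \<sigma> w = c}) \<le> p * real (card (lcol X L))"
    and r0: "0 \<le> (\<Sum>p\<in>pairs X {w}. r (snd p))"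
  shows "influence_le X {w} (p * (1 + (\<Sum>p\<in>pairs X {w}. r (snd p))))"
  unfolding influence_le_def
proof (intro allI impI)
  fix L x y S g
  assume S: "S \<subseteq> {w}" and ax: "admissible X (remove_color L x S)" and ay: "admissible X (remove_color L y S)" and g: "unit_valued g"
  define R where "R = 1 + (\<Sum>p\<in>pairs X {w}. r (snd p))"
  have R0: "0 \<le> R" using r0 by (simp add: R_def)
  show "\<bar>EL X (remove_color L x S) (light_stat g X) - EL X (remove_color L y S) (light_stat g X)\<bar> \<le> p * (1 + (\<Sum>p\<in>pairs X {w}. r (snd p)))"
  proof (cases "S = {}")
    case True
    then show ?thesis using p R0 by (simp add: remove_color_def R_def)
  next
    case False
    then have Sw: "S = {w}" using S by blast
    have wX: "{w} \<subseteq> X" using w by simp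
    have fin: "finite (L u)" if "u \<in> X" for u
      using ax that by (auto simp: admissible_def remove_color_def split: if_splits)
    define e where "e c = (\<lambda>v. if v = w then c else 0 :: nat)" for c
    define c where "c u = real (card (lcol (X - {w}) (cut L (e u) {w})))" for u
    define f where "f u = revealed_mean g X {w} L (e u)" for u
    have cx: "real (card (lcol (X - {w}) (cut (remove_color L z S) \<kappa> {w}))) = real (card (lcol (X - {w}) (cut L \<kappa> {w})))" for z \<kappa>
      using lcol_cong[of "X - {w}" "cut (remove_color L z S) \<kappa> {w}" "cut L \<kappa> {w}"] cut_rem[OF S] by simp
    have fx: "revealed_mean g X {w} (remove_color L z S) \<kappa> = revealed_mean g X {w} L \<kappa>" for z \<kappa>
      unfolding revealed_mean_def using EL_cong[of "X - {w}" "cut (remove_color L z S) \<kappa> {w}" "cut L \<kappa> {w}"] cut_rem[OF S] by simp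
    have re: "(\<Sum>\<kappa>\<in>lcol {w} (remove_color L z S). h \<kappa>) = (\<Sum>u\<in>L w - {z}. h (e u))" for z and h :: "_ \<Rightarrow> real"
      using sum.reindex_bij_betw[OF lcol_singleton[where L = "remove_color L z S" and w = w], of h] by (simp add: Sw remove_color_def e_def)
    have E: "EL X (remove_color L z S) (light_stat g X) = (\<Sum>u\<in>L w - {z}. c u * f u) / sum c (L w - {z})"
      if "admissible X (remove_color L z S)" for z
      by (subst EL_reveal[OF X(1) wX]) (use that in \<open>auto simp: cx fx admissible_def re c_def f_def\<close>)
    have T: "real (card (lcol X (remove_color L z S))) = sum c (L w - {z})" if "admissible X (remove_color L z S)" for z
      using card_lcol_split[OF wX X(1), where L = "remove_color L z S"] that cx re[where z = z] by (simp add: admissible_def c_def)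
    have P: "0 < sum c (L w - {z})" if z: "admissible X (remove_color L z S)" for z
    proof -
      have "finite (lcol X (remove_color L z S))" by (rule finite_lcol[OF X(1)]) (use z in \<open>auto simp: admissible_def\<close>)
      then show ?thesis using z T[OF z] by (metis admissible_def card_gt_0_iff of_nat_0_less_iff)
    qed
    have pz: "c u \<le> p * sum c (L w - {z})" if z: "admissible X (remove_color L z S)" and u: "u \<in> L w - {z}" for z u
    proof -
      have ff: "\<And>u. u \<in> X \<Longrightarrow> finite (remove_color L z S u)" using z by (simp add: admissible_def)
      have fl: "finite (lcol X (remove_color L z S))" "\<And>\<kappa>. finite (lcol (X - {w}) (cut (remove_color L z S) \<kappa> {w}))"
        using ff X(1) by (auto intro!: finite_lcol simp: cut_def)
      have "real (card {\<sigma> \<in> lcol X (remove_color L z S). \<sigma> w = u}) = (\<Sum>\<sigma>\<in>lcol X (remove_color L z S). if \<sigma> w = u then 1 else 0)"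
        using fl by (simp add: sum.If_cases Int_def)
      also have "\<dots> = (\<Sum>\<kappa>\<in>lcol {w} (remove_color L z S). \<Sum>\<sigma>\<in>lcol (X - {w}) (cut (remove_color L z S) \<kappa> {w}). if \<kappa> w = u then 1 else 0)"
        using sum_lcol_split[OF wX X(1) ff, where H = "\<lambda>\<sigma>. if \<sigma> w = u then 1::real else 0"] by (simp add: merge_def)
      also have "\<dots> = (\<Sum>\<kappa>\<in>lcol {w} (remove_color L z S). if \<kappa> w = u then real (card (lcol (X - {w}) (cut L \<kappa> {w}))) else 0)"
        by (intro sum.cong refl) (simp add: cx)
      also have "\<dots> = (\<Sum>u'\<in>L w - {z}. if u' = u then c u else 0)"
        unfolding re by (intro sum.cong refl) (auto simp: e_def c_def)
      also have "\<dots> = c u" using u fin[OF w(1)] by simp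
      finally have "real (card {\<sigma> \<in> lcol X (remove_color L z S). \<sigma> w = u}) = c u" .
      then show ?thesis using p(2)[OF z, of u] T[OF z] by simp
    qed
    have "\<bar>(\<Sum>u\<in>L w - {x}. c u * f u) / sum c (L w - {x}) - (\<Sum>u\<in>L w - {y}. c u * f u) / sum c (L w - {y})\<bar> \<le> p * R"
    proof (rule avoid_diff)
      fix u v assume uv: "u \<in> L w" "v \<in> L w" "0 < c u" "0 < c v"
      have lu: "a + card (Nb z \<inter> X) \<le> card (L z)" if "z \<in> X - {w}" "light z" for z
      proof -
        have "remove_color L x S z = L z" using that Sw by (auto simp: remove_color_def)
        then show ?thesis using ax that by (metis Diff_iff admissible_def)
      qed
      have "\<bar>EL (X - {w}) (cut L (e u) {w}) (light_stat g (X - {w})) - EL (X - {w}) (cut L (e v) {w}) (light_stat g (X - {w}))\<bar>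
        \<le> (\<Sum>p\<in>pairs X {w}. r (snd p))"
        by (rule light_osc[OF X w fin lu r])
           (use uv admissible_cut_pos[OF X(1) fin] g in \<open>auto simp: c_def\<close>)
      moreover have "\<bar>g w (e u w) - g w (e v w)\<bar> \<le> 1" using g by (smt (verit) unit_valued_def)
      ultimately show "\<bar>f u - f v\<bar> \<le> R"
        using w by (simp add: f_def revealed_mean_def R_def light_stat_light)
    qed (use fin[OF w(1)] P[OF ax] P[OF ay] pz[OF ax] pz[OF ay] p R0 in \<open>auto simp: c_def\<close>)
    then show ?thesis unfolding E[OF ax] E[OF ay] R_def .
  qed
qed

end

context light_graph
begin

section \<open>Recursive influence bound with witness sets\<close>

definition base_influence :: "'a set \<Rightarrow> real" where
  "base_influence J = (if \<exists>u. light u \<and> J = {u} then B else 0)"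

text \<open>A light vertex may have influence \<open>B\<close> for free. Any further amount
  \<open>t\<close> has to be certified by a connected set \<open>W\<close> of at least that weight,
  which turns the recursive estimate into a property of the graph. For big clusters \<open>t\<close>
  is at least 2, so that a light vertex next to one has enough budget for the weak marginal
  bound.\<close>

definition influence_witness :: "'a set \<Rightarrow> 'a set \<Rightarrow> real \<Rightarrow> 'a set \<Rightarrow> bool" where
  "influence_witness X J t W \<longleftrightarrow> 0 \<le> t \<and> influence_le X J (base_influence J + t) \<and>
     (0 < t \<longrightarrow> conn W \<and> J \<subseteq> W \<and> W \<subseteq> X \<and> t \<le> val W) \<and> ((\<nexists>u. light u \<and> J = {u}) \<longrightarrow> 2 \<le> t)"

lemma base_influence_cl: "base_influence (cluster v) = (if light v then B else 0)"
proof (cases "light v")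
  case False
  then have "\<not> (\<exists>u. light u \<and> cluster v = {u})" using cluster_big_sub self_cl by (metis singletonD)
  then show ?thesis using False by (simp only: base_influence_def if_False)
qed (auto simp: base_influence_def)

text \<open>What the surroundings of one cluster contribute: \<open>B\<close> for each edge to a
  light vertex, and the certified amounts, whose witnesses are glued to \<open>K\<close> by
  \<open>val_superadditive\<close>.\<close>

lemma children_sum:
  assumes X: "finite X" "X \<subseteq> V" "closed X" and v: "v \<in> X" and K: "K = cluster v"
    and t: "\<And>u. u \<in> X - K \<Longrightarrow> influence_witness (X - K) (cluster u) (t (cluster u)) (Wf (cluster u))"
  shows "(\<Sum>p\<in>pairs X K. base_influence (snd p) + t (snd p)) \<le> B * (\<Sum>h\<in>K. real (card (Nb h \<inter> X))) + (\<Sum>p\<in>pairs X K. t (snd p))"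
    and "0 \<le> (\<Sum>p\<in>pairs X K. t (snd p))"
    and "\<exists>W. conn W \<and> K \<subseteq> W \<and> W \<subseteq> X \<and> sum gg K - sum ll K + (\<Sum>p\<in>pairs X K. t (snd p)) \<le> val W"
proof -
  have KX: "K \<subseteq> X" using X v K by (auto simp: closed_def)
  have fK: "finite K" using KX X finite_subset by blast
  have fP: "finite (pairs X K)" using finite_pairs X fK by blast
  have pt: "influence_witness (X - K) (snd p) (t (snd p)) (Wf (snd p))" if "p \<in> pairs X K" for p
    using that t by (auto simp: pairs_def)
  have t0: "0 \<le> t (snd p)" if "p \<in> pairs X K" for p using pt[OF that] by (simp add: influence_witness_def)
  show "0 \<le> (\<Sum>p\<in>pairs X K. t (snd p))" by (intro sum_nonneg t0)
  define PL where "PL = {p \<in> pairs X K. \<exists>u. light u \<and> snd p = {u}}"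
  have "(\<Sum>p\<in>pairs X K. base_influence (snd p)) = (\<Sum>p\<in>PL. B)"
    unfolding PL_def base_influence_def using fP by (subst sum.inter_filter[symmetric]) auto
  also have "\<dots> = B * real (card PL)" by simp
  also have "real (card PL) \<le> (\<Sum>h\<in>K. real (card (Nb h \<inter> X)))"
  proof -
    have "PL \<subseteq> (\<lambda>(h, u). (h, {u})) ` (SIGMA h:K. Nb h \<inter> X)"
    proof
      fix p assume "p \<in> PL"
      then obtain h u where "p = (h, {u})" "(h, {u}) \<in> pairs X K" by (cases p) (auto simp: PL_def)
      moreover from this obtain ua where ua: "ua \<in> X - K" "{u} = cluster ua" "h \<in> K" "{u} \<inter> Nb h \<noteq> {}"
        by (auto simp: pairs_def)
      moreover from ua have "ua = u" using self_cl[of ua] by auto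
      ultimately have "p = (h, {u})" "h \<in> K" "u \<in> Nb h \<inter> X" by auto
      then show "p \<in> (\<lambda>(h, u). (h, {u})) ` (SIGMA h:K. Nb h \<inter> X)" by force
    qed
    then have "card PL \<le> card (SIGMA h:K. Nb h \<inter> X)"
      using fK by (meson card_image_le card_mono finite_Int finite_Nb finite_SigmaI finite_imageI order_trans)
    also have "\<dots> = (\<Sum>h\<in>K. card (Nb h \<inter> X))" using fK by simp
    finally show ?thesis by (metis of_nat_le_iff of_nat_sum)
  qed
  finally have "(\<Sum>p\<in>pairs X K. base_influence (snd p)) \<le> B * (\<Sum>h\<in>K. real (card (Nb h \<inter> X)))"
    using B0 by (simp add: mult_left_mono)
  then show "(\<Sum>p\<in>pairs X K. base_influence (snd p) + t (snd p)) \<le> B * (\<Sum>h\<in>K. real (card (Nb h \<inter> X))) + (\<Sum>p\<in>pairs X K. t (snd p))"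
    by (simp add: sum.distrib)
  define I where "I = {p \<in> pairs X K. 0 < t (snd p)}"
  define e where "e p = (fst p, SOME u. u \<in> snd p \<and> adj (fst p) u)" for p :: "'a \<times> 'a set"
  have ee: "fst p \<in> K \<and> snd (e p) \<in> snd p \<and> adj (fst p) (snd (e p))" if "p \<in> pairs X K" for p
  proof -
    have "\<exists>u. u \<in> snd p \<and> adj (fst p) u" using that by (auto simp: pairs_def in_Nb)
    from someI_ex[OF this] show ?thesis using that by (auto simp: e_def pairs_def)
  qed
  have WI: "conn (Wf (snd p)) \<and> snd p \<subseteq> Wf (snd p) \<and> Wf (snd p) \<subseteq> X - K \<and> t (snd p) \<le> val (Wf (snd p)) \<and> 0 < t (snd p)"
    if "p \<in> I" for p using that pt[of p] by (auto simp: I_def influence_witness_def)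
  define W where "W = K \<union> (\<Union>p\<in>I. Wf (snd p))"
  have fI: "finite I" using fP by (simp add: I_def)
  \<comment> \<open>A pair is recovered from its edge: the first component is its start, the second
    is the cluster of its end.\<close>
  have inj: "inj_on e I"
  proof (rule inj_onI)
    fix p q assume pq: "p \<in> I" "q \<in> I" "e p = e q"
    then have "snd (e p) \<in> snd p \<inter> snd q" using ee by (metis I_def IntI mem_Collect_eq)
    moreover have "\<exists>u. snd p = cluster u" "\<exists>u. snd q = cluster u" using pq by (auto simp: I_def pairs_def)
    then obtain u u' where "snd p = cluster u" "snd q = cluster u'" by blast
    ultimately have "snd p = snd q" using cluster_eq by (metis IntD1 IntD2)
    moreover have "fst p = fst q" using pq by (simp add: e_def)
    ultimately show "p = q" by (simp add: prod_eq_iff)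
  qed
  have cK: "conn K" by (simp add: K conn_cl)
  have eI: "fst (e p) \<in> K \<and> snd (e p) \<in> Wf (snd p) \<and> adj (fst (e p)) (snd (e p))" if "p \<in> I" for p
  proof -
    have "p \<in> pairs X K" using that by (simp add: I_def)
    moreover have "fst (e p) = fst p" by (simp add: e_def)
    ultimately show ?thesis using WI[OF that] ee[of p] by auto
  qed
  have "conn W" unfolding W_def
  proof (rule conn_UN[OF fI cK, of "\<lambda>p. Wf (snd p)" e])
    show "conn (Wf (snd p))" if "p \<in> I" for p using WI[OF that] by blast
    show "fst (e p) \<in> K \<and> snd (e p) \<in> Wf (snd p) \<and> adj (fst (e p)) (snd (e p))" if "p \<in> I" for p
      using eI[OF that] .
  qed
  moreover have "sum gg K - sum ll K + (\<Sum>p\<in>I. val (Wf (snd p))) \<le> val W" unfolding W_def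
  proof (rule val_superadditive[OF cK _ _ fI _ _ inj])
    show "K \<subseteq> V" using KX X by blast
    show "-1 \<le> sum gg K - sum ll K" using conn_unit_score K by simp
    show "conn (Wf (snd p)) \<and> Wf (snd p) \<subseteq> V \<and> Wf (snd p) \<inter> K = {} \<and> 0 \<le> val (Wf (snd p))" if "p \<in> I" for p
      using WI[OF that] X by auto
    show "fst (e p) \<in> K \<and> snd (e p) \<in> Wf (snd p) \<and> adj (fst (e p)) (snd (e p))" if "p \<in> I" for p
      using eI[OF that] .
  qed
  moreover have "(\<Sum>p\<in>pairs X K. t (snd p)) \<le> (\<Sum>p\<in>I. val (Wf (snd p)))"
  proof -
    have "(\<Sum>p\<in>pairs X K. t (snd p)) = (\<Sum>p\<in>I. t (snd p))"
      by (rule sum.mono_neutral_right) (use fP t0 in \<open>force simp: I_def\<close>)+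
    also have "\<dots> \<le> (\<Sum>p\<in>I. val (Wf (snd p)))" by (intro sum_mono) (use WI in auto)
    finally show ?thesis .
  qed
  moreover have "W \<subseteq> X" using WI KX by (auto simp: W_def)
  moreover have "K \<subseteq> W" by (simp add: W_def)
  ultimately show "\<exists>W. conn W \<and> K \<subseteq> W \<and> W \<subseteq> X \<and> sum gg K - sum ll K + (\<Sum>p\<in>pairs X K. t (snd p)) \<le> val W"
    by (intro exI[of _ W]) linarith
qed

text \<open>Recursion on the set left after removing one cluster. A big cluster pays
  \<open>B\<close> per incident edge out of its \<open>gg\<close>. For a light vertex without big
  neighbours the contributions \<open>B\<close> of the neighbours are contracted below
  \<open>B\<close>, and the certified sum \<open>Xs\<close> may shrink by 1, the discount of the new
  vertex in the glued witness.\<close>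

lemma unit_bound:
  assumes "finite X" "X \<subseteq> V" "closed X" "v \<in> X"
  shows "\<exists>t W. influence_witness X (cluster v) t W"
  using assms
proof (induction "card X" arbitrary: X v rule: less_induct)
  case less
  define K where "K = cluster v"
  have KX: "K \<subseteq> X" using less.prems by (auto simp: closed_def K_def)
  have vK: "v \<in> K" by (simp add: K_def self_cl)
  have smaller: "card (X - K) < card X" using less.prems KX vK by (intro psubset_card_mono) auto
  have clX: "closed (X - K)" using closed_Diff less.prems K_def by blast
  have "\<exists>t W. influence_witness (X - K) (cluster u) t W" if "u \<in> X - K" for u
    using less.hyps[OF smaller] less.prems that clX by auto
  then have "\<forall>J. \<exists>q. J \<in> cluster ` (X - K) \<longrightarrow> influence_witness (X - K) J (fst q) (snd q)" by fastforce
  then obtain q where q: "\<And>J. J \<in> cluster ` (X - K) \<Longrightarrow> influence_witness (X - K) J (fst (q J)) (snd (q J))" by metis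
  define t where "t J = fst (q J)" for J
  have ok: "influence_witness (X - K) (cluster u) (t (cluster u)) (snd (q (cluster u)))" if "u \<in> X - K" for u
    using q that by (simp add: t_def)
  define Xs where "Xs = (\<Sum>p\<in>pairs X K. t (snd p))"
  note ch = children_sum[OF less.prems K_def ok, folded Xs_def]
  define R where "R = (\<Sum>p\<in>pairs X K. base_influence (snd p) + t (snd p))"
  have bd: "influence_le (X - K) J (base_influence J + t J)" if "(h, J) \<in> pairs X K" for h J
    using that ok by (auto simp: pairs_def influence_witness_def)
  have t0: "0 \<le> t (snd p)" if "p \<in> pairs X K" for p using that ok by (auto simp: pairs_def influence_witness_def)
  obtain W where W: "conn W" "K \<subseteq> W" "W \<subseteq> X" "sum gg K - sum ll K + Xs \<le> val W" using ch(3) by blast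
  have R0: "0 \<le> R" unfolding R_def using t0 B0 by (intro sum_nonneg add_nonneg_nonneg) (auto simp: base_influence_def)
  show ?case
  proof (cases "light v")
    case False
    have "influence_le X K R" unfolding R_def K_def
      using influence_le_cluster[OF less.prems False, of "\<lambda>J. base_influence J + t J"] bd by (simp add: K_def)
    have big: "\<not> light h" if "h \<in> K" for h using that cluster_big_sub False by (auto simp: K_def)
    have KV: "K \<subseteq> V" using KX less.prems by blast
    have fK: "finite K" using KV finV finite_subset by blast
    have "sum ll K = 0" using big by (intro sum.neutral) (simp add: ll_eq)
    have "B * (\<Sum>h\<in>K. real (card (Nb h \<inter> X))) \<le> sum gg K"
      unfolding sum_distrib_left
    proof (rule sum_mono)
      fix h assume h: "h \<in> K"
      have "real (card (Nb h \<inter> X)) \<le> real (card (Nb h))" by (simp add: card_mono)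
      then show "B * real (card (Nb h \<inter> X)) \<le> gg h"
        using gg_big[of h] big h KV B0 by (smt (verit) mult_left_mono subsetD)
    qed
    then have "R \<le> sum gg K + Xs" using ch(1) by (simp add: R_def)
    moreover have "2 \<le> sum gg K"
    proof -
      have "gg v \<le> sum gg K" using fK vK gg_nonneg by (intro member_le_sum) auto
      then show ?thesis using gg_big[of v] vK KV False by auto
    qed
    ultimately have "influence_witness X (cluster v) (sum gg K + Xs) W"
      unfolding influence_witness_def base_influence_cl using W ch(2) \<open>influence_le X K R\<close> influence_le_mono \<open>sum ll K = 0\<close> False by (auto simp: K_def)
    then show ?thesis by blast
  next
    case True
    have Kw: "K = {v}" using True by (simp add: K_def)
    have K1: "sum gg K - sum ll K = -1" using True by (simp add: Kw gg_light ll_eq)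
    define m where "m = card (Nb v \<inter> X)"
    have mD: "m \<le> D" using light_deg[OF True] card_mono[of "Nb v" "Nb v \<inter> X"] by (simp add: m_def)
    have Rm: "R \<le> B * real m + Xs" using ch(1) by (simp add: R_def Kw m_def)
    have a0: "real a \<ge> 4" using a4 by simp
    have Xs0: "0 \<le> Xs" using ch(2) .
    have vV: "v \<in> X" using less.prems by simp
    have goal: "\<exists>t W. influence_witness X (cluster v) t W" if b: "influence_le X {v} (B + max 0 (Xs - 1))"
    proof -
      have "influence_witness X (cluster v) (max 0 (Xs - 1)) W"
        unfolding influence_witness_def using b W K1 True by (auto simp: base_influence_cl Kw base_influence_def)
      then show ?thesis by blast
    qed
    show ?thesis
    proof (cases "\<forall>u\<in>Nb v \<inter> X. light u")
      case False
      then obtain u where u: "u \<in> Nb v \<inter> X" "\<not> light u" by blast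
      have uK: "u \<in> X - K" using u True Kw by auto
      have "(v, cluster u) \<in> pairs X K" using uK u self_cl by (auto simp: pairs_def Kw)
      moreover have "2 \<le> t (cluster u)"
        using ok[OF uK] base_influence_cl[of u] u cluster_big_sub self_cl unfolding influence_witness_def by (metis singletonD)
      ultimately have "2 \<le> Xs" unfolding Xs_def
        using member_le_sum[of "(v, cluster u)" "pairs X K" "\<lambda>p. t (snd p)"] t0 finite_pairs[of X K] less.prems KX finite_subset
        by fastforce
      have "influence_le X {v} (1 / real a * (1 + (\<Sum>p\<in>pairs X {v}. base_influence (snd p) + t (snd p))))"
        by (rule influence_le_light[OF less.prems True])
           (use light_marginal_weak[OF less.prems(1) vV _ True] bd R0 in \<open>auto simp: Kw R_def\<close>)
      then have b: "influence_le X {v} (1 / real a * (1 + R))" by (simp add: R_def Kw)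
      have "1 / real a * (1 + R) \<le> 1 / real a * ((1 + real D * B) + Xs)"
        using Rm mD B0 mult_right_mono[of "real m" "real D" B] by (intro mult_left_mono) (auto simp: mult.commute)
      also have "\<dots> = (1 + real D * B) / real a + Xs / real a" by (simp add: add_divide_distrib)
      also have "Xs / real a \<le> Xs / 4" using a0 Xs0 by (intro divide_left_mono) auto
      \<comment> \<open>By \<open>DB\<close> the first summand is at most 1 / 2, and 1 / 2 + Xs / 4
        \<le> Xs - 1 holds exactly for Xs \<ge> 2.\<close>
      finally have "1 / real a * (1 + R) \<le> B + max 0 (Xs - 1)" using DB \<open>2 \<le> Xs\<close> B0 by linarith
      then show ?thesis using goal influence_le_mono[OF b] by blast
    next
      case AL: True
      \<comment> \<open>The smaller of the weak and the strong marginal bound; for a vertex without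
        neighbours the strong one says nothing.\<close>
      define p where "p = (if m = 0 then 1 / real a else min (1 / real a) ((1 - \<delta>) / real m))"
      have p: "0 \<le> p" "p \<le> 1 / real a" "real m * p \<le> 1 - \<delta>"
        using \<delta>0 by (auto simp: p_def min_def field_simps)
      have "influence_le X {v} (p * (1 + (\<Sum>p\<in>pairs X {v}. base_influence (snd p) + t (snd p))))"
      proof (rule influence_le_light[OF less.prems True _ p(1)])
        fix L c assume L: "admissible X L"
        let ?P = "real (card {\<sigma> \<in> lcol X L. \<sigma> v = c})" and ?T = "real (card (lcol X L))"
        have 1: "?P \<le> 1 / real a * ?T" using light_marginal_weak[OF less.prems(1) vV L True] .
        have "real m * ?P \<le> (1 - \<delta>) * ?T"
          unfolding m_def by (rule light_marginal_strong[OF less.prems(2) vV L True]) (use AL in auto)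
        then have "m \<noteq> 0 \<Longrightarrow> ?P \<le> (1 - \<delta>) / real m * ?T" by (simp add: field_simps)
        then show "?P \<le> p * ?T" using 1 by (auto simp: p_def min_def)
      qed (use bd R0 in \<open>auto simp: Kw R_def\<close>)
      then have b: "influence_le X {v} (p * (1 + R))" by (simp add: R_def Kw)
      have "p * (1 + R) \<le> p * (1 + (B * real m + Xs))" using Rm p by (intro mult_left_mono) auto
      also have "\<dots> = p + B * (real m * p) + p * Xs" by (simp add: algebra_simps)
      also have "\<dots> \<le> 1 / real a + B * (1 - \<delta>) + 1 / real a * Xs"
        using p B0 Xs0 by (intro add_mono mult_left_mono mult_right_mono) auto
      \<comment> \<open>Half of the gain \<open>\<delta> * B\<close> pays for the summand
        \<open>1 / a\<close>. The other half is at least \<open>1 / a\<close> again and pays for the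
        part of \<open>Xs / a\<close> beyond \<open>max 0 (Xs - 1)\<close>.\<close>
      also have "\<dots> \<le> B - \<delta> * B / 2 + Xs / real a" using aB by (simp add: algebra_simps)
      also have "\<dots> \<le> B + max 0 (Xs - 1)"
      proof (cases "Xs \<le> 1")
        case True
        then have "Xs / real a \<le> 1 / real a" using a0 by (simp add: divide_right_mono)
        then show ?thesis using aB by simp
      next
        case False
        have "(Xs - 1) / real a \<le> (Xs - 1) / 1" using False a0 by (intro divide_left_mono) auto
        then have "Xs / real a \<le> (Xs - 1) + 1 / real a" by (simp add: diff_divide_distrib)
        then show ?thesis using aB False by simp
      qed
      finally show ?thesis using goal influence_le_mono[OF b] by blast
    qed
  qed
qed

text \<open>The at most \<open>D\<close> neighbours of \<open>w\<close> account for
  \<open>D * B\<close>. The certified amounts sum to at most \<open>F + 1\<close>: the glued witness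
  has weight at most \<open>F\<close> and has been discounted by 1 for \<open>w\<close>.\<close>

lemma influence_bound:
  assumes X: "X \<subseteq> V" "closed X" and w: "w \<in> X" "light w"
    and L: "\<And>u. u \<in> X \<Longrightarrow> finite (L u)" "\<And>u. u \<in> X - {w} \<Longrightarrow> light u \<Longrightarrow> a + card (Nb u \<inter> X) \<le> card (L u)"
    and ne: "lcol (X - {w}) (cut L \<kappa> {w}) \<noteq> {}" "lcol (X - {w}) (cut L \<kappa>' {w}) \<noteq> {}" and g: "unit_valued g"
    and F: "\<And>W. W \<subseteq> V \<Longrightarrow> conn W \<Longrightarrow> val W \<le> F"
  shows "\<bar>EL (X - {w}) (cut L \<kappa> {w}) (light_stat g (X - {w})) - EL (X - {w}) (cut L \<kappa>' {w}) (light_stat g (X - {w}))\<bar>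
     \<le> real D * B + F + 1"
proof -
  have fX: "finite X" using X finV finite_subset by blast
  have clw: "cluster w = {w}" using w by simp
  have clX: "closed (X - {w})" using closed_Diff[of X w] X clw by simp
  have "\<exists>t W. influence_witness (X - {w}) (cluster u) t W" if "u \<in> X - {w}" for u
    using unit_bound[of "X - {w}" u] fX X clX that by auto
  then have "\<forall>J. \<exists>q. J \<in> cluster ` (X - {w}) \<longrightarrow> influence_witness (X - {w}) J (fst q) (snd q)" by fastforce
  then obtain q where q: "\<And>J. J \<in> cluster ` (X - {w}) \<Longrightarrow> influence_witness (X - {w}) J (fst (q J)) (snd (q J))" by metis
  define t where "t J = fst (q J)" for J
  have ok: "influence_witness (X - {w}) (cluster u) (t (cluster u)) (snd (q (cluster u)))" if "u \<in> X - {w}" for u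
    using q that by (simp add: t_def)
  define Xs where "Xs = (\<Sum>p\<in>pairs X {w}. t (snd p))"
  note ch = children_sum[OF fX X w(1) clw[symmetric] ok, folded Xs_def]
  obtain W where W: "conn W" "W \<subseteq> X" "sum gg {w} - sum ll {w} + Xs \<le> val W" using ch(3) by blast
  have "val W \<le> F" using F W X by auto
  then have XsF: "Xs \<le> F + 1" using W w by (simp add: gg_light ll_eq)
  have "\<bar>EL (X - {w}) (cut L \<kappa> {w}) (light_stat g (X - {w})) - EL (X - {w}) (cut L \<kappa>' {w}) (light_stat g (X - {w}))\<bar>
     \<le> (\<Sum>p\<in>pairs X {w}. base_influence (snd p) + t (snd p))"
    by (rule light_osc[OF fX X w L, of "\<lambda>J. base_influence J + t J"])
       (use ne g ok in \<open>auto simp: pairs_def influence_witness_def\<close>)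
  also have "\<dots> \<le> B * real (card (Nb w \<inter> X)) + Xs" using ch(1) by simp
  also have "B * real (card (Nb w \<inter> X)) \<le> real D * B"
  proof -
    have "card (Nb w \<inter> X) \<le> D" using light_deg[OF w(2)] card_mono[of "Nb w" "Nb w \<inter> X"] by simp
    then show ?thesis using B0 by (simp add: mult.commute mult_left_mono)
  qed
  finally show ?thesis using XsF by linarith
qed

end

section \<open>Spectral independence and deletion of light vertices\<close>

locale cspace =
  fixes Om :: "('a \<Rightarrow> nat) set"
  assumes finOm [simp]: "finite Om"
begin

definition fib :: "'a set \<Rightarrow> ('a \<Rightarrow> nat) \<Rightarrow> ('a \<Rightarrow> nat) set" where
  "fib X \<sigma> = {\<tau> \<in> Om. \<forall>v. v \<notin> X \<longrightarrow> \<tau> v = \<sigma> v}"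

definition E :: "'a set \<Rightarrow> (('a \<Rightarrow> nat) \<Rightarrow> real) \<Rightarrow> ('a \<Rightarrow> nat) \<Rightarrow> real" where
  "E X f \<sigma> = (\<Sum>\<tau>\<in>fib X \<sigma>. f \<tau>) / real (card (fib X \<sigma>))"

text \<open>Expected conditional variance given the colors outside \<open>X\<close>, summed instead
  of averaged. Under the uniform law the common factor \<open>card Om\<close> cancels in the
  homogeneous inequalities that follow.\<close>

definition EV :: "'a set \<Rightarrow> (('a \<Rightarrow> nat) \<Rightarrow> real) \<Rightarrow> real" where
  "EV X f = (\<Sum>\<sigma>\<in>Om. (f \<sigma> - E X f \<sigma>)\<^sup>2)"

lemma fib_sub: "fib X \<sigma> \<subseteq> Om" by (auto simp: fib_def)

lemma finite_fib [simp]: "finite (fib X \<sigma>)"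
  using finite_subset[OF fib_sub] by simp

lemma fib_self: "\<sigma> \<in> Om \<Longrightarrow> \<sigma> \<in> fib X \<sigma>" by (simp add: fib_def)

lemma fib_eq: "\<tau> \<in> fib X \<sigma> \<Longrightarrow> fib X \<tau> = fib X \<sigma>"
  by (auto simp: fib_def)

lemma fib_sym: "\<sigma> \<in> Om \<Longrightarrow> \<tau> \<in> fib X \<sigma> \<Longrightarrow> \<sigma> \<in> fib X \<tau>"
  using fib_eq fib_self by blast

lemma fib_mono: "X' \<subseteq> X \<Longrightarrow> fib X' \<sigma> \<subseteq> fib X \<sigma>"
  by (auto simp: fib_def)

lemma card_fib_pos: "\<sigma> \<in> Om \<Longrightarrow> 0 < real (card (fib X \<sigma>))"
  using fib_self[of \<sigma> X] by (auto simp: card_gt_0_iff)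

lemma fib_ne: "\<sigma> \<in> Om \<Longrightarrow> fib X \<sigma> \<noteq> {}"
  using fib_self by blast

lemma E_fib: "\<tau> \<in> fib X \<sigma> \<Longrightarrow> E X f \<tau> = E X f \<sigma>"
  by (simp add: E_def fib_eq)

text \<open>Averaging within fibres spreads each value over its own fibre with total weight 1, so
  sums over any union of fibres are preserved, not only over \<open>Om\<close>.\<close>

lemma sum_E_closed:
  assumes S: "S \<subseteq> Om" "\<And>\<tau>. \<tau> \<in> S \<Longrightarrow> fib X \<tau> \<subseteq> S"
  shows "(\<Sum>\<tau>\<in>S. E X f \<tau>) = (\<Sum>\<tau>\<in>S. f \<tau>)"
proof -
  have fS: "finite S" using S(1) finite_subset finOm by blast
  have "(\<Sum>\<tau>\<in>S. E X f \<tau>) = (\<Sum>\<tau>\<in>S. \<Sum>\<rho>\<in>S. if \<rho> \<in> fib X \<tau> then f \<rho> / real (card (fib X \<rho>)) else 0)"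
  proof (rule sum.cong[OF refl])
    fix \<tau> assume t: "\<tau> \<in> S"
    have "S \<inter> fib X \<tau> = fib X \<tau>" using S(2)[OF t] by blast
    then have "(\<Sum>\<rho>\<in>S. if \<rho> \<in> fib X \<tau> then f \<rho> / real (card (fib X \<rho>)) else 0)
      = (\<Sum>\<rho>\<in>fib X \<tau>. f \<rho> / real (card (fib X \<rho>)))"
      using fS by (simp add: sum.inter_restrict[symmetric])
    also have "\<dots> = (\<Sum>\<rho>\<in>fib X \<tau>. f \<rho> / real (card (fib X \<tau>)))"
      by (intro sum.cong refl) (simp add: fib_eq)
    finally show "E X f \<tau> = (\<Sum>\<rho>\<in>S. if \<rho> \<in> fib X \<tau> then f \<rho> / real (card (fib X \<rho>)) else 0)"
      by (simp add: E_def sum_divide_distrib)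
  qed
  also have "\<dots> = (\<Sum>\<rho>\<in>S. \<Sum>\<tau>\<in>S. if \<rho> \<in> fib X \<tau> then f \<rho> / real (card (fib X \<rho>)) else 0)"
    by (rule sum.swap)
  also have "\<dots> = (\<Sum>\<rho>\<in>S. f \<rho>)"
  proof (rule sum.cong[OF refl])
    fix \<rho> assume r: "\<rho> \<in> S"
    then have rO: "\<rho> \<in> Om" using S by blast
    have "{\<tau> \<in> S. \<rho> \<in> fib X \<tau>} = fib X \<rho>"
      using S(2)[OF r] fib_sym S(1) rO fib_sub by blast
    then have "(\<Sum>\<tau>\<in>S. if \<rho> \<in> fib X \<tau> then f \<rho> / real (card (fib X \<rho>)) else 0)
      = (\<Sum>\<tau>\<in>fib X \<rho>. f \<rho> / real (card (fib X \<rho>)))"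
      using fS by (simp add: sum.inter_filter[symmetric])
    then show "(\<Sum>\<tau>\<in>S. if \<rho> \<in> fib X \<tau> then f \<rho> / real (card (fib X \<rho>)) else 0) = f \<rho>"
      using fib_ne[OF rO] by simp
  qed
  finally show ?thesis .
qed

lemma sum_E: "(\<Sum>\<tau>\<in>Om. E X f \<tau>) = (\<Sum>\<tau>\<in>Om. f \<tau>)"
  by (rule sum_E_closed) (auto simp: fib_def)

lemma E_mult_right:
  assumes "\<And>\<tau>. \<tau> \<in> fib X \<sigma> \<Longrightarrow> h \<tau> = h \<sigma>"
  shows "E X (\<lambda>\<tau>. f \<tau> * h \<tau>) \<sigma> = E X f \<sigma> * h \<sigma>"
  using assms by (simp add: E_def sum_distrib_right)

lemma E_tower:
  assumes "X' \<subseteq> X" "\<sigma> \<in> Om"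
  shows "E X (E X' f) \<sigma> = E X f \<sigma>"
proof -
  have "(\<Sum>\<tau>\<in>fib X \<sigma>. E X' f \<tau>) = (\<Sum>\<tau>\<in>fib X \<sigma>. f \<tau>)"
    by (rule sum_E_closed[OF fib_sub]) (use fib_mono[OF assms(1)] fib_eq in blast)
  then show ?thesis by (simp add: E_def)
qed

lemma E_tower2:
  assumes "X' \<subseteq> X" "\<sigma> \<in> Om"
  shows "E X' (E X f) \<sigma> = E X f \<sigma>"
proof -
  have "E X f \<tau> = E X f \<sigma>" if "\<tau> \<in> fib X' \<sigma>" for \<tau>
    using that fib_mono[OF assms(1)] by (intro E_fib) blast
  then show ?thesis using fib_ne[OF assms(2)] by (simp add: E_def[of X'])
qed

lemma E_diff: "E X (\<lambda>\<tau>. f \<tau> - g \<tau>) \<sigma> = E X f \<sigma> - E X g \<sigma>"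
  by (simp add: E_def sum_subtractf diff_divide_distrib)

lemma E_sum: "E X (\<lambda>\<tau>. \<Sum>i\<in>I. f i \<tau>) \<sigma> = (\<Sum>i\<in>I. E X (f i) \<sigma>)"
  unfolding E_def by (subst sum.swap) (simp add: sum_divide_distrib)

text \<open>Conditional expectations are orthogonal projections: both sides equal the inner product
  of \<open>E X f\<close> with \<open>E X g\<close>.\<close>

lemma E_selfadj: "(\<Sum>\<sigma>\<in>Om. E X f \<sigma> * g \<sigma>) = (\<Sum>\<sigma>\<in>Om. f \<sigma> * E X g \<sigma>)"
proof -
  have "(\<Sum>\<sigma>\<in>Om. E X f \<sigma> * E X g \<sigma>) = (\<Sum>\<sigma>\<in>Om. f \<sigma> * E X g \<sigma>)" for f g
  proof -
    have "(\<Sum>\<sigma>\<in>Om. f \<sigma> * E X g \<sigma>) = (\<Sum>\<sigma>\<in>Om. E X (\<lambda>\<tau>. f \<tau> * E X g \<tau>) \<sigma>)" by (simp add: sum_E)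
    also have "\<dots> = (\<Sum>\<sigma>\<in>Om. E X f \<sigma> * E X g \<sigma>)"
      by (intro sum.cong refl E_mult_right E_fib)
    finally show ?thesis by simp
  qed
  from this[of f g] this[of g f] show ?thesis by (simp add: mult.commute)
qed

lemma sum_E_sq: "(\<Sum>\<sigma>\<in>Om. f \<sigma> * E X f \<sigma>) = (\<Sum>\<sigma>\<in>Om. (E X f \<sigma>)\<^sup>2)"
proof -
  have "(\<Sum>\<sigma>\<in>Om. f \<sigma> * E X f \<sigma>) = (\<Sum>\<sigma>\<in>Om. f \<sigma> * E X (E X f) \<sigma>)"
    by (intro sum.cong refl) (simp add: E_tower)
  also have "\<dots> = (\<Sum>\<sigma>\<in>Om. E X f \<sigma> * E X f \<sigma>)" by (simp add: E_selfadj)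
  finally show ?thesis by (simp add: power2_eq_square)
qed

lemma EV_eq: "EV X f = (\<Sum>\<sigma>\<in>Om. (f \<sigma>)\<^sup>2) - (\<Sum>\<sigma>\<in>Om. (E X f \<sigma>)\<^sup>2)"
proof -
  have "EV X f = (\<Sum>\<sigma>\<in>Om. (f \<sigma>)\<^sup>2 - 2 * (f \<sigma> * E X f \<sigma>) + (E X f \<sigma>)\<^sup>2)"
    unfolding EV_def by (intro sum.cong refl) (simp add: power2_diff)
  also have "\<dots> = (\<Sum>\<sigma>\<in>Om. (f \<sigma>)\<^sup>2) - 2 * (\<Sum>\<sigma>\<in>Om. f \<sigma> * E X f \<sigma>) + (\<Sum>\<sigma>\<in>Om. (E X f \<sigma>)\<^sup>2)"
    by (simp add: sum.distrib sum_subtractf sum_distrib_left)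
  finally show ?thesis by (simp add: sum_E_sq)
qed

lemma EV_nonneg: "0 \<le> EV X f"
  unfolding EV_def by (simp add: sum_nonneg)

lemma E_contract: "(\<Sum>\<sigma>\<in>Om. (E X f \<sigma>)\<^sup>2) \<le> (\<Sum>\<sigma>\<in>Om. (f \<sigma>)\<^sup>2)"
  using EV_nonneg[of X f] by (simp add: EV_eq)

lemma EV_Pythagoras:
  assumes "X' \<subseteq> X"
  shows "EV X f = EV X' f + (\<Sum>\<sigma>\<in>Om. (E X' f \<sigma> - E X f \<sigma>)\<^sup>2)"
proof -
  have "EV X (E X' f) = (\<Sum>\<sigma>\<in>Om. (E X' f \<sigma>)\<^sup>2) - (\<Sum>\<sigma>\<in>Om. (E X f \<sigma>)\<^sup>2)"
    unfolding EV_eq by (simp add: E_tower[OF assms] cong: sum.cong)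
  moreover have "EV X (E X' f) = (\<Sum>\<sigma>\<in>Om. (E X' f \<sigma> - E X f \<sigma>)\<^sup>2)"
    unfolding EV_def by (simp add: E_tower[OF assms] cong: sum.cong)
  ultimately show ?thesis by (simp add: EV_eq)
qed

lemma EV_mono: "X' \<subseteq> X \<Longrightarrow> EV X' f \<le> EV X f"
  using EV_Pythagoras[of X' X f] by (simp add: sum_nonneg)

text \<open>By the Pythagorean identity the surplus over \<open>EV X1\<close> is the squared norm of
  \<open>E X1\<close> applied to \<open>f - E X2 f\<close>, and \<open>E X1\<close> is a
  contraction.\<close>

lemma EV_tensor:
  assumes "\<And>\<sigma>. \<sigma> \<in> Om \<Longrightarrow> E X1 (E X2 f) \<sigma> = E (X1 \<union> X2) f \<sigma>"
  shows "EV (X1 \<union> X2) f \<le> EV X1 f + EV X2 f"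
proof -
  have "(\<Sum>\<sigma>\<in>Om. (E X1 f \<sigma> - E (X1 \<union> X2) f \<sigma>)\<^sup>2) = (\<Sum>\<sigma>\<in>Om. (E X1 (\<lambda>\<tau>. f \<tau> - E X2 f \<tau>) \<sigma>)\<^sup>2)"
    by (intro sum.cong refl) (simp add: E_diff assms)
  also have "\<dots> \<le> EV X2 f" unfolding EV_def by (rule E_contract)
  finally show ?thesis using EV_Pythagoras[of X1 "X1 \<union> X2" f] by simp
qed

text \<open>The operator \<open>T\<close> is self-adjoint, so its Rayleigh quotient is controlled by the growth rate of
its iterates in any seminorm; here the seminorm is the oscillation on fibres.\<close>

lemma spectral_independence:
  assumes Y: "finite Y" "Y \<subseteq> X" and Lam: "1 \<le> \<Lambda>"
    and contr: "\<And>N \<phi> u \<tau> \<tau>'. 0 \<le> N \<Longrightarrow>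
      (\<And>w \<tau> \<tau>'. w \<in> Y \<Longrightarrow> \<tau> \<in> Om \<Longrightarrow> \<tau>' \<in> fib (X - {w}) \<tau> \<Longrightarrow> \<phi> w \<tau>' = \<phi> w \<tau>) \<Longrightarrow>
      (\<And>w \<tau> \<tau>'. w \<in> Y \<Longrightarrow> \<tau> \<in> Om \<Longrightarrow> \<tau>' \<in> fib X \<tau> \<Longrightarrow> \<bar>\<phi> w \<tau>' - \<phi> w \<tau>\<bar> \<le> N) \<Longrightarrow>
      u \<in> Y \<Longrightarrow> \<tau> \<in> Om \<Longrightarrow> \<tau>' \<in> fib X \<tau> \<Longrightarrow>
      \<bar>E (X - {u}) (\<lambda>\<sigma>. \<Sum>w\<in>Y. \<phi> w \<sigma>) \<tau>' - E (X - {u}) (\<lambda>\<sigma>. \<Sum>w\<in>Y. \<phi> w \<sigma>) \<tau>\<bar> \<le> \<Lambda> * N"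
  shows "(\<Sum>u\<in>Y. EV X f - EV (X - {u}) f) \<le> \<Lambda> * EV X f"
proof -
  define h where "h \<sigma> = f \<sigma> - E X f \<sigma>" for \<sigma>
  define T where "T g = (\<lambda>\<sigma>. \<Sum>u\<in>Y. E (X - {u}) g \<sigma>)" for g
  define ip where "ip g g' = (\<Sum>\<sigma>\<in>Om. g \<sigma> * g' \<sigma>)" for g g' :: "_ \<Rightarrow> real"
  define hi where "hi i = (T ^^ i) h" for i
  define r where "r i = ip h (hi i)" for i
  have hiS: "hi (Suc i) = T (hi i)" for i by (simp add: hi_def)
  have Tadj: "ip (T g) g' = ip g (T g')" for g g'
  proof -
    have "ip (T g) g' = (\<Sum>u\<in>Y. \<Sum>\<sigma>\<in>Om. E (X - {u}) g \<sigma> * g' \<sigma>)"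
      unfolding ip_def T_def sum_distrib_right by (rule sum.swap)
    also have "\<dots> = (\<Sum>u\<in>Y. \<Sum>\<sigma>\<in>Om. g \<sigma> * E (X - {u}) g' \<sigma>)" by (simp add: E_selfadj)
    also have "\<dots> = ip g (T g')" unfolding ip_def T_def sum_distrib_left by (rule sum.swap)
    finally show ?thesis .
  qed
  have Tm: "ip (hi i) (hi j) = r (i + j)" for i j
  proof (induction i arbitrary: j)
    case (Suc i)
    have "ip (hi (Suc i)) (hi j) = ip (hi i) (hi (Suc j))" by (simp add: hiS Tadj)
    then show ?case using Suc[of "Suc j"] by simp
  qed (simp add: r_def hi_def)
  \<comment> \<open>The numbers \<open>r i\<close> are the moments of the self-adjoint operator
    \<open>T\<close> at \<open>h\<close>; Cauchy-Schwarz relates each of them to the one at twice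
    the index.\<close>
  have CS: "(r i)\<^sup>2 \<le> r 0 * r (2 * i)" for i
  proof -
    have "(r i)\<^sup>2 \<le> (\<Sum>\<sigma>\<in>Om. (h \<sigma>)\<^sup>2) * (\<Sum>\<sigma>\<in>Om. (hi i \<sigma>)\<^sup>2)"
      unfolding r_def ip_def by (rule Cauchy_Schwarz_ineq_sum)
    also have "(\<Sum>\<sigma>\<in>Om. (h \<sigma>)\<^sup>2) = r 0" by (simp add: r_def ip_def hi_def power2_eq_square)
    also have "(\<Sum>\<sigma>\<in>Om. (hi i \<sigma>)\<^sup>2) = ip (hi i) (hi i)" by (simp add: ip_def power2_eq_square)
    also have "\<dots> = r (2 * i)" by (simp add: Tm mult_2)
    finally show ?thesis .
  qed
  have r0: "r 0 = EV X f" by (simp add: r_def ip_def hi_def EV_def h_def power2_eq_square)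
  have r0nn: "0 \<le> r 0" by (simp add: r0 EV_nonneg)
  \<comment> \<open>All iterates keep mean 0 on the fibres of \<open>X\<close>, which later allows
    \<open>phi_b\<close> to bound their size by their oscillation.\<close>
  have Eh: "E X (hi i) \<sigma> = 0" if "\<sigma> \<in> Om" for i \<sigma>
  proof (induction i)
    case 0
    then show ?case using E_tower[of X X \<sigma> f] that by (simp add: hi_def h_def E_diff)
  next
    case (Suc i)
    have "E X (hi (Suc i)) \<sigma> = (\<Sum>u\<in>Y. E X (E (X - {u}) (hi i)) \<sigma>)"
      by (simp add: hiS T_def E_sum)
    also have "\<dots> = 0" using Suc that by (simp add: E_tower)
    finally show ?case .
  qed
  have r1: "(\<Sum>u\<in>Y. EV X f - EV (X - {u}) f) = r 1"
  proof -
    have "EV X f - EV (X - {u}) f = (\<Sum>\<sigma>\<in>Om. h \<sigma> * E (X - {u}) h \<sigma>)" for u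
    proof -
      have "EV X f - EV (X - {u}) f = (\<Sum>\<sigma>\<in>Om. (E (X - {u}) f \<sigma> - E X f \<sigma>)\<^sup>2)"
        using EV_Pythagoras[of "X - {u}" X f] by auto
      also have "\<dots> = (\<Sum>\<sigma>\<in>Om. (E (X - {u}) h \<sigma>)\<^sup>2)"
      proof (rule sum.cong[OF refl])
        fix \<sigma> assume "\<sigma> \<in> Om"
        then have "E (X - {u}) h \<sigma> = E (X - {u}) f \<sigma> - E X f \<sigma>"
          unfolding h_def E_diff by (simp add: E_tower2)
        then show "(E (X - {u}) f \<sigma> - E X f \<sigma>)\<^sup>2 = (E (X - {u}) h \<sigma>)\<^sup>2" by simp
      qed
      finally show ?thesis by (simp add: sum_E_sq)
    qed
    then have "(\<Sum>u\<in>Y. EV X f - EV (X - {u}) f) = (\<Sum>u\<in>Y. \<Sum>\<sigma>\<in>Om. h \<sigma> * E (X - {u}) h \<sigma>)" by simp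
    also have "\<dots> = ip h (T h)" unfolding ip_def T_def sum_distrib_left by (rule sum.swap)
    finally show ?thesis by (simp add: r_def hi_def)
  qed
  define \<phi> where "\<phi> i w = E (X - {w}) (hi i)" for i w
  have hiphi: "hi (Suc i) = (\<lambda>\<sigma>. \<Sum>w\<in>Y. \<phi> i w \<sigma>)" for i by (simp add: hiS T_def \<phi>_def)
  define N where "N = (\<Sum>w\<in>Y. \<Sum>\<sigma>\<in>Om. 2 * \<bar>\<phi> 0 w \<sigma>\<bar>)"
  have N0: "0 \<le> N" by (simp add: N_def sum_nonneg)
  have osc: "\<bar>\<phi> i w \<tau>' - \<phi> i w \<tau>\<bar> \<le> \<Lambda> ^ i * N"
    if "w \<in> Y" "\<tau> \<in> Om" "\<tau>' \<in> fib X \<tau>" for i w \<tau> \<tau>'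
    using that
  proof (induction i arbitrary: w \<tau> \<tau>')
    case 0
    have b: "2 * \<bar>\<phi> 0 w \<sigma>\<bar> \<le> N" if "\<sigma> \<in> Om" for \<sigma>
    proof -
      have "2 * \<bar>\<phi> 0 w \<sigma>\<bar> \<le> (\<Sum>\<sigma>\<in>Om. 2 * \<bar>\<phi> 0 w \<sigma>\<bar>)"
        using that by (intro member_le_sum[of \<sigma> Om "\<lambda>\<sigma>. 2 * \<bar>\<phi> 0 w \<sigma>\<bar>"]) auto
      also have "\<dots> \<le> N" unfolding N_def
        using 0 Y by (intro member_le_sum[of w Y "\<lambda>w. \<Sum>\<sigma>\<in>Om. 2 * \<bar>\<phi> 0 w \<sigma>\<bar>"]) (auto simp: sum_nonneg)
      finally show ?thesis .
    qed
    have "\<tau>' \<in> Om" using 0 fib_sub by blast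
    then show ?case using b[of \<tau>] b[of \<tau>'] 0 by simp
  next
    case (Suc i)
    have "\<bar>E (X - {w}) (\<lambda>\<sigma>. \<Sum>w\<in>Y. \<phi> i w \<sigma>) \<tau>' - E (X - {w}) (\<lambda>\<sigma>. \<Sum>w\<in>Y. \<phi> i w \<sigma>) \<tau>\<bar> \<le> \<Lambda> * (\<Lambda> ^ i * N)"
      by (rule contr) (use Suc N0 Lam in \<open>auto simp: \<phi>_def E_fib\<close>)
    then show ?case by (simp add: \<phi>_def hiphi[folded \<phi>_def] mult.assoc)
  qed
  have phi_b: "\<bar>\<phi> i w \<tau>\<bar> \<le> \<Lambda> ^ i * N" if w: "w \<in> Y" and t: "\<tau> \<in> Om" for i w \<tau>
  proof -
    have "E X (\<phi> i w) \<tau> = 0" unfolding \<phi>_def using E_tower[of "X - {w}" X \<tau>] Eh[OF t] t by auto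
    then have "(\<Sum>\<tau>'\<in>fib X \<tau>. \<phi> i w \<tau>') = 0" using fib_ne[OF t] by (simp add: E_def)
    then have "\<bar>\<phi> i w \<tau>\<bar> = \<bar>\<Sum>\<tau>'\<in>fib X \<tau>. \<phi> i w \<tau> - \<phi> i w \<tau>'\<bar> / real (card (fib X \<tau>))"
      using card_fib_pos[OF t, of X] fib_ne[OF t] by (simp add: sum_subtractf abs_mult)
    also have "\<dots> \<le> (\<Sum>\<tau>'\<in>fib X \<tau>. \<Lambda> ^ i * N) / real (card (fib X \<tau>))"
    proof (intro divide_right_mono order_trans[OF sum_abs] sum_mono)
      fix \<tau>' assume "\<tau>' \<in> fib X \<tau>"
      then show "\<bar>\<phi> i w \<tau> - \<phi> i w \<tau>'\<bar> \<le> \<Lambda> ^ i * N" using osc[OF w t] by (simp add: abs_minus_commute)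
    qed simp
    also have "\<dots> = \<Lambda> ^ i * N" using fib_ne[OF t] by simp
    finally show ?thesis .
  qed
  define C where "C = (\<Sum>\<sigma>\<in>Om. \<bar>h \<sigma>\<bar> * (real (card Y) * N))"
  have rC: "r (Suc i) \<le> C * \<Lambda> ^ Suc i" for i
  proof -
    have "r (Suc i) \<le> (\<Sum>\<sigma>\<in>Om. \<bar>h \<sigma>\<bar> * (real (card Y) * (\<Lambda> ^ i * N)))"
      unfolding r_def ip_def
    proof (rule sum_mono)
      fix \<sigma> assume s: "\<sigma> \<in> Om"
      have "\<bar>hi (Suc i) \<sigma>\<bar> \<le> (\<Sum>w\<in>Y. \<Lambda> ^ i * N)"
        unfolding hiphi by (intro order_trans[OF sum_abs] sum_mono phi_b s)
      then have "\<bar>h \<sigma> * hi (Suc i) \<sigma>\<bar> \<le> \<bar>h \<sigma>\<bar> * (real (card Y) * (\<Lambda> ^ i * N))"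
        by (simp add: abs_mult mult_left_mono)
      then show "h \<sigma> * hi (Suc i) \<sigma> \<le> \<bar>h \<sigma>\<bar> * (real (card Y) * (\<Lambda> ^ i * N))" by linarith
    qed
    also have "\<dots> = C * \<Lambda> ^ i" by (simp add: C_def sum_distrib_left sum_distrib_right mult_ac)
    also have "\<dots> \<le> C * \<Lambda> ^ Suc i"
      using Lam N0 by (intro mult_left_mono) (auto simp: C_def sum_nonneg)
    finally show ?thesis .
  qed
  have "r 1 \<le> \<Lambda> * r 0"
  proof (rule ccontr)
    assume neg: "\<not> r 1 \<le> \<Lambda> * r 0"
    have "r 0 \<noteq> 0"
    proof
      assume z: "r 0 = 0"
      then have "(r 1)\<^sup>2 \<le> 0" using CS[of 1] by simp
      then show False using neg z by simp
    qed
    then have r0p: "0 < r 0" using r0nn by simp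
    define q where "q = r 1 / r 0"
    have q: "q > \<Lambda>" using neg r0p by (simp add: q_def pos_less_divide_eq)
    \<comment> \<open>If the Rayleigh quotient \<open>q\<close> exceeded \<Lambda>, the moments at
      powers of 2 would grow like powers of \<open>q\<close>, against the growth rate \<Lambda> in
      \<open>rC\<close>.\<close>
    have pw: "q ^ (2 ^ j) \<le> r (2 ^ j) / r 0" for j
    proof (induction j)
      case (Suc j)
      have "q ^ (2 ^ Suc j) = (q ^ (2 ^ j))\<^sup>2" by (simp add: power_mult[symmetric] mult.commute)
      also have "\<dots> \<le> (r (2 ^ j) / r 0)\<^sup>2" using Suc q Lam by (intro power_mono) auto
      also have "\<dots> = (r (2 ^ j))\<^sup>2 / (r 0 * r 0)" by (simp add: power_divide power2_eq_square)
      also have "\<dots> \<le> (r 0 * r (2 ^ Suc j)) / (r 0 * r 0)" using CS[of "2 ^ j"] r0p by (intro divide_right_mono) auto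
      finally show ?case using r0p by simp
    qed (simp add: q_def)
    have "1 < q / \<Lambda>" using q Lam by simp
    then obtain m where m: "C / r 0 < (q / \<Lambda>) ^ m" using real_arch_pow by blast
    have "(q / \<Lambda>) ^ m \<le> (q / \<Lambda>) ^ (2 ^ m)"
      using \<open>1 < q / \<Lambda>\<close> by (intro power_increasing) (auto simp: less_imp_le)
    also have "\<dots> = q ^ (2 ^ m) / \<Lambda> ^ (2 ^ m)" by (simp add: power_divide)
    also have "\<dots> \<le> (r (2 ^ m) / r 0) / \<Lambda> ^ (2 ^ m)" using pw[of m] Lam by (intro divide_right_mono) auto
    also have "\<dots> \<le> (C * \<Lambda> ^ (2 ^ m) / r 0) / \<Lambda> ^ (2 ^ m)"
      using rC[of "2 ^ m - 1"] Lam r0p by (intro divide_right_mono) auto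
    also have "\<dots> = C / r 0" using Lam by simp
    finally show False using m by simp
  qed
  then show ?thesis by (simp add: r1 r0)
qed

end

text \<open>The mean of \<open>h\<close> over the sets left after deleting \<open>j\<close> random elements.\<close>

primrec deletion_avg :: "nat \<Rightarrow> ('a set \<Rightarrow> real) \<Rightarrow> 'a set \<Rightarrow> real" where
  "deletion_avg 0 h Y = h Y"
| "deletion_avg (Suc j) h Y = (\<Sum>u\<in>Y. deletion_avg j h (Y - {u})) / real (card Y)"

section \<open>Averages over random deletions\<close>

lemma deletion_avg_mono:
  assumes "finite Y" "\<And>Z. Z \<subseteq> Y \<Longrightarrow> card Z = card Y - j \<Longrightarrow> h Z \<le> g Z" "j \<le> card Y"
  shows "deletion_avg j h Y \<le> deletion_avg j g Y"
  using assms
proof (induction j arbitrary: Y)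
  case (Suc j)
  have "deletion_avg j h (Y - {u}) \<le> deletion_avg j g (Y - {u})" if "u \<in> Y" for u
    by (rule Suc.IH) (use Suc.prems that in auto)
  then show ?case by (simp add: divide_right_mono sum_mono)
qed simp

lemma deletion_avg_add: "deletion_avg j (\<lambda>Z. h Z + g Z) Y = deletion_avg j h Y + deletion_avg j g Y"
  by (induction j arbitrary: Y) (simp_all add: sum.distrib add_divide_distrib)

lemma deletion_avg_cmult: "deletion_avg j (\<lambda>Z. c * h Z) Y = c * deletion_avg j h Y"
  by (induction j arbitrary: Y) (simp_all add: sum_distrib_left[symmetric])

lemma deletion_avg_const: "finite Y \<Longrightarrow> j \<le> card Y \<Longrightarrow> deletion_avg j (\<lambda>_. c) Y = c"
proof (induction j arbitrary: Y)
  case (Suc j)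
  have "deletion_avg j (\<lambda>_. c) (Y - {u}) = c" if "u \<in> Y" for u
    by (rule Suc.IH) (use Suc.prems that in auto)
  then show ?case using Suc.prems by (cases "Y = {}") auto
qed simp

lemma deletion_avg_sum: "deletion_avg j (\<lambda>Z. \<Sum>i\<in>I. h i Z) Y = (\<Sum>i\<in>I. deletion_avg j (h i) Y)"
proof (induction j arbitrary: Y)
  case (Suc j)
  then show ?case by (simp add: sum_divide_distrib) (subst sum.swap, rule refl)
qed simp

text \<open>The probability that \<open>W\<close> survives is a product of factors 1 - w / M with w
  = card W and decreasing M. Bernoulli's inequality bounds each factor by (1 - 1 / M) ^ w, and these
  powers telescope: without replacement, joint survival is no likelier than for independent
  deletions.\<close>

lemma deletion_avg_contains:
  assumes "finite Y" "j \<le> card Y"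
  shows "deletion_avg j (\<lambda>Z. if W \<subseteq> Z then 1 else 0) Y \<le> (real (card Y - j) / real (card Y)) ^ card W"
proof (cases "W \<subseteq> Y")
  case False
  have "deletion_avg j (\<lambda>Z. if W \<subseteq> Z then 1 else 0) Y \<le> deletion_avg j (\<lambda>Z. 0) Y"
    by (rule deletion_avg_mono) (use assms False in auto)
  then show ?thesis using deletion_avg_const[OF assms, of 0] by (simp add: order_trans)
next
  case True
  then show ?thesis using assms
  proof (induction j arbitrary: Y)
    case (Suc j)
    define M where "M = card Y"
    define w where "w = card W"
    have M: "M \<ge> 1" using Suc.prems by (simp add: M_def)
    have wM: "w \<le> M" using Suc.prems by (simp add: w_def M_def card_mono)
    have fW: "finite W" using Suc.prems finite_subset by blast
    define q where "q = (real (M - 1 - j) / real (M - 1)) ^ w"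
    have "deletion_avg j (\<lambda>Z. if W \<subseteq> Z then 1 else 0) (Y - {u}) \<le> (if u \<in> W then 0 else q)" if u: "u \<in> Y" for u
    proof (cases "u \<in> W")
      case True
      have "deletion_avg j (\<lambda>Z. if W \<subseteq> Z then 1 else 0) (Y - {u}) \<le> deletion_avg j (\<lambda>Z. 0) (Y - {u})"
        by (rule deletion_avg_mono) (use Suc.prems True u in auto)
      also have "\<dots> = 0" by (rule deletion_avg_const) (use Suc.prems u in auto)
      finally show ?thesis using True by simp
    next
      case False
      have "deletion_avg j (\<lambda>Z. if W \<subseteq> Z then 1 else 0) (Y - {u}) \<le> (real (card (Y - {u}) - j) / real (card (Y - {u}))) ^ card W"
        by (rule Suc.IH) (use Suc.prems False u in auto)
      then show ?thesis using False u Suc.prems by (simp add: q_def w_def M_def)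
    qed
    then have "deletion_avg (Suc j) (\<lambda>Z. if W \<subseteq> Z then 1 else 0) Y \<le> (\<Sum>u\<in>Y. if u \<in> W then 0 else q) / real M"
      by (simp add: M_def divide_right_mono sum_mono)
    also have "(\<Sum>u\<in>Y. if u \<in> W then 0 else q) = real (M - w) * q"
      using Suc.prems fW by (simp add: sum.If_cases M_def w_def card_Diff_subset Diff_eq[symmetric])
    also have "real (M - w) * q / real M = (1 + real w * (- 1 / real M)) * q"
      using wM M by (simp add: of_nat_diff field_simps)
    also have "\<dots> \<le> (1 + (- 1 / real M)) ^ w * q"
      using M by (intro mult_right_mono Bernoulli_inequality) (auto simp: q_def)
    also have "\<dots> = ((1 - 1 / real M) * (real (M - 1 - j) / real (M - 1))) ^ w"
      by (simp only: q_def power_mult_distrib add_uminus_conv_diff minus_divide_left[symmetric])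
    also have "\<dots> = (real (M - Suc j) / real M) ^ w"
    proof (cases "M = 1")
      case False
      then have "(1 - 1 / real M) = real (M - 1) / real M" using M by (simp add: of_nat_diff field_simps)
      then show ?thesis using False M by simp
    qed (use Suc.prems in \<open>auto simp: M_def\<close>)
    finally show ?case by (simp add: M_def w_def)
  qed auto
qed

text \<open>Puts the loss of one deletion into a form whose product over the steps telescopes. The
  factor 2 in the exponent absorbs the second order error as long as L / i is at most 1 / 2.\<close>

lemma one_minus_ge_powr:
  assumes "0 \<le> L" "2 * L \<le> real i" "1 < i"
  shows "(real (i - 1) / real i) powr (2 * L) \<le> 1 - L / real i"
proof -
  define x where "x = L / real i"
  have x: "0 \<le> x" "2 * x \<le> 1" using assms by (auto simp: x_def field_simps)
  have "ln (real (i - 1) / real i) \<le> real (i - 1) / real i - 1"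
    using assms by (intro ln_le_minus_one) auto
  also have "\<dots> = - (1 / real i)" using assms by (simp add: of_nat_diff field_simps)
  finally have "2 * L * ln (real (i - 1) / real i) \<le> 2 * L * (- (1 / real i))"
    using assms by (intro mult_left_mono) auto
  also have "\<dots> = - (2 * x)" by (simp add: x_def)
  finally have "(real (i - 1) / real i) powr (2 * L) \<le> exp (- (2 * x))"
    using assms by (simp add: powr_def)
  also have "\<dots> \<le> 1 - x"
  proof -
    have "1 \<le> (1 - x) * (1 + 2 * x)" using x mult_nonneg_nonneg[of x "1 - 2 * x"] by (simp add: algebra_simps)
    also have "\<dots> \<le> (1 - x) * exp (2 * x)" using x by (intro mult_left_mono) auto
    finally show ?thesis by (simp add: exp_minus field_simps)
  qed
  finally show ?thesis by (simp add: x_def)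
qed

text \<open>By \<open>step\<close>, deleting a random element from a set of size i loses on average
  at most the fraction L / i of \<open>h\<close>. The product of the reciprocal factors telescopes
  through \<open>one_minus_ge_powr\<close>.\<close>

lemma local_to_global:
  assumes h0: "\<And>Z. 0 \<le> h Z" and L: "0 \<le> L" and Y: "finite Y" "j < card Y" "2 * L \<le> real (card Y - j)"
    and step: "\<And>Z. Z \<subseteq> Y \<Longrightarrow> Z \<noteq> {} \<Longrightarrow> (\<Sum>u\<in>Z. h Z - h (Z - {u})) \<le> L * h Z"
  shows "h Y \<le> (real (card Y) / real (card Y - j)) powr (2 * L) * deletion_avg j h Y"
  using Y step
proof (induction j arbitrary: Y)
  case 0
  then show ?case by (cases "Y = {}") auto
next
  case (Suc j)
  define M where "M = card Y"
  have M: "1 < M" "Suc j < M" using Suc.prems by (auto simp: M_def)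
  define c where "c = (real (M - 1) / real (M - 1 - j)) powr (2 * L)"
  have "h (Y - {u}) \<le> c * deletion_avg j h (Y - {u})" if u: "u \<in> Y" for u
  proof -
    have cu: "card (Y - {u}) = M - 1" using u Suc.prems by (simp add: M_def)
    have "h (Y - {u}) \<le> (real (card (Y - {u})) / real (card (Y - {u}) - j)) powr (2 * L) * deletion_avg j h (Y - {u})"
    proof (rule Suc.IH)
      show "j < card (Y - {u})" using M(2) by (simp add: cu)
      show "2 * L \<le> real (card (Y - {u}) - j)" using Suc.prems(3) M by (simp add: cu M_def)
      show "(\<Sum>u\<in>Z. h Z - h (Z - {u})) \<le> L * h Z" if "Z \<subseteq> Y - {u}" "Z \<noteq> {}" for Z
        by (rule Suc.prems(4)) (use that in auto)
    qed (use Suc.prems in simp)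
    then show ?thesis by (simp only: cu c_def)
  qed
  then have "(\<Sum>u\<in>Y. h (Y - {u})) \<le> (\<Sum>u\<in>Y. c * deletion_avg j h (Y - {u}))" by (intro sum_mono)
  also have "\<dots> = c * (\<Sum>u\<in>Y. deletion_avg j h (Y - {u}))" by (rule sum_distrib_left[symmetric])
  also have "(\<Sum>u\<in>Y. deletion_avg j h (Y - {u})) = real M * deletion_avg (Suc j) h Y" using M by (simp add: M_def)
  finally have a: "(\<Sum>u\<in>Y. h (Y - {u})) \<le> c * (real M * deletion_avg (Suc j) h Y)" .
  have "(\<Sum>u\<in>Y. h Y - h (Y - {u})) \<le> L * h Y" using Suc.prems(4)[of Y] M by (cases "Y = {}") (auto simp: M_def)
  then have "(real M - L) * h Y \<le> c * (real M * deletion_avg (Suc j) h Y)"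
    using a by (simp add: sum_subtractf M_def algebra_simps)
  then have "(1 - L / real M) * h Y \<le> c * deletion_avg (Suc j) h Y"
    using M by (simp add: field_simps)
  moreover have "(real (M - 1) / real M) powr (2 * L) * h Y \<le> (1 - L / real M) * h Y"
    using one_minus_ge_powr[of L M] L M Suc.prems h0 by (intro mult_right_mono) (auto simp: M_def)
  ultimately have b: "(real (M - 1) / real M) powr (2 * L) * h Y \<le> c * deletion_avg (Suc j) h Y" by linarith
  have "h Y = (real M / real (M - 1)) powr (2 * L) * ((real (M - 1) / real M) powr (2 * L) * h Y)"
    using M by (simp add: powr_mult[symmetric] mult.assoc[symmetric])
  also have "\<dots> \<le> (real M / real (M - 1)) powr (2 * L) * (c * deletion_avg (Suc j) h Y)"
    using b by (intro mult_left_mono) auto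
  also have "\<dots> = ((real M / real (M - 1)) powr (2 * L) * c) * deletion_avg (Suc j) h Y" by simp
  also have "(real M / real (M - 1)) powr (2 * L) * c = (real M / real (M - Suc j)) powr (2 * L)"
    using M unfolding c_def by (subst powr_mult[symmetric]) auto
  finally show ?case by (simp add: M_def)
qed

section \<open>Decay of variance when light vertices are frozen\<close>

context light_graph
begin

definition k :: nat where "k = a + D"

definition Om :: "('a \<Rightarrow> nat) set" where "Om = lcol V (\<lambda>_. {..<k})"

lemma finite_Om: "finite Om"
  unfolding Om_def by (rule finite_lcol) (use finV in auto)

end

sublocale light_graph \<subseteq> cspace Om
  by unfold_locales (rule finite_Om)

context light_graph
begin

lemma Om_col: "\<sigma> \<in> Om \<Longrightarrow> v \<in> V \<Longrightarrow> \<sigma> v < k"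
  by (simp add: Om_def lcol_def)

lemma Om_out: "\<sigma> \<in> Om \<Longrightarrow> v \<notin> V \<Longrightarrow> \<sigma> v = 0"
  by (simp add: Om_def lcol_def)

lemma Om_adj: "\<sigma> \<in> Om \<Longrightarrow> adj u v \<Longrightarrow> \<sigma> u \<noteq> \<sigma> v"
  using adj_V adj_V2 by (simp add: Om_def lcol_def)

lemma OmI:
  assumes "\<And>v. v \<in> V \<Longrightarrow> \<sigma> v < k" "\<And>v. v \<notin> V \<Longrightarrow> \<sigma> v = 0" "\<And>u v. adj u v \<Longrightarrow> \<sigma> u \<noteq> \<sigma> v"
  shows "\<sigma> \<in> Om"
  using assms by (simp add: Om_def lcol_def)

lemma merge_Om:
  assumes t: "\<theta> \<in> Om" and s: "\<sigma> \<in> Om"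
    and d: "\<And>u v. u \<in> X \<Longrightarrow> v \<notin> X \<Longrightarrow> adj u v \<Longrightarrow> \<theta> u \<noteq> \<sigma> v"
  shows "merge X \<theta> \<sigma> \<in> Om"
proof (rule OmI)
  show "merge X \<theta> \<sigma> u \<noteq> merge X \<theta> \<sigma> v" if e: "adj u v" for u v
    using Om_adj[OF t e] Om_adj[OF s e] d[of u v] d[of v u] e adj_sym[OF e]
    unfolding merge_def by (auto split: if_splits)
qed (use t s in \<open>auto simp: merge_def Om_col Om_out\<close>)

lemma fibD: "\<tau> \<in> fib X \<sigma> \<Longrightarrow> v \<notin> X \<Longrightarrow> \<tau> v = \<sigma> v"
  by (simp add: fib_def)

lemma fib_Om: "\<tau> \<in> fib X \<sigma> \<Longrightarrow> \<tau> \<in> Om"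
  by (simp add: fib_def)

lemma fibI: "\<tau> \<in> Om \<Longrightarrow> (\<And>v. v \<notin> X \<Longrightarrow> \<tau> v = \<sigma> v) \<Longrightarrow> \<tau> \<in> fib X \<sigma>"
  by (simp add: fib_def)

definition free :: "('a \<Rightarrow> nat) \<Rightarrow> 'a set \<Rightarrow> 'a \<Rightarrow> nat set" where
  "free \<sigma> X = cut (\<lambda>_. {..<k}) \<sigma> (V - X)"

text \<open>Fibres of the coloring space are list-coloring instances, which makes the influence
  bounds available for conditional means.\<close>

lemma fib_lcol:
  assumes s: "\<sigma> \<in> Om" and X: "X \<subseteq> V"
  shows "bij_betw (\<lambda>\<rho>. merge X \<rho> \<sigma>) (lcol X (free \<sigma> X)) (fib X \<sigma>)"
proof (rule bij_betwI[where g = "restr X"])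
  show "(\<lambda>\<rho>. merge X \<rho> \<sigma>) \<in> lcol X (free \<sigma> X) \<rightarrow> fib X \<sigma>"
  proof
    fix \<rho> assume r: "\<rho> \<in> lcol X (free \<sigma> X)"
    have ne: "\<rho> u \<noteq> \<sigma> v" if "u \<in> X" "v \<notin> X" "adj u v" for u v
    proof -
      have "v \<in> Nb u \<inter> (V - X)" using that adj_V2 by (auto simp: in_Nb)
      then show ?thesis using r that by (auto simp: lcol_def free_def cut_def)
    qed
    have "merge X \<rho> \<sigma> \<in> Om"
    proof (rule OmI)
      show "merge X \<rho> \<sigma> v < k" if "v \<in> V" for v
        using r s that by (auto simp: merge_def Om_col lcol_def free_def cut_def)
      show "merge X \<rho> \<sigma> v = 0" if "v \<notin> V" for v
        using X s that by (auto simp: merge_def Om_out)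
      show "merge X \<rho> \<sigma> u \<noteq> merge X \<rho> \<sigma> v" if e: "adj u v" for u v
        using Om_adj[OF s e] ne[of u v] ne[of v u] e adj_sym[OF e] r
        unfolding merge_def lcol_def by (auto split: if_splits)
    qed
    then show "merge X \<rho> \<sigma> \<in> fib X \<sigma>" by (simp add: fib_def merge_def)
  qed
  show "restr X \<in> fib X \<sigma> \<rightarrow> lcol X (free \<sigma> X)"
  proof
    fix \<tau> assume t: "\<tau> \<in> fib X \<sigma>"
    have "\<tau> v \<in> free \<sigma> X v" if v: "v \<in> X" for v
    proof -
      have "\<tau> v \<noteq> \<sigma> u" if "u \<in> Nb v \<inter> (V - X)" for u
        using Om_adj[OF fib_Om[OF t], of v u] fibD[OF t, of u] that by (auto simp: in_Nb)
      then show ?thesis using Om_col[OF fib_Om[OF t], of v] v X by (auto simp: free_def cut_def)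
    qed
    then show "restr X \<tau> \<in> lcol X (free \<sigma> X)" using Om_adj[OF fib_Om[OF t]] by (simp add: lcol_def restr_def)
  qed
  show "restr X (merge X \<rho> \<sigma>) = \<rho>" if "\<rho> \<in> lcol X (free \<sigma> X)" for \<rho>
    using that by (auto simp: lcol_def restr_def merge_def fun_eq_iff)
  show "merge X (restr X \<tau>) \<sigma> = \<tau>" if "\<tau> \<in> fib X \<sigma>" for \<tau>
    using that by (auto simp: fib_def restr_def merge_def fun_eq_iff)
qed

lemma E_EL:
  assumes s: "\<sigma> \<in> Om" and X: "X \<subseteq> V"
  shows "E X h \<sigma> = EL X (free \<sigma> X) (\<lambda>\<rho>. h (merge X \<rho> \<sigma>))"
  unfolding E_def EL_def
  using sum.reindex_bij_betw[OF fib_lcol[OF assms], of h] bij_betw_same_card[OF fib_lcol[OF assms]] by simp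

lemma card_free:
  assumes "light v" "v \<in> X" "X \<subseteq> V"
  shows "a + card (Nb v \<inter> X) \<le> card (free \<sigma> X v)"
proof -
  have "card (Nb v) = card (Nb v \<inter> X) + card (Nb v \<inter> (V - X))"
    using Nb_V[of v] by (subst card_Un_disjoint[symmetric]) (auto intro!: arg_cong[of _ _ card])
  moreover have "card (\<sigma> ` (Nb v \<inter> (V - X))) \<le> card (Nb v \<inter> (V - X))" by (intro card_image_le) simp
  moreover have "card {..<k} - card (\<sigma> ` (Nb v \<inter> (V - X))) \<le> card (free \<sigma> X v)"
    unfolding free_def cut_def by (rule diff_card_le_card_Diff) simp
  ultimately show ?thesis using light_deg[OF assms(1)] by (simp add: k_def)
qed

text \<open>Derives the contraction required in \<open>spectral_independence\<close> from
  \<open>influence_bound\<close>. On the fibre of \<tau> each \<open>\<phi> w\<close> depends on the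
  colour of \<open>w\<close> alone, so after subtracting minima and dividing by \<open>N\<close> the
  sum becomes a \<open>light_stat\<close>. The constant is 1 for \<open>\<phi> u\<close> itself plus
  \<open>D * B + F + 1\<close> for the other vertices.\<close>

lemma oscillation_contraction:
  assumes X: "X \<subseteq> V" "closed X" and Y: "Y = {w \<in> X. light w}"
    and F: "\<And>W. W \<subseteq> V \<Longrightarrow> conn W \<Longrightarrow> val W \<le> F"
    and N: "0 \<le> N"
    and dep: "\<And>w \<tau> \<tau>'. w \<in> Y \<Longrightarrow> \<tau> \<in> Om \<Longrightarrow> \<tau>' \<in> fib (X - {w}) \<tau> \<Longrightarrow> \<phi> w \<tau>' = (\<phi> w \<tau> :: real)"
    and osc: "\<And>w \<tau> \<tau>'. w \<in> Y \<Longrightarrow> \<tau> \<in> Om \<Longrightarrow> \<tau>' \<in> fib X \<tau> \<Longrightarrow> \<bar>\<phi> w \<tau>' - \<phi> w \<tau>\<bar> \<le> N"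
    and u: "u \<in> Y" and t: "\<tau> \<in> Om" "\<tau>' \<in> fib X \<tau>"
  shows "\<bar>E (X - {u}) (\<lambda>\<sigma>. \<Sum>w\<in>Y. \<phi> w \<sigma>) \<tau>' - E (X - {u}) (\<lambda>\<sigma>. \<Sum>w\<in>Y. \<phi> w \<sigma>) \<tau>\<bar> \<le> (2 + real D * B + F) * N"
proof -
  have fX: "finite X" using X finV finite_subset by blast
  have fY: "finite Y" using fX Y by simp
  have uX: "u \<in> X" "light u" using u Y by auto
  have t': "\<tau>' \<in> Om" using t fib_Om by blast
  define m where "m w = Min (\<phi> w ` fib X \<tau>)" for w
  have m: "m w \<le> \<phi> w \<rho>" if "\<rho> \<in> fib X \<tau>" for w \<rho> using that by (simp add: m_def)
  have mN: "\<phi> w \<rho> \<le> m w + N" if w: "w \<in> Y" and r: "\<rho> \<in> fib X \<tau>" for w \<rho>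
  proof -
    have "m w \<in> \<phi> w ` fib X \<tau>" unfolding m_def using r by (intro Min_in) auto
    then obtain \<rho>' where r': "\<rho>' \<in> fib X \<tau>" "m w = \<phi> w \<rho>'" by blast
    have "\<rho> \<in> fib X \<rho>'" using r r' fib_eq by blast
    then show ?thesis using osc[OF w, of \<rho>' \<rho>] r' fib_Om by fastforce
  qed
  \<comment> \<open>Colours that do not occur at \<open>w\<close> get the value 0. For
    \<open>N = 0\<close> the division also gives 0, in accordance with \<open>\<phi> w\<close> being
    constant on the fibre.\<close>
  define g where "g w c = (if \<exists>\<rho>\<in>fib X \<tau>. w \<in> Y \<and> \<rho> w = c then
      (\<phi> w (SOME \<rho>. \<rho> \<in> fib X \<tau> \<and> \<rho> w = c) - m w) / N else 0)" for w c
  have gphi: "N * g w (\<rho> w) = \<phi> w \<rho> - m w" if w: "w \<in> Y" and r: "\<rho> \<in> fib X \<tau>" for w \<rho>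
  proof -
    define \<rho>' where "\<rho>' = (SOME \<rho>'. \<rho>' \<in> fib X \<tau> \<and> \<rho>' w = \<rho> w)"
    have r': "\<rho>' \<in> fib X \<tau>" "\<rho>' w = \<rho> w"
      unfolding \<rho>'_def using r someI[of "\<lambda>\<rho>'. \<rho>' \<in> fib X \<tau> \<and> \<rho>' w = \<rho> w" \<rho>] by auto
    have "\<rho>' \<in> fib (X - {w}) \<rho>"
      using r r' by (auto simp: fib_def)
    then have "\<phi> w \<rho>' = \<phi> w \<rho>" using dep[OF w fib_Om[OF r]] by blast
    moreover have "N = 0 \<Longrightarrow> \<phi> w \<rho> = m w" using m[OF r, of w] mN[OF w r] by simp
    ultimately show ?thesis using w r by (auto simp: g_def \<rho>'_def)
  qed
  have g: "unit_valued g" unfolding unit_valued_def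
  proof (intro allI)
    fix w c
    show "0 \<le> g w c \<and> g w c \<le> 1"
    proof (cases "N > 0 \<and> (\<exists>\<rho>\<in>fib X \<tau>. w \<in> Y \<and> \<rho> w = c)")
      case True
      then obtain \<rho> where r: "\<rho> \<in> fib X \<tau>" "w \<in> Y" "\<rho> w = c" by blast
      have "0 \<le> N * g w c" "N * g w c \<le> N" using gphi[OF r(2,1)] m[OF r(1), of w] mN[OF r(2,1)] r(3) by auto
      then show ?thesis using True by (simp add: zero_le_mult_iff)
    next
      case False
      then show ?thesis using N by (auto simp: g_def)
    qed
  qed
  define L where "L = free \<tau> X"
  have fr: "EL (X - {u}) (free \<rho> (X - {u})) H = EL (X - {u}) (cut L \<rho> {u}) H" if r: "\<rho> \<in> fib X \<tau>" for \<rho> H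
  proof (rule EL_cong)
    fix v assume v: "v \<in> X - {u}"
    have "Nb v \<inter> (V - (X - {u})) = (Nb v \<inter> (V - X)) \<union> (Nb v \<inter> {u})" using uX X by auto
    then have "\<rho> ` (Nb v \<inter> (V - (X - {u}))) = \<tau> ` (Nb v \<inter> (V - X)) \<union> \<rho> ` (Nb v \<inter> {u})"
      using fibD[OF r] by (auto simp: image_Un)
    then show "free \<rho> (X - {u}) v = cut L \<rho> {u} v" by (auto simp: free_def L_def cut_def)
  qed
  define H where "H = light_stat g (X - {u})"
  have Ef: "E (X - {u}) (\<lambda>\<sigma>. \<Sum>w\<in>Y. \<phi> w \<sigma>) \<rho> = \<phi> u \<rho> + (\<Sum>w\<in>Y - {u}. m w) + N * EL (X - {u}) (cut L \<rho> {u}) H"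
    if r: "\<rho> \<in> fib X \<tau>" for \<rho>
  proof -
    have rO: "\<rho> \<in> Om" using fib_Om[OF r] .
    have XuV: "X - {u} \<subseteq> V" using X by blast
    have sp: "(\<Sum>w\<in>Y. \<phi> w \<sigma>) = \<phi> u \<rho> + (\<Sum>w\<in>Y - {u}. m w) + N * (\<Sum>w\<in>Y - {u}. g w (\<sigma> w))"
      if s: "\<sigma> \<in> fib (X - {u}) \<rho>" for \<sigma>
    proof -
      have sX: "\<sigma> \<in> fib X \<tau>" using s r fib_mono[of "X - {u}" X \<rho>] fib_eq[OF r] by blast
      have "(\<Sum>w\<in>Y. \<phi> w \<sigma>) = \<phi> u \<sigma> + (\<Sum>w\<in>Y - {u}. \<phi> w \<sigma>)" using u fY by (simp add: sum.remove)
      also have "\<phi> u \<sigma> = \<phi> u \<rho>" using dep[OF u rO s] .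
      also have "(\<Sum>w\<in>Y - {u}. \<phi> w \<sigma>) = (\<Sum>w\<in>Y - {u}. m w + N * g w (\<sigma> w))"
        using gphi sX by (intro sum.cong refl) simp
      finally show ?thesis by (simp add: sum.distrib sum_distrib_left)
    qed
    define c where "c = \<phi> u \<rho> + (\<Sum>w\<in>Y - {u}. m w)"
    have "E (X - {u}) (\<lambda>\<sigma>. \<Sum>w\<in>Y. \<phi> w \<sigma>) \<rho> = E (X - {u}) (\<lambda>\<sigma>. c + N * (\<Sum>w\<in>Y - {u}. g w (\<sigma> w))) \<rho>"
      unfolding E_def using sp by (simp add: c_def cong: sum.cong)
    also have "\<dots> = c + N * E (X - {u}) (\<lambda>\<sigma>. \<Sum>w\<in>Y - {u}. g w (\<sigma> w)) \<rho>"
      using fib_ne[OF rO, of "X - {u}"]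
      by (simp add: E_def sum.distrib add_divide_distrib sum_distrib_left[symmetric])
    also have "E (X - {u}) (\<lambda>\<sigma>. \<Sum>w\<in>Y - {u}. g w (\<sigma> w)) \<rho> = EL (X - {u}) (free \<rho> (X - {u})) H"
    proof -
      have "{w \<in> X - {u}. light w} = Y - {u}" using Y by auto
      moreover have "(\<Sum>w\<in>Y - {u}. g w (merge (X - {u}) \<rho>' \<rho> w)) = (\<Sum>w\<in>Y - {u}. g w (\<rho>' w))" for \<rho>'
        by (intro sum.cong refl) (use Y in \<open>auto simp: merge_def\<close>)
      ultimately show ?thesis unfolding E_EL[OF rO XuV] H_def light_stat_def by simp
    qed
    finally show ?thesis using fr[OF r] by (simp add: c_def)
  qed
  have ne: "lcol (X - {u}) (cut L \<rho> {u}) \<noteq> {}" if r: "\<rho> \<in> fib X \<tau>" for \<rho>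
  proof -
    have "X - {u} \<subseteq> V" using X by blast
    then have "lcol (X - {u}) (free \<rho> (X - {u})) \<noteq> {}"
      using fib_lcol[OF fib_Om[OF r]] fib_ne[OF fib_Om[OF r]] by (metis bij_betw_empty1)
    moreover have "lcol (X - {u}) (free \<rho> (X - {u})) = lcol (X - {u}) (cut L \<rho> {u})"
    proof (rule lcol_cong)
      fix v assume v: "v \<in> X - {u}"
      have "Nb v \<inter> (V - (X - {u})) = (Nb v \<inter> (V - X)) \<union> (Nb v \<inter> {u})" using uX X by auto
      then have "\<rho> ` (Nb v \<inter> (V - (X - {u}))) = \<tau> ` (Nb v \<inter> (V - X)) \<union> \<rho> ` (Nb v \<inter> {u})"
        using fibD[OF r] by (auto simp: image_Un)
      then show "free \<rho> (X - {u}) v = cut L \<rho> {u} v" by (auto simp: free_def L_def cut_def)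
    qed
    ultimately show ?thesis by simp
  qed
  have "\<bar>EL (X - {u}) (cut L \<tau>' {u}) H - EL (X - {u}) (cut L \<tau> {u}) H\<bar> \<le> real D * B + F + 1"
    unfolding H_def
  proof (rule influence_bound[OF X uX])
    show "finite (L v)" for v by (simp add: L_def free_def cut_def)
    show "a + card (Nb v \<inter> X) \<le> card (L v)" if "v \<in> X - {u}" "light v" for v
      unfolding L_def using card_free[of v X \<tau>] that X by blast
  qed (use ne t fib_self g F in auto)
  then have "\<bar>N * EL (X - {u}) (cut L \<tau>' {u}) H - N * EL (X - {u}) (cut L \<tau> {u}) H\<bar> \<le> N * (real D * B + F + 1)"
    using N by (simp add: right_diff_distrib[symmetric] abs_mult mult_left_mono)
  moreover have "\<bar>\<phi> u \<tau>' - \<phi> u \<tau>\<bar> \<le> N" using osc[OF u t] .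
  ultimately show ?thesis using Ef[OF t(2)] Ef[OF fib_self[OF t(1)]] by (simp add: algebra_simps abs_le_iff)
qed

lemma variance_step:
  assumes X: "X \<subseteq> V" "closed X" and Y: "Y = {w \<in> X. light w}"
    and F: "\<And>W. W \<subseteq> V \<Longrightarrow> conn W \<Longrightarrow> val W \<le> F" and F0: "0 \<le> F"
  shows "(\<Sum>u\<in>Y. EV X f - EV (X - {u}) f) \<le> (2 + real D * B + F) * EV X f"
proof (rule spectral_independence)
  show "finite Y" using finite_subset[OF X(1) finV] Y by simp
  show "Y \<subseteq> X" using Y by auto
  show "1 \<le> 2 + real D * B + F" using B0 F0 by (simp add: add_nonneg_nonneg add_increasing)
qed (rule oscillation_contraction[OF X Y F], assumption+)

text \<open>Without edges between \<open>X1\<close> and \<open>X2\<close> the fibre over the union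
  is a product: the fibre over \<open>X2\<close> looks the same for every coloring in the fibre over
  \<open>X1\<close>.\<close>

lemma E_tensor:
  assumes X: "X1 \<inter> X2 = {}" and ne: "\<And>u v. u \<in> X1 \<Longrightarrow> v \<in> X2 \<Longrightarrow> \<not> adj u v" and s: "\<sigma> \<in> Om"
  shows "E X1 (E X2 f) \<sigma> = E (X1 \<union> X2) f \<sigma>"
proof -
  have dj: "x \<notin> X2" if "x \<in> X1" for x using X that by blast
  have ne': "\<not> adj v u" if "u \<in> X1" "v \<in> X2" for u v using ne[OF that] adj_sym by blast
  have b2: "bij_betw (merge X1 \<tau>) (fib X2 \<sigma>) (fib X2 \<tau>)" if t: "\<tau> \<in> fib X1 \<sigma>" for \<tau>
  proof (rule bij_betwI[where g = "merge X1 \<sigma>"])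
    show "merge X1 \<tau> \<in> fib X2 \<sigma> \<rightarrow> fib X2 \<tau>"
    proof
      fix \<rho> assume r: "\<rho> \<in> fib X2 \<sigma>"
      have "merge X1 \<tau> \<rho> \<in> Om"
      proof (rule merge_Om[OF fib_Om[OF t] fib_Om[OF r]])
        fix u v assume uv: "u \<in> X1" "v \<notin> X1" "adj u v"
        then have "v \<notin> X2" using ne by blast
        then have "\<rho> v = \<tau> v" using fibD[OF r] fibD[OF t] uv by metis
        then show "\<tau> u \<noteq> \<rho> v" using Om_adj[OF fib_Om[OF t] uv(3)] by simp
      qed
      then show "merge X1 \<tau> \<rho> \<in> fib X2 \<tau>" using fibD[OF r] fibD[OF t] by (auto intro!: fibI simp: merge_def)
    qed
    show "merge X1 \<sigma> \<in> fib X2 \<tau> \<rightarrow> fib X2 \<sigma>"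
    proof
      fix \<rho> assume r: "\<rho> \<in> fib X2 \<tau>"
      have "merge X1 \<sigma> \<rho> \<in> Om"
      proof (rule merge_Om[OF s fib_Om[OF r]])
        fix u v assume uv: "u \<in> X1" "v \<notin> X1" "adj u v"
        then have "v \<notin> X2" using ne by blast
        then have "\<rho> v = \<sigma> v" using fibD[OF r] fibD[OF t] uv by metis
        then show "\<sigma> u \<noteq> \<rho> v" using Om_adj[OF s uv(3)] by simp
      qed
      then show "merge X1 \<sigma> \<rho> \<in> fib X2 \<sigma>" using fibD[OF r] fibD[OF t] by (auto intro!: fibI simp: merge_def)
    qed
    show "merge X1 \<sigma> (merge X1 \<tau> \<rho>) = \<rho>" if "\<rho> \<in> fib X2 \<sigma>" for \<rho>
      using fibD[OF that] dj by (auto simp: merge_def fun_eq_iff)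
    show "merge X1 \<tau> (merge X1 \<sigma> \<rho>) = \<rho>" if "\<rho> \<in> fib X2 \<tau>" for \<rho>
      using fibD[OF that] dj by (auto simp: merge_def fun_eq_iff)
  qed
  have b: "bij_betw (\<lambda>p. merge X1 (fst p) (snd p)) (fib X1 \<sigma> \<times> fib X2 \<sigma>) (fib (X1 \<union> X2) \<sigma>)"
  proof (rule bij_betwI[where g = "\<lambda>\<theta>. (merge X1 \<theta> \<sigma>, merge X2 \<theta> \<sigma>)"])
    show "(\<lambda>p. merge X1 (fst p) (snd p)) \<in> fib X1 \<sigma> \<times> fib X2 \<sigma> \<rightarrow> fib (X1 \<union> X2) \<sigma>"
    proof
      fix p assume p: "p \<in> fib X1 \<sigma> \<times> fib X2 \<sigma>"
      then have t: "fst p \<in> fib X1 \<sigma>" and "snd p \<in> fib X2 \<sigma>" by auto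
      then have "merge X1 (fst p) (snd p) \<in> fib X2 (fst p)" using bij_betw_apply[OF b2[OF t]] by blast
      then show "merge X1 (fst p) (snd p) \<in> fib (X1 \<union> X2) \<sigma>" using t by (auto simp: fib_def)
    qed
    show "(\<lambda>\<theta>. (merge X1 \<theta> \<sigma>, merge X2 \<theta> \<sigma>)) \<in> fib (X1 \<union> X2) \<sigma> \<rightarrow> fib X1 \<sigma> \<times> fib X2 \<sigma>"
    proof
      fix \<theta> assume t: "\<theta> \<in> fib (X1 \<union> X2) \<sigma>"
      have "merge X1 \<theta> \<sigma> \<in> Om"
      proof (rule merge_Om[OF fib_Om[OF t] s])
        fix u v assume uv: "u \<in> X1" "v \<notin> X1" "adj u v"
        then have "v \<notin> X1 \<union> X2" using ne by blast
        then show "\<theta> u \<noteq> \<sigma> v" using Om_adj[OF fib_Om[OF t] uv(3)] fibD[OF t] by metis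
      qed
      moreover have "merge X2 \<theta> \<sigma> \<in> Om"
      proof (rule merge_Om[OF fib_Om[OF t] s])
        fix u v assume uv: "u \<in> X2" "v \<notin> X2" "adj u v"
        then have "v \<notin> X1 \<union> X2" using ne' by blast
        then show "\<theta> u \<noteq> \<sigma> v" using Om_adj[OF fib_Om[OF t] uv(3)] fibD[OF t] by metis
      qed
      ultimately show "(merge X1 \<theta> \<sigma>, merge X2 \<theta> \<sigma>) \<in> fib X1 \<sigma> \<times> fib X2 \<sigma>" by (simp add: fib_def merge_def)
    qed
    show "(merge X1 (merge X1 (fst p) (snd p)) \<sigma>, merge X2 (merge X1 (fst p) (snd p)) \<sigma>) = p"
      if pp: "p \<in> fib X1 \<sigma> \<times> fib X2 \<sigma>" for p
    proof -
      obtain \<tau> \<rho> where p: "p = (\<tau>, \<rho>)" "\<tau> \<in> fib X1 \<sigma>" "\<rho> \<in> fib X2 \<sigma>" using pp by (cases p) auto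
      show ?thesis using fibD[OF p(2)] fibD[OF p(3)] dj unfolding p(1) by (auto simp: merge_def fun_eq_iff)
    qed
    show "merge X1 (fst (merge X1 \<theta> \<sigma>, merge X2 \<theta> \<sigma>)) (snd (merge X1 \<theta> \<sigma>, merge X2 \<theta> \<sigma>)) = \<theta>"
      if "\<theta> \<in> fib (X1 \<union> X2) \<sigma>" for \<theta>
      using fibD[OF that] by (auto simp: merge_def fun_eq_iff)
  qed
  have e2: "E X2 f \<tau> = (\<Sum>\<rho>\<in>fib X2 \<sigma>. f (merge X1 \<tau> \<rho>)) / real (card (fib X2 \<sigma>))" if t: "\<tau> \<in> fib X1 \<sigma>" for \<tau>
    unfolding E_def using sum.reindex_bij_betw[OF b2[OF t], of f] bij_betw_same_card[OF b2[OF t]] by simp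
  have "E X1 (E X2 f) \<sigma> = (\<Sum>\<tau>\<in>fib X1 \<sigma>. (\<Sum>\<rho>\<in>fib X2 \<sigma>. f (merge X1 \<tau> \<rho>)) / real (card (fib X2 \<sigma>))) / real (card (fib X1 \<sigma>))"
    unfolding E_def[of X1] using e2 by simp
  also have "\<dots> = (\<Sum>p\<in>fib X1 \<sigma> \<times> fib X2 \<sigma>. f (merge X1 (fst p) (snd p))) / real (card (fib X1 \<sigma> \<times> fib X2 \<sigma>))"
    by (simp add: sum.cartesian_product case_prod_unfold sum_divide_distrib[symmetric] card_cartesian_product mult.commute)
  also have "\<dots> = E (X1 \<union> X2) f \<sigma>"
    unfolding E_def using sum.reindex_bij_betw[OF b, of f] bij_betw_same_card[OF b] by simp
  finally show ?thesis .
qed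

lemma EV_tensor_adj:
  assumes "X1 \<inter> X2 = {}" "\<And>u v. u \<in> X1 \<Longrightarrow> v \<in> X2 \<Longrightarrow> \<not> adj u v"
  shows "EV (X1 \<union> X2) f \<le> EV X1 f + EV X2 f"
  by (rule EV_tensor) (rule E_tensor[OF assms])

end

section \<open>Poincare inequality by elimination\<close>

lemma sq_avg_le:
  fixes g :: "'b \<Rightarrow> real"
  assumes "finite B" "B \<noteq> {}"
  shows "((\<Sum>x\<in>B. g x) / real (card B))\<^sup>2 \<le> (\<Sum>x\<in>B. (g x)\<^sup>2) / real (card B)"
proof -
  have c: "0 < real (card B)" using assms by (simp add: card_gt_0_iff)
  have "(\<Sum>x\<in>B. g x)\<^sup>2 \<le> (\<Sum>x\<in>B. (g x)\<^sup>2) * real (card B)"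
    using Cauchy_Schwarz_ineq_sum[of g "\<lambda>_. 1" B] by simp
  then show ?thesis using c by (simp add: power_divide power2_eq_square divide_le_eq)
qed

lemma sub_avg_le:
  fixes f :: "'b \<Rightarrow> real"
  assumes "finite A" "B \<subseteq> A" "B \<noteq> {}" and q: "0 < q" "q * real (card A) \<le> real (card B)"
  shows "((\<Sum>x\<in>B. f x) / real (card B) - m)\<^sup>2 \<le> ((\<Sum>x\<in>A. (f x - m)\<^sup>2) / real (card A)) / q"
proof -
  have fB: "finite B" using assms finite_subset by blast
  have c: "0 < real (card B)" using assms fB by (simp add: card_gt_0_iff)
  have cA: "0 < real (card A)" using assms by (auto simp: card_gt_0_iff)
  have "(\<Sum>x\<in>B. f x) / real (card B) - m = (\<Sum>x\<in>B. f x - m) / real (card B)"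
    using c by (simp add: sum_subtractf diff_divide_distrib)
  then have "((\<Sum>x\<in>B. f x) / real (card B) - m)\<^sup>2 \<le> (\<Sum>x\<in>B. (f x - m)\<^sup>2) / real (card B)"
    using sq_avg_le[OF fB assms(3), of "\<lambda>x. f x - m"] by simp
  also have "\<dots> \<le> (\<Sum>x\<in>A. (f x - m)\<^sup>2) / (q * real (card A))"
    using assms q c cA by (intro frac_le sum_mono2) (auto simp: sum_nonneg)
  finally show ?thesis by (simp add: mult.commute)
qed

lemma sq_sum3: "(x - y :: real)\<^sup>2 \<le> 3 * ((x - z)\<^sup>2 + (z - w)\<^sup>2 + (w - y)\<^sup>2)"
proof -
  define a b c where "a = x - z" and "b = z - w" and "c = w - y"
  have "(a + b + c)\<^sup>2 \<le> 3 * (a\<^sup>2 + b\<^sup>2 + c\<^sup>2)"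
    using sum_squares_ge_zero[of "a - b" "b - c"] zero_le_power2[of "a - c"]
    by (simp add: power2_eq_square algebra_simps)
  moreover have "a + b + c = x - y" by (simp add: a_def b_def c_def)
  ultimately show ?thesis by (simp add: a_def b_def c_def)
qed

section \<open>Comparing conditional means on two fibres\<close>

context light_graph
begin

text \<open>A sum over the fibre instead of a mean, so that it bounds the difference of
  \<open>f\<close> at any two of its points. The price is the fibre size in
  \<open>sum_Sq\<close>.\<close>

definition Sq :: "'a set \<Rightarrow> (('a \<Rightarrow> nat) \<Rightarrow> real) \<Rightarrow> ('a \<Rightarrow> nat) \<Rightarrow> real" where
  "Sq J f \<rho> = (\<Sum>\<theta>\<in>fib J \<rho>. (f \<theta> - E J f \<theta>)\<^sup>2)"

text \<open>These are the colorings that can be carried to the other fibre by recolouring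
  \<open>J\<close> alone; their proportion decides how cheaply two fibres compare.\<close>

definition compatible :: "'a set \<Rightarrow> 'a set \<Rightarrow> ('a \<Rightarrow> nat) \<Rightarrow> ('a \<Rightarrow> nat) \<Rightarrow> ('a \<Rightarrow> nat) set" where
  "compatible Z J \<kappa> \<tau> = {\<rho> \<in> fib Z \<tau>. merge J \<kappa> \<rho> \<in> Om}"

lemma Sq_nonneg: "0 \<le> Sq J f \<rho>"
  by (simp add: Sq_def sum_nonneg)

lemma card_fib_le: "finite J \<Longrightarrow> J \<subseteq> V \<Longrightarrow> card (fib J \<sigma>) \<le> k ^ card J"
proof -
  assume J: "finite J" "J \<subseteq> V"
  have "inj_on (\<lambda>\<tau>. restrict \<tau> J) (fib J \<sigma>)"
  proof (rule inj_onI)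
    fix x y assume xy: "x \<in> fib J \<sigma>" "y \<in> fib J \<sigma>" "restrict x J = restrict y J"
    show "x = y"
    proof
      fix v show "x v = y v"
        using fibD[OF xy(1), of v] fibD[OF xy(2), of v] fun_cong[OF xy(3), of v]
        by (cases "v \<in> J") auto
    qed
  qed
  moreover have "(\<lambda>\<tau>. restrict \<tau> J) ` fib J \<sigma> \<subseteq> PiE J (\<lambda>_. {..<k})"
    using J Om_col fib_Om by fastforce
  ultimately have "card (fib J \<sigma>) \<le> card (PiE J (\<lambda>_. {..<k}))"
    using J by (intro card_inj_on_le) (auto intro: finite_PiE)
  then show ?thesis using J by (simp add: card_PiE)
qed

lemma sum_Sq:
  assumes "finite J" "J \<subseteq> V"
  shows "(\<Sum>\<rho>\<in>Om. Sq J f \<rho>) \<le> real (k ^ card J) * EV J f"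
proof -
  have "(\<Sum>\<rho>\<in>Om. Sq J f \<rho>) \<le> (\<Sum>\<rho>\<in>Om. real (k ^ card J) * E J (\<lambda>\<theta>. (f \<theta> - E J f \<theta>)\<^sup>2) \<rho>)"
  proof (rule sum_mono)
    fix \<rho> assume r: "\<rho> \<in> Om"
    have "Sq J f \<rho> = real (card (fib J \<rho>)) * E J (\<lambda>\<theta>. (f \<theta> - E J f \<theta>)\<^sup>2) \<rho>"
      using fib_ne[OF r] by (simp add: Sq_def E_def[of J "\<lambda>\<theta>. (f \<theta> - E J f \<theta>)\<^sup>2"])
    also have "\<dots> \<le> real (k ^ card J) * E J (\<lambda>\<theta>. (f \<theta> - E J f \<theta>)\<^sup>2) \<rho>"
      using card_fib_le[OF assms, of \<rho>]
      by (intro mult_right_mono) (auto simp: E_def sum_nonneg simp flip: of_nat_power)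
    finally show "Sq J f \<rho> \<le> real (k ^ card J) * E J (\<lambda>\<theta>. (f \<theta> - E J f \<theta>)\<^sup>2) \<rho>" .
  qed
  also have "\<dots> = real (k ^ card J) * EV J f"
    by (simp add: sum_distrib_left[symmetric] sum_E EV_def)
  finally show ?thesis .
qed

lemma E_affine:
  assumes "\<sigma> \<in> Om"
  shows "E X (\<lambda>\<tau>. \<alpha> + \<beta> * h \<tau>) \<sigma> = \<alpha> + \<beta> * E X h \<sigma>"
proof -
  have "(\<Sum>\<tau>\<in>fib X \<sigma>. \<alpha> + \<beta> * h \<tau>) = real (card (fib X \<sigma>)) * \<alpha> + \<beta> * (\<Sum>\<tau>\<in>fib X \<sigma>. h \<tau>)"
    by (simp add: sum.distrib sum_distrib_left)
  then show ?thesis using fib_ne[OF assms] by (simp add: E_def add_divide_distrib)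
qed

lemma pair_diff_le_Sq:
  assumes "\<rho> \<in> Om" "\<rho>' \<in> fib J \<rho>"
  shows "(f \<rho> - f \<rho>')\<^sup>2 \<le> 2 * Sq J f \<rho>"
proof (cases "\<rho> = \<rho>'")
  case False
  define m where "m = E J f \<rho>"
  have "(f \<rho> - f \<rho>')\<^sup>2 \<le> 2 * ((f \<rho> - m)\<^sup>2 + (f \<rho>' - m)\<^sup>2)"
    using zero_le_power2[of "f \<rho> + f \<rho>' - 2 * m"] by (simp add: power2_eq_square algebra_simps)
  also have "(f \<rho> - m)\<^sup>2 + (f \<rho>' - m)\<^sup>2 = (\<Sum>\<theta>\<in>{\<rho>, \<rho>'}. (f \<theta> - E J f \<theta>)\<^sup>2)"
    using False assms by (simp add: m_def E_fib)
  also have "\<dots> \<le> Sq J f \<rho>" unfolding Sq_def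
    using assms fib_self by (intro sum_mono2) auto
  finally show ?thesis by simp
qed (simp add: Sq_nonneg)

text \<open>Transport between the two fibres: restrict the first to the colorings compatible with
  the new colors on \<open>J\<close>, recolour \<open>J\<close>, and land in the second. Each
  restriction costs a conditional variance over \<open>q\<close>, the recolouring costs
  \<open>Sq J f\<close>, and \<open>sq_sum3\<close> adds the three.\<close>

lemma pair_bound:
  assumes KX: "J \<subseteq> K" "K \<subseteq> X" and t: "\<tau> \<in> Om" "\<tau>' \<in> fib X \<tau>" and agree: "\<And>v. v \<in> K - J \<Longrightarrow> \<tau>' v = \<tau> v"
    and q: "0 < q" "q * real (card (fib (X - K) \<tau>)) \<le> real (card (compatible (X - K) J \<tau>' \<tau>))"
      "q * real (card (fib (X - K) \<tau>')) \<le> real (card (compatible (X - K) J \<tau> \<tau>'))"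
  shows "(E (X - K) f \<tau> - E (X - K) f \<tau>')\<^sup>2
    \<le> 3 / q * (E (X - K) (\<lambda>\<rho>. (f \<rho> - E (X - K) f \<rho>)\<^sup>2) \<tau> + E (X - K) (\<lambda>\<rho>. (f \<rho> - E (X - K) f \<rho>)\<^sup>2) \<tau>')
      + 6 / q * E (X - K) (Sq J f) \<tau>"
proof -
  define Z where "Z = X - K"
  define C where "C = compatible Z J \<tau>' \<tau>"
  have t': "\<tau>' \<in> Om" using t fib_Om by blast
  have merge_in: "merge J \<tau>2 \<rho> \<in> fib Z \<tau>2 \<and> merge J \<tau>1 (merge J \<tau>2 \<rho>) = \<rho>"
    if r: "\<rho> \<in> compatible Z J \<tau>2 \<tau>1" and a: "\<tau>2 \<in> fib X \<tau>1" "\<And>v. v \<in> K - J \<Longrightarrow> \<tau>2 v = \<tau>1 v" for \<rho> \<tau>1 \<tau>2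
  proof -
    have r1: "\<rho> \<in> fib Z \<tau>1" "merge J \<tau>2 \<rho> \<in> Om" using r by (auto simp: compatible_def)
    have "merge J \<tau>2 \<rho> v = \<tau>2 v" if "v \<notin> Z" for v
      using fibD[OF r1(1) that] fibD[OF a(1), of v] a(2)[of v] that by (auto simp: merge_def Z_def)
    moreover have "merge J \<tau>1 (merge J \<tau>2 \<rho>) = \<rho>"
      using fibD[OF r1(1)] KX by (auto simp: merge_def Z_def fun_eq_iff)
    ultimately show ?thesis using r1 by (auto intro: fibI)
  qed
  have tt: "\<tau> \<in> fib X \<tau>'" using t fib_sym by blast
  have inj: "inj_on (merge J \<tau>') C"
    by (rule inj_on_inverseI[where g = "merge J \<tau>"]) (use merge_in[OF _ t(2) agree] in \<open>auto simp: C_def\<close>)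
  have inj': "inj_on (merge J \<tau>) (compatible Z J \<tau> \<tau>')"
    by (rule inj_on_inverseI[where g = "merge J \<tau>'"]) (use merge_in[OF _ tt agree[symmetric]] in auto)
  have fC: "finite C" unfolding C_def compatible_def by simp
  have CZ: "C \<subseteq> fib Z \<tau>" by (auto simp: C_def compatible_def)
  have into: "merge J \<tau>' ` C \<subseteq> fib Z \<tau>'" using merge_in[OF _ t(2) agree] by (auto simp: C_def)
  \<comment> \<open>The transport is reversible, so the compatible set on the second side shows that
    \<open>C\<close> is also large relative to the fibre of \<tau>'.\<close>
  have "merge J \<tau> ` compatible Z J \<tau> \<tau>' \<subseteq> C"
  proof
    fix x assume "x \<in> merge J \<tau> ` compatible Z J \<tau> \<tau>'"
    then obtain \<rho> where r: "\<rho> \<in> compatible Z J \<tau> \<tau>'" "x = merge J \<tau> \<rho>" by blast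
    have "x \<in> fib Z \<tau>" "merge J \<tau>' x = \<rho>" using merge_in[OF r(1) tt agree[symmetric]] r(2) by auto
    moreover have "\<rho> \<in> Om" using r by (auto simp: compatible_def fib_def)
    ultimately show "x \<in> C" by (simp add: C_def compatible_def)
  qed
  then have "card (compatible Z J \<tau> \<tau>') \<le> card C" using card_inj_on_le[OF inj'] fC by blast
  then have q2: "q * real (card (fib Z \<tau>')) \<le> real (card C)" using q(3) by (simp add: Z_def)
  have q1: "q * real (card (fib Z \<tau>)) \<le> real (card C)" using q(2) by (simp add: Z_def C_def)
  have cp: "0 < real (card C)"
    using q1 q(1) card_fib_pos[OF t(1), of Z] by (smt (verit) mult_pos_pos)
  then have Cne: "C \<noteq> {}" by auto
  define F where "F = E Z f"
  define m1 where "m1 = (\<Sum>\<rho>\<in>C. f \<rho>) / real (card C)"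
  define m2 where "m2 = (\<Sum>\<rho>\<in>C. f (merge J \<tau>' \<rho>)) / real (card C)"
  have V: "E Z (\<lambda>\<rho>. (f \<rho> - E Z f \<rho>)\<^sup>2) \<theta> = (\<Sum>\<rho>\<in>fib Z \<theta>. (f \<rho> - F \<theta>)\<^sup>2) / real (card (fib Z \<theta>))" for \<theta>
    unfolding E_def[of Z "\<lambda>\<rho>. (f \<rho> - E Z f \<rho>)\<^sup>2"] F_def using E_fib by (simp cong: sum.cong)
  have 1: "(m1 - F \<tau>)\<^sup>2 \<le> E Z (\<lambda>\<rho>. (f \<rho> - E Z f \<rho>)\<^sup>2) \<tau> / q"
    unfolding V m1_def by (rule sub_avg_le[OF _ CZ Cne q(1) q1]) simp
  have "m2 = (\<Sum>\<rho>\<in>merge J \<tau>' ` C. f \<rho>) / real (card (merge J \<tau>' ` C))"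
    unfolding m2_def using inj by (simp add: sum.reindex card_image)
  then have 2: "(m2 - F \<tau>')\<^sup>2 \<le> E Z (\<lambda>\<rho>. (f \<rho> - E Z f \<rho>)\<^sup>2) \<tau>' / q"
    unfolding V using sub_avg_le[OF _ into _ q(1), of "f" "F \<tau>'"] q2 Cne inj by (simp add: card_image)
  have "(m1 - m2)\<^sup>2 = ((\<Sum>\<rho>\<in>C. f \<rho> - f (merge J \<tau>' \<rho>)) / real (card C))\<^sup>2"
    by (simp add: m1_def m2_def sum_subtractf diff_divide_distrib)
  also have "\<dots> \<le> (\<Sum>\<rho>\<in>C. (f \<rho> - f (merge J \<tau>' \<rho>))\<^sup>2) / real (card C)" by (rule sq_avg_le[OF fC Cne])
  also have "\<dots> \<le> (\<Sum>\<rho>\<in>fib Z \<tau>. 2 * Sq J f \<rho>) / (q * real (card (fib Z \<tau>)))"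
  proof (rule frac_le)
    have "(\<Sum>\<rho>\<in>C. (f \<rho> - f (merge J \<tau>' \<rho>))\<^sup>2) \<le> (\<Sum>\<rho>\<in>C. 2 * Sq J f \<rho>)"
    proof (rule sum_mono)
      fix \<rho> assume r: "\<rho> \<in> C"
      have "merge J \<tau>' \<rho> \<in> fib J \<rho>" "\<rho> \<in> Om" using r by (auto simp: C_def compatible_def fib_def merge_def)
      then show "(f \<rho> - f (merge J \<tau>' \<rho>))\<^sup>2 \<le> 2 * Sq J f \<rho>" by (intro pair_diff_le_Sq)
    qed
    also have "\<dots> \<le> (\<Sum>\<rho>\<in>fib Z \<tau>. 2 * Sq J f \<rho>)" using CZ Sq_nonneg by (intro sum_mono2) auto
    finally show "(\<Sum>\<rho>\<in>C. (f \<rho> - f (merge J \<tau>' \<rho>))\<^sup>2) \<le> (\<Sum>\<rho>\<in>fib Z \<tau>. 2 * Sq J f \<rho>)" .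
    show "0 \<le> (\<Sum>\<rho>\<in>fib Z \<tau>. 2 * Sq J f \<rho>)" by (simp add: sum_nonneg Sq_nonneg)
    show "0 < q * real (card (fib Z \<tau>))" using q(1) card_fib_pos[OF t(1)] by simp
  qed (rule q1)
  also have "\<dots> = 2 / q * E Z (Sq J f) \<tau>" by (simp add: E_def sum_distrib_left[symmetric])
  finally have 3: "(m1 - m2)\<^sup>2 \<le> 2 / q * E Z (Sq J f) \<tau>" .
  have "(F \<tau> - F \<tau>')\<^sup>2 \<le> 3 * ((F \<tau> - m1)\<^sup>2 + (m1 - m2)\<^sup>2 + (m2 - F \<tau>')\<^sup>2)" by (rule sq_sum3)
  also have "\<dots> \<le> 3 * (E Z (\<lambda>\<rho>. (f \<rho> - E Z f \<rho>)\<^sup>2) \<tau> / q + 2 / q * E Z (Sq J f) \<tau> + E Z (\<lambda>\<rho>. (f \<rho> - E Z f \<rho>)\<^sup>2) \<tau>' / q)"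
    using 1 2 3 by (simp add: power2_commute)
  also have "\<dots> = 3 / q * (E Z (\<lambda>\<rho>. (f \<rho> - E Z f \<rho>)\<^sup>2) \<tau> + E Z (\<lambda>\<rho>. (f \<rho> - E Z f \<rho>)\<^sup>2) \<tau>') + 6 / q * E Z (Sq J f) \<tau>"
    by (simp add: algebra_simps add_divide_distrib)
  finally show ?thesis by (simp add: F_def Z_def)
qed

text \<open>The means over the smaller fibres are compared for all pairs in the fibre of
  \<open>X\<close> by \<open>pair_bound\<close> with \<open>J = K\<close>. The factor
  \<open>k ^ card K\<close> bounds the size of a fibre of \<open>K\<close>, by which
  \<open>Sq\<close> exceeds a variance.\<close>

lemma elimination:
  assumes KX: "K \<subseteq> X" "X \<subseteq> V" and q: "0 < q" "q \<le> 1"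
    and C: "\<And>\<tau> \<tau>'. \<tau> \<in> Om \<Longrightarrow> \<tau>' \<in> fib X \<tau> \<Longrightarrow> q * real (card (fib (X - K) \<tau>)) \<le> real (card (compatible (X - K) K \<tau>' \<tau>))"
  shows "EV X f \<le> 7 * real (k ^ card K) / q * (EV (X - K) f + EV K f)"
proof -
  define Z where "Z = X - K"
  define F where "F = E Z f"
  define W where "W = E Z (\<lambda>\<rho>. (f \<rho> - E Z f \<rho>)\<^sup>2)"
  have fK: "finite K" by (rule finite_subset[OF subset_trans[OF KX] finV])
  have ZX: "Z \<subseteq> X" by (auto simp: Z_def)
  have pt: "(F \<tau> - E X f \<tau>)\<^sup>2 \<le> 3 / q * W \<tau> + 3 / q * E X W \<tau> + 6 / q * E Z (Sq K f) \<tau>" if t: "\<tau> \<in> Om" for \<tau>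
  proof -
    have ne: "fib X \<tau> \<noteq> {}" using fib_ne[OF t] .
    have c: "0 < real (card (fib X \<tau>))" using card_fib_pos[OF t] .
    have "F \<tau> - E X f \<tau> = F \<tau> - E X F \<tau>" unfolding F_def using E_tower[OF ZX t] by simp
    also have "\<dots> = (\<Sum>\<tau>'\<in>fib X \<tau>. F \<tau> - F \<tau>') / real (card (fib X \<tau>))"
      using ne by (simp add: E_def[of X] sum_subtractf diff_divide_distrib)
    finally have "(F \<tau> - E X f \<tau>)\<^sup>2 \<le> (\<Sum>\<tau>'\<in>fib X \<tau>. (F \<tau> - F \<tau>')\<^sup>2) / real (card (fib X \<tau>))"
      using sq_avg_le[OF _ ne, of "\<lambda>\<tau>'. F \<tau> - F \<tau>'"] by simp
    also have "\<dots> \<le> (\<Sum>\<tau>'\<in>fib X \<tau>. 3 / q * W \<tau> + 3 / q * W \<tau>' + 6 / q * E Z (Sq K f) \<tau>) / real (card (fib X \<tau>))"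
    proof (intro divide_right_mono sum_mono)
      fix \<tau>' assume t': "\<tau>' \<in> fib X \<tau>"
      have "(F \<tau> - F \<tau>')\<^sup>2 \<le> 3 / q * (W \<tau> + W \<tau>') + 6 / q * E Z (Sq K f) \<tau>"
        unfolding F_def W_def Z_def
        by (rule pair_bound[OF order_refl KX(1) t t' _ q(1) C[OF t t'] C[OF fib_Om[OF t'] fib_sym[OF t t']]]) simp
      then show "(F \<tau> - F \<tau>')\<^sup>2 \<le> 3 / q * W \<tau> + 3 / q * W \<tau>' + 6 / q * E Z (Sq K f) \<tau>"
        by (simp add: distrib_left)
    qed simp
    also have "\<dots> = E X (\<lambda>\<tau>'. (3 / q * W \<tau> + 6 / q * E Z (Sq K f) \<tau>) + 3 / q * W \<tau>') \<tau>"
      unfolding E_def by (simp add: add_ac)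
    also have "\<dots> = 3 / q * W \<tau> + 3 / q * E X W \<tau> + 6 / q * E Z (Sq K f) \<tau>"
      by (subst E_affine[OF t]) simp
    finally show ?thesis .
  qed
  have sW: "(\<Sum>\<tau>\<in>Om. W \<tau>) = EV Z f" by (simp add: W_def sum_E EV_def)
  have "EV X f = EV Z f + (\<Sum>\<tau>\<in>Om. (F \<tau> - E X f \<tau>)\<^sup>2)" unfolding F_def by (rule EV_Pythagoras[OF ZX])
  also have "\<dots> \<le> EV Z f + (\<Sum>\<tau>\<in>Om. 3 / q * W \<tau> + 3 / q * E X W \<tau> + 6 / q * E Z (Sq K f) \<tau>)"
    by (intro add_left_mono sum_mono pt)
  also have "\<dots> = EV Z f + 6 / q * EV Z f + 6 / q * (\<Sum>\<tau>\<in>Om. Sq K f \<tau>)"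
    by (simp only: sum.distrib sum_distrib_left[symmetric] sum_E sW)
  also have "\<dots> \<le> EV Z f + 6 / q * EV Z f + 6 / q * (real (k ^ card K) * EV K f)"
    using q sum_Sq[OF fK, of f] KX by (intro add_left_mono mult_left_mono) auto
  also have "\<dots> \<le> 7 * real (k ^ card K) / q * (EV Z f + EV K f)"
  proof -
    have k1: "1 \<le> real (k ^ card K)" using a4 by (simp add: k_def)
    have "1 + 6 / q \<le> 7 * real (k ^ card K) / q"
    proof -
      have "1 + 6 / q \<le> 7 / q" using q by (simp add: field_simps)
      also have "\<dots> \<le> 7 * real (k ^ card K) / q" using k1 q by (intro divide_right_mono) auto
      finally show ?thesis .
    qed
    then have "(1 + 6 / q) * EV Z f \<le> 7 * real (k ^ card K) / q * EV Z f"
      by (intro mult_right_mono EV_nonneg)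
    moreover have "6 / q * real (k ^ card K) * EV K f \<le> 7 * real (k ^ card K) / q * EV K f"
      using q by (intro mult_right_mono EV_nonneg) (simp add: divide_right_mono)
    ultimately show ?thesis by (simp add: algebra_simps)
  qed
  finally show ?thesis by (simp add: Z_def)
qed

lemma card_fib_light:
  assumes "light u" "u \<in> V" "\<rho> \<in> Om"
  shows "a \<le> card (fib {u} \<rho>)"
proof -
  have "card (fib {u} \<rho>) = card (lcol {u} (free \<rho> {u}))"
    using bij_betw_same_card[OF fib_lcol[OF assms(3), of "{u}"]] assms by simp
  also have "\<dots> = card (free \<rho> {u} u)"
    using bij_betw_same_card[OF lcol_singleton[of u "free \<rho> {u}"]] by simp
  also have "a \<le> \<dots>" using card_free[of u "{u}" \<rho>] assms by simp
  finally show ?thesis .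
qed

text \<open>The vertices of \<open>U\<close> are treated one by one. The event for the others does
  not involve \<open>u\<close>, so it is a union of fibres of \<open>u\<close>, and resampling
  \<open>u\<close> among its at least \<open>a\<close> free colours avoids \<open>Bad u\<close> with
  probability at least 1 - card (Bad u) / a. This holds for every coloring of the rest, so adjacent
  vertices of \<open>U\<close> do no harm.\<close>

lemma flexible:
  assumes U: "finite U" "U \<subseteq> Z" "U \<subseteq> V" "\<And>u. u \<in> U \<Longrightarrow> light u"
    and influence_le: "\<And>u. u \<in> U \<Longrightarrow> finite (Bad u) \<and> 2 * card (Bad u) \<le> a" and t: "\<tau> \<in> Om"
  shows "exp (- (2 * (\<Sum>u\<in>U. real (card (Bad u))) / real a)) * real (card (fib Z \<tau>))
     \<le> real (card {\<rho> \<in> fib Z \<tau>. \<forall>u\<in>U. \<rho> u \<notin> Bad u})"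
  using U influence_le
proof (induction U rule: finite_induct)
  case empty
  then show ?case by simp
next
  case (insert u U)
  define S where "S = {\<rho> \<in> fib Z \<tau>. \<forall>u\<in>U. \<rho> u \<notin> Bad u}"
  define b where "b = card (Bad u)"
  define x where "x = real b / real a"
  have IH: "exp (- (2 * (\<Sum>u\<in>U. real (card (Bad u))) / real a)) * real (card (fib Z \<tau>)) \<le> real (card S)"
    unfolding S_def by (rule insert.IH) (use insert.prems in auto)
  have SO: "S \<subseteq> Om" by (auto simp: S_def fib_def)
  have fS: "finite S" by (simp add: S_def)
  have cluster: "fib {u} \<rho> \<subseteq> S" if "\<rho> \<in> S" for \<rho>
    using that insert by (fastforce simp: S_def fib_def)
  have E1: "1 - x \<le> E {u} (\<lambda>\<theta>. if \<theta> u \<notin> Bad u then 1 else 0) \<rho>" if r: "\<rho> \<in> S" for \<rho>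
  proof -
    define m where "m = card (fib {u} \<rho>)"
    have m: "a \<le> m" unfolding m_def using card_fib_light[of u \<rho>] insert.prems r SO by auto
    have "inj_on (\<lambda>\<theta>. \<theta> u) (fib {u} \<rho>)"
    proof (rule inj_onI)
      fix y z assume yz: "y \<in> fib {u} \<rho>" "z \<in> fib {u} \<rho>" "y u = z u"
      show "y = z" using fibD[OF yz(1)] fibD[OF yz(2)] yz(3) by (metis ext singletonD)
    qed
    then have "card {\<theta> \<in> fib {u} \<rho>. \<theta> u \<in> Bad u} \<le> b"
      unfolding b_def using insert.prems by (intro card_inj_on_le[of "\<lambda>\<theta>. \<theta> u"]) (auto simp: inj_on_def)
    moreover have "m = card {\<theta> \<in> fib {u} \<rho>. \<theta> u \<in> Bad u} + card {\<theta> \<in> fib {u} \<rho>. \<theta> u \<notin> Bad u}"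
      unfolding m_def by (subst card_Un_disjoint[symmetric]) (auto intro!: arg_cong[of _ _ card])
    ultimately have "real m - real b \<le> real (card {\<theta> \<in> fib {u} \<rho>. \<theta> u \<notin> Bad u})" by linarith
    moreover have "E {u} (\<lambda>\<theta>. if \<theta> u \<notin> Bad u then 1 else 0) \<rho> = real (card {\<theta> \<in> fib {u} \<rho>. \<theta> u \<notin> Bad u}) / real m"
      by (simp add: E_def m_def sum.inter_filter[symmetric])
    moreover have "1 - x \<le> (real m - real b) / real m"
    proof -
      have "real b / real m \<le> real b / real a" using m a4 by (intro divide_left_mono) auto
      then show ?thesis using m a4 by (simp add: x_def diff_divide_distrib)
    qed
    ultimately show ?thesis using m a4 by (smt (verit) divide_right_mono of_nat_0_le_iff)
  qed
  have "real (card {\<rho> \<in> S. \<rho> u \<notin> Bad u}) = (\<Sum>\<rho>\<in>S. if \<rho> u \<notin> Bad u then 1 else 0)"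
    using fS by (simp add: sum.inter_filter[symmetric])
  also have "\<dots> = (\<Sum>\<rho>\<in>S. E {u} (\<lambda>\<theta>. if \<theta> u \<notin> Bad u then 1 else 0) \<rho>)"
    by (rule sum_E_closed[OF SO cluster, symmetric])
  also have "\<dots> \<ge> (\<Sum>\<rho>\<in>S. 1 - x)" by (intro sum_mono E1)
  finally have "(1 - x) * real (card S) \<le> real (card {\<rho> \<in> S. \<rho> u \<notin> Bad u})" by (simp add: mult.commute)
  moreover have "exp (- (2 * x)) * real (card S) \<le> (1 - x) * real (card S)"
  proof -
    have x: "0 \<le> x" "2 * x \<le> 1"
      using insert.prems(4)[of u] a4 by (auto simp: x_def b_def field_simps simp flip: of_nat_mult)
    have "1 \<le> (1 - x) * (1 + 2 * x)" using x mult_nonneg_nonneg[of x "1 - 2 * x"] by (simp add: algebra_simps)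
    also have "\<dots> \<le> (1 - x) * exp (2 * x)" using x by (intro mult_left_mono) auto
    finally have "exp (- (2 * x)) \<le> 1 - x" by (simp add: exp_minus field_simps)
    then show ?thesis by (intro mult_right_mono) auto
  qed
  moreover have "exp (- (2 * x)) * (exp (- (2 * (\<Sum>u\<in>U. real (card (Bad u))) / real a)) * real (card (fib Z \<tau>)))
     \<le> exp (- (2 * x)) * real (card S)" using IH by (intro mult_left_mono) auto
  moreover have "exp (- (2 * (\<Sum>u\<in>insert u U. real (card (Bad u))) / real a))
     = exp (- (2 * x)) * exp (- (2 * (\<Sum>u\<in>U. real (card (Bad u))) / real a))"
    using insert.hyps by (simp add: x_def b_def exp_add[symmetric] add_divide_distrib distrib_left)
  ultimately have "exp (- (2 * (\<Sum>u\<in>insert u U. real (card (Bad u))) / real a)) * real (card (fib Z \<tau>))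
     \<le> real (card {\<rho> \<in> S. \<rho> u \<notin> Bad u})" by (simp only: mult.assoc)
  moreover have "{\<rho> \<in> S. \<rho> u \<notin> Bad u} = {\<rho> \<in> fib Z \<tau>. \<forall>u\<in>insert u U. \<rho> u \<notin> Bad u}" by (auto simp: S_def)
  ultimately show ?case by (simp only:)
qed

definition compat_bound :: "'a set \<Rightarrow> real" where
  "compat_bound J = exp (- (2 * (\<Sum>h\<in>J. real (card (Nb h))) / real a))"

text \<open>Recolouring \<open>J\<close> conflicts only with neighbours in \<open>Z\<close> that
  carry a forbidden colour. Each edge at \<open>J\<close> forbids at most one colour at its other
  end, so the exponents of \<open>flexible\<close> add up to at most the degrees in
  \<open>compat_bound\<close>.\<close>

lemma compatible_fraction:
  assumes Z: "Z \<inter> J = {}" "Z \<subseteq> V" "J \<subseteq> V"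
    and light: "\<And>u h. u \<in> Z \<Longrightarrow> h \<in> J \<Longrightarrow> adj u h \<Longrightarrow> light u"
    and few: "\<And>u. u \<in> Z \<Longrightarrow> 2 * card (Nb u \<inter> J) \<le> a"
    and t: "\<tau> \<in> Om" and kap: "\<And>v. v \<in> J \<Longrightarrow> \<kappa> v < k"
    and ok: "\<And>u v. u \<in> J \<Longrightarrow> v \<in> J \<Longrightarrow> adj u v \<Longrightarrow> \<kappa> u \<noteq> \<kappa> v"
      "\<And>u v. u \<in> J \<Longrightarrow> v \<notin> J \<union> Z \<Longrightarrow> adj u v \<Longrightarrow> \<kappa> u \<noteq> \<tau> v"
  shows "compat_bound J * real (card (fib Z \<tau>)) \<le> real (card (compatible Z J \<kappa> \<tau>))"
proof -
  define U where "U = {u \<in> Z. \<exists>h\<in>J. adj u h}"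
  define Bad where "Bad u = \<kappa> ` (Nb u \<inter> J)" for u
  have fZ: "finite Z" and fJ: "finite J" using Z finV finite_subset by blast+
  have fU: "finite U" using fZ by (simp add: U_def)
  have cB: "card (Bad u) \<le> card (Nb u \<inter> J)" for u unfolding Bad_def by (intro card_image_le) simp
  have "(\<Sum>u\<in>U. card (Nb u \<inter> J)) \<le> (\<Sum>h\<in>J. card (Nb h))"
  proof -
    have "(\<Sum>u\<in>U. card (Nb u \<inter> J)) = card (SIGMA u:U. Nb u \<inter> J)" using fU by simp
    also have "\<dots> \<le> card (SIGMA h:J. Nb h)"
    proof (rule card_inj_on_le[of prod.swap])
      show "prod.swap ` (SIGMA u:U. Nb u \<inter> J) \<subseteq> (SIGMA h:J. Nb h)" using adj_sym by (auto simp: in_Nb)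
    qed (use fJ in auto)
    finally show ?thesis using fJ by simp
  qed
  moreover have "(\<Sum>u\<in>U. card (Bad u)) \<le> (\<Sum>u\<in>U. card (Nb u \<inter> J))" by (intro sum_mono cB)
  ultimately have "(\<Sum>u\<in>U. card (Bad u)) \<le> (\<Sum>h\<in>J. card (Nb h))" by linarith
  then have "(\<Sum>u\<in>U. real (card (Bad u))) \<le> (\<Sum>h\<in>J. real (card (Nb h)))"
    by (metis of_nat_le_iff of_nat_sum)
  then have "compat_bound J \<le> exp (- (2 * (\<Sum>u\<in>U. real (card (Bad u))) / real a))"
    unfolding compat_bound_def by (simp add: divide_right_mono)
  then have "compat_bound J * real (card (fib Z \<tau>)) \<le> exp (- (2 * (\<Sum>u\<in>U. real (card (Bad u))) / real a)) * real (card (fib Z \<tau>))"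
    by (intro mult_right_mono) auto
  also have "\<dots> \<le> real (card {\<rho> \<in> fib Z \<tau>. \<forall>u\<in>U. \<rho> u \<notin> Bad u})"
  proof (rule flexible[OF fU _ _ _ _ t])
    show "U \<subseteq> Z" "U \<subseteq> V" using Z by (auto simp: U_def)
    show "light u" if "u \<in> U" for u using that light by (auto simp: U_def)
    show "finite (Bad u) \<and> 2 * card (Bad u) \<le> a" if "u \<in> U" for u
      using few[of u] cB[of u] that by (auto simp: Bad_def U_def)
  qed
  also have "{\<rho> \<in> fib Z \<tau>. \<forall>u\<in>U. \<rho> u \<notin> Bad u} \<subseteq> compatible Z J \<kappa> \<tau>"
  proof
    fix \<rho> assume "\<rho> \<in> {\<rho> \<in> fib Z \<tau>. \<forall>u\<in>U. \<rho> u \<notin> Bad u}"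
    then have r: "\<rho> \<in> fib Z \<tau>" "\<And>u. u \<in> U \<Longrightarrow> \<rho> u \<notin> Bad u" by auto
    have d: "\<kappa> u \<noteq> \<rho> v" if uv: "u \<in> J" "v \<notin> J" "adj u v" for u v
    proof (cases "v \<in> Z")
      case True
      then have "v \<in> U" using uv adj_sym by (auto simp: U_def)
      then have "\<rho> v \<notin> Bad v" by (rule r(2))
      then show ?thesis using uv adj_sym by (force simp: Bad_def in_Nb)
    next
      case False
      then show ?thesis using ok(2)[of u v] uv fibD[OF r(1)] by auto
    qed
    have rO: "\<rho> \<in> Om" using r fib_Om by blast
    have "merge J \<kappa> \<rho> \<in> Om"
    proof (rule OmI)
      show "merge J \<kappa> \<rho> v < k" if "v \<in> V" for v using that kap Om_col[OF rO] by (simp add: merge_def)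
      show "merge J \<kappa> \<rho> v = 0" if "v \<notin> V" for v using that Z Om_out[OF rO] by (auto simp: merge_def)
      show "merge J \<kappa> \<rho> u \<noteq> merge J \<kappa> \<rho> v" if e: "adj u v" for u v
        using d[of u v] d[of v u] ok(1)[of u v] Om_adj[OF rO e] e adj_sym[OF e]
        unfolding merge_def by (auto split: if_splits)
    qed
    then show "\<rho> \<in> compatible Z J \<kappa> \<tau>" using r by (simp add: compatible_def)
  qed
  then have "card {\<rho> \<in> fib Z \<tau>. \<forall>u\<in>U. \<rho> u \<notin> Bad u} \<le> card (compatible Z J \<kappa> \<tau>)"
    by (intro card_mono) (auto simp: compatible_def)
  finally show ?thesis by simp
qed

lemma compat_bound_pos: "0 < compat_bound J" by (simp add: compat_bound_def)

lemma compat_bound_le1: "compat_bound J \<le> 1" by (simp add: compat_bound_def sum_nonneg)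

end

section \<open>Few cycles near big clusters, and elimination cluster by cluster\<close>

context light_graph
begin

lemma big_cluster_ex:
  assumes v: "v \<in> V" "\<not> light v"
  shows "finite (cluster v)" "cluster v \<subseteq> V" "sum ll (cluster v) = 0" "0 \<le> sum gg (cluster v)" "excess (cluster v) \<le> 0" "-2 \<le> excess (cluster v)"
proof -
  show V: "cluster v \<subseteq> V" using cluster_V v by blast
  then show f: "finite (cluster v)" using finV finite_subset by blast
  show l: "sum ll (cluster v) = 0" using cluster_big_sub v by (intro sum.neutral) (auto simp: ll_eq)
  show g: "0 \<le> sum gg (cluster v)" by (simp add: sum_nonneg gg_nonneg)
  show "excess (cluster v) \<le> 0" using few_cycles[OF V conn_cl] l g by simp
  show "-2 \<le> excess (cluster v)" using excess_ge[OF conn_cl f] .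
qed

text \<open>A third edge would raise the excess of the cluster together with \<open>u\<close> to at
  least 2. With two edges at most, \<open>a \<ge> 4\<close> suffices for the condition on bad
  colours in \<open>flexible\<close>.\<close>

lemma few_edges_to_cluster:
  assumes v: "v \<in> V" and u: "u \<in> V" "u \<notin> cluster v"
  shows "2 * card (Nb u \<inter> cluster v) \<le> a"
proof (cases "light v")
  case True
  have "card (Nb u \<inter> {v}) \<le> card {v}" by (intro card_mono) auto
  then show ?thesis using True a4 by simp
next
  case False
  note b = big_cluster_ex[OF v False]
  have "card (Nb u \<inter> cluster v) \<le> 2"
  proof (rule ccontr)
    assume n: "\<not> card (Nb u \<inter> cluster v) \<le> 2"
    then have "Nb u \<inter> cluster v \<noteq> {}" by auto
    then obtain h where "h \<in> cluster v" "adj u h" by (auto simp: Nb_def)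
    then have c: "conn (insert u (cluster v))" using conn_insert[OF conn_cl, of h v u] adj_sym by blast
    have "ll u \<le> 1" by (simp add: ll_eq)
    then have "-10 \<le> 4 * sum gg (insert u (cluster v)) - sum ll (insert u (cluster v))"
      using b u gg_nonneg[of u] by simp
    moreover have "insert u (cluster v) \<subseteq> V" using b(2) u(1) by simp
    ultimately have "excess (insert u (cluster v)) \<le> 0" using few_cycles[OF _ c] by blast
    then show False using excess_insert[OF b(1) u(2)] b(6) n by simp
  qed
  then show ?thesis using a4 by linarith
qed

text \<open>The factor of \<open>elimination\<close> spread over the vertices of a block, so that
  eliminating a whole component costs a product over its vertices.\<close>

definition vertex_cost :: "'a \<Rightarrow> real" where
  "vertex_cost h = 7 * real k * exp (2 * real (card (Nb h)) / real a)"

lemma vertex_cost_ge1: "1 \<le> vertex_cost h"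
proof -
  have "1 \<le> real k" "1 \<le> exp (2 * real (card (Nb h)) / real a)" using a4 by (auto simp: k_def)
  then have "1 * 1 \<le> (7 * real k) * exp (2 * real (card (Nb h)) / real a)" by (intro mult_mono) auto
  then show ?thesis by (simp add: vertex_cost_def)
qed

lemma prod_cv_ge1: "1 \<le> (\<Prod>h\<in>W. vertex_cost h)"
  by (rule prod_ge_1) (rule vertex_cost_ge1)

lemma prod_cv_mono: "finite W \<Longrightarrow> W' \<subseteq> W \<Longrightarrow> (\<Prod>h\<in>W'. vertex_cost h) \<le> (\<Prod>h\<in>W. vertex_cost h)"
proof -
  assume W: "finite W" "W' \<subseteq> W"
  have "(\<Prod>h\<in>W'. vertex_cost h) * 1 \<le> (\<Prod>h\<in>W'. vertex_cost h) * (\<Prod>h\<in>W - W'. vertex_cost h)"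
    using prod_cv_ge1[of W'] by (intro mult_left_mono prod_cv_ge1) linarith
  also have "\<dots> = (\<Prod>h\<in>W. vertex_cost h)" using W by (metis mult.commute prod.subset_diff)
  finally show ?thesis by simp
qed

lemma cost_le_prod:
  assumes "finite J" "J \<noteq> {}"
  shows "7 * real (k ^ card J) / compat_bound J \<le> (\<Prod>h\<in>J. vertex_cost h)"
proof -
  have e: "(\<Prod>h\<in>J. exp (2 * real (card (Nb h)) / real a)) = 1 / compat_bound J"
    using assms by (simp add: compat_bound_def exp_sum[symmetric] exp_minus inverse_eq_divide sum_distrib_left sum_divide_distrib)
  have "(7::real) \<le> 7 ^ card J"
    using self_le_power[of "7::real" "card J"] assms by (simp add: card_gt_0_iff)
  then have "7 * real (k ^ card J) / compat_bound J \<le> 7 ^ card J * real (k ^ card J) / compat_bound J"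
    using compat_bound_pos[of J] by (intro divide_right_mono mult_right_mono) auto
  also have "\<dots> = (\<Prod>h\<in>J. vertex_cost h)"
    unfolding vertex_cost_def prod.distrib e by (simp add: power_mult_distrib)
  finally show ?thesis .
qed

text \<open>Big clusters go before light vertices: then every neighbour of the removed block is
  light, as \<open>compatible_fraction\<close> requires. Once no big vertex is left, light vertices
  follow singly.\<close>

lemma unit_elimination:
  assumes X: "X \<subseteq> V" "closed X" and v: "v \<in> X" and ok: "\<not> light v \<or> (\<forall>u\<in>X. light u)"
  shows "EV X f \<le> (\<Prod>h\<in>cluster v. vertex_cost h) * (EV (X - cluster v) f + EV (cluster v) f)"
proof -
  have KX: "cluster v \<subseteq> X" using X v by (auto simp: closed_def)
  have fK: "finite (cluster v)" by (rule finite_subset[OF subset_trans[OF KX X(1)] finV])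
  have "EV X f \<le> 7 * real (k ^ card (cluster v)) / compat_bound (cluster v) * (EV (X - cluster v) f + EV (cluster v) f)"
  proof (rule elimination[OF KX X(1) compat_bound_pos compat_bound_le1])
    fix \<tau> \<tau>' assume t: "\<tau> \<in> Om" "\<tau>' \<in> fib X \<tau>"
    have t': "\<tau>' \<in> Om" using t fib_Om by blast
    show "compat_bound (cluster v) * real (card (fib (X - cluster v) \<tau>)) \<le> real (card (compatible (X - cluster v) (cluster v) \<tau>' \<tau>))"
    proof (rule compatible_fraction[OF _ _ _ _ _ t(1)])
      show "light u" if u: "u \<in> X - cluster v" "h \<in> cluster v" "adj u h" for u h
      proof (rule ccontr)
        assume nl: "\<not> light u"
        then have "\<not> light v" using ok u by auto
        then have "\<not> light h" using cluster_big_sub u by blast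
        then have "cluster u = cluster v" using cluster_adj[OF u(3) nl] cluster_eq[OF u(2)] by simp
        then show False using u(1) self_cl by blast
      qed
      show "2 * card (Nb u \<inter> cluster v) \<le> a" if "u \<in> X - cluster v" for u
        using few_edges_to_cluster[of v u] that v X by blast
      show "\<tau>' u < k" if "u \<in> cluster v" for u using Om_col[OF t'] that KX X by blast
      show "\<tau>' u \<noteq> \<tau>' w" if "adj u w" for u w using Om_adj[OF t' that] .
      show "\<tau>' u \<noteq> \<tau> w" if "w \<notin> cluster v \<union> (X - cluster v)" "adj u w" for u w
        using Om_adj[OF t' that(2)] fibD[OF t(2), of w] that(1) KX by auto
    qed (use KX X in auto)
  qed
  also have "\<dots> \<le> (\<Prod>h\<in>cluster v. vertex_cost h) * (EV (X - cluster v) f + EV (cluster v) f)"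
    using self_cl by (intro mult_right_mono cost_le_prod[OF fK] add_nonneg_nonneg EV_nonneg) blast
  finally show ?thesis .
qed

lemma EV_empty: "EV {} f = 0"
proof -
  have "fib {} \<sigma> = {\<sigma>}" if "\<sigma> \<in> Om" for \<sigma> using that by (auto simp: fib_def)
  then show ?thesis by (simp add: EV_def E_def)
qed

text \<open>Eliminating a cluster from a connected set multiplies the constant by the share of that
  cluster, and for a disconnected set the variance tensorises over the parts. Hence only products
  over connected sets enter, never over all of \<open>X\<close>.\<close>

lemma unit_Poincare:
  assumes "X \<subseteq> V" "closed X" "1 \<le> T"
    and "\<And>W. W \<subseteq> X \<Longrightarrow> conn W \<Longrightarrow> closed W \<Longrightarrow> (\<Prod>h\<in>W. vertex_cost h) \<le> T"
  shows "EV X f \<le> T * (\<Sum>J\<in>cluster ` X. EV J f)"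
  using assms
proof (induction "card X" arbitrary: X T rule: less_induct)
  case less
  have fX: "finite X" by (rule finite_subset[OF less.prems(1) finV])
  consider "X = {}" | "conn X" | "X \<noteq> {}" "\<not> conn X" by blast
  then show ?case
  proof cases
    case 1
    then show ?thesis by (simp add: EV_empty)
  next
    case 2
    obtain v where v: "v \<in> X" "\<not> light v \<or> (\<forall>u\<in>X. light u)" using conn_ne[OF 2] by blast
    define J where "J = cluster v"
    have JX: "J \<subseteq> X" "v \<in> J" using less.prems v self_cl by (auto simp: J_def closed_def)
    define G where "G = (\<Prod>h\<in>J. vertex_cost h)"
    define T' where "T' = (\<Prod>h\<in>X - J. vertex_cost h)"
    have G1: "1 \<le> G" and T1: "1 \<le> T'" unfolding G_def T'_def by (rule prod_cv_ge1)+
    have GT: "G * T' \<le> T"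
    proof -
      have "G * T' = (\<Prod>h\<in>X. vertex_cost h)" unfolding G_def T'_def using prod.subset_diff[OF JX(1) fX, of vertex_cost] by simp
      then show ?thesis using less.prems(4)[OF order_refl 2 less.prems(2)] by simp
    qed
    have smaller: "card (X - J) < card X" using fX JX by (intro psubset_card_mono) auto
    have IH: "EV (X - J) f \<le> T' * (\<Sum>J\<in>cluster ` (X - J). EV J f)"
    proof (rule less.hyps[OF smaller])
      show "closed (X - J)" unfolding J_def using closed_Diff less.prems(2) by blast
      show "(\<Prod>h\<in>W. vertex_cost h) \<le> T'" if "W \<subseteq> X - J" for W
        unfolding T'_def using fX that by (intro prod_cv_mono) auto
    qed (use less.prems T1 in auto)
    have Jn: "J \<notin> cluster ` (X - J)"
    proof
      assume "J \<in> cluster ` (X - J)"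
      then obtain u where "u \<in> X - J" "cluster u = J" by auto
      then show False using self_cl by blast
    qed
    have clX: "cluster ` X = insert J (cluster ` (X - J))"
    proof -
      have c: "cluster u = J" if "u \<in> J" for u using that cluster_eq unfolding J_def by blast
      have "cluster ` X = cluster ` (J \<union> (X - J))" using JX(1) by (simp add: Un_absorb1)
      also have "\<dots> = cluster ` J \<union> cluster ` (X - J)" by (rule image_Un)
      also have "cluster ` J = {J}" using c JX(2) by force
      finally show ?thesis by simp
    qed
    define S where "S = (\<Sum>J\<in>cluster ` (X - J). EV J f)"
    have S0: "0 \<le> S" "0 \<le> EV J f" by (simp_all add: S_def sum_nonneg EV_nonneg)
    have "EV X f \<le> G * (EV (X - J) f + EV J f)"
      unfolding G_def J_def using unit_elimination[OF less.prems(1,2) v] .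
    also have "\<dots> \<le> G * (T' * S + T' * EV J f)"
      using IH G1 T1 S0 mult_right_mono[OF T1 S0(2)] by (intro mult_left_mono add_mono) (auto simp: S_def)
    also have "\<dots> = (G * T') * (S + EV J f)" by (simp add: algebra_simps)
    also have "\<dots> \<le> T * (S + EV J f)" using GT S0 by (intro mult_right_mono) auto
    also have "S + EV J f = (\<Sum>J\<in>cluster ` X. EV J f)" unfolding clX using Jn fX by (simp add: S_def)
    finally show ?thesis .
  next
    case 3
    then obtain P where P: "P \<subset> X" "P \<noteq> {}" "\<And>x y. x \<in> P \<Longrightarrow> y \<in> X - P \<Longrightarrow> \<not> adj x y"
      unfolding conn_def by blast
    have side: "cluster v \<subseteq> P \<or> cluster v \<inter> P = {}" if v: "v \<in> X" for v
    proof (rule ccontr)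
      assume n: "\<not> ?thesis"
      have "cluster v \<subseteq> X" using less.prems(2) v by (simp add: closed_def)
      moreover obtain x y where "x \<in> cluster v \<inter> P" "y \<in> cluster v" "y \<notin> cluster v \<inter> P" "adj x y"
        using conn_edge[OF conn_cl[of v], of "cluster v \<inter> P"] n by blast
      ultimately show False using P(3)[of x y] by blast
    qed
    have c1: "closed P" unfolding closed_def using side P(1) self_cl by blast
    have c2: "closed (X - P)" unfolding closed_def using side self_cl less.prems(2) by (fastforce simp: closed_def)
    have s1: "card P < card X" "card (X - P) < card X" using fX P(1,2) by (auto intro!: psubset_card_mono)
    have I1: "EV P f \<le> T * (\<Sum>J\<in>cluster ` P. EV J f)"
      by (rule less.hyps[OF s1(1)]) (use less.prems P c1 in auto)
    have I2: "EV (X - P) f \<le> T * (\<Sum>J\<in>cluster ` (X - P). EV J f)"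
    proof (rule less.hyps[OF s1(2) _ c2 less.prems(3)])
      show "X - P \<subseteq> V" using less.prems(1) by blast
      show "(\<Prod>h\<in>W. vertex_cost h) \<le> T" if "W \<subseteq> X - P" "conn W" "closed W" for W
        by (rule less.prems(4)) (use that in auto)
    qed
    have "cluster ` P \<inter> cluster ` (X - P) = {}"
    proof (rule ccontr)
      assume "cluster ` P \<inter> cluster ` (X - P) \<noteq> {}"
      then obtain x y where "x \<in> P" "y \<in> X - P" "cluster x = cluster y" by auto
      then show False using c1 self_cl[of y] by (auto simp: closed_def)
    qed
    moreover have "cluster ` X = cluster ` P \<union> cluster ` (X - P)" using P(1) by blast
    moreover have "finite P" "finite (X - P)" using fX P(1) finite_subset by auto
    ultimately have sm: "(\<Sum>J\<in>cluster ` X. EV J f) = (\<Sum>J\<in>cluster ` P. EV J f) + (\<Sum>J\<in>cluster ` (X - P). EV J f)"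
      by (simp add: sum.union_disjoint)
    have "X = P \<union> (X - P)" using P(1) by blast
    then have "EV X f \<le> EV P f + EV (X - P) f"
      using EV_tensor_adj[of P "X - P" f] P(3) by auto
    then show ?thesis using I1 I2 sm by (simp add: distrib_left)
  qed
qed

lemma conn_sub_card:
  assumes "conn W" "finite W" "1 \<le> m" "m \<le> card W"
  shows "\<exists>P\<subseteq>W. conn P \<and> card P = m"
  using assms(3,4)
proof (induction m rule: nat_induct_at_least)
  case base
  obtain x where "x \<in> W" using conn_ne[OF assms(1)] by blast
  then show ?case by (intro exI[of _ "{x}"]) auto
next
  case (Suc m)
  then obtain P where P: "P \<subseteq> W" "conn P" "card P = m" by auto
  have "P \<noteq> W" using P Suc by auto
  then obtain x y where xy: "x \<in> P" "y \<in> W" "y \<notin> P" "adj x y"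
    using conn_edge[OF assms(1) P(1) conn_ne[OF P(2)]] by metis
  have "finite P" using P assms(2) finite_subset by blast
  then have "card (insert y P) = Suc m" using xy P by simp
  then show ?case using P xy conn_insert[OF P(2) xy(1,4)] by (intro exI[of _ "insert y P"]) auto
qed

text \<open>Three connected neighbours of the cluster, each attached by its own edge, would raise
  the excess of the union to at least -2 - 2 + 6.\<close>

lemma cluster_nbrs_small:
  assumes v: "v \<in> V" "\<not> light v" and W: "conn W" "W \<subseteq> V - cluster v" "\<And>u. u \<in> W \<Longrightarrow> \<exists>h\<in>cluster v. adj u h"
  shows "card W \<le> 2"
proof (rule ccontr)
  assume n: "\<not> card W \<le> 2"
  note b = big_cluster_ex[OF v]
  have fW: "finite W" by (rule finite_subset[OF W(2)]) (simp add: finV)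
  obtain P where P: "P \<subseteq> W" "conn P" "card P = 3" using conn_sub_card[OF W(1) fW, of 3] n by auto
  have fP: "finite P" by (rule finite_subset[OF P(1) fW])
  define e where "e u = (SOME h. h \<in> cluster v \<and> adj u h, u)" for u
  have e: "fst (e u) \<in> cluster v \<and> adj (fst (e u)) u \<and> snd (e u) = u" if "u \<in> P" for u
  proof -
    have "\<exists>h. h \<in> cluster v \<and> adj u h" using W(3) P that by blast
    from someI_ex[OF this] show ?thesis using adj_sym by (auto simp: e_def)
  qed
  have "excess (cluster v \<union> P) \<ge> excess (cluster v) + excess P + 2 * int (card P)"
    by (rule excess_connect[OF conn_cl b(1) fP _ _ P(2) fP, of e])
       (use e W P conn_ne[OF P(2)] in \<open>auto simp: inj_on_def e_def\<close>)
  then have x: "excess (cluster v \<union> P) > 0" using b(6) excess_ge[OF P(2) fP] P(3) by simp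
  obtain u where u: "u \<in> P" using conn_ne[OF P(2)] by blast
  have c: "conn (cluster v \<union> P)"
    by (rule conn_Un_edge[OF conn_cl P(2), of "fst (e u)" v u]) (use e[OF u] u in auto)
  have "sum ll P \<le> (\<Sum>x\<in>P. 1)" by (intro sum_mono) (simp add: ll_eq)
  then have "sum ll P \<le> 3" using P by simp
  moreover have "sum ll (cluster v \<union> P) = sum ll (cluster v) + sum ll P"
    using b(1) fP W P by (intro sum.union_disjoint) auto
  moreover have "0 \<le> sum gg (cluster v \<union> P)" by (simp add: sum_nonneg gg_nonneg)
  ultimately have "-10 \<le> 4 * sum gg (cluster v \<union> P) - sum ll (cluster v \<union> P)" using b(3) by simp
  then have "excess (cluster v \<union> P) \<le> 0" using few_cycles[OF _ c] b(2) W P by blast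
  then show False using x by simp
qed

text \<open>Vertices outside \<open>P\<close> are left out here; in the application the light
  neighbours of the cluster are adjusted before every move.\<close>

definition recoloring :: "'a set \<Rightarrow> (('a \<Rightarrow> nat) \<times> ('a \<Rightarrow> nat)) set" where
  "recoloring P = {(\<alpha>, \<beta>). \<alpha> \<in> lcol P (\<lambda>_. {..<k}) \<and> \<beta> \<in> lcol P (\<lambda>_. {..<k}) \<and> (\<exists>h\<in>P. \<forall>w. w \<noteq> h \<longrightarrow> \<alpha> w = \<beta> w)}"

text \<open>Induction over a vertex \<open>v\<close> with at most two neighbours. A move at
  \<open>h\<close> on the remaining vertices is lifted by first moving \<open>v\<close> to a colour
  that avoids its neighbours and the new colour of \<open>h\<close>; these are at most three
  colours, and there are at least four.\<close>

lemma recoloring_connected: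
  assumes "finite P" and deg: "\<And>P'. P' \<subseteq> P \<Longrightarrow> P' \<noteq> {} \<Longrightarrow> \<exists>v\<in>P'. card (Nb v \<inter> P') \<le> 2"
    and "\<alpha> \<in> lcol P (\<lambda>_. {..<k})" "\<beta> \<in> lcol P (\<lambda>_. {..<k})"
  shows "(\<alpha>, \<beta>) \<in> (recoloring P)\<^sup>*"
  using assms
proof (induction "card P" arbitrary: P \<alpha> \<beta>)
  case 0
  then have "P = {}" by simp
  then show ?case using 0 by (auto simp: lcol_def fun_eq_iff)
next
  case (Suc m)
  then have "P \<noteq> {}" by auto
  then obtain v where v: "v \<in> P" "card (Nb v \<inter> P) \<le> 2" using Suc.prems(2)[of P] by blast
  define Q where "Q = P - {v}"
  have rQ: "restr Q \<gamma> \<in> lcol Q (\<lambda>_. {..<k})" if "\<gamma> \<in> lcol P (\<lambda>_. {..<k})" for \<gamma>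
    using that by (auto simp: lcol_def restr_def Q_def)
  have IH: "(restr Q \<alpha>, restr Q \<beta>) \<in> (recoloring Q)\<^sup>*"
  proof (rule Suc.hyps(1))
    show "m = card Q" "finite Q" using Suc.hyps(2) Suc.prems(1) v(1) by (auto simp: Q_def)
    show "\<exists>v\<in>P'. card (Nb v \<inter> P') \<le> 2" if "P' \<subseteq> Q" "P' \<noteq> {}" for P'
      by (rule Suc.prems(2)) (use that in \<open>auto simp: Q_def\<close>)
    show "restr Q \<alpha> \<in> lcol Q (\<lambda>_. {..<k})" "restr Q \<beta> \<in> lcol Q (\<lambda>_. {..<k})"
      by (rule rQ, rule Suc.prems)+
  qed
  have lift: "\<exists>\<gamma>'. \<gamma>' \<in> lcol P (\<lambda>_. {..<k}) \<and> restr Q \<gamma>' = \<delta> \<and> (\<gamma>, \<gamma>') \<in> (recoloring P)\<^sup>*"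
    if "(\<delta>0, \<delta>) \<in> (recoloring Q)\<^sup>*" "\<gamma> \<in> lcol P (\<lambda>_. {..<k})" "restr Q \<gamma> = \<delta>0" for \<gamma> \<delta>0 \<delta>
    using that
  proof (induction rule: rtrancl_induct)
    case base
    then show ?case by blast
  next
    case (step \<delta>1 \<delta>2)
    then obtain \<gamma>1 where g1: "\<gamma>1 \<in> lcol P (\<lambda>_. {..<k})" "restr Q \<gamma>1 = \<delta>1" "(\<gamma>, \<gamma>1) \<in> (recoloring P)\<^sup>*" by blast
    obtain h where h: "h \<in> Q" "\<And>w. w \<noteq> h \<Longrightarrow> \<delta>1 w = \<delta>2 w" "\<delta>2 \<in> lcol Q (\<lambda>_. {..<k})"
      using step.hyps(2) by (auto simp: recoloring_def)
    have "card (insert (\<delta>2 h) (\<delta>1 ` (Nb v \<inter> P))) \<le> Suc (card (\<delta>1 ` (Nb v \<inter> P)))"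
      by (rule card_insert_le_m1) auto
    also have "card (\<delta>1 ` (Nb v \<inter> P)) \<le> 2" using v(2) card_image_le[of "Nb v \<inter> P" \<delta>1] by simp
    also have "Suc 2 < card {..<k}" using a4 by (simp add: k_def)
    finally have lt: "card (insert (\<delta>2 h) (\<delta>1 ` (Nb v \<inter> P))) < card {..<k}" by simp
    have "\<not> {..<k} \<subseteq> insert (\<delta>2 h) (\<delta>1 ` (Nb v \<inter> P))"
    proof
      assume "{..<k} \<subseteq> insert (\<delta>2 h) (\<delta>1 ` (Nb v \<inter> P))"
      then have "card {..<k} \<le> card (insert (\<delta>2 h) (\<delta>1 ` (Nb v \<inter> P)))" by (intro card_mono) auto
      then show False using lt by simp
    qed
    then obtain c where c: "c < k" "c \<noteq> \<delta>2 h" "c \<notin> \<delta>1 ` (Nb v \<inter> P)" by blast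
    define \<gamma>2 where "\<gamma>2 = \<gamma>1(v := c)"
    define \<gamma>3 where "\<gamma>3 = \<gamma>2(h := \<delta>2 h)"
    have d1: "\<gamma>1 w = \<delta>1 w" if "w \<in> Q" for w using g1(2) that by (metis restr_def)
    have hv: "h \<noteq> v" "h \<in> P" using h by (auto simp: Q_def)
    have e2: "\<gamma>2 \<in> lcol P (\<lambda>_. {..<k})"
    proof -
      have "c \<noteq> \<gamma>1 w" if "w \<in> P" "adj v w" for w
      proof -
        have "w \<in> Q" using that adj_irrefl by (auto simp: Q_def)
        moreover have "\<delta>1 w \<noteq> c" using c(3) that by (auto simp: in_Nb)
        ultimately show ?thesis using d1 by auto
      qed
      then show ?thesis using g1(1) c(1) v(1) adj_irrefl adj_commute
        unfolding lcol_def \<gamma>2_def by auto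
    qed
    have q3: "\<gamma>3 w = \<delta>2 w" if "w \<in> Q" for w
      using that h(2)[of w] d1[OF that] hv by (auto simp: \<gamma>3_def \<gamma>2_def Q_def)
    have e3: "\<gamma>3 \<in> lcol P (\<lambda>_. {..<k})"
    proof -
      have "\<gamma>3 u \<noteq> \<gamma>3 w" if uw: "u \<in> P" "w \<in> P" "adj u w" for u w
      proof -
        have nv: "\<gamma>3 v \<noteq> \<gamma>3 w" if "w \<in> P" "adj v w" for w
        proof (cases "w = h")
          case True
          then show ?thesis using c(2) hv by (simp add: \<gamma>3_def \<gamma>2_def)
        next
          case False
          then have "\<gamma>3 w = \<gamma>2 w" "\<gamma>3 v = \<gamma>2 v" using hv by (auto simp: \<gamma>3_def)
          then show ?thesis using e2 v(1) that by (simp add: lcol_def)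
        qed
        show ?thesis
        proof (cases "u = v \<or> w = v")
          case True
          then show ?thesis using nv[of w] nv[of u] uw adj_sym by metis
        next
          case False
          then have "u \<in> Q" "w \<in> Q" using uw by (auto simp: Q_def)
          then show ?thesis using q3 h(3) uw by (simp add: lcol_def)
        qed
      qed
      moreover have "\<delta>2 h < k" using h by (auto simp: lcol_def)
      ultimately show ?thesis using e2 hv unfolding lcol_def \<gamma>3_def by auto
    qed
    have s1: "(\<gamma>1, \<gamma>2) \<in> recoloring P" using g1(1) e2 v(1) unfolding recoloring_def \<gamma>2_def by auto
    have s2: "(\<gamma>2, \<gamma>3) \<in> recoloring P" using e2 e3 hv unfolding recoloring_def \<gamma>3_def by auto
    have "restr Q \<gamma>3 = \<delta>2" using q3 h(3) by (auto simp: restr_def lcol_def fun_eq_iff)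
    moreover have "(\<gamma>, \<gamma>3) \<in> (recoloring P)\<^sup>*"
      by (rule rtrancl_into_rtrancl[OF rtrancl_into_rtrancl[OF g1(3) s1] s2])
    ultimately show ?case using e3 by blast
  qed
  obtain \<gamma> where g: "\<gamma> \<in> lcol P (\<lambda>_. {..<k})" "restr Q \<gamma> = restr Q \<beta>" "(\<alpha>, \<gamma>) \<in> (recoloring P)\<^sup>*"
    using lift[OF IH Suc.prems(3) refl] by blast
  have "\<gamma> w = \<beta> w" if "w \<noteq> v" for w
  proof (cases "w \<in> P")
    case True
    then have "w \<in> Q" using that by (simp add: Q_def)
    then show ?thesis using fun_cong[OF g(2), of w] by (simp add: restr_def)
  next
    case False
    then show ?thesis using g(1) Suc.prems(4) by (simp add: lcol_def)
  qed
  then have "(\<gamma>, \<beta>) \<in> recoloring P" using g(1) Suc.prems(4) v(1) unfolding recoloring_def by auto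
  then show ?case using g(3) by (rule rtrancl_into_rtrancl[rotated])
qed

text \<open>If all degrees inside \<open>P\<close> were at least 3, its excess would be at least
  \<open>card P\<close>, but by monotonicity it is at most that of the cluster.\<close>

lemma cluster_degenerate:
  assumes v: "v \<in> V" "\<not> light v" and P: "P \<subseteq> cluster v" "P \<noteq> {}"
  shows "\<exists>u\<in>P. card (Nb u \<inter> P) \<le> 2"
proof (rule ccontr)
  assume n: "\<not> ?thesis"
  note b = big_cluster_ex[OF v]
  have fP: "finite P" by (rule finite_subset[OF P(1) b(1)])
  have "double_edges P = card (SIGMA u:P. Nb u \<inter> P)"
    unfolding double_edges_def by (rule arg_cong[of _ _ card]) (auto simp: in_Nb)
  also have "\<dots> = (\<Sum>u\<in>P. card (Nb u \<inter> P))" using fP by simp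
  also have "\<dots> \<ge> (\<Sum>u\<in>P. 3)" using n by (intro sum_mono) auto
  finally have "3 * card P \<le> double_edges P" by simp
  moreover have "0 < card P" using fP P by (simp add: card_gt_0_iff)
  ultimately have "0 < excess P" by (simp add: excess_def)
  moreover have "excess P \<le> excess (cluster v)" by (rule excess_mono[OF conn_cl b(1) P])
  ultimately show False using b(5) by simp
qed

end

section \<open>Poincare inequality for a big cluster with its light neighbours\<close>

context light_graph
begin

definition outer_nbrs :: "'a set \<Rightarrow> 'a set" where
  "outer_nbrs K = {u. u \<notin> K \<and> (\<exists>h\<in>K. adj u h)}"

lemma outer_nbrs_sub: "outer_nbrs K \<subseteq> V"
  by (auto simp: outer_nbrs_def adj_V)

lemma outer_nbrs_light:
  assumes "\<not> light v" "u \<in> outer_nbrs (cluster v)"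
  shows "light u"
proof (rule ccontr)
  assume nl: "\<not> light u"
  obtain h where h: "h \<in> cluster v" "adj u h" "u \<notin> cluster v" using assms by (auto simp: outer_nbrs_def)
  have "\<not> light h" using cluster_big_sub assms(1) h(1) by blast
  then have "cluster u = cluster v" using cluster_adj[OF h(2) nl] cluster_eq[OF h(1)] by simp
  then show False using h(3) self_cl by blast
qed

text \<open>The components of the light neighbourhood have at most two vertices, so the cost is that
  of two light vertices, whatever the degrees in the cluster.\<close>

lemma EV_nbrs:
  assumes v: "v \<in> V" "\<not> light v"
  shows "EV (outer_nbrs (cluster v)) f \<le> (7 * real k * exp (2 * real D / real a))\<^sup>2 * (\<Sum>u\<in>outer_nbrs (cluster v). EV {u} f)"
proof -
  define N where "N = outer_nbrs (cluster v)"
  define c where "c = 7 * real k * exp (2 * real D / real a)"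
  have lN: "light u" if "u \<in> N" for u using outer_nbrs_light[OF v(2)] that by (simp add: N_def)
  have cvc: "vertex_cost u \<le> c" if "u \<in> N" for u
    using light_deg[OF lN[OF that]] by (simp add: vertex_cost_def c_def mult_left_mono divide_right_mono)
  have c1: "1 \<le> c"
  proof -
    have "1 \<le> real k" "1 \<le> exp (2 * real D / real a)" using a4 by (auto simp: k_def)
    then have "1 * 1 \<le> (7 * real k) * exp (2 * real D / real a)" by (intro mult_mono) auto
    then show ?thesis by (simp add: c_def)
  qed
  have "EV N f \<le> c\<^sup>2 * (\<Sum>J\<in>cluster ` N. EV J f)"
  proof (rule unit_Poincare)
    show "N \<subseteq> V" using outer_nbrs_sub by (simp add: N_def)
    show "closed N" using lN by (simp add: closed_def)
    show "1 \<le> c\<^sup>2" using c1 by simp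
    fix W assume W: "W \<subseteq> N" "conn W"
    have "card W \<le> 2"
    proof (rule cluster_nbrs_small[OF v W(2)])
      show "W \<subseteq> V - cluster v" using W(1) outer_nbrs_sub by (auto simp: N_def outer_nbrs_def)
      show "\<exists>h\<in>cluster v. adj u h" if "u \<in> W" for u using that W(1) by (auto simp: N_def outer_nbrs_def)
    qed
    have "(\<Prod>h\<in>W. vertex_cost h) \<le> (\<Prod>h\<in>W. c)"
    proof (intro prod_mono conjI)
      fix h assume "h \<in> W"
      then show "vertex_cost h \<le> c" "0 \<le> vertex_cost h" using cvc W(1) vertex_cost_ge1[of h] by auto
    qed
    also have "\<dots> \<le> c\<^sup>2" using \<open>card W \<le> 2\<close> c1 by (simp add: power_increasing)
    finally show "(\<Prod>h\<in>W. vertex_cost h) \<le> c\<^sup>2" .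
  qed
  moreover have "(\<Sum>J\<in>cluster ` N. EV J f) = (\<Sum>u\<in>N. EV {u} f)"
  proof -
    have "(\<Sum>J\<in>cluster ` N. EV J f) = (\<Sum>u\<in>N. EV (cluster u) f)"
      by (subst sum.reindex) (use lN in \<open>auto simp: inj_on_def\<close>)
    then show ?thesis using lN by simp
  qed
  ultimately show ?thesis by (simp add: N_def c_def)
qed

lemma card_lcol_le:
  assumes "finite K"
  shows "card (lcol K (\<lambda>_. {..<k})) \<le> k ^ card K"
proof -
  have f: "finite (PiE K (\<lambda>_. {..<k}))" using assms by (intro finite_PiE) auto
  have "inj_on (\<lambda>f. restrict f K) (lcol K (\<lambda>_. {..<k}))"
  proof (rule inj_onI)
    fix x y assume xy: "x \<in> lcol K (\<lambda>_. {..<k})" "y \<in> lcol K (\<lambda>_. {..<k})" "restrict x K = restrict y K"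
    show "x = y"
    proof
      fix v show "x v = y v"
        using xy(1,2) fun_cong[OF xy(3), of v] by (cases "v \<in> K") (auto simp: lcol_def)
    qed
  qed
  moreover have "(\<lambda>f. restrict f K) ` lcol K (\<lambda>_. {..<k}) \<subseteq> PiE K (\<lambda>_. {..<k})"
    by (auto simp: lcol_def)
  ultimately have "card (lcol K (\<lambda>_. {..<k})) \<le> card (PiE K (\<lambda>_. {..<k}))"
    using f by (rule card_inj_on_le)
  then show ?thesis using assms by (simp add: card_PiE)
qed

text \<open>With its surroundings fixed, a big vertex may have no freedom at all, so single-site
  variances inside the cluster cannot control it. The light neighbours are therefore added to the
  block. Every one-vertex recolouring of the cluster is compatible with a fraction \<open>q\<close>
  of their colorings, and these moves connect all colorings of the cluster. So the mean
  \<open>F\<close> over the neighbours varies by at most the number of moves times the cost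
  \<open>R\<close> of one.\<close>

lemma EV_cluster:
  assumes v: "v \<in> V" "\<not> light v"
  defines "K \<equiv> cluster v"
  shows "EV K f \<le> 7 * real k ^ (5 * card K + 1) / (compat_bound K)\<^sup>2 * (7 * real k * exp (2 * real D / real a))\<^sup>2 *
     (\<Sum>u\<in>K \<union> outer_nbrs K. EV {u} f)"
proof -
  define N where "N = outer_nbrs K"
  define X where "X = K \<union> N"
  define q where "q = compat_bound K"
  define F where "F = E N f"
  note b = big_cluster_ex[OF v, folded K_def]
  have XK: "X - K = N" and KX: "K \<subseteq> X" and NX: "N \<subseteq> X" by (auto simp: X_def N_def outer_nbrs_def)
  have XV: "X \<subseteq> V" using b outer_nbrs_sub by (auto simp: X_def N_def)
  have q: "0 < q" "q \<le> 1" by (auto simp: q_def compat_bound_pos compat_bound_le1)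
  have k1: "1 \<le> real k" using a4 by (simp add: k_def)
  have NL: "light u" if "u \<in> N" for u using outer_nbrs_light[OF v(2)] that by (simp add: N_def K_def)
  have frac: "compat_bound J * real (card (fib N \<tau>)) \<le> real (card (compatible N J \<kappa> \<tau>))"
    if J: "J \<subseteq> K" and t: "\<tau> \<in> Om" and kap: "\<And>v. v \<in> K \<Longrightarrow> \<kappa> v < k"
      and ok: "\<And>u w. u \<in> J \<Longrightarrow> w \<in> J \<Longrightarrow> adj u w \<Longrightarrow> \<kappa> u \<noteq> \<kappa> w" "\<And>u w. u \<in> J \<Longrightarrow> w \<in> K - J \<Longrightarrow> adj u w \<Longrightarrow> \<kappa> u \<noteq> \<tau> w"
    for J \<tau> \<kappa>
  proof (rule compatible_fraction[OF _ _ _ _ _ t])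
    show "N \<inter> J = {}" using J by (auto simp: N_def outer_nbrs_def)
    show "N \<subseteq> V" "J \<subseteq> V" using outer_nbrs_sub J b by (auto simp: N_def)
    show "light u" if "u \<in> N" for u using NL that .
    show "2 * card (Nb u \<inter> J) \<le> a" if u: "u \<in> N" for u
    proof -
      have "card (Nb u \<inter> J) \<le> card (Nb u \<inter> K)" using J by (intro card_mono) auto
      moreover have "2 * card (Nb u \<inter> K) \<le> a" unfolding K_def
        by (rule few_edges_to_cluster[OF v(1)]) (use u outer_nbrs_sub in \<open>auto simp: N_def outer_nbrs_def K_def\<close>)
      ultimately show ?thesis by linarith
    qed
    show "\<kappa> v < k" if "v \<in> J" for v using kap J that by blast
    show "\<kappa> u \<noteq> \<kappa> w" if "u \<in> J" "w \<in> J" "adj u w" for u w using ok that by blast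
    show "\<kappa> u \<noteq> \<tau> w" if uw: "u \<in> J" "w \<notin> J \<union> N" "adj u w" for u w
    proof -
      have "w \<in> K" using uw J adj_sym by (auto simp: N_def outer_nbrs_def)
      then show ?thesis using ok(2) uw by blast
    qed
  qed
  define W where "W = E N (\<lambda>\<rho>. (f \<rho> - E N f \<rho>)\<^sup>2)"
  \<comment> \<open>Collects the local costs of all possible moves, so that one and the same
    function bounds every step of a path.\<close>
  define G where "G \<rho> = (f \<rho> - F \<rho>)\<^sup>2 + (\<Sum>h\<in>K. Sq {h} f \<rho>)" for \<rho>
  have G0: "0 \<le> G \<rho>" for \<rho> by (simp add: G_def sum_nonneg Sq_nonneg)
  \<comment> \<open>Twice \<open>2 * card K\<close> from the squared number of moves, and once
    \<open>card K\<close> from the density of a single fibre in \<open>size\<close>.\<close>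
  define M where "M = real k ^ (5 * card K)"
  have pt: "(F \<tau>0 - E X f \<tau>0)\<^sup>2 \<le> 6 * M / q\<^sup>2 * E X G \<tau>0" if t0: "\<tau>0 \<in> Om" for \<tau>0
  proof -
    define S where "S = fib X \<tau>0"
    define A where "A = (\<Sum>\<rho>\<in>S. G \<rho>)"
    have A0: "0 \<le> A" by (simp add: A_def sum_nonneg G0)
    have SO: "\<tau> \<in> Om" if "\<tau> \<in> S" for \<tau> using that fib_Om by (simp add: S_def)
    have Seq: "fib X \<tau> = S" if "\<tau> \<in> S" for \<tau> using that fib_eq by (simp add: S_def)
    have NS: "fib N \<tau> \<subseteq> S" if "\<tau> \<in> S" for \<tau> using fib_mono[OF NX, of \<tau>] Seq[OF that] by simp
    have cS: "0 < real (card S)" using card_fib_pos[OF t0] by (simp add: S_def)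
    have rK: "restr K \<tau> \<in> lcol K (\<lambda>_. {..<k})" if "\<tau> \<in> Om" for \<tau>
      using that Om_col[OF that] Om_adj[OF that] b(2) by (auto simp: lcol_def restr_def)
    have fibN: "fib N \<tau> = {\<theta> \<in> S. restr K \<theta> = restr K \<tau>}" if "\<tau> \<in> S" for \<tau>
    proof -
      have t: "\<tau> w = \<tau>0 w" if "w \<notin> X" for w using fibD[of \<tau> X \<tau>0 w] \<open>\<tau> \<in> S\<close> that by (simp add: S_def)
      have KN: "w \<notin> N" if "w \<in> K" for w using that by (auto simp: N_def outer_nbrs_def)
      have "(\<forall>v. v \<notin> N \<longrightarrow> \<theta> v = \<tau> v) \<longleftrightarrow> (\<forall>v. v \<notin> X \<longrightarrow> \<theta> v = \<tau>0 v) \<and> restr K \<theta> = restr K \<tau>" for \<theta>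
      proof
        assume e: "\<forall>v. v \<notin> N \<longrightarrow> \<theta> v = \<tau> v"
        then show "(\<forall>v. v \<notin> X \<longrightarrow> \<theta> v = \<tau>0 v) \<and> restr K \<theta> = restr K \<tau>"
          using t KN NX by (auto simp: restr_def fun_eq_iff)
      next
        assume e: "(\<forall>v. v \<notin> X \<longrightarrow> \<theta> v = \<tau>0 v) \<and> restr K \<theta> = restr K \<tau>"
        show "\<forall>v. v \<notin> N \<longrightarrow> \<theta> v = \<tau> v"
        proof (intro allI impI)
          fix w assume w: "w \<notin> N"
          show "\<theta> w = \<tau> w"
          proof (cases "w \<in> K")
            case True
            then show ?thesis using fun_cong[OF conjunct2[OF e], of w] by (simp add: restr_def)
          next
            case False
            then have "w \<notin> X" using w by (simp add: X_def)
            then show ?thesis using e t by simp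
          qed
        qed
      qed
      then show ?thesis by (auto simp: fib_def S_def)
    qed
    \<comment> \<open>By recolouring \<open>K\<close>, a fraction \<open>q\<close> of any other
      fibre of \<open>N\<close> injects into this one, and at most \<open>k ^ card K\<close> fibres
      make up \<open>S\<close>.\<close>
    have size: "q * real (card S) \<le> real k ^ card K * real (card (fib N \<tau>))" if t: "\<tau> \<in> S" for \<tau>
    proof -
      define img where "img = restr K ` S"
      have fS: "finite S" by (simp add: S_def)
      have cimg: "real (card img) \<le> real k ^ card K"
      proof -
        have "card img \<le> card (lcol K (\<lambda>_. {..<k}))"
          unfolding img_def using rK SO b(1) by (intro card_mono finite_lcol) auto
        also have "\<dots> \<le> k ^ card K" by (rule card_lcol_le[OF b(1)])
        finally show ?thesis by (metis of_nat_le_iff of_nat_power)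
      qed
      have each: "q * real (card (fib N \<theta>)) \<le> real (card (fib N \<tau>))" if th: "\<theta> \<in> S" for \<theta>
      proof -
        have "q * real (card (fib N \<theta>)) \<le> real (card (compatible N K \<tau> \<theta>))"
          unfolding q_def by (rule frac) (use th t SO Om_col Om_adj b(2) in auto)
        also have "card (compatible N K \<tau> \<theta>) \<le> card (fib N \<tau>)"
        proof (rule card_inj_on_le[of "merge K \<tau>"])
          show "inj_on (merge K \<tau>) (compatible N K \<tau> \<theta>)"
          proof (rule inj_onI)
            fix x y assume xy: "x \<in> compatible N K \<tau> \<theta>" "y \<in> compatible N K \<tau> \<theta>" "merge K \<tau> x = merge K \<tau> y"
            have f: "x \<in> fib N \<theta>" "y \<in> fib N \<theta>" using xy by (auto simp: compatible_def)
            have KN: "w \<notin> N" if "w \<in> K" for w using that by (auto simp: N_def outer_nbrs_def)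
            show "x = y"
            proof
              fix w show "x w = y w"
                using fibD[OF f(1), of w] fibD[OF f(2), of w] fun_cong[OF xy(3), of w] KN[of w]
                by (cases "w \<in> K") (auto simp: merge_def)
            qed
          qed
          show "merge K \<tau> ` compatible N K \<tau> \<theta> \<subseteq> fib N \<tau>"
          proof
            fix y assume "y \<in> merge K \<tau> ` compatible N K \<tau> \<theta>"
            then obtain x where x: "x \<in> fib N \<theta>" "y = merge K \<tau> x" "y \<in> Om" by (auto simp: compatible_def)
            have "y w = \<tau> w" if "w \<notin> N" for w
            proof (cases "w \<in> K")
              case False
              then have "w \<notin> X" using that by (simp add: X_def)
              then show ?thesis using fibD[OF x(1) that] t th False x(2) fibD[of \<theta> X \<tau>0 w] fibD[of \<tau> X \<tau>0 w]
                by (simp add: merge_def S_def)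
            qed (simp add: x merge_def)
            then show "y \<in> fib N \<tau>" using x(3) by (rule fibI[rotated])
          qed
        qed simp
        finally show ?thesis by simp
      qed
      have "real (card S) = (\<Sum>\<kappa>\<in>img. real (card {\<theta> \<in> S. restr K \<theta> = \<kappa>}))"
        using sum.image_gen[OF fS, of "\<lambda>_. 1::real" "restr K"] by (simp add: img_def)
      also have "q * \<dots> = (\<Sum>\<kappa>\<in>img. q * real (card {\<theta> \<in> S. restr K \<theta> = \<kappa>}))" by (rule sum_distrib_left)
      also have "\<dots> \<le> (\<Sum>\<kappa>\<in>img. real (card (fib N \<tau>)))"
      proof (rule sum_mono)
        fix \<kappa> assume "\<kappa> \<in> img"
        then obtain \<theta> where "\<theta> \<in> S" "\<kappa> = restr K \<theta>" by (auto simp: img_def)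
        then show "q * real (card {\<theta> \<in> S. restr K \<theta> = \<kappa>}) \<le> real (card (fib N \<tau>))"
          using each[of \<theta>] fibN[of \<theta>] by simp
      qed
      also have "\<dots> \<le> real k ^ card K * real (card (fib N \<tau>))" using cimg by (simp add: mult_right_mono)
      finally show ?thesis .
    qed
    \<comment> \<open>The root of the bound that \<open>pair_bound\<close> gives for one move, after
      \<open>Enb\<close> has replaced means over a fibre of \<open>N\<close> by sums over
      \<open>S\<close>. It does not depend on the move.\<close>
    define R where "R = sqrt (6 * real k ^ card K / (q\<^sup>2 * real (card S)) * A)"
    have R0: "0 \<le> R" using A0 q cS by (simp add: R_def)
    have R2: "R\<^sup>2 = 6 * real k ^ card K / (q\<^sup>2 * real (card S)) * A" using A0 q cS by (simp add: R_def)
    have Enb: "E N g \<tau> \<le> (\<Sum>\<rho>\<in>S. g \<rho>) * (real k ^ card K / (q * real (card S)))"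
      if t: "\<tau> \<in> S" and g: "\<And>\<rho>. 0 \<le> g \<rho>" for \<tau> g
    proof -
      have c: "0 < real (card (fib N \<tau>))" using card_fib_pos[OF SO[OF t]] .
      have "E N g \<tau> \<le> (\<Sum>\<rho>\<in>S. g \<rho>) / real (card (fib N \<tau>))"
        unfolding E_def using NS[OF t] g by (intro divide_right_mono sum_mono2) (auto simp: S_def)
      also have "1 / real (card (fib N \<tau>)) \<le> real k ^ card K / (q * real (card S))"
        using size[OF t] c cS q by (simp add: field_simps)
      then have "(\<Sum>\<rho>\<in>S. g \<rho>) * (1 / real (card (fib N \<tau>))) \<le> (\<Sum>\<rho>\<in>S. g \<rho>) * (real k ^ card K / (q * real (card S)))"
        using g by (intro mult_left_mono) (auto simp: sum_nonneg)
      then have "(\<Sum>\<rho>\<in>S. g \<rho>) / real (card (fib N \<tau>)) \<le> (\<Sum>\<rho>\<in>S. g \<rho>) * (real k ^ card K / (q * real (card S)))" by simp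
      finally show ?thesis .
    qed
    have stepR: "\<bar>F \<tau> - F \<theta>\<bar> \<le> R" if t: "\<tau> \<in> S" and th: "\<theta> \<in> S" and h: "h \<in> K" "\<And>w. w \<in> K \<Longrightarrow> w \<noteq> h \<Longrightarrow> \<theta> w = \<tau> w" for \<tau> \<theta> h
    proof -
      have tO: "\<tau> \<in> Om" and thO: "\<theta> \<in> Om" using t th SO by auto
      have qh: "q \<le> compat_bound {h}"
      proof -
        have "real (card (Nb h)) \<le> (\<Sum>h\<in>K. real (card (Nb h)))" using h b(1) by (intro member_le_sum) auto
        then show ?thesis unfolding q_def compat_bound_def by (simp add: divide_right_mono)
      qed
      have c1: "q * real (card (fib N \<tau>)) \<le> real (card (compatible N {h} \<theta> \<tau>))"
      proof -
        have "compat_bound {h} * real (card (fib N \<tau>)) \<le> real (card (compatible N {h} \<theta> \<tau>))"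
        proof (rule frac[OF _ tO])
          show "\<theta> u \<noteq> \<tau> w" if "u \<in> {h}" "w \<in> K - {h}" "adj u w" for u w
            using Om_adj[OF thO that(3)] h(2)[of w] that(2) by auto
        qed (use h b(2) Om_col[OF thO] adj_irrefl in auto)
        then show ?thesis using mult_right_mono[OF qh, of "real (card (fib N \<tau>))"] by linarith
      qed
      have c2: "q * real (card (fib N \<theta>)) \<le> real (card (compatible N {h} \<tau> \<theta>))"
      proof -
        have "compat_bound {h} * real (card (fib N \<theta>)) \<le> real (card (compatible N {h} \<tau> \<theta>))"
        proof (rule frac[OF _ thO])
          show "\<tau> u \<noteq> \<theta> w" if "u \<in> {h}" "w \<in> K - {h}" "adj u w" for u w
            using Om_adj[OF tO that(3)] h(2)[of w] that(2) by auto
        qed (use h b(2) Om_col[OF tO] adj_irrefl in auto)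
        then show ?thesis using mult_right_mono[OF qh, of "real (card (fib N \<theta>))"] by linarith
      qed
      have "(F \<tau> - F \<theta>)\<^sup>2 \<le> 3 / q * (W \<tau> + W \<theta>) + 6 / q * E N (Sq {h} f) \<tau>"
        using pair_bound[of "{h}" K X \<tau> \<theta> q f] h KX tO Seq[OF t] th q(1) c1 c2
        by (auto simp: XK F_def W_def)
      also have "\<dots> \<le> 3 / q * (2 * ((\<Sum>\<rho>\<in>S. (f \<rho> - F \<rho>)\<^sup>2) * (real k ^ card K / (q * real (card S)))))
         + 6 / q * ((\<Sum>\<rho>\<in>S. Sq {h} f \<rho>) * (real k ^ card K / (q * real (card S))))"
        using Enb[OF t, of "\<lambda>\<rho>. (f \<rho> - F \<rho>)\<^sup>2"] Enb[OF th, of "\<lambda>\<rho>. (f \<rho> - F \<rho>)\<^sup>2"] Enb[OF t, of "Sq {h} f"] q(1)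
        by (intro add_mono mult_left_mono) (auto simp: W_def F_def Sq_nonneg)
      also have "\<dots> = 6 * real k ^ card K / (q\<^sup>2 * real (card S)) * (\<Sum>\<rho>\<in>S. (f \<rho> - F \<rho>)\<^sup>2 + Sq {h} f \<rho>)"
        by (simp only: sum.distrib) (simp add: distrib_left power2_eq_square[of q] mult_ac)
      also have "\<dots> \<le> R\<^sup>2" unfolding R2 A_def
      proof (intro mult_left_mono sum_mono)
        fix \<rho> assume "\<rho> \<in> S"
        have "Sq {h} f \<rho> \<le> (\<Sum>h\<in>K. Sq {h} f \<rho>)" using h b(1) Sq_nonneg by (intro member_le_sum) auto
        then show "(f \<rho> - F \<rho>)\<^sup>2 + Sq {h} f \<rho> \<le> G \<rho>" by (simp add: G_def)
      qed (use q cS in auto)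
      finally show ?thesis using R0 by (metis abs_le_square_iff abs_of_nonneg)
    qed
    \<comment> \<open>A sequence of moves on \<open>K\<close> is realised by actual colorings:
      before each move the neighbours are changed, within their fibre, to a coloring compatible with
      it, and this leaves \<open>F\<close> unchanged.\<close>
    have reach: "\<exists>\<theta>\<in>S. restr K \<theta> = \<beta> \<and> \<bar>F \<tau> - F \<theta>\<bar> \<le> real i * R"
      if "(\<alpha>, \<beta>) \<in> recoloring K ^^ i" "\<tau> \<in> S" "restr K \<tau> = \<alpha>" for \<alpha> \<beta> i \<tau>
      using that
    proof (induction i arbitrary: \<beta>)
      case 0
      then show ?case by (intro bexI[of _ \<tau>]) auto
    next
      case (Suc i)
      then obtain \<gamma> where g: "(\<alpha>, \<gamma>) \<in> recoloring K ^^ i" "(\<gamma>, \<beta>) \<in> recoloring K" by auto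
      obtain \<theta> where th: "\<theta> \<in> S" "restr K \<theta> = \<gamma>" "\<bar>F \<tau> - F \<theta>\<bar> \<le> real i * R" using Suc.IH[OF g(1) Suc.prems(2,3)] by blast
      obtain h where h: "h \<in> K" "\<And>w. w \<noteq> h \<Longrightarrow> \<gamma> w = \<beta> w" "\<beta> \<in> lcol K (\<lambda>_. {..<k})" using g(2) by (auto simp: recoloring_def)
      have thb: "\<theta> w = \<beta> w" if "w \<in> K" "w \<noteq> h" for w using h(2)[OF that(2)] th(2) that(1) by (auto simp: restr_def)
      have "compat_bound {h} * real (card (fib N \<theta>)) \<le> real (card (compatible N {h} \<beta> \<theta>))"
      proof (rule frac[OF _ SO[OF th(1)]])
        show "\<beta> u \<noteq> \<theta> w" if "u \<in> {h}" "w \<in> K - {h}" "adj u w" for u w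
          using thb[of w] h that by (auto simp: lcol_def)
      qed (use h adj_irrefl in \<open>auto simp: lcol_def\<close>)
      moreover have "0 < compat_bound {h} * real (card (fib N \<theta>))" using compat_bound_pos card_fib_pos[OF SO[OF th(1)]] by simp
      ultimately have "card (compatible N {h} \<beta> \<theta>) \<noteq> 0" by linarith
      then obtain \<rho> where r: "\<rho> \<in> fib N \<theta>" "merge {h} \<beta> \<rho> \<in> Om" by (metis (no_types, lifting) compatible_def card.empty ex_in_conv mem_Collect_eq)
      define \<theta>' where "\<theta>' = merge {h} \<beta> \<rho>"
      have rS: "\<rho> \<in> S" using NS[OF th(1)] r(1) by blast
      have t'S: "\<theta>' \<in> S"
        using r(2) rS h(1) KX fibD[of \<rho> X \<tau>0] by (auto simp: S_def \<theta>'_def merge_def intro!: fibI)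
      have KN: "w \<notin> N" if "w \<in> K" for w using that by (auto simp: N_def outer_nbrs_def)
      have v1: "\<theta>' w = \<theta> w" if "w \<in> K" "w \<noteq> h" for w
        using fibD[OF r(1) KN[OF that(1)]] that by (simp add: \<theta>'_def merge_def)
      have "restr K \<theta>' w = \<beta> w" for w
        using v1 thb h(1,3) by (cases "w \<in> K"; cases "w = h") (auto simp: restr_def \<theta>'_def merge_def lcol_def)
      then have "restr K \<theta>' = \<beta>" by blast
      moreover have "\<bar>F \<theta> - F \<theta>'\<bar> \<le> R" by (rule stepR[OF th(1) t'S h(1) v1])
      ultimately show ?case using t'S th(3) by (intro bexI[of _ \<theta>']) (auto simp: distrib_right)
    qed
    \<comment> \<open>A path in a finite relation needs no more steps than the relation has pairs,
      which gives \<open>k ^ (2 * card K)\<close>.\<close>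
    have diff: "\<bar>F \<tau> - F \<tau>'\<bar> \<le> real k ^ (2 * card K) * R" if t: "\<tau> \<in> S" "\<tau>' \<in> S" for \<tau> \<tau>'
    proof -
      have fr: "finite (recoloring K)"
        by (rule finite_subset[of _ "lcol K (\<lambda>_. {..<k}) \<times> lcol K (\<lambda>_. {..<k})"])
           (use b(1) in \<open>auto simp: recoloring_def intro!: finite_lcol\<close>)
      have cluster: "card (lcol K (\<lambda>_. {..<k})) \<le> k ^ card K" by (rule card_lcol_le[OF b(1)])
      have "card (recoloring K) \<le> card (lcol K (\<lambda>_. {..<k}) \<times> lcol K (\<lambda>_. {..<k}))"
        by (rule card_mono) (use b(1) in \<open>auto simp: recoloring_def intro!: finite_lcol\<close>)
      also have "\<dots> \<le> k ^ card K * k ^ card K" using cluster by (simp add: card_cartesian_product mult_le_mono)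
      also have "\<dots> = k ^ (2 * card K)" by (simp add: power_add[symmetric] mult_2)
      finally have cr: "card (recoloring K) \<le> k ^ (2 * card K)" .
      have "(restr K \<tau>, restr K \<tau>') \<in> (recoloring K)\<^sup>*"
        by (rule recoloring_connected[OF b(1)]) (use cluster_degenerate[OF v] rK SO t in \<open>auto simp: K_def\<close>)
      then obtain i where i: "i \<le> card (recoloring K)" "(restr K \<tau>, restr K \<tau>') \<in> recoloring K ^^ i"
        using rtrancl_finite_eq_relpow[OF fr] by auto
      obtain \<theta> where th: "\<theta> \<in> S" "restr K \<theta> = restr K \<tau>'" "\<bar>F \<tau> - F \<theta>\<bar> \<le> real i * R"
        using reach[OF i(2) t(1) refl] by blast
      have "\<theta> \<in> fib N \<tau>'" using th fibN[OF t(2)] by simp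
      then have "F \<theta> = F \<tau>'" unfolding F_def by (rule E_fib)
      moreover have "real i * R \<le> real (k ^ (2 * card K)) * R"
        using i(1) cr R0 by (intro mult_right_mono of_nat_mono) auto
      ultimately show ?thesis using th(3) by simp
    qed
    have "F \<tau>0 - E X f \<tau>0 = F \<tau>0 - E X F \<tau>0" unfolding F_def using E_tower[OF NX t0] by simp
    also have "\<dots> = (\<Sum>\<tau>'\<in>S. F \<tau>0 - F \<tau>') / real (card S)"
      using cS by (simp add: E_def[of X] S_def[symmetric] sum_subtractf diff_divide_distrib)
    finally have "\<bar>F \<tau>0 - E X f \<tau>0\<bar> = \<bar>\<Sum>\<tau>'\<in>S. F \<tau>0 - F \<tau>'\<bar> / real (card S)" by simp
    also have "\<dots> \<le> (\<Sum>\<tau>'\<in>S. real k ^ (2 * card K) * R) / real (card S)"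
    proof (intro divide_right_mono order_trans[OF sum_abs] sum_mono)
      fix \<tau>' assume "\<tau>' \<in> S"
      then show "\<bar>F \<tau>0 - F \<tau>'\<bar> \<le> real k ^ (2 * card K) * R"
        using diff[of \<tau>0 \<tau>'] fib_self[OF t0] by (simp add: S_def)
    qed simp
    also have "\<dots> = real k ^ (2 * card K) * R" using cS by simp
    finally have "(F \<tau>0 - E X f \<tau>0)\<^sup>2 \<le> (real k ^ (2 * card K) * R)\<^sup>2"
      using R0 by (simp add: abs_le_square_iff[symmetric])
    also have "\<dots> = (real k ^ (2 * card K))\<^sup>2 * (6 * real k ^ card K / (q\<^sup>2 * real (card S)) * A)"
      by (simp add: power_mult_distrib R2)
    also have "\<dots> = 6 * M / q\<^sup>2 * (A / real (card S))"
      by (simp add: M_def power_mult[symmetric] power_add[symmetric] mult_ac)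
    also have "A / real (card S) = E X G \<tau>0" by (simp add: A_def S_def E_def)
    finally show ?thesis .
  qed
  have M1: "1 \<le> M" using k1 by (simp add: M_def)
  have sG: "(\<Sum>\<tau>\<in>Om. G \<tau>) \<le> EV N f + real k * (\<Sum>h\<in>K. EV {h} f)"
  proof -
    have "(\<Sum>\<tau>\<in>Om. G \<tau>) = EV N f + (\<Sum>h\<in>K. \<Sum>\<tau>\<in>Om. Sq {h} f \<tau>)"
      unfolding G_def sum.distrib F_def EV_def by (subst sum.swap) simp
    also have "(\<Sum>h\<in>K. \<Sum>\<tau>\<in>Om. Sq {h} f \<tau>) \<le> (\<Sum>h\<in>K. real k * EV {h} f)"
      using sum_Sq[of "{_}" f] b(2) by (intro sum_mono) fastforce
    finally show ?thesis by (simp add: sum_distrib_left)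
  qed
  have S0: "0 \<le> (\<Sum>h\<in>K. EV {h} f)" by (simp add: sum_nonneg EV_nonneg)
  have c6: "0 \<le> 6 * M / q\<^sup>2" using M1 q by simp
  have "EV K f \<le> EV X f" by (rule EV_mono[OF KX])
  also have "EV X f = EV N f + (\<Sum>\<tau>\<in>Om. (F \<tau> - E X f \<tau>)\<^sup>2)" unfolding F_def by (rule EV_Pythagoras[OF NX])
  also have "\<dots> \<le> EV N f + (\<Sum>\<tau>\<in>Om. 6 * M / q\<^sup>2 * E X G \<tau>)" by (intro add_left_mono sum_mono pt)
  also have "\<dots> = EV N f + 6 * M / q\<^sup>2 * (\<Sum>\<tau>\<in>Om. G \<tau>)" by (simp only: sum_distrib_left[symmetric] sum_E)
  also have "\<dots> \<le> EV N f + 6 * M / q\<^sup>2 * (EV N f + real k * (\<Sum>h\<in>K. EV {h} f))"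
    using sG c6 by (intro add_left_mono mult_left_mono) auto
  also have "\<dots> \<le> 7 * real k * M / q\<^sup>2 * (EV N f + (\<Sum>h\<in>K. EV {h} f))"
  proof -
    have Mq: "1 \<le> M / q\<^sup>2"
    proof -
      have "q\<^sup>2 \<le> 1" using q by (simp add: power_le_one)
      then show ?thesis using M1 q by (simp add: pos_le_divide_eq)
    qed
    have "EV N f \<le> M / q\<^sup>2 * EV N f" using mult_right_mono[OF Mq EV_nonneg[of N f]] by simp
    moreover have "7 * (M / q\<^sup>2) * EV N f \<le> 7 * real k * M / q\<^sup>2 * EV N f"
      using k1 Mq mult_right_mono[OF k1, of "M / q\<^sup>2"] by (intro mult_right_mono EV_nonneg) auto
    moreover have "6 * M / q\<^sup>2 * (real k * (\<Sum>h\<in>K. EV {h} f)) \<le> 7 * real k * M / q\<^sup>2 * (\<Sum>h\<in>K. EV {h} f)"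
    proof -
      have "6 * M / q\<^sup>2 * real k \<le> 7 * real k * M / q\<^sup>2" using k1 Mq M1 q by (simp add: divide_right_mono mult.commute)
      then have "(6 * M / q\<^sup>2 * real k) * (\<Sum>h\<in>K. EV {h} f) \<le> 7 * real k * M / q\<^sup>2 * (\<Sum>h\<in>K. EV {h} f)"
        by (intro mult_right_mono S0)
      then show ?thesis by (simp add: mult_ac)
    qed
    ultimately show ?thesis by (simp add: distrib_left)
  qed
  also have "\<dots> \<le> 7 * real k * M / q\<^sup>2 * ((7 * real k * exp (2 * real D / real a))\<^sup>2 * (\<Sum>u\<in>K \<union> N. EV {u} f))"
  proof (rule mult_left_mono)
    define c where "c = (7 * real k * exp (2 * real D / real a))\<^sup>2"
    have "1 \<le> exp (2 * real D / real a)" by simp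
    then have "1 * 1 \<le> (7 * real k) * exp (2 * real D / real a)" using k1 by (intro mult_mono) auto
    then have c1: "1 \<le> c" by (simp add: c_def one_le_power)
    have "EV N f \<le> c * (\<Sum>u\<in>N. EV {u} f)" using EV_nbrs[OF v] by (simp add: c_def N_def K_def)
    moreover have "(\<Sum>h\<in>K. EV {h} f) \<le> c * (\<Sum>h\<in>K. EV {h} f)" using mult_right_mono[OF c1 S0] by simp
    moreover have "(\<Sum>u\<in>K \<union> N. EV {u} f) = (\<Sum>h\<in>K. EV {h} f) + (\<Sum>u\<in>N. EV {u} f)"
      using b(1) finite_subset[OF outer_nbrs_sub finV, of K] by (intro sum.union_disjoint) (auto simp: N_def outer_nbrs_def)
    ultimately show "EV N f + (\<Sum>h\<in>K. EV {h} f) \<le> (7 * real k * exp (2 * real D / real a))\<^sup>2 * (\<Sum>u\<in>K \<union> N. EV {u} f)"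
      by (simp add: c_def[symmetric] distrib_left)
    show "0 \<le> 7 * real k * M / q\<^sup>2" using k1 M1 by simp
  qed
  finally show ?thesis by (simp add: M_def q_def N_def mult_ac power_add)
qed

end

section \<open>The global Poincare inequality\<close>

context light_graph
begin

text \<open>A big vertex belongs to one block only, and a light vertex borders at most one cluster
  per neighbour. Single-site variances are thus counted at most \<open>D + 1\<close> times, and once
  more for light vertices as clusters of their own.\<close>

lemma unit_sum_le:
  assumes T2: "1 \<le> T2"
    "\<And>v. v \<in> V \<Longrightarrow> \<not> light v \<Longrightarrow> 7 * real k ^ (5 * card (cluster v) + 1) / (compat_bound (cluster v))\<^sup>2 * (7 * real k * exp (2 * real D / real a))\<^sup>2 \<le> T2"
  shows "(\<Sum>J\<in>cluster ` V. EV J f) \<le> T2 * (real D + 2) * (\<Sum>u\<in>V. EV {u} f)"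
proof -
  define A where "A = {v \<in> V. light v}"
  define C where "C = cluster ` (V - A)"
  define S where "S = (\<Sum>u\<in>V. EV {u} f)"
  have S0: "0 \<le> S" by (simp add: S_def sum_nonneg EV_nonneg)
  have fC: "finite C" using finV by (simp add: C_def)
  have "(\<Sum>J\<in>cluster ` V. EV J f) \<le> (\<Sum>J\<in>cluster ` A. EV J f) + (\<Sum>J\<in>C. EV J f)"
  proof -
    have "cluster ` V = cluster ` (A \<union> (V - A))" by (rule arg_cong[of _ _ "image cluster"]) (auto simp: A_def)
    then have "cluster ` V = cluster ` A \<union> C" by (simp only: image_Un C_def)
    moreover have "finite (cluster ` A)" using finV by (simp add: A_def)
    moreover have "(\<Sum>J\<in>cluster ` A \<union> C. EV J f) \<le> (\<Sum>J\<in>cluster ` A. EV J f) + (\<Sum>J\<in>C. EV J f)"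
      using \<open>finite (cluster ` A)\<close> fC by (subst sum_Un) (auto intro!: sum_nonneg EV_nonneg)
    ultimately show ?thesis by simp
  qed
  also have "(\<Sum>J\<in>cluster ` A. EV J f) = (\<Sum>u\<in>A. EV {u} f)"
    by (subst sum.reindex) (auto simp: inj_on_def A_def)
  also have "\<dots> \<le> S" unfolding S_def using finV by (intro sum_mono2) (auto simp: A_def EV_nonneg)
  also have "(\<Sum>J\<in>C. EV J f) \<le> (\<Sum>J\<in>C. T2 * (\<Sum>u\<in>V. if u \<in> J \<union> outer_nbrs J then EV {u} f else 0))"
  proof (rule sum_mono)
    fix J assume "J \<in> C"
    then obtain v where v: "v \<in> V" "\<not> light v" "J = cluster v" by (auto simp: C_def A_def)
    have sub: "J \<union> outer_nbrs J \<subseteq> V" using cluster_V[OF v(1)] v(3) outer_nbrs_sub by simp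
    have "EV J f \<le> 7 * real k ^ (5 * card (cluster v) + 1) / (compat_bound (cluster v))\<^sup>2 * (7 * real k * exp (2 * real D / real a))\<^sup>2 * (\<Sum>u\<in>J \<union> outer_nbrs J. EV {u} f)"
      using EV_cluster[OF v(1,2), of f] v(3) by simp
    also have "\<dots> \<le> T2 * (\<Sum>u\<in>J \<union> outer_nbrs J. EV {u} f)"
      by (intro mult_right_mono T2(2) v sum_nonneg EV_nonneg)
    also have "(\<Sum>u\<in>J \<union> outer_nbrs J. EV {u} f) = (\<Sum>u\<in>V. if u \<in> J \<union> outer_nbrs J then EV {u} f else 0)"
      using sub finV by (subst sum.inter_restrict[symmetric]) (auto intro!: sum.cong)
    finally show "EV J f \<le> T2 * (\<Sum>u\<in>V. if u \<in> J \<union> outer_nbrs J then EV {u} f else 0)" .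
  qed
  also have "\<dots> = T2 * (\<Sum>u\<in>V. \<Sum>J\<in>C. if u \<in> J \<union> outer_nbrs J then EV {u} f else 0)"
    by (subst sum.swap) (simp add: sum_distrib_left)
  also have "(\<Sum>u\<in>V. \<Sum>J\<in>C. if u \<in> J \<union> outer_nbrs J then EV {u} f else 0) \<le> (\<Sum>u\<in>V. (real D + 1) * EV {u} f)"
  proof (rule sum_mono)
    fix u assume u: "u \<in> V"
    have "(\<Sum>J\<in>C. if u \<in> J \<union> outer_nbrs J then EV {u} f else 0) = real (card {J \<in> C. u \<in> J \<union> outer_nbrs J}) * EV {u} f"
      using fC by (simp add: sum.inter_filter[symmetric])
    also have "\<dots> \<le> (real D + 1) * EV {u} f"
    proof (intro mult_right_mono EV_nonneg)
      have "card {J \<in> C. u \<in> J \<union> outer_nbrs J} \<le> D + 1"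
      proof (cases "light u")
        case False
        have "{J \<in> C. u \<in> J \<union> outer_nbrs J} \<subseteq> {cluster u}"
        proof
          fix J assume "J \<in> {J \<in> C. u \<in> J \<union> outer_nbrs J}"
          then obtain v where v: "\<not> light v" "J = cluster v" "u \<in> J \<union> outer_nbrs J" by (auto simp: C_def A_def)
          then have "u \<in> cluster v" using outer_nbrs_light[OF v(1), of u] False by auto
          then show "J \<in> {cluster u}" using cluster_eq v by simp
        qed
        then have "card {J \<in> C. u \<in> J \<union> outer_nbrs J} \<le> card {cluster u}" by (intro card_mono) auto
        then show ?thesis by simp
      next
        case True
        have "{J \<in> C. u \<in> J \<union> outer_nbrs J} \<subseteq> cluster ` Nb u"
        proof
          fix J assume "J \<in> {J \<in> C. u \<in> J \<union> outer_nbrs J}"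
          then obtain v where v: "\<not> light v" "J = cluster v" "u \<in> J \<union> outer_nbrs J" by (auto simp: C_def A_def)
          then have "u \<notin> J" using cluster_big_sub True by blast
          then obtain h where h: "h \<in> J" "adj u h" using v by (auto simp: outer_nbrs_def)
          then have "J = cluster h" using cluster_eq[of h v] v(2) by simp
          then show "J \<in> cluster ` Nb u" using h(2) by (simp add: in_Nb)
        qed
        then have "card {J \<in> C. u \<in> J \<union> outer_nbrs J} \<le> card (Nb u)"
          by (meson card_image_le card_mono finite_Nb finite_imageI order_trans)
        then show ?thesis using light_deg[OF True] by simp
      qed
      then show "real (card {J \<in> C. u \<in> J \<union> outer_nbrs J}) \<le> real D + 1"
        by (metis of_nat_1 of_nat_add of_nat_mono)
    qed
    finally show "(\<Sum>J\<in>C. if u \<in> J \<union> outer_nbrs J then EV {u} f else 0) \<le> (real D + 1) * EV {u} f" .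
  qed
  also have "(\<Sum>u\<in>V. (real D + 1) * EV {u} f) = (real D + 1) * S" by (simp add: S_def sum_distrib_left)
  finally have "(\<Sum>J\<in>cluster ` V. EV J f) \<le> S + T2 * ((real D + 1) * S)" using T2(1) by simp
  also have "\<dots> \<le> T2 * S + T2 * ((real D + 1) * S)" using mult_right_mono[OF T2(1) S0] by simp
  finally show ?thesis by (simp add: S_def algebra_simps)
qed

text \<open>Freezing bounds the variance on \<open>V\<close> by an average over random remainders
  \<open>Y\<close>. Remainders with a large component are so rare that bounding their variance by
  the total one costs at most half of it, which is moved to the left side and gives the factor 2. On
  the others the elimination bound applies.\<close>

theorem Poincare:
  fixes j :: nat
  defines "A \<equiv> {v \<in> V. light v}"
  assumes F: "\<And>W. W \<subseteq> V \<Longrightarrow> conn W \<Longrightarrow> 4 * sum gg W - sum ll W \<le> F" and F0: "0 \<le> F"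
    and j: "j < card A" "2 * (2 + real D * B + F) \<le> real (card A - j)"
    and bad: "deletion_avg j (\<lambda>Y. if \<exists>W \<subseteq> (V - A) \<union> Y. conn W \<and> a0 < real (card (W \<inter> A)) then 1 else 0) A \<le> pb"
    and half: "(real (card A) / real (card A - j)) powr (2 * (2 + real D * B + F)) * pb \<le> 1 / 2"
    and T1: "1 \<le> T1" "\<And>W. W \<subseteq> V \<Longrightarrow> conn W \<Longrightarrow> real (card (W \<inter> A)) \<le> a0 \<Longrightarrow> (\<Prod>h\<in>W. vertex_cost h) \<le> T1"
    and T2: "1 \<le> T2"
    "\<And>v. v \<in> V \<Longrightarrow> \<not> light v \<Longrightarrow> 7 * real k ^ (5 * card (cluster v) + 1) / (compat_bound (cluster v))\<^sup>2 * (7 * real k * exp (2 * real D / real a))\<^sup>2 \<le> T2"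
  shows "EV V f \<le> 2 * (real (card A) / real (card A - j)) powr (2 * (2 + real D * B + F)) * T1 * T2 * (real D + 2) * (\<Sum>u\<in>V. EV {u} f)"
proof -
  define h where "h Y = EV ((V - A) \<union> Y) f" for Y
  define loss where "loss = (real (card A) / real (card A - j)) powr (2 * (2 + real D * B + F))"
  define badY where "badY Y = (if \<exists>W \<subseteq> (V - A) \<union> Y. conn W \<and> a0 < real (card (W \<inter> A)) then 1 else (0::real))" for Y
  define S where "S = (\<Sum>J\<in>cluster ` V. EV J f)"
  have fA: "finite A" using finV by (simp add: A_def)
  have hA: "h A = EV V f" by (simp add: h_def A_def Un_absorb1 Collect_mono Un_commute) (rule arg_cong[of _ _ "\<lambda>X. EV X f"], auto)
  have h0: "0 \<le> h Y" for Y by (simp add: h_def EV_nonneg)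
  \<comment> \<open>Only light vertices are frozen, so every remainder contains all big vertices and
    is a union of clusters.\<close>
  have clo: "closed ((V - A) \<union> Y)" if "Y \<subseteq> A" for Y
    unfolding closed_def
  proof
    fix v assume v: "v \<in> (V - A) \<union> Y"
    show "cluster v \<subseteq> (V - A) \<union> Y"
    proof (cases "light v")
      case False
      then have "v \<in> V" using v that by (auto simp: A_def)
      then have "cluster v \<subseteq> V" by (rule cluster_V)
      then show ?thesis using cluster_big_sub[OF False] by (auto simp: A_def)
    qed (use v in simp)
  qed
  have valF: "val W \<le> F" if "W \<subseteq> V" "conn W" for W
    using F[OF that] val_le_score[of W] by linarith
  have hloss: "h A \<le> loss * deletion_avg j h A" unfolding loss_def
  proof (rule local_to_global[OF h0 _ fA j])
    show "0 \<le> 2 + real D * B + F" using F0 B0 by simp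
    fix Z assume Z: "Z \<subseteq> A" "Z \<noteq> {}"
    define X where "X = (V - A) \<union> Z"
    have ZX: "Z = {w \<in> X. light w}" using Z by (auto simp: X_def A_def)
    have XV: "X \<subseteq> V" using Z by (auto simp: X_def A_def)
    have "(V - A) \<union> (Z - {u}) = X - {u}" if "u \<in> Z" for u using that Z by (auto simp: X_def)
    then have "(\<Sum>u\<in>Z. h Z - h (Z - {u})) = (\<Sum>u\<in>Z. EV X f - EV (X - {u}) f)"
      by (intro sum.cong refl) (simp add: h_def X_def)
    also have "\<dots> \<le> (2 + real D * B + F) * EV X f"
      by (rule variance_step[OF XV _ ZX valF F0]) (use clo[OF Z(1)] in \<open>simp_all add: X_def\<close>)
    finally show "(\<Sum>u\<in>Z. h Z - h (Z - {u})) \<le> (2 + real D * B + F) * h Z" by (simp add: h_def X_def)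
  qed
  have "deletion_avg j h A \<le> deletion_avg j (\<lambda>Y. h A * badY Y + T1 * S) A"
  proof (rule deletion_avg_mono[OF fA])
    fix Z assume Z: "Z \<subseteq> A"
    have S0: "0 \<le> S" by (simp add: S_def sum_nonneg EV_nonneg)
    show "h Z \<le> h A * badY Z + T1 * S"
    proof (cases "badY Z = 1")
      case True
      have "h Z \<le> h A" unfolding h_def using Z by (intro EV_mono) auto
      moreover have "0 \<le> T1 * S" using T1(1) S0 by simp
      ultimately show ?thesis using True by simp
    next
      case False
      define X where "X = (V - A) \<union> Z"
      have XV: "X \<subseteq> V" using Z by (auto simp: X_def A_def)
      have good: "real (card (W \<inter> A)) \<le> a0" if "W \<subseteq> X" "conn W" for W
        using False that by (auto simp: badY_def X_def split: if_splits)
      have "EV X f \<le> T1 * (\<Sum>J\<in>cluster ` X. EV J f)"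
      proof (rule unit_Poincare[OF XV _ T1(1)])
        show "closed X" using clo[OF Z] by (simp add: X_def)
        show "(\<Prod>h\<in>W. vertex_cost h) \<le> T1" if "W \<subseteq> X" "conn W" for W
          by (rule T1(2)[OF subset_trans[OF that(1) XV] that(2) good[OF that]])
      qed
      also have "(\<Sum>J\<in>cluster ` X. EV J f) \<le> S"
        unfolding S_def using XV finV by (intro sum_mono2) (auto simp: EV_nonneg)
      finally have "EV X f \<le> T1 * S" using T1(1) by simp
      moreover have "badY Z = 0" using False by (simp add: badY_def split: if_splits)
      ultimately show ?thesis by (simp add: h_def X_def)
    qed
  qed (use j in simp)
  also have "deletion_avg j (\<lambda>Y. h A * badY Y + T1 * S) A = h A * deletion_avg j badY A + T1 * S"
    using deletion_avg_const[OF fA, of j "T1 * S"] j by (simp add: deletion_avg_add deletion_avg_cmult)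
  also have "\<dots> \<le> h A * pb + T1 * S"
    using bad[folded badY_def] h0[of A] by (intro add_right_mono mult_left_mono) auto
  finally have "loss * deletion_avg j h A \<le> loss * (h A * pb + T1 * S)"
    by (intro mult_left_mono) (auto simp: loss_def)
  then have "h A \<le> loss * (h A * pb + T1 * S)" using hloss by linarith
  then have "h A \<le> h A * (loss * pb) + loss * T1 * S" by (simp add: algebra_simps)
  also have "h A * (loss * pb) \<le> h A * (1 / 2)" using half h0 by (intro mult_left_mono) (auto simp: loss_def)
  finally have "h A \<le> 2 * loss * T1 * S" by simp
  also have "\<dots> \<le> 2 * loss * T1 * (T2 * (real D + 2) * (\<Sum>u\<in>V. EV {u} f))"
    unfolding S_def using unit_sum_le[OF T2] T1(1) by (intro mult_left_mono) (auto simp: loss_def)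
  finally show ?thesis by (simp add: hA loss_def mult_ac)
qed

end

section \<open>Mixing time\<close>

definition gadj :: "nat \<Rightarrow> nat set set \<Rightarrow> nat \<Rightarrow> nat \<Rightarrow> bool" where
  "gadj n Es u v \<longleftrightarrow> u < n \<and> v < n \<and> u \<noteq> v \<and> {u, v} \<in> Es"

lemma sgraph_gadj: "sgraph {..<n} (gadj n Es)"
  by unfold_locales (auto simp: gadj_def insert_commute)

lemma finite_colorings: "finite (colorings n Es k)"
proof (rule finite_subset)
  show "finite {f. \<forall>x. (x \<in> {..<n} \<longrightarrow> f x \<in> {..<k}) \<and> (x \<notin> {..<n} \<longrightarrow> f x = (0::nat))}"
    by (rule finite_set_of_finite_funs) auto
qed (auto simp: colorings_def)

lemma card_colorings_le: "card (colorings n Es k) \<le> k ^ n"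
proof -
  have "inj_on (\<lambda>f. restrict f {..<n}) (colorings n Es k)"
  proof (rule inj_onI)
    fix x y assume xy: "x \<in> colorings n Es k" "y \<in> colorings n Es k" "restrict x {..<n} = restrict y {..<n}"
    show "x = y"
    proof
      fix v show "x v = y v"
        using xy(1,2) fun_cong[OF xy(3), of v] by (cases "v < n") (auto simp: colorings_def)
    qed
  qed
  moreover have "(\<lambda>f. restrict f {..<n}) ` colorings n Es k \<subseteq> PiE {..<n} (\<lambda>_. {..<k})"
    by (auto simp: colorings_def PiE_def extensional_def)
  ultimately have "card (colorings n Es k) \<le> card (PiE {..<n} (\<lambda>_. {..<k}))"
    by (rule card_inj_on_le) (simp add: finite_PiE)
  then show ?thesis by (simp add: card_PiE)
qed

text \<open>A heat bath update draws from the conditional law at one vertex. By reversibility it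
  acts on distributions by the same averaging operator \<open>E {v}\<close> as on functions.\<close>

lemma glauber_dist_Suc:
  assumes "cspace (colorings n Es k)" and t: "\<tau> \<in> colorings n Es k"
  shows "glauber_dist n Es k (Suc t) x0 \<tau> =
    (1 / real n) * (\<Sum>v<n. cspace.E (colorings n Es k) {v} (glauber_dist n Es k t x0) \<tau>)"
proof -
  interpret cspace "colorings n Es k" by fact
  define g where "g = glauber_dist n Es k t x0"
  have fibav: "(\<forall>w. w \<noteq> v \<longrightarrow> \<tau> w = \<sigma> w) \<and> \<tau> v \<in> avail_colors n Es k \<sigma> v \<longleftrightarrow> \<sigma> \<in> fib {v} \<tau>"
    if s: "\<sigma> \<in> colorings n Es k" and v: "v < n" for \<sigma> v
  proof
    assume "(\<forall>w. w \<noteq> v \<longrightarrow> \<tau> w = \<sigma> w) \<and> \<tau> v \<in> avail_colors n Es k \<sigma> v"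
    then show "\<sigma> \<in> fib {v} \<tau>" using s by (auto simp: fib_def)
  next
    assume f: "\<sigma> \<in> fib {v} \<tau>"
    then have e: "\<forall>w. w \<noteq> v \<longrightarrow> \<tau> w = \<sigma> w" by (simp add: fib_def)
    have "\<tau> v \<notin> \<sigma> ` nbrs n Es v"
    proof
      assume "\<tau> v \<in> \<sigma> ` nbrs n Es v"
      then obtain u where u: "u < n" "u \<noteq> v" "{u, v} \<in> Es" "\<tau> v = \<sigma> u" by (auto simp: nbrs_def)
      have "\<tau> u \<noteq> \<tau> v" using t v u(1-3) unfolding colorings_def by blast
      then show False using u e by simp
    qed
    then show "(\<forall>w. w \<noteq> v \<longrightarrow> \<tau> w = \<sigma> w) \<and> \<tau> v \<in> avail_colors n Es k \<sigma> v"
      using e t v by (auto simp: avail_colors_def colorings_def)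
  qed
  \<comment> \<open>The colours available at \<open>v\<close> depend on the other vertices only, so
    their number is constant along the fibre; this is the reversibility of the update.\<close>
  have av: "card (avail_colors n Es k \<sigma> v) = card (fib {v} \<tau>)" if s: "\<sigma> \<in> fib {v} \<tau>" and v: "v < n" for \<sigma> v
  proof -
    have sc: "\<sigma> \<in> colorings n Es k" using s fib_sub by blast
    have "bij_betw (\<lambda>c. \<sigma>(v := c)) (avail_colors n Es k \<sigma> v) (fib {v} \<tau>)"
    proof (rule bij_betwI[where g = "\<lambda>\<theta>. \<theta> v"])
      show "(\<lambda>c. \<sigma>(v := c)) \<in> avail_colors n Es k \<sigma> v \<rightarrow> fib {v} \<tau>"
      proof
        fix c assume c: "c \<in> avail_colors n Es k \<sigma> v"
        have nb: "\<sigma> u \<noteq> c" if "u < n" "u \<noteq> v" "{u, v} \<in> Es" for u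
          using c that by (auto simp: avail_colors_def nbrs_def)
        have "\<sigma>(v := c) \<in> colorings n Es k"
          using sc c v nb by (auto simp: colorings_def avail_colors_def insert_commute)
        then show "\<sigma>(v := c) \<in> fib {v} \<tau>" using s by (auto simp: fib_def)
      qed
      show "(\<lambda>\<theta>. \<theta> v) \<in> fib {v} \<tau> \<rightarrow> avail_colors n Es k \<sigma> v"
      proof
        fix \<theta> assume th: "\<theta> \<in> fib {v} \<tau>"
        have "\<theta> v \<noteq> \<sigma> u" if "u \<in> nbrs n Es v" for u
        proof -
          have "\<theta> u = \<sigma> u" using th s that by (auto simp: fib_def nbrs_def)
          moreover have "\<theta> \<in> colorings n Es k" "u < n" "u \<noteq> v" "{u, v} \<in> Es"
            using th fib_sub that by (auto simp: nbrs_def)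
          then have "\<theta> u \<noteq> \<theta> v" using v unfolding colorings_def by blast
          ultimately show ?thesis by simp
        qed
        moreover have "\<theta> v < k"
        proof -
          have "\<theta> \<in> colorings n Es k" using th fib_sub by blast
          then show ?thesis using v by (simp add: colorings_def)
        qed
        ultimately show "\<theta> v \<in> avail_colors n Es k \<sigma> v" by (auto simp: avail_colors_def)
      qed
      show "(\<sigma>(v := \<theta> v)) = \<theta>" if "\<theta> \<in> fib {v} \<tau>" for \<theta>
        using that s by (auto simp: fib_def fun_eq_iff)
    qed simp
    then show ?thesis by (rule bij_betw_same_card)
  qed
  have "glauber_dist n Es k (Suc t) x0 \<tau> = (\<Sum>\<sigma>\<in>colorings n Es k. (1 / real n) * (\<Sum>v<n. if \<sigma> \<in> fib {v} \<tau> then g \<sigma> / real (card (fib {v} \<tau>)) else 0))"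
  proof (simp only: glauber_dist.simps, rule sum.cong[OF refl])
    fix \<sigma> assume s: "\<sigma> \<in> colorings n Es k"
    have "(\<Sum>v<n. if (\<forall>w. w \<noteq> v \<longrightarrow> \<tau> w = \<sigma> w) \<and> \<tau> v \<in> avail_colors n Es k \<sigma> v
        then 1 / real (card (avail_colors n Es k \<sigma> v)) else 0) = (\<Sum>v<n. if \<sigma> \<in> fib {v} \<tau> then 1 / real (card (fib {v} \<tau>)) else 0)"
      using fibav[OF s] av by (intro sum.cong refl) auto
    then have "g \<sigma> * glauber_P n Es k \<sigma> \<tau> = g \<sigma> * ((1 / real n) * (\<Sum>v<n. if \<sigma> \<in> fib {v} \<tau> then 1 / real (card (fib {v} \<tau>)) else 0))"
      by (simp add: glauber_P_def)
    also have "\<dots> = (1 / real n) * (\<Sum>v<n. g \<sigma> * (if \<sigma> \<in> fib {v} \<tau> then 1 / real (card (fib {v} \<tau>)) else 0))"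
      by (simp add: sum_distrib_left)
    also have "(\<Sum>v<n. g \<sigma> * (if \<sigma> \<in> fib {v} \<tau> then 1 / real (card (fib {v} \<tau>)) else 0))
       = (\<Sum>v<n. if \<sigma> \<in> fib {v} \<tau> then g \<sigma> / real (card (fib {v} \<tau>)) else 0)"
      by (intro sum.cong refl) auto
    finally show "glauber_dist n Es k t x0 \<sigma> * glauber_P n Es k \<sigma> \<tau> =
      (1 / real n) * (\<Sum>v<n. if \<sigma> \<in> fib {v} \<tau> then g \<sigma> / real (card (fib {v} \<tau>)) else 0)"
      by (simp add: g_def)
  qed
  also have "\<dots> = (1 / real n) * (\<Sum>\<sigma>\<in>colorings n Es k. \<Sum>v<n. if \<sigma> \<in> fib {v} \<tau> then g \<sigma> / real (card (fib {v} \<tau>)) else 0)"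
    by (rule sum_distrib_left[symmetric])
  also have "(\<Sum>\<sigma>\<in>colorings n Es k. \<Sum>v<n. if \<sigma> \<in> fib {v} \<tau> then g \<sigma> / real (card (fib {v} \<tau>)) else 0)
     = (\<Sum>v<n. \<Sum>\<sigma>\<in>colorings n Es k. if \<sigma> \<in> fib {v} \<tau> then g \<sigma> / real (card (fib {v} \<tau>)) else 0)"
    by (rule sum.swap)
  also have "\<dots> = (\<Sum>v<n. E {v} g \<tau>)"
  proof (rule sum.cong[OF refl])
    fix v
    have "(\<Sum>\<sigma>\<in>colorings n Es k. if \<sigma> \<in> fib {v} \<tau> then g \<sigma> / real (card (fib {v} \<tau>)) else 0)
      = (\<Sum>\<sigma>\<in>fib {v} \<tau>. g \<sigma> / real (card (fib {v} \<tau>)))"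
      using fib_sub[of "{v}" \<tau>] by (subst sum.inter_restrict[symmetric]) (auto intro!: sum.cong)
    then show "(\<Sum>\<sigma>\<in>colorings n Es k. if \<sigma> \<in> fib {v} \<tau> then g \<sigma> / real (card (fib {v} \<tau>)) else 0) = E {v} g \<tau>"
      by (simp add: E_def sum_divide_distrib)
  qed
  finally show ?thesis by (simp add: g_def)
qed

text \<open>The deviation from uniform contracts in square norm: averaging over the updated vertex
  loses at least the mean of the single-site variances, by \<open>P\<close> a fraction 1 / (n * T)
  of the norm. The squared norm starts at no more than 1, and the passage to total variation
  multiplies it by at most \<open>k ^ n\<close>. This explains \<open>n * ln k\<close>; the summand
  2 enters as exp (- 2) \<le> 1 / 4.\<close>

lemma mixes_by_Poincare:
  assumes n: "0 < n" and k: "1 \<le> k" and T: "0 < T"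
    and P: "\<And>f. cspace.EV (colorings n Es k) {..<n} f \<le> T * (\<Sum>v<n. cspace.EV (colorings n Es k) {v} f)"
    and t: "real n * T * (real n * ln (real k) + 2) \<le> real t"
  shows "mixes_by n Es k t"
  unfolding mixes_by_def
proof
  fix x0 assume x0: "x0 \<in> colorings n Es k"
  interpret cspace "colorings n Es k" by unfold_locales (rule finite_colorings)
  let ?Om = "colorings n Es k"
  define N where "N = real (card ?Om)"
  define g where "g i \<tau> = glauber_dist n Es k i x0 \<tau> - 1 / N" for i \<tau>
  have Npos: "1 \<le> N" using x0 finite_colorings[of n Es k] card_gt_0_iff[of ?Om] by (auto simp: N_def Suc_le_eq)
  have gS: "g (Suc i) \<tau> = (1 / real n) * (\<Sum>v<n. E {v} (g i) \<tau>)" if "\<tau> \<in> ?Om" for i \<tau>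
  proof -
    have c: "E {v} (\<lambda>_. 1 / N) \<tau> = 1 / N" for v using fib_ne[OF that] by (simp add: E_def)
    have "(\<Sum>v<n. E {v} (g i) \<tau>) = (\<Sum>v<n. E {v} (glauber_dist n Es k i x0) \<tau> - 1 / N)"
      unfolding g_def E_diff c ..
    also have "\<dots> = (\<Sum>v<n. E {v} (glauber_dist n Es k i x0) \<tau>) - real n * (1 / N)"
      by (simp add: sum_subtractf)
    finally show ?thesis using n glauber_dist_Suc[OF cspace_axioms that, of i x0]
      by (simp only: g_def) (simp add: right_diff_distrib)
  qed
  have sg: "(\<Sum>\<tau>\<in>?Om. g i \<tau>) = 0" for i
  proof (induction i)
    case 0
    have "(\<Sum>\<tau>\<in>?Om. g 0 \<tau>) = (\<Sum>\<tau>\<in>?Om. if \<tau> = x0 then 1 else 0) - (\<Sum>\<tau>\<in>?Om. 1 / N)"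
      by (simp add: g_def sum_subtractf)
    also have "\<dots> = 0"
    proof -
      have "?Om \<noteq> {}" using x0 by blast
      then show ?thesis using x0 finite_colorings[of n Es k] by (simp add: N_def)
    qed
    finally show ?case .
  next
    case (Suc i)
    have "(\<Sum>\<tau>\<in>?Om. g (Suc i) \<tau>) = (1 / real n) * (\<Sum>\<tau>\<in>?Om. \<Sum>v<n. E {v} (g i) \<tau>)"
      unfolding sum_distrib_left using gS by (intro sum.cong refl) (simp add: sum_distrib_left)
    also have "(\<Sum>\<tau>\<in>?Om. \<Sum>v<n. E {v} (g i) \<tau>) = (\<Sum>v<n. \<Sum>\<tau>\<in>?Om. E {v} (g i) \<tau>)" by (rule sum.swap)
    also have "\<dots> = 0" using Suc by (simp add: sum_E)
    finally show ?case by simp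
  qed
  define r where "r i = (\<Sum>\<tau>\<in>?Om. (g i \<tau>)\<^sup>2)" for i
  have r_nn: "0 \<le> r i" for i by (simp add: r_def sum_nonneg)
  have EVall: "EV {..<n} (g i) = r i" for i
  proof -
    have out: "\<theta> v = 0" if "\<theta> \<in> ?Om" "v \<notin> {..<n}" for \<theta> v using that by (simp add: colorings_def)
    have "fib {..<n} \<tau> = ?Om" if "\<tau> \<in> ?Om" for \<tau>
      using that by (auto simp: fib_def out)
    then have "E {..<n} (g i) \<tau> = 0" if "\<tau> \<in> ?Om" for \<tau> using that sg by (simp add: E_def)
    then show ?thesis by (simp add: EV_def r_def)
  qed
  define \<gamma> where "\<gamma> = 1 / (real n * T)"
  have step: "r (Suc i) \<le> (1 - \<gamma>) * r i" for i
  proof -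
    have "r (Suc i) \<le> (\<Sum>\<tau>\<in>?Om. (\<Sum>v<n. (E {v} (g i) \<tau>)\<^sup>2) / real n)"
      unfolding r_def
    proof (rule sum_mono)
      fix \<tau> assume "\<tau> \<in> ?Om"
      then have "(g (Suc i) \<tau>)\<^sup>2 = (\<Sum>v<n. E {v} (g i) \<tau>)\<^sup>2 / (real n)\<^sup>2"
        using gS by (simp add: power_divide)
      also have "\<dots> \<le> ((\<Sum>v<n. (E {v} (g i) \<tau>)\<^sup>2) * real n) / (real n)\<^sup>2"
        using Cauchy_Schwarz_ineq_sum[of "\<lambda>v. E {v} (g i) \<tau>" "\<lambda>_. 1" "{..<n}"] by (intro divide_right_mono) auto
      also have "\<dots> = (\<Sum>v<n. (E {v} (g i) \<tau>)\<^sup>2) / real n" using n by (simp add: power2_eq_square)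
      finally show "(g (Suc i) \<tau>)\<^sup>2 \<le> (\<Sum>v<n. (E {v} (g i) \<tau>)\<^sup>2) / real n" .
    qed
    also have "\<dots> = (\<Sum>v<n. \<Sum>\<tau>\<in>?Om. (E {v} (g i) \<tau>)\<^sup>2) / real n"
      unfolding sum_divide_distrib[symmetric] by (subst sum.swap) (rule refl)
    also have "\<dots> = (\<Sum>v<n. r i - EV {v} (g i)) / real n"
      by (simp add: EV_eq r_def)
    also have "\<dots> = r i - (\<Sum>v<n. EV {v} (g i)) / real n"
      using n by (simp add: sum_subtractf diff_divide_distrib)
    also have "\<dots> \<le> r i - (r i / T) / real n"
    proof -
      have "r i / T \<le> (\<Sum>v<n. EV {v} (g i))"
        using P[of "g i"] T EVall[of i] by (simp add: divide_le_eq mult.commute)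
      then have "r i / T / real n \<le> (\<Sum>v<n. EV {v} (g i)) / real n" by (rule divide_right_mono) simp
      then show ?thesis by linarith
    qed
    also have "\<dots> = (1 - \<gamma>) * r i" by (simp add: \<gamma>_def left_diff_distrib)
    finally show ?thesis .
  qed
  have g0: "0 < \<gamma>" using n T by (simp add: \<gamma>_def)
  have rt: "r i \<le> exp (- \<gamma> * real i) * r 0" for i
  proof (induction i)
    case (Suc i)
    have "r (Suc i) \<le> (1 - \<gamma>) * r i" by (rule step)
    also have "\<dots> \<le> exp (- \<gamma>) * r i" using exp_ge_add_one_self[of "- \<gamma>"] r_nn by (intro mult_right_mono) auto
    also have "\<dots> \<le> exp (- \<gamma>) * (exp (- \<gamma> * real i) * r 0)" using Suc by simp
    also have "\<dots> = exp (- \<gamma> * real (Suc i)) * r 0" by (simp add: exp_add[symmetric] algebra_simps)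
    finally show ?case .
  qed simp
  have r01: "r 0 \<le> 1"
  proof -
    have "r 0 = (\<Sum>\<tau>\<in>?Om. g 0 \<tau> * (if \<tau> = x0 then 1 else 0)) - (1 / N) * (\<Sum>\<tau>\<in>?Om. g 0 \<tau>)"
      unfolding r_def sum_distrib_left sum_subtractf[symmetric]
      by (intro sum.cong refl) (simp add: g_def power2_eq_square algebra_simps)
    also have "(\<Sum>\<tau>\<in>?Om. g 0 \<tau> * (if \<tau> = x0 then 1 else 0)) = (\<Sum>\<tau>\<in>?Om. if \<tau> = x0 then g 0 x0 else 0)"
      by (intro sum.cong refl) simp
    also have "\<dots> - (1 / N) * (\<Sum>\<tau>\<in>?Om. g 0 \<tau>) = g 0 x0" using x0 finite_colorings[of n Es k] sg[of 0] by simp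
    also have "\<dots> \<le> 1" using Npos by (simp add: g_def)
    finally show ?thesis .
  qed
  have "(\<Sum>\<tau>\<in>?Om. \<bar>g t \<tau>\<bar>)\<^sup>2 \<le> r t * N"
    using Cauchy_Schwarz_ineq_sum[of "\<lambda>\<tau>. \<bar>g t \<tau>\<bar>" "\<lambda>_. 1" ?Om] by (simp add: r_def N_def)
  also have "\<dots> \<le> exp (- \<gamma> * real t) * N"
  proof -
    have "r t \<le> exp (- \<gamma> * real t)" using order_trans[OF rt[of t] mult_left_mono[OF r01 exp_ge_zero]] by simp
    then show ?thesis using Npos by (intro mult_right_mono) auto
  qed
  also have "\<dots> \<le> exp (- (real n * ln (real k) + 2)) * N"
  proof -
    have "real n * ln (real k) + 2 \<le> \<gamma> * real t"
      using t n T by (simp add: \<gamma>_def field_simps)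
    then show ?thesis using Npos by (intro mult_right_mono) auto
  qed
  also have "\<dots> \<le> exp (- (real n * ln (real k) + 2)) * exp (real n * ln (real k))"
  proof -
    have "N \<le> real (k ^ n)" unfolding N_def using card_colorings_le of_nat_le_iff by blast
    also have "\<dots> = exp (real n * ln (real k))" using k by (simp add: exp_of_nat_mult)
    finally show ?thesis by (intro mult_left_mono) auto
  qed
  also have "\<dots> = exp (-2)" by (simp add: exp_add[symmetric])
  also have "\<dots> \<le> (1 / 2)\<^sup>2"
  proof -
    have "(2::real) \<le> exp 1" using exp_ge_add_one_self[of 1] by simp
    then have "2\<^sup>2 \<le> (exp 1 :: real)\<^sup>2" by (intro power_mono) auto
    then have "(4::real) \<le> exp 2" by (simp add: exp_double[symmetric] power2_eq_square exp_add[symmetric])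
    then show ?thesis by (simp add: exp_minus field_simps)
  qed
  finally have "(\<Sum>\<tau>\<in>?Om. \<bar>g t \<tau>\<bar>) \<le> 1 / 2" by (rule power2_le_imp_le) simp
  then show "tv_to_uniform n Es k t x0 \<le> 1 / 4"
    by (simp add: tv_to_uniform_def g_def N_def)
qed

lemma mixing_time_le:
  assumes "mixes_by n Es k t"
  shows "\<exists>T. mixing_time n Es k = enat T \<and> T \<le> t"
proof -
  have "\<exists>T. mixes_by n Es k T" using assms by blast
  then have "mixing_time n Es k = enat (LEAST T. mixes_by n Es k T)" by (simp add: mixing_time_def)
  moreover have "(LEAST T. mixes_by n Es k T) \<le> t" using assms by (rule Least_le)
  ultimately show ?thesis by blast
qed

section \<open>First moments in the random graph\<close>

text \<open>Trees are built by hanging a whole subtree at the root, so each larger tree splits into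
  two rooted trees and one edge; the quadratic recursion of \<open>tree_sum\<close> needs this
  shape. The edge set is recorded so that its presence in the graph can be charged.\<close>

inductive rooted_tree :: "'a \<Rightarrow> 'a set \<Rightarrow> 'a set set \<Rightarrow> bool" where
  single: "rooted_tree v {v} {}"
| join: "rooted_tree v W F \<Longrightarrow> rooted_tree w W' F' \<Longrightarrow> W \<inter> W' = {} \<Longrightarrow> rooted_tree v (W \<union> W') (insert {v, w} (F \<union> F'))"

lemma rooted_tree_props:
  "rooted_tree v W F \<Longrightarrow> finite W \<and> v \<in> W \<and> finite F \<and> card F + 1 = card W \<and> (\<forall>e\<in>F. \<exists>x y. x \<in> W \<and> y \<in> W \<and> x \<noteq> y \<and> e = {x, y})"
proof (induction rule: rooted_tree.induct)
  case (join v W F w W' F')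
  have d1: "F \<inter> F' = {}"
  proof (rule ccontr)
    assume "F \<inter> F' \<noteq> {}"
    then obtain e where e: "e \<in> F" "e \<in> F'" by blast
    then obtain x y where "x \<in> W" "e = {x, y}" using join by blast
    moreover obtain x' y' where "x' \<in> W'" "y' \<in> W'" "e = {x', y'}" using join e by blast
    ultimately show False using join.hyps by (auto simp: doubleton_eq_iff)
  qed
  have d2: "{v, w} \<notin> F \<union> F'"
  proof
    assume "{v, w} \<in> F \<union> F'"
    then obtain x y where "(x \<in> W \<and> y \<in> W) \<or> (x \<in> W' \<and> y \<in> W')" "{v, w} = {x, y}" using join by blast
    moreover have "v \<in> W" "w \<in> W'" using join by auto
    ultimately show False using join.hyps by (auto simp: doubleton_eq_iff)
  qed
  have "card (insert {v, w} (F \<union> F')) = 1 + card F + card F'"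
    using d1 d2 join by (simp add: card_Un_disjoint)
  moreover have "card (W \<union> W') = card W + card W'" using join by (intro card_Un_disjoint) auto
  moreover have "v \<noteq> w" using join by auto
  then have "\<forall>e\<in>insert {v, w} (F \<union> F'). \<exists>x y. x \<in> W \<union> W' \<and> y \<in> W \<union> W' \<and> x \<noteq> y \<and> e = {x, y}"
    using join.IH by (metis UnCI UnE insertE)
  ultimately show ?case using join by auto
qed auto

text \<open>A leaf may be attached at any vertex, although the inductive rule attaches at the root
  only. This is what growing a spanning tree requires.\<close>

lemma rooted_tree_extend: "rooted_tree v W F \<Longrightarrow> u \<in> W \<Longrightarrow> x \<notin> W \<Longrightarrow> rooted_tree v (insert x W) (insert {u, x} F)"
proof (induction rule: rooted_tree.induct)
  case (single v)
  have "rooted_tree v ({v} \<union> {x}) (insert {v, x} ({} \<union> {}))"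
    by (rule rooted_tree.join[OF rooted_tree.single rooted_tree.single]) (use single in auto)
  then show ?case using single by (simp add: insert_commute)
next
  case (join v W F w W' F')
  show ?case
  proof (cases "u \<in> W")
    case True
    have "rooted_tree v (insert x W \<union> W') (insert {v, w} (insert {u, x} F \<union> F'))"
      by (rule rooted_tree.join) (use join True in auto)
    then show ?thesis by (simp add: insert_commute)
  next
    case False
    have "rooted_tree v (W \<union> insert x W') (insert {v, w} (F \<union> insert {u, x} F'))"
      by (rule rooted_tree.join) (use join False in auto)
    then show ?thesis by (simp add: insert_commute)
  qed
qed

lemma (in sgraph) conn_RT:
  assumes "conn W" "finite W" "v \<in> W"
  shows "\<exists>F. rooted_tree v W F \<and> (\<forall>e\<in>F. \<exists>x y. adj x y \<and> e = {x, y})"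
proof -
  have "\<exists>P F. P \<subseteq> W \<and> card P = m \<and> rooted_tree v P F \<and> (\<forall>e\<in>F. \<exists>x y. adj x y \<and> e = {x, y})"
    if "1 \<le> m" "m \<le> card W" for m
    using that
  proof (induction m rule: nat_induct_at_least)
    case base
    then show ?case using assms(3) rooted_tree.single[of v] by (intro exI[of _ "{v}"] exI[of _ "{}"]) auto
  next
    case (Suc m)
    then obtain P F where P: "P \<subseteq> W" "card P = m" "rooted_tree v P F" "\<forall>e\<in>F. \<exists>x y. adj x y \<and> e = {x, y}" by auto
    have "P \<noteq> W" using P Suc by auto
    moreover have "P \<noteq> {}" using rooted_tree_props[OF P(3)] by auto
    ultimately obtain x y where xy: "x \<in> P" "y \<in> W" "y \<notin> P" "adj x y"
      using conn_edge[OF assms(1) P(1)] by metis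
    have "finite P" using P(1) assms(2) finite_subset by blast
    then have "card (insert y P) = Suc m" using xy P by simp
    moreover have "rooted_tree v (insert y P) (insert {x, y} F)" by (rule rooted_tree_extend[OF P(3) xy(1,3)])
    ultimately show ?case using P xy by (intro exI[of _ "insert y P"] exI[of _ "insert {x, y} F"]) auto
  qed
  from this[of "card W"] obtain P F where P: "P \<subseteq> W" "card P = card W" "rooted_tree v P F" "\<forall>e\<in>F. \<exists>x y. adj x y \<and> e = {x, y}"
    using conn_ne[OF assms(1)] assms(2) by (auto simp: Suc_le_eq card_gt_0_iff)
  then have "P = W" using card_subset_eq[OF assms(2)] by blast
  then show ?thesis using P by blast
qed

definition rooted_trees :: "nat \<Rightarrow> nat \<Rightarrow> (nat set \<times> nat set set) set" where
  "rooted_trees n v = {t. rooted_tree v (fst t) (snd t) \<and> fst t \<subseteq> {..<n}}"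

lemma rooted_trees_sub: "rooted_trees n v \<subseteq> Pow {..<n} \<times> Pow (Pow {..<n})"
proof
  fix t assume t: "t \<in> rooted_trees n v"
  have "snd t \<subseteq> Pow {..<n}"
  proof
    fix e assume "e \<in> snd t"
    then obtain x y where "x \<in> fst t" "y \<in> fst t" "e = {x, y}"
      using rooted_tree_props[of v "fst t" "snd t"] t by (auto simp: rooted_trees_def)
    then show "e \<in> Pow {..<n}" using t by (auto simp: rooted_trees_def)
  qed
  then show "t \<in> Pow {..<n} \<times> Pow (Pow {..<n})" using t by (auto simp: rooted_trees_def mem_Times_iff)
qed

lemma finite_RTs [simp]: "finite (rooted_trees n v)"
  by (rule finite_subset[OF rooted_trees_sub]) simp

text \<open>Splitting off the last subtree at the root shows that the generating function of labelled
trees satisfies \<open>x = z + x\<^sup>2\<close>, whose smaller solution is \<open>1/2\<close> at \<open>z = 1/4\<close>.\<close>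

lemma tree_sum:
  assumes n: "0 < n"
  shows "(\<Sum>t\<in>rooted_trees n v. (1 / 4) ^ card (fst t) * (1 / real n) ^ (card (fst t) - 1)) \<le> 1 / 2"
proof -
  define wt :: "nat set \<times> nat set set \<Rightarrow> real" where "wt t = (1 / 4) ^ card (fst t) * (1 / real n) ^ (card (fst t) - 1)" for t
  \<comment> \<open>Truncation by size makes the recursion well-founded, while the bound 1 / 2 is
    the same at every level.\<close>
  define R where "R S v = {t \<in> rooted_trees n v. card (fst t) \<le> S}" for S v
  have wt0: "0 \<le> wt t" for t by (simp add: wt_def)
  have fR: "finite (R S v)" for S v by (simp add: R_def)
  have bnd: "(\<Sum>t\<in>R S v. wt t) \<le> 1 / 2" for S v
  proof (induction S arbitrary: v)
    case 0
    have "R 0 v = {}" using rooted_tree_props by (fastforce simp: R_def rooted_trees_def)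
    then show ?case by simp
  next
    case (Suc S)
    define J where "J = (SIGMA w:{..<n}. R S v \<times> R S w)"
    define jn where "jn q = (fst (fst (snd q)) \<union> fst (snd (snd q)), insert {v, fst q} (snd (fst (snd q)) \<union> snd (snd (snd q))))"
      for q :: "nat \<times> (nat set \<times> nat set set) \<times> (nat set \<times> nat set set)"
    define J' where "J' = {q \<in> J. fst (fst (snd q)) \<inter> fst (snd (snd q)) = {}}"
    have fJ: "finite J" using fR by (simp add: J_def)
    have sub: "R (Suc S) v \<subseteq> insert ({v}, {}) (jn ` J')"
    proof
      fix t assume t: "t \<in> R (Suc S) v"
      have rt: "rooted_tree v (fst t) (snd t)" using t by (simp add: R_def rooted_trees_def)
      then show "t \<in> insert ({v}, {}) (jn ` J')"
      proof cases
        case single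
        then show ?thesis by (simp add: prod_eq_iff)
      next
        case (join W F w W' F')
        have p: "finite W" "finite W'" "v \<in> W" "w \<in> W'" using rooted_tree_props[OF join(3)] rooted_tree_props[OF join(4)] by auto
        have sz: "card W + card W' \<le> Suc S"
          using t join p card_Un_disjoint[OF p(1,2) join(5)] by (simp add: R_def)
        have "card W \<ge> 1" "card W' \<ge> 1" using p by (auto simp: Suc_le_eq card_gt_0_iff)
        then have "(W, F) \<in> R S v" "(W', F') \<in> R S w" using sz t join by (auto simp: R_def rooted_trees_def)
        moreover have "w < n" using p t join by (auto simp: R_def rooted_trees_def)
        ultimately have "(w, (W, F), (W', F')) \<in> J'" using join by (simp add: J'_def J_def)
        moreover have "t = jn (w, (W, F), (W', F'))" using join by (simp add: jn_def prod_eq_iff)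
        ultimately show ?thesis by blast
      qed
    qed
    have wj: "wt (jn q) = wt (fst (snd q)) * wt (snd (snd q)) / real n" if q: "q \<in> J'" for q
    proof -
      obtain w W F W' F' where qq: "q = (w, (W, F), (W', F'))" by (metis prod.collapse)
      have r: "rooted_tree v W F" "rooted_tree w W' F'" "W \<inter> W' = {}" using q qq by (auto simp: J'_def J_def R_def rooted_trees_def)
      have p: "finite W" "finite W'" "v \<in> W" "w \<in> W'" using rooted_tree_props[OF r(1)] rooted_tree_props[OF r(2)] by auto
      have "card W \<ge> 1" "card W' \<ge> 1" using p by (auto simp: Suc_le_eq card_gt_0_iff)
      moreover have "card (W \<union> W') = card W + card W'" by (rule card_Un_disjoint[OF p(1,2) r(3)])
      ultimately have c: "card (W \<union> W') - 1 = (card W - 1) + (card W' - 1) + 1" "card (W \<union> W') = card W + card W'" by auto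
      have "wt (jn q) = (1 / 4) ^ card (W \<union> W') * (1 / real n) ^ (card (W \<union> W') - 1)"
        by (simp only: qq jn_def wt_def fst_conv snd_conv)
      also have "\<dots> = (1 / 4) ^ (card W + card W') * (1 / real n) ^ ((card W - 1) + (card W' - 1) + 1)"
        by (simp only: c(1)) (simp only: c(2))
      also have "\<dots> = wt (W, F) * wt (W', F') / real n"
        by (simp only: power_add wt_def fst_conv power_one_right) simp
      finally show ?thesis by (simp only: qq fst_conv snd_conv)
    qed
    have fJ': "finite J'" unfolding J'_def by (rule finite_subset[OF _ fJ]) blast
    have fi: "finite (insert ({v}, {}) (jn ` J'))" using fJ' by simp
    have "(\<Sum>t\<in>R (Suc S) v. wt t) \<le> (\<Sum>t\<in>insert ({v}, {}) (jn ` J'). wt t)"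
      by (rule sum_mono2[OF fi sub wt0])
    also have "\<dots> \<le> wt ({v}, {}) + (\<Sum>t\<in>jn ` J'. wt t)"
      using fJ' wt0[of "({v}, {})"] by (simp add: sum.insert_if)
    also have "(\<Sum>t\<in>jn ` J'. wt t) \<le> (\<Sum>q\<in>J'. wt (jn q))"
      using sum_image_le[OF fJ', of wt jn] wt0 by (simp only: comp_def)
    also have "\<dots> = (\<Sum>q\<in>J'. wt (fst (snd q)) * wt (snd (snd q)) / real n)"
      by (rule sum.cong[OF refl wj])
    also have "\<dots> \<le> (\<Sum>q\<in>J. wt (fst (snd q)) * wt (snd (snd q)) / real n)"
    proof (rule sum_mono2[OF fJ])
      show "J' \<subseteq> J" unfolding J'_def by blast
      show "0 \<le> wt (fst (snd q)) * wt (snd (snd q)) / real n" for q using wt0 by simp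
    qed
    also have "\<dots> = (\<Sum>w<n. (\<Sum>t\<in>R S v. wt t) * (\<Sum>t\<in>R S w. wt t) / real n)"
    proof -
      have "(\<Sum>w<n. \<Sum>t\<in>R S v \<times> R S w. wt (fst t) * wt (snd t) / real n)
        = (\<Sum>q\<in>J. wt (fst (snd q)) * wt (snd (snd q)) / real n)"
        unfolding J_def using fR
        by (subst sum.Sigma) (simp_all add: case_prod_unfold)
      moreover have "(\<Sum>t\<in>R S v \<times> R S w. wt (fst t) * wt (snd t) / real n)
        = (\<Sum>t\<in>R S v. wt t) * (\<Sum>t\<in>R S w. wt t) / real n" for w
        by (simp add: sum_product sum.cartesian_product case_prod_unfold sum_divide_distrib[symmetric])
      ultimately show ?thesis by simp
    qed
    \<comment> \<open>The n choices of the subtree's root are paid by the factor 1 / n of the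
      connecting edge. Together with the single vertex this gives 1 / 4 + 1 / 4 = 1 / 2.\<close>
    also have "\<dots> \<le> (\<Sum>w<n. (1 / 2) * (1 / 2) / real n)"
      using Suc wt0 by (intro sum_mono divide_right_mono mult_mono) (auto simp: sum_nonneg)
    also have "\<dots> = 1 / 4" using n by simp
    also have "wt ({v}, {}) = 1 / 4" by (simp add: wt_def)
    finally show ?case by simp
  qed
  have "rooted_trees n v = R n v"
  proof -
    have "card W \<le> n" if "W \<subseteq> {..<n}" for W using card_mono[OF _ that] by simp
    then show ?thesis by (auto simp: R_def rooted_trees_def)
  qed
  then show ?thesis using bnd[of n v] by (simp add: wt_def)
qed

section \<open>Exponential moments in the random graph\<close>

definition gnp_mean :: "nat \<Rightarrow> real \<Rightarrow> (nat set set \<Rightarrow> real) \<Rightarrow> real" where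
  "gnp_mean n p h = (\<Sum>G\<in>Pow (vertex_pairs n). p ^ card G * (1 - p) ^ (card (vertex_pairs n) - card G) * h G)"

lemma finite_vertex_pairs [simp]: "finite (vertex_pairs n)"
  by (rule finite_subset[of _ "Pow {..<n}"]) (auto simp: vertex_pairs_def)

lemma gnp_prob_eq_mean: "gnp_prob n p A = gnp_mean n p (\<lambda>G. if A G then 1 else 0)"
proof -
  have "{E. E \<subseteq> vertex_pairs n \<and> A E} = {E \<in> Pow (vertex_pairs n). A E}" by auto
  then show ?thesis unfolding gnp_prob_def gnp_mean_def
    by (simp only: sum.inter_filter[OF finite_Pow_iff[THEN iffD2, OF finite_vertex_pairs]])
       (intro sum.cong refl, simp)
qed

lemma gnp_mean_mono:
  assumes "0 \<le> p" "p \<le> 1" "\<And>G. G \<subseteq> vertex_pairs n \<Longrightarrow> h G \<le> g G"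
  shows "gnp_mean n p h \<le> gnp_mean n p g"
  unfolding gnp_mean_def using assms by (intro sum_mono mult_left_mono) auto

lemma gnp_mean_sum: "gnp_mean n p (\<lambda>G. \<Sum>i\<in>I. h i G) = (\<Sum>i\<in>I. gnp_mean n p (h i))"
  unfolding gnp_mean_def sum_distrib_left by (rule sum.swap)

lemma gnp_mean_cmult: "gnp_mean n p (\<lambda>G. c * h G) = c * gnp_mean n p h"
  unfolding gnp_mean_def sum_distrib_left by (intro sum.cong refl) simp

lemma gnp_mean_add: "gnp_mean n p (\<lambda>G. h G + g G) = gnp_mean n p h + gnp_mean n p g"
  unfolding gnp_mean_def by (simp add: distrib_left sum.distrib)

text \<open>Independence of the edges: expanding the product over subsets of the pairs gives the sum
  over graphs, and edges of \<open>F\<close> lose the alternative of being absent.\<close>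

lemma gnp_mean_prod:
  assumes "F \<subseteq> vertex_pairs n"
  shows "gnp_mean n p (\<lambda>G. if F \<subseteq> G then \<Prod>e\<in>G. \<phi> e else 0)
    = (\<Prod>e\<in>vertex_pairs n. p * \<phi> e + (if e \<in> F then 0 else 1 - p))"
proof -
  let ?V = "vertex_pairs n"
  have "(\<Prod>e\<in>?V. p * \<phi> e + (if e \<in> F then 0 else 1 - p))
    = (\<Sum>G\<in>Pow ?V. (\<Prod>e\<in>G. p * \<phi> e) * (\<Prod>e\<in>?V - G. if e \<in> F then 0 else 1 - p))"
    by (rule prod_add) simp
  also have "\<dots> = gnp_mean n p (\<lambda>G. if F \<subseteq> G then \<Prod>e\<in>G. \<phi> e else 0)"
    unfolding gnp_mean_def
  proof (rule sum.cong[OF refl])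
    fix G assume G: "G \<in> Pow ?V"
    have fG: "finite G" using G finite_subset[OF _ finite_vertex_pairs] by auto
    show "(\<Prod>e\<in>G. p * \<phi> e) * (\<Prod>e\<in>?V - G. if e \<in> F then 0 else 1 - p)
      = p ^ card G * (1 - p) ^ (card ?V - card G) * (if F \<subseteq> G then \<Prod>e\<in>G. \<phi> e else 0)"
    proof (cases "F \<subseteq> G")
      case True
      then have "(\<Prod>e\<in>?V - G. if e \<in> F then 0 else 1 - p) = (\<Prod>e\<in>?V - G. 1 - p)"
        by (intro prod.cong refl) auto
      also have "\<dots> = (1 - p) ^ (card ?V - card G)" using G fG by (simp add: card_Diff_subset)
      finally show ?thesis using True by (simp add: prod.distrib)
    next
      case False
      then obtain e where "e \<in> F" "e \<notin> G" by blast
      then have "\<exists>e\<in>?V - G. (if e \<in> F then 0 else 1 - p) = 0" using assms by auto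
      then have "(\<Prod>e\<in>?V - G. if e \<in> F then 0 else 1 - p) = 0" by (intro prod_zero) simp_all
      then show ?thesis using False by simp
    qed
  qed
  finally show ?thesis by simp
qed

definition gdeg :: "nat \<Rightarrow> nat set set \<Rightarrow> nat \<Rightarrow> nat" where
  "gdeg n G x = card {u. gadj n G x u}"

lemma gdeg_edges:
  assumes G: "G \<subseteq> vertex_pairs n"
  shows "gdeg n G x = card {e \<in> G. x \<in> e}"
proof -
  have "bij_betw (\<lambda>u. {x, u}) {u. gadj n G x u} {e \<in> G. x \<in> e}"
    unfolding bij_betw_def
  proof
    show "inj_on (\<lambda>u. {x, u}) {u. gadj n G x u}" by (auto simp: inj_on_def doubleton_eq_iff)
    show "(\<lambda>u. {x, u}) ` {u. gadj n G x u} = {e \<in> G. x \<in> e}"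
    proof
      show "(\<lambda>u. {x, u}) ` {u. gadj n G x u} \<subseteq> {e \<in> G. x \<in> e}" by (auto simp: gadj_def)
      show "{e \<in> G. x \<in> e} \<subseteq> (\<lambda>u. {x, u}) ` {u. gadj n G x u}"
      proof
        fix e assume e: "e \<in> {e \<in> G. x \<in> e}"
        then obtain u w where uw: "u < w" "w < n" "e = {u, w}" using G by (auto simp: vertex_pairs_def)
        define y where "y = (if x = u then w else u)"
        have "e = {x, y}" "x < n" "y < n" "x \<noteq> y" using e uw by (auto simp: y_def)
        then show "e \<in> (\<lambda>u. {x, u}) ` {u. gadj n G x u}" using e by (intro image_eqI[of _ _ y]) (auto simp: gadj_def)
      qed
    qed
  qed
  then show ?thesis unfolding gdeg_def by (rule bij_betw_same_card)
qed

lemma sum_dg: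
  assumes G: "G \<subseteq> vertex_pairs n" and M: "finite M"
  shows "(\<Sum>x\<in>M. gdeg n G x) = (\<Sum>e\<in>G. card (e \<inter> M))"
proof -
  have fG: "finite G" using G finite_vertex_pairs finite_subset by blast
  have "(\<Sum>x\<in>M. gdeg n G x) = (\<Sum>x\<in>M. \<Sum>e\<in>G. if x \<in> e then 1 else 0)"
    using fG by (simp add: gdeg_edges[OF G] sum.inter_filter[symmetric])
  also have "\<dots> = (\<Sum>e\<in>G. \<Sum>x\<in>M. if x \<in> e then 1 else 0)" by (rule sum.swap)
  also have "\<dots> = (\<Sum>e\<in>G. card (e \<inter> M))"
    using M by (intro sum.cong refl) (simp add: sum.inter_filter[symmetric] Int_def conj_commute)
  finally show ?thesis .
qed

text \<open>A degree sum counts each edge by its number of ends in \<open>M\<close>, so its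
  exponential factors over the edges. A forced edge costs at most \<open>p * exp (2 * b)\<close>,
  and the remaining exponent is linear in the number of ends, of which every vertex has at most
  n.\<close>

lemma gnp_mean_degrees:
  assumes F: "F \<subseteq> vertex_pairs n" and M: "M \<subseteq> {..<n}" and p: "0 \<le> p" "p \<le> 1" and np: "real n * p \<le> d"
    and b: "0 \<le> b" "b \<le> 1 / 2"
  shows "gnp_mean n p (\<lambda>G. if F \<subseteq> G then exp (b * (\<Sum>x\<in>M. real (gdeg n G x))) else 0)
     \<le> (p * exp (2 * b)) ^ card F * exp (d * (b + 2 * b\<^sup>2)) ^ card M"
proof -
  let ?V = "vertex_pairs n"
  have fM: "finite M" using M finite_subset by blast
  define \<phi> where "\<phi> e = exp (b * real (card (e \<inter> M)))" for e
  have c2: "card (e \<inter> M) \<le> 2" if ev: "e \<in> ?V" for e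
  proof -
    obtain u w where "e = {u, w}" using ev by (auto simp: vertex_pairs_def)
    then have "card (e \<inter> M) \<le> card {u, w}" by (intro card_mono) auto
    also have "\<dots> \<le> 2" by (simp add: card_insert_if)
    finally show ?thesis .
  qed
  have c0: "1 \<le> \<phi> e" for e using b by (simp add: \<phi>_def)
  have e2: "exp (2 * b) \<le> 1 + 2 * b + (2 * b)\<^sup>2" using b by (intro exp_bound) auto
  \<comment> \<open>The quadratic term is such that one end and two ends in \<open>M\<close> are
    covered by the same bound per end.\<close>
  have phi1: "\<phi> e - 1 \<le> real (card (e \<inter> M)) * (b + 2 * b\<^sup>2)" if e: "e \<in> ?V" for e
  proof -
    consider "card (e \<inter> M) = 0" | "card (e \<inter> M) = 1" | "card (e \<inter> M) = 2" using c2[OF e] by linarith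
    then show ?thesis
    proof cases
      case 2
      have "exp b \<le> 1 + b + b\<^sup>2" using b by (intro exp_bound) auto
      then have "exp b - 1 \<le> b + 2 * b\<^sup>2" using zero_le_power2[of b] by linarith
      then show ?thesis using 2 by (simp add: \<phi>_def)
    next
      case 3
      then show ?thesis using e2 by (simp add: \<phi>_def power2_eq_square algebra_simps)
    qed (simp add: \<phi>_def)
  qed
  have "gnp_mean n p (\<lambda>G. if F \<subseteq> G then exp (b * (\<Sum>x\<in>M. real (gdeg n G x))) else 0)
     = gnp_mean n p (\<lambda>G. if F \<subseteq> G then \<Prod>e\<in>G. \<phi> e else 0)"
    unfolding gnp_mean_def
  proof (rule sum.cong[OF refl])
    fix G assume G: "G \<in> Pow ?V"
    then have "finite G" using finite_subset[OF _ finite_vertex_pairs] by auto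
    moreover have "(\<Sum>x\<in>M. real (gdeg n G x)) = (\<Sum>e\<in>G. real (card (e \<inter> M)))"
      using sum_dg[of G n M] G fM by (metis PowD of_nat_sum)
    ultimately have "exp (b * (\<Sum>x\<in>M. real (gdeg n G x))) = (\<Prod>e\<in>G. \<phi> e)"
      by (simp add: \<phi>_def exp_sum sum_distrib_left)
    then show "p ^ card G * (1 - p) ^ (card ?V - card G) * (if F \<subseteq> G then exp (b * (\<Sum>x\<in>M. real (gdeg n G x))) else 0)
      = p ^ card G * (1 - p) ^ (card ?V - card G) * (if F \<subseteq> G then \<Prod>e\<in>G. \<phi> e else 0)" by simp
  qed
  also have "\<dots> = (\<Prod>e\<in>?V. p * \<phi> e + (if e \<in> F then 0 else 1 - p))" by (rule gnp_mean_prod[OF F])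
  also have "\<dots> \<le> (\<Prod>e\<in>?V. (if e \<in> F then p * exp (2 * b) else 1) * exp (p * (real (card (e \<inter> M)) * (b + 2 * b\<^sup>2))))"
  proof (intro prod_mono conjI)
    fix e assume e: "e \<in> ?V"
    show "0 \<le> p * \<phi> e + (if e \<in> F then 0 else 1 - p)" using p by (simp add: \<phi>_def)
    have m: "1 \<le> exp (p * (real (card (e \<inter> M)) * (b + 2 * b\<^sup>2)))" using p b by simp
    have "p * \<phi> e + (1 - p) \<le> exp (p * (real (card (e \<inter> M)) * (b + 2 * b\<^sup>2)))"
    proof -
      have "p * \<phi> e + (1 - p) = 1 + p * (\<phi> e - 1)" by (simp add: algebra_simps)
      also have "\<dots> \<le> 1 + p * (real (card (e \<inter> M)) * (b + 2 * b\<^sup>2))"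
        using phi1[OF e] p by (intro add_left_mono mult_left_mono) auto
      also have "\<dots> \<le> exp (p * (real (card (e \<inter> M)) * (b + 2 * b\<^sup>2)))" by (rule exp_ge_add_one_self)
      finally show ?thesis .
    qed
    moreover have "p * \<phi> e \<le> p * exp (2 * b) * exp (p * (real (card (e \<inter> M)) * (b + 2 * b\<^sup>2)))"
    proof -
      have "b * real (card (e \<inter> M)) \<le> b * 2" using c2[OF e] b by (intro mult_left_mono) auto
      then have "\<phi> e \<le> exp (2 * b)" by (simp add: \<phi>_def)
      then have "p * \<phi> e * 1 \<le> p * exp (2 * b) * exp (p * (real (card (e \<inter> M)) * (b + 2 * b\<^sup>2)))"
        using p m by (intro mult_mono) (auto simp: \<phi>_def)
      then show ?thesis by simp
    qed
    ultimately show "p * \<phi> e + (if e \<in> F then 0 else 1 - p)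
      \<le> (if e \<in> F then p * exp (2 * b) else 1) * exp (p * (real (card (e \<inter> M)) * (b + 2 * b\<^sup>2)))" by simp
  qed
  also have "\<dots> = (p * exp (2 * b)) ^ card F * exp (\<Sum>e\<in>?V. p * (real (card (e \<inter> M)) * (b + 2 * b\<^sup>2)))"
  proof -
    have "(\<Prod>e\<in>?V. if e \<in> F then p * exp (2 * b) else 1) = (p * exp (2 * b)) ^ card F"
      using F by (simp add: prod.If_cases Int_absorb1)
    then show ?thesis by (simp add: prod.distrib exp_sum)
  qed
  also have "\<dots> \<le> (p * exp (2 * b)) ^ card F * exp (d * (b + 2 * b\<^sup>2)) ^ card M"
  proof (intro mult_left_mono)
    have "(\<Sum>e\<in>?V. card (e \<inter> M)) = (\<Sum>x\<in>M. gdeg n ?V x)" using sum_dg[of ?V n M] fM by simp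
    also have "\<dots> \<le> (\<Sum>x\<in>M. n)"
    proof (rule sum_mono)
      fix x
      have "gdeg n ?V x \<le> card {..<n}" unfolding gdeg_def by (intro card_mono) (auto simp: gadj_def)
      then show "gdeg n ?V x \<le> n" by simp
    qed
    finally have "(\<Sum>e\<in>?V. card (e \<inter> M)) \<le> card M * n" by simp
    then have "real (\<Sum>e\<in>?V. card (e \<inter> M)) \<le> real (card M * n)" by (simp only: of_nat_le_iff)
    then have "(\<Sum>e\<in>?V. real (card (e \<inter> M))) \<le> real (card M) * real n" by (simp only: of_nat_sum of_nat_mult)
    then have "p * (\<Sum>e\<in>?V. real (card (e \<inter> M))) \<le> real (card M) * (real n * p)"
      using p mult_left_mono[of "\<Sum>e\<in>?V. real (card (e \<inter> M))" "real (card M) * real n" p] by (simp add: mult_ac)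
    also have "\<dots> \<le> real (card M) * d" using np by (intro mult_left_mono) auto
    finally have "p * (\<Sum>e\<in>?V. real (card (e \<inter> M))) * (b + 2 * b\<^sup>2) \<le> real (card M) * d * (b + 2 * b\<^sup>2)"
      using b by (intro mult_right_mono) auto
    then have "(\<Sum>e\<in>?V. p * (real (card (e \<inter> M)) * (b + 2 * b\<^sup>2))) \<le> real (card M) * (d * (b + 2 * b\<^sup>2))"
      by (simp add: sum_distrib_left sum_distrib_right mult_ac)
    then show "exp (\<Sum>e\<in>?V. p * (real (card (e \<inter> M)) * (b + 2 * b\<^sup>2))) \<le> exp (d * (b + 2 * b\<^sup>2)) ^ card M"
      by (simp flip: exp_of_nat_mult)
  qed (use p in simp)
  finally show ?thesis .
qed

section \<open>Typical graphs by first moments\<close>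

text \<open>The quantity \<open>4 * sum gg W - sum ll W\<close> for weights \<open>gg\<close>
  proportional to the degree of a big vertex.\<close>

definition score :: "nat \<Rightarrow> real \<Rightarrow> real \<Rightarrow> nat set set \<Rightarrow> nat set \<Rightarrow> real" where
  "score n \<gamma> t G W = (\<Sum>x\<in>W. if t < real (gdeg n G x) then 4 * \<gamma> * real (gdeg n G x) else -1)"

text \<open>The sum over trees is a weighted count of the trees in the graph. It takes the place of
  a bound on the number of connected sets of each size in later union bounds.\<close>

definition typical :: "nat \<Rightarrow> real \<Rightarrow> real \<Rightarrow> real \<Rightarrow> real \<Rightarrow> nat set set \<Rightarrow> bool" where
  "typical n \<gamma> t d S G \<longleftrightarrow>
    (\<forall>W. W \<subseteq> {..<n} \<longrightarrow> sgraph.conn (gadj n G) W \<longrightarrow>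
       score n \<gamma> t G W \<le> S \<and> (-10 \<le> score n \<gamma> t G W \<longrightarrow> sgraph.excess (gadj n G) W \<le> 0)) \<and>
    (\<Sum>v<n. \<Sum>s\<in>rooted_trees n v. if snd s \<subseteq> G then (1 / (4 * d)) ^ card (fst s) else 0) \<le> (real n)\<^sup>2 \<and>
    real n \<le> 2 * real (card {x. x < n \<and> real (gdeg n G x) \<le> t})"

text \<open>\<mu> is the rate in exp (\<mu> * score), and \<open>a1\<close> is a tilt that pays for
  a vertex being big: by \<open>zb\<close> a big vertex, like a light one, contributes at most exp
  (- \<mu>) to the mean. In \<open>yb\<close> the 96 is 16 * 3 * 2, with 16 for the positions of two
  extra edges, 3 for exp (2 * b), and 2 for the choice between big and light.\<close>

locale first_moment =
  fixes n :: nat and p d \<mu> \<gamma> t a1 :: real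
  assumes n0: "0 < n" and p: "0 \<le> p" "p \<le> 1" and np: "real n * p \<le> d" and d1: "1 \<le> d"
    and l0: "0 < \<mu>" and \<gamma>0: "0 < \<gamma>" and a1: "0 < a1" and b: "4 * \<gamma> * \<mu> + a1 \<le> 1 / 2"
    and zb: "d * ((4 * \<gamma> * \<mu> + a1) + 2 * (4 * \<gamma> * \<mu> + a1)\<^sup>2) - a1 * t \<le> - \<mu>"
    and yb: "96 * d * exp (- \<mu>) \<le> 1 / 4" and gt: "1 \<le> 4 * \<gamma> * t" and t0: "0 \<le> t"
begin

text \<open>Expansion over the set \<open>M\<close> of big vertices. The condition that a degree
  exceeds \<open>t\<close> is replaced by the factor exp (a1 * (gdeg - t)), which is at least 1 if
  it holds, so that only exponentials of degree sums remain.\<close>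

lemma gnp_mean_score:
  assumes F: "F \<subseteq> vertex_pairs n" and W: "W \<subseteq> {..<n}"
  shows "gnp_mean n p (\<lambda>G. if F \<subseteq> G then exp (\<mu> * score n \<gamma> t G W) else 0) \<le> (3 * p) ^ card F * (2 * exp (- \<mu>)) ^ card W"
proof -
  define b where "b = 4 * \<gamma> * \<mu> + a1"
  have b0: "0 \<le> b" "b \<le> 1 / 2" using b \<gamma>0 l0 a1 by (auto simp: b_def)
  have fW: "finite W" using W finite_subset by blast
  define w where "w M = exp (- \<mu>) ^ card (W - M) * exp (- a1 * t) ^ card M" for M
  have w0: "0 \<le> w M" for M by (simp add: w_def)
  have pw: "exp (\<mu> * score n \<gamma> t G W) \<le> (\<Sum>M\<in>Pow W. w M * exp (b * (\<Sum>x\<in>M. real (gdeg n G x))))" for G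
  proof -
    have "exp (\<mu> * score n \<gamma> t G W) = (\<Prod>x\<in>W. exp (\<mu> * (if t < real (gdeg n G x) then 4 * \<gamma> * real (gdeg n G x) else -1)))"
      using fW by (simp add: score_def sum_distrib_left exp_sum)
    also have "\<dots> \<le> (\<Prod>x\<in>W. exp (b * real (gdeg n G x) + - a1 * t) + exp (- \<mu>))"
    proof (intro prod_mono conjI)
      fix x
      show "exp (\<mu> * (if t < real (gdeg n G x) then 4 * \<gamma> * real (gdeg n G x) else -1)) \<le> exp (b * real (gdeg n G x) + - a1 * t) + exp (- \<mu>)"
      proof (cases "t < real (gdeg n G x)")
        case True
        have "\<mu> * (4 * \<gamma> * real (gdeg n G x)) \<le> b * real (gdeg n G x) + - a1 * t"
          using True a1 by (simp add: b_def algebra_simps)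
        then have "exp (\<mu> * (4 * \<gamma> * real (gdeg n G x))) \<le> exp (b * real (gdeg n G x) + - a1 * t)" by simp
        then show ?thesis using True by (simp add: add_increasing2)
      qed (simp add: add_increasing)
    qed simp
    also have "\<dots> = (\<Sum>M\<in>Pow W. (\<Prod>x\<in>M. exp (b * real (gdeg n G x) + - a1 * t)) * (\<Prod>x\<in>W - M. exp (- \<mu>)))"
      by (rule prod_add) (rule fW)
    also have "\<dots> = (\<Sum>M\<in>Pow W. w M * exp (b * (\<Sum>x\<in>M. real (gdeg n G x))))"
    proof (rule sum.cong[OF refl])
      fix M assume "M \<in> Pow W"
      then have fM: "finite M" using fW finite_subset by blast
      have "(\<Prod>x\<in>M. exp (b * real (gdeg n G x) + - a1 * t)) = exp (b * (\<Sum>x\<in>M. real (gdeg n G x))) * exp (- a1 * t) ^ card M"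
        using fM by (simp only: exp_add exp_sum sum_distrib_left prod.distrib prod_constant)
      then show "(\<Prod>x\<in>M. exp (b * real (gdeg n G x) + - a1 * t)) * (\<Prod>x\<in>W - M. exp (- \<mu>)) = w M * exp (b * (\<Sum>x\<in>M. real (gdeg n G x)))"
        by (simp add: w_def)
    qed
    finally show ?thesis .
  qed
  have "gnp_mean n p (\<lambda>G. if F \<subseteq> G then exp (\<mu> * score n \<gamma> t G W) else 0)
    \<le> gnp_mean n p (\<lambda>G. \<Sum>M\<in>Pow W. w M * (if F \<subseteq> G then exp (b * (\<Sum>x\<in>M. real (gdeg n G x))) else 0))"
  proof (rule gnp_mean_mono[OF p])
    fix G show "(if F \<subseteq> G then exp (\<mu> * score n \<gamma> t G W) else 0)
      \<le> (\<Sum>M\<in>Pow W. w M * (if F \<subseteq> G then exp (b * (\<Sum>x\<in>M. real (gdeg n G x))) else 0))"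
      using pw[of G] by simp
  qed
  also have "\<dots> = (\<Sum>M\<in>Pow W. w M * gnp_mean n p (\<lambda>G. if F \<subseteq> G then exp (b * (\<Sum>x\<in>M. real (gdeg n G x))) else 0))"
    by (simp only: gnp_mean_sum gnp_mean_cmult)
  also have "\<dots> \<le> (\<Sum>M\<in>Pow W. w M * ((p * exp (2 * b)) ^ card F * exp (d * (b + 2 * b\<^sup>2)) ^ card M))"
    using W by (intro sum_mono mult_left_mono[OF _ w0] gnp_mean_degrees[OF F _ p np b0]) auto
  also have "\<dots> = (p * exp (2 * b)) ^ card F * (\<Sum>M\<in>Pow W. (\<Prod>x\<in>M. exp (d * (b + 2 * b\<^sup>2) - a1 * t)) * (\<Prod>x\<in>W - M. exp (- \<mu>)))"
    unfolding sum_distrib_left w_def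
    by (intro sum.cong refl) (simp add: power_mult_distrib[symmetric] exp_add[symmetric] mult_ac)
  also have "(\<Sum>M\<in>Pow W. (\<Prod>x\<in>M. exp (d * (b + 2 * b\<^sup>2) - a1 * t)) * (\<Prod>x\<in>W - M. exp (- \<mu>)))
    = (\<Prod>x\<in>W. exp (d * (b + 2 * b\<^sup>2) - a1 * t) + exp (- \<mu>))"
    by (rule prod_add[symmetric]) (rule fW)
  also have "(p * exp (2 * b)) ^ card F * \<dots> \<le> (3 * p) ^ card F * (2 * exp (- \<mu>)) ^ card W"
  proof (intro mult_mono)
    have "exp (2 * b) \<le> exp 1" using b0 by simp
    also have "\<dots> \<le> 3" by (rule exp_le)
    finally have "p * exp (2 * b) \<le> p * 3" using p by (intro mult_left_mono) auto
    then show "(p * exp (2 * b)) ^ card F \<le> (3 * p) ^ card F" using p by (intro power_mono) auto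
    have "exp (d * (b + 2 * b\<^sup>2) - a1 * t) \<le> exp (- \<mu>)" using zb by (simp add: b_def)
    then show "(\<Prod>x\<in>W. exp (d * (b + 2 * b\<^sup>2) - a1 * t) + exp (- \<mu>)) \<le> (2 * exp (- \<mu>)) ^ card W"
      unfolding prod_constant by (intro power_mono) auto
  qed (use p in \<open>auto intro!: prod_nonneg add_nonneg_nonneg\<close>)
  finally show ?thesis .
qed

lemma tree_edges: "s \<in> rooted_trees n v \<Longrightarrow> snd s \<subseteq> vertex_pairs n"
proof
  fix e assume s: "s \<in> rooted_trees n v" and "e \<in> snd s"
  then obtain x y where "x \<in> fst s" "y \<in> fst s" "x \<noteq> y" "e = {x, y}"
    using rooted_tree_props[of v "fst s" "snd s"] by (auto simp: rooted_trees_def)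
  moreover have "fst s \<subseteq> {..<n}" using s by (simp add: rooted_trees_def)
  ultimately show "e \<in> vertex_pairs n" unfolding vertex_pairs_def
    by (cases "x < y") (auto simp: insert_commute nat_neq_iff)
qed

text \<open>Turns the mean of a tree on \<open>w\<close> vertices with \<open>m\<close> further
  edges into the weight of \<open>tree_sum\<close>; the constant of \<open>yb\<close> is spent
  here.\<close>

lemma tree_weight:
  assumes "1 \<le> w"
  shows "16 ^ w * ((3 * p) ^ (w - 1 + m) * (2 * exp (- \<mu>)) ^ w) \<le> (3 * d / real n) ^ m * ((1 / 4) ^ w * (1 / real n) ^ (w - 1))"
proof -
  have pd: "p \<le> d / real n" using np n0 by (simp add: field_simps)
  have "(3 * p) ^ (w - 1 + m) \<le> (3 * d / real n) ^ (w - 1 + m)" using p pd by (intro power_mono) auto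
  also have "\<dots> = (3 * d / real n) ^ m * ((3 * d) ^ (w - 1) * (1 / real n) ^ (w - 1))"
    by (simp add: power_add power_divide mult_ac)
  also have "\<dots> \<le> (3 * d / real n) ^ m * ((3 * d) ^ w * (1 / real n) ^ (w - 1))"
    using d1 by (intro mult_left_mono mult_right_mono power_increasing) auto
  finally have "16 ^ w * ((3 * p) ^ (w - 1 + m) * (2 * exp (- \<mu>)) ^ w)
    \<le> 16 ^ w * ((3 * d / real n) ^ m * ((3 * d) ^ w * (1 / real n) ^ (w - 1)) * (2 * exp (- \<mu>)) ^ w)"
    by (intro mult_left_mono mult_right_mono) auto
  also have "\<dots> = (3 * d / real n) ^ m * ((96 * d * exp (- \<mu>)) ^ w * (1 / real n) ^ (w - 1))"
  proof -
    have "(96 * d * exp (- \<mu>)) ^ w = (16 * (3 * d) * (2 * exp (- \<mu>))) ^ w"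
      by (rule arg_cong[of _ _ "\<lambda>x. x ^ w"]) simp
    also have "\<dots> = 16 ^ w * (3 * d) ^ w * (2 * exp (- \<mu>)) ^ w" by (simp only: power_mult_distrib)
    finally show ?thesis by (simp only: mult_ac)
  qed
  also have "\<dots> \<le> (3 * d / real n) ^ m * ((1 / 4) ^ w * (1 / real n) ^ (w - 1))"
    using d1 yb by (intro mult_left_mono mult_right_mono power_mono) auto
  finally show ?thesis .
qed

lemma rooted_trees_card: "s \<in> rooted_trees n v \<Longrightarrow> 1 \<le> card (fst s) \<and> card (snd s) = card (fst s) - 1 \<and> finite (fst s) \<and> finite (snd s)"
  using rooted_tree_props[of v "fst s" "snd s"] by (auto simp: rooted_trees_def)

lemma gnp_mean_heavy:
  "gnp_mean n p (\<lambda>G. \<Sum>v<n. \<Sum>s\<in>rooted_trees n v. if snd s \<subseteq> G then exp (\<mu> * score n \<gamma> t G (fst s)) else 0) \<le> real n / 2"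
proof -
  have "gnp_mean n p (\<lambda>G. if snd s \<subseteq> G then exp (\<mu> * score n \<gamma> t G (fst s)) else 0)
    \<le> (1 / 4) ^ card (fst s) * (1 / real n) ^ (card (fst s) - 1)" if s: "s \<in> rooted_trees n v" for s v
  proof -
    have "gnp_mean n p (\<lambda>G. if snd s \<subseteq> G then exp (\<mu> * score n \<gamma> t G (fst s)) else 0)
      \<le> (3 * p) ^ card (snd s) * (2 * exp (- \<mu>)) ^ card (fst s)"
      using s by (intro gnp_mean_score tree_edges[OF s]) (auto simp: rooted_trees_def)
    also have "\<dots> = 1 * ((3 * p) ^ (card (fst s) - 1 + 0) * (2 * exp (- \<mu>)) ^ card (fst s))"
      using rooted_trees_card[OF s] by simp
    also have "\<dots> \<le> 16 ^ card (fst s) * ((3 * p) ^ (card (fst s) - 1 + 0) * (2 * exp (- \<mu>)) ^ card (fst s))"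
      using p by (intro mult_right_mono) auto
    also have "\<dots> \<le> (3 * d / real n) ^ 0 * ((1 / 4) ^ card (fst s) * (1 / real n) ^ (card (fst s) - 1))"
      using rooted_trees_card[OF s] by (intro tree_weight) auto
    finally show ?thesis by simp
  qed
  then have "gnp_mean n p (\<lambda>G. \<Sum>v<n. \<Sum>s\<in>rooted_trees n v. if snd s \<subseteq> G then exp (\<mu> * score n \<gamma> t G (fst s)) else 0)
    \<le> (\<Sum>v<n. \<Sum>s\<in>rooted_trees n v. (1 / 4) ^ card (fst s) * (1 / real n) ^ (card (fst s) - 1))"
    unfolding gnp_mean_sum by (intro sum_mono) auto
  also have "\<dots> \<le> (\<Sum>v<n. 1 / 2)" using tree_sum[OF n0] by (intro sum_mono)
  finally show ?thesis by simp
qed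

text \<open>A spanning tree of \<open>W\<close> is one of the summands.\<close>

lemma heavy_component:
  assumes W: "W \<subseteq> {..<n}" "sgraph.conn (gadj n G) W" "S \<le> score n \<gamma> t G W"
  shows "exp (\<mu> * S) \<le> (\<Sum>v<n. \<Sum>s\<in>rooted_trees n v. if snd s \<subseteq> G then exp (\<mu> * score n \<gamma> t G (fst s)) else 0)"
proof -
  interpret sgraph "{..<n}" "gadj n G" by (rule sgraph_gadj)
  define h where "h s = (if snd s \<subseteq> G then exp (\<mu> * score n \<gamma> t G (fst s)) else 0)" for s :: "nat set \<times> nat set set"
  obtain v where v: "v \<in> W" using conn_ne[OF W(2)] by blast
  have fW: "finite W" using W(1) finite_subset by blast
  obtain F where F: "rooted_tree v W F" "\<forall>e\<in>F. \<exists>x y. gadj n G x y \<and> e = {x, y}" using conn_RT[OF W(2) fW v] by blast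
  have s: "(W, F) \<in> rooted_trees n v" "F \<subseteq> G" using F W by (auto simp: rooted_trees_def gadj_def)
  have "exp (\<mu> * S) \<le> h (W, F)" using W(3) s l0 by (simp add: h_def)
  also have "\<dots> \<le> (\<Sum>s\<in>rooted_trees n v. h s)" by (rule member_le_sum[OF s(1)]) (auto simp: h_def)
  also have "\<dots> \<le> (\<Sum>v<n. \<Sum>s\<in>rooted_trees n v. h s)"
    using v W(1) by (intro member_le_sum sum_nonneg) (auto simp: h_def)
  finally show ?thesis by (simp add: h_def)
qed


definition extra :: "(nat set \<times> nat set set) \<Rightarrow> (nat \<times> nat) \<times> (nat \<times> nat) \<Rightarrow> nat set set" where
  "extra s q = insert {fst (fst q), snd (fst q)} (insert {fst (snd q), snd (snd q)} (snd s))"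

text \<open>Quadruples of tree vertices overcount the pairs of extra edges, but there are only
  \<open>w ^ 4\<close> of them on \<open>w\<close> vertices. The condition on the cardinality says
  that the two edges are distinct and not in the tree.\<close>

definition extras :: "(nat set \<times> nat set set) \<Rightarrow> ((nat \<times> nat) \<times> (nat \<times> nat)) set" where
  "extras s = {q \<in> (fst s \<times> fst s) \<times> (fst s \<times> fst s). extra s q \<subseteq> vertex_pairs n \<and> card (extra s q) = card (snd s) + 2}"

text \<open>Each extra edge gains a factor of order d / n, whereas the positions cost only
  \<open>w ^ 4 \<le> 16 ^ w\<close>. Summed over n roots this is of order 1 / n.\<close>

lemma gnp_mean_cyclic:
  "gnp_mean n p (\<lambda>G. \<Sum>v<n. \<Sum>s\<in>rooted_trees n v. \<Sum>q\<in>extras s. if extra s q \<subseteq> G then exp (\<mu> * score n \<gamma> t G (fst s)) else 0)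
    \<le> 9 * d\<^sup>2 / (2 * real n)"
proof -
  have "gnp_mean n p (\<lambda>G. \<Sum>q\<in>extras s. if extra s q \<subseteq> G then exp (\<mu> * score n \<gamma> t G (fst s)) else 0)
    \<le> (3 * d / real n)\<^sup>2 * ((1 / 4) ^ card (fst s) * (1 / real n) ^ (card (fst s) - 1))" if s: "s \<in> rooted_trees n v" for s v
  proof -
    let ?w = "card (fst s)"
    have fs: "finite (fst s)" and w1: "1 \<le> ?w" and cs: "card (snd s) = ?w - 1" using rooted_trees_card[OF s] by auto
    have "gnp_mean n p (\<lambda>G. if extra s q \<subseteq> G then exp (\<mu> * score n \<gamma> t G (fst s)) else 0)
      \<le> (3 * p) ^ (?w - 1 + 2) * (2 * exp (- \<mu>)) ^ ?w" if q: "q \<in> extras s" for q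
    proof -
      have "gnp_mean n p (\<lambda>G. if extra s q \<subseteq> G then exp (\<mu> * score n \<gamma> t G (fst s)) else 0)
        \<le> (3 * p) ^ card (extra s q) * (2 * exp (- \<mu>)) ^ ?w"
        using q s by (intro gnp_mean_score) (auto simp: rooted_trees_def extras_def)
      also have "card (extra s q) = ?w - 1 + 2" using q cs by (simp add: extras_def)
      finally show ?thesis .
    qed
    then have "gnp_mean n p (\<lambda>G. \<Sum>q\<in>extras s. if extra s q \<subseteq> G then exp (\<mu> * score n \<gamma> t G (fst s)) else 0)
      \<le> (\<Sum>q\<in>extras s. (3 * p) ^ (?w - 1 + 2) * (2 * exp (- \<mu>)) ^ ?w)"
      unfolding gnp_mean_sum by (intro sum_mono)
    also have "\<dots> = real (card (extras s)) * ((3 * p) ^ (?w - 1 + 2) * (2 * exp (- \<mu>)) ^ ?w)" by simp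
    also have "\<dots> \<le> 16 ^ ?w * ((3 * p) ^ (?w - 1 + 2) * (2 * exp (- \<mu>)) ^ ?w)"
    proof (rule mult_right_mono)
      have "card (extras s) \<le> card ((fst s \<times> fst s) \<times> (fst s \<times> fst s))"
        using fs by (intro card_mono) (auto simp: extras_def)
      also have "\<dots> = ?w ^ 4" by (simp add: card_cartesian_product eval_nat_numeral)
      also have "\<dots> \<le> (2 ^ ?w) ^ 4" by (intro power_mono less_imp_le[OF less_exp]) auto
      also have "\<dots> = (2 ^ 4) ^ ?w" by (simp only: power_mult[symmetric] mult.commute)
      also have "(2 ^ 4 :: nat) = 16" by simp
      finally have "real (card (extras s)) \<le> real (16 ^ ?w)" by (simp only: of_nat_le_iff)
      then show "real (card (extras s)) \<le> 16 ^ ?w" by simp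
    qed (use p in simp)
    also have "\<dots> \<le> (3 * d / real n)\<^sup>2 * ((1 / 4) ^ ?w * (1 / real n) ^ (?w - 1))"
      by (rule tree_weight[OF w1])
    finally show ?thesis .
  qed
  then have "gnp_mean n p (\<lambda>G. \<Sum>v<n. \<Sum>s\<in>rooted_trees n v. \<Sum>q\<in>extras s. if extra s q \<subseteq> G then exp (\<mu> * score n \<gamma> t G (fst s)) else 0)
    \<le> (\<Sum>v<n. \<Sum>s\<in>rooted_trees n v. (3 * d / real n)\<^sup>2 * ((1 / 4) ^ card (fst s) * (1 / real n) ^ (card (fst s) - 1)))"
    by (subst gnp_mean_sum, subst gnp_mean_sum) (intro sum_mono, blast)
  also have "\<dots> = (\<Sum>v<n. (3 * d / real n)\<^sup>2 * (\<Sum>s\<in>rooted_trees n v. (1 / 4) ^ card (fst s) * (1 / real n) ^ (card (fst s) - 1)))"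
    by (simp only: sum_distrib_left)
  also have "\<dots> \<le> (\<Sum>v<n. (3 * d / real n)\<^sup>2 * (1 / 2))"
    using tree_sum[OF n0] by (intro sum_mono mult_left_mono) auto
  also have "\<dots> = 9 * d\<^sup>2 / (2 * real n)" using n0 by (simp add: power2_eq_square field_simps)
  finally show ?thesis .
qed

text \<open>Positive excess means at least \<open>card W + 1\<close> edges, two more than a spanning
  tree has.\<close>

lemma cyclic_component:
  assumes W: "W \<subseteq> {..<n}" "sgraph.conn (gadj n G) W" "-10 \<le> score n \<gamma> t G W" "0 < sgraph.excess (gadj n G) W"
  shows "exp (- (10 * \<mu>)) \<le> (\<Sum>v<n. \<Sum>s\<in>rooted_trees n v. \<Sum>q\<in>extras s. if extra s q \<subseteq> G then exp (\<mu> * score n \<gamma> t G (fst s)) else 0)"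
proof -
  interpret sgraph "{..<n}" "gadj n G" by (rule sgraph_gadj)
  define h where "h s q = (if extra s q \<subseteq> G then exp (\<mu> * score n \<gamma> t G (fst s)) else 0)" for s q
  have h0: "0 \<le> h s q" for s q by (simp add: h_def)
  obtain v where v: "v \<in> W" using conn_ne[OF W(2)] by blast
  have fW: "finite W" using W(1) finite_subset by blast
  obtain F where F: "rooted_tree v W F" "\<forall>e\<in>F. \<exists>x y. gadj n G x y \<and> e = {x, y}" using conn_RT[OF W(2) fW v] by blast
  have s: "(W, F) \<in> rooted_trees n v" "F \<subseteq> G" using F W by (auto simp: rooted_trees_def gadj_def)
  have fF: "finite F" and cF: "card F = card W - 1" and cW: "1 \<le> card W" using rooted_trees_card[OF s(1)] by auto
  let ?O = "{q \<in> W \<times> W. gadj n G (fst q) (snd q)}"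
  have few: "card {q \<in> ?O. {fst q, snd q} \<in> H} \<le> 2 * card H" if H: "finite H" for H
  proof -
    have "card {q \<in> ?O. {fst q, snd q} = e} \<le> 2" for e
    proof (cases "\<exists>x y. e = {x, y}")
      case True
      then obtain x y where e: "e = {x, y}" by blast
      have "{q \<in> ?O. {fst q, snd q} = e} \<subseteq> {(x, y), (y, x)}"
        unfolding e by (auto simp: doubleton_eq_iff)
      then have "card {q \<in> ?O. {fst q, snd q} = e} \<le> card {(x, y), (y, x)}" by (intro card_mono) auto
      also have "\<dots> \<le> 2" using card_length[of "[(x, y), (y, x)]"] by simp
      finally show ?thesis .
    next
      case False
      then have "{q \<in> ?O. {fst q, snd q} = e} = {}" by blast
      then show ?thesis by (simp only: card.empty)
    qed
    moreover have "{q \<in> ?O. {fst q, snd q} \<in> H} = (\<Union>e\<in>H. {q \<in> ?O. {fst q, snd q} = e})" by blast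
    ultimately show ?thesis using card_UN_le[OF H, of "\<lambda>e. {q \<in> ?O. {fst q, snd q} = e}"]
        sum_bounded_above[of H "\<lambda>e. card {q \<in> ?O. {fst q, snd q} = e}" 2] by simp
  qed
  have cO: "2 * card W < card ?O" using W(4) by (simp add: excess_def double_edges_def)
  \<comment> \<open>There are more than \<open>2 * card W\<close> ordered adjacent pairs, and each
    edge accounts for at most two, so \<open>card W\<close> edges do not exhaust them.\<close>
  have pick: "\<exists>q\<in>?O. {fst q, snd q} \<notin> H" if "finite H" "card H \<le> card W" for H
  proof (rule ccontr)
    assume "\<not> ?thesis"
    then have "?O = {q \<in> ?O. {fst q, snd q} \<in> H}" by blast
    then show False using few[OF that(1)] that(2) cO by simp
  qed
  obtain q1 where q1: "q1 \<in> ?O" "{fst q1, snd q1} \<notin> F" using pick[OF fF] cF by auto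
  obtain q2 where q2: "q2 \<in> ?O" "{fst q2, snd q2} \<notin> insert {fst q1, snd q1} F"
  proof -
    have "finite (insert {fst q1, snd q1} F)" "card (insert {fst q1, snd q1} F) \<le> card W"
      using fF cF cW q1(2) by simp_all
    from pick[OF this] show thesis using that by blast
  qed
  have excess: "extra (W, F) (q1, q2) = insert {fst q1, snd q1} (insert {fst q2, snd q2} F)" by (simp add: extra_def)
  have d1: "{fst q1, snd q1} \<notin> insert {fst q2, snd q2} F" and d2: "{fst q2, snd q2} \<notin> F"
    using q1(2) q2(2) by (simp_all only: insert_iff) argo+
  have "card (extra (W, F) (q1, q2)) = card F + 2"
    unfolding excess card_insert_disjoint[OF finite.insertI[OF fF] d1] card_insert_disjoint[OF fF d2] by simp
  moreover have "{fst q, snd q} \<in> vertex_pairs n" if "q \<in> ?O" for q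
    using that unfolding vertex_pairs_def
    by (cases "fst q < snd q") (auto simp: gadj_def insert_commute nat_neq_iff)
  then have "extra (W, F) (q1, q2) \<subseteq> vertex_pairs n" using q1(1) q2(1) tree_edges[OF s(1)] by (auto simp: excess)
  ultimately have q: "(q1, q2) \<in> extras (W, F)" using q1(1) q2(1) by (auto simp: extras_def)
  have "extra (W, F) (q1, q2) \<subseteq> G" unfolding excess using q1(1) q2(1) s(2) by (auto simp: gadj_def)
  moreover have "- (10 * \<mu>) \<le> \<mu> * score n \<gamma> t G W"
    using mult_left_mono[OF W(3), of \<mu>] l0 by simp
  ultimately have "exp (- (10 * \<mu>)) \<le> h (W, F) (q1, q2)" by (simp add: h_def)
  also have "\<dots> \<le> (\<Sum>q\<in>extras (W, F). h (W, F) q)"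
    using fW h0 by (intro member_le_sum[OF q]) (auto simp: extras_def)
  also have "\<dots> \<le> (\<Sum>s\<in>rooted_trees n v. \<Sum>q\<in>extras s. h s q)"
    by (rule member_le_sum[OF s(1), of "\<lambda>s. \<Sum>q\<in>extras s. h s q"]) (auto intro: sum_nonneg h0)
  also have "\<dots> \<le> (\<Sum>v<n. \<Sum>s\<in>rooted_trees n v. \<Sum>q\<in>extras s. h s q)"
    using v W(1) by (intro member_le_sum[of v _ "\<lambda>v. \<Sum>s\<in>rooted_trees n v. \<Sum>q\<in>extras s. h s q"]) (auto intro!: sum_nonneg h0)
  finally show ?thesis by (simp add: h_def)
qed

text \<open>The weight 1 / (4 * d) per vertex offsets the mean factor d / n of an edge up to the 1 /
  n and the 1 / 4 of \<open>tree_sum\<close>.\<close>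

lemma gnp_mean_trees:
  "gnp_mean n p (\<lambda>G. \<Sum>v<n. \<Sum>s\<in>rooted_trees n v. if snd s \<subseteq> G then (1 / (4 * d)) ^ card (fst s) else 0) \<le> real n / 2"
proof -
  have "gnp_mean n p (\<lambda>G. if snd s \<subseteq> G then (1 / (4 * d)) ^ card (fst s) else 0)
    \<le> (1 / 4) ^ card (fst s) * (1 / real n) ^ (card (fst s) - 1)" if s: "s \<in> rooted_trees n v" for s v
  proof -
    let ?w = "card (fst s)"
    have w1: "1 \<le> ?w" and cs: "card (snd s) = ?w - 1" using rooted_trees_card[OF s] by auto
    have pd: "p \<le> d / real n" using np n0 by (simp add: field_simps)
    have "gnp_mean n p (\<lambda>G. if snd s \<subseteq> G then (1 / (4 * d)) ^ ?w else 0)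
      = (1 / (4 * d)) ^ ?w * gnp_mean n p (\<lambda>G. if snd s \<subseteq> G then exp (0 * (\<Sum>x\<in>{}. real (gdeg n G x))) else 0)"
      unfolding gnp_mean_cmult[symmetric] by (rule arg_cong[of _ _ "gnp_mean n p"]) auto
    also have "\<dots> \<le> (1 / (4 * d)) ^ ?w * ((p * exp (2 * 0)) ^ card (snd s) * exp (d * (0 + 2 * 0\<^sup>2)) ^ card ({} :: nat set))"
      using d1 by (intro mult_left_mono gnp_mean_degrees tree_edges[OF s] p np) auto
    also have "\<dots> = (1 / (4 * d)) ^ ?w * p ^ (?w - 1)" by (simp add: cs)
    also have "\<dots> \<le> (1 / (4 * d)) ^ ?w * (d / real n) ^ (?w - 1)"
      using d1 p pd by (intro mult_left_mono power_mono) auto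
    also have "\<dots> = (1 / 4) ^ ?w * (1 / real n) ^ (?w - 1) * ((1 / d) ^ ?w * d ^ (?w - 1))"
      by (simp add: power_divide power_mult_distrib)
    also have "\<dots> \<le> (1 / 4) ^ ?w * (1 / real n) ^ (?w - 1) * 1"
    proof (intro mult_left_mono)
      have "(1 / d) ^ ?w * d ^ (?w - 1) \<le> (1 / d) ^ ?w * d ^ ?w"
        using d1 by (intro mult_left_mono power_increasing) auto
      also have "\<dots> = 1" using d1 by (simp add: power_divide)
      finally show "(1 / d) ^ ?w * d ^ (?w - 1) \<le> 1" .
    qed simp
    finally show ?thesis by simp
  qed
  then have "gnp_mean n p (\<lambda>G. \<Sum>v<n. \<Sum>s\<in>rooted_trees n v. if snd s \<subseteq> G then (1 / (4 * d)) ^ card (fst s) else 0)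
    \<le> (\<Sum>v<n. \<Sum>s\<in>rooted_trees n v. (1 / 4) ^ card (fst s) * (1 / real n) ^ (card (fst s) - 1))"
    unfolding gnp_mean_sum by (intro sum_mono) auto
  also have "\<dots> \<le> (\<Sum>v<n. 1 / 2)" using tree_sum[OF n0] by (intro sum_mono)
  finally show ?thesis by simp
qed

lemma gnp_mean_one: "gnp_mean n p (\<lambda>_. 1) = 1"
  using gnp_mean_prod[of "{}" n p "\<lambda>_. 1"] by simp

text \<open>By \<open>gt\<close> a big vertex scores at least 1, a light one -1. A minority of light
  vertices thus gives the whole vertex set a nonnegative score, an event that
  \<open>gnp_mean_score\<close> makes exponentially unlikely.\<close>

lemma many_light:
  assumes "2 * real (card {x. x < n \<and> real (gdeg n G x) \<le> t}) < real n"
  shows "0 \<le> score n \<gamma> t G {..<n}"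
proof -
  let ?L = "{x. x < n \<and> real (gdeg n G x) \<le> t}"
  have "card {..<n} = card ?L + card ({..<n} - ?L)"
    using card_Un_disjoint[of ?L "{..<n} - ?L"] by (simp add: Un_absorb1 subset_iff)
  then have c: "real n = real (card ?L) + real (card ({..<n} - ?L))" by simp
  have "(\<Sum>x\<in>{..<n} - ?L. 1) + (\<Sum>x\<in>?L. - 1) \<le> (\<Sum>x\<in>{..<n} - ?L. if t < real (gdeg n G x) then 4 * \<gamma> * real (gdeg n G x) else -1)
     + (\<Sum>x\<in>?L. if t < real (gdeg n G x) then 4 * \<gamma> * real (gdeg n G x) else -1)"
  proof (intro add_mono sum_mono)
    fix x assume "x \<in> {..<n} - ?L"
    then have tx: "t < real (gdeg n G x)" by auto
    then have "4 * \<gamma> * t \<le> 4 * \<gamma> * real (gdeg n G x)" using \<gamma>0 by (intro mult_left_mono) auto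
    then show "1 \<le> (if t < real (gdeg n G x) then 4 * \<gamma> * real (gdeg n G x) else -1)" using gt tx by simp
  qed auto
  also have "\<dots> = score n \<gamma> t G {..<n}" unfolding score_def
    by (rule sum.subset_diff[symmetric]) auto
  finally show ?thesis using c assms by simp
qed

text \<open>Markov's inequality for the sum \<open>bad\<close> of four nonnegative quantities,
  scaled so that each way of failing \<open>typical\<close> makes one of them at least 1.\<close>

lemma gnp_typical:
  "gnp_prob n p (typical n \<gamma> t d (2 * ln (real n) / \<mu>))
    \<ge> 1 - (1 / real n + exp (10 * \<mu>) * 9 * d\<^sup>2 / (2 * real n) + (2 * exp (- \<mu>)) ^ n)"
proof -
  define S where "S = 2 * ln (real n) / \<mu>"
  define H1 where "H1 G = (\<Sum>v<n. \<Sum>s\<in>rooted_trees n v. if snd s \<subseteq> G then exp (\<mu> * score n \<gamma> t G (fst s)) else 0)" for G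
  define H2 where "H2 G = (\<Sum>v<n. \<Sum>s\<in>rooted_trees n v. \<Sum>q\<in>extras s. if extra s q \<subseteq> G then exp (\<mu> * score n \<gamma> t G (fst s)) else 0)" for G
  define H3 where "H3 G = (\<Sum>v<n. \<Sum>s\<in>rooted_trees n v. if snd s \<subseteq> G then (1 / (4 * d)) ^ card (fst s) else 0)" for G
  define H4 where "H4 G = exp (\<mu> * score n \<gamma> t G {..<n})" for G
  define bad where "bad G = (1 / (real n)\<^sup>2) * H1 G + exp (10 * \<mu>) * H2 G + (1 / (real n)\<^sup>2) * H3 G + H4 G" for G
  have H0: "0 \<le> H1 G" "0 \<le> H2 G" "0 \<le> H3 G" "0 \<le> H4 G" for G
    using d1 by (auto simp: H1_def H2_def H3_def H4_def intro!: sum_nonneg)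
  have n2: "0 < (real n)\<^sup>2" using n0 by simp
  have eS: "exp (\<mu> * S) = (real n)\<^sup>2" using l0 n0 by (simp add: S_def exp_double)
  have "1 - bad G \<le> (if typical n \<gamma> t d S G then 1 else 0)" for G
  proof (cases "typical n \<gamma> t d S G")
    case True
    have "0 \<le> bad G" using H0 by (simp add: bad_def)
    then show ?thesis using True by simp
  next
    case False
    then consider W where "W \<subseteq> {..<n}" "sgraph.conn (gadj n G) W" "S \<le> score n \<gamma> t G W"
      | W where "W \<subseteq> {..<n}" "sgraph.conn (gadj n G) W" "-10 \<le> score n \<gamma> t G W" "0 < sgraph.excess (gadj n G) W"
      | "(real n)\<^sup>2 \<le> H3 G" | "2 * real (card {x. x < n \<and> real (gdeg n G x) \<le> t}) < real n"
      unfolding typical_def H3_def by force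
    then have "1 \<le> bad G"
    proof cases
      case 1
      then have "(real n)\<^sup>2 \<le> H1 G" unfolding eS[symmetric] H1_def by (intro heavy_component)
      then have "1 \<le> (1 / (real n)\<^sup>2) * H1 G" using n2 by (simp add: field_simps)
      then show ?thesis using H0(2-4)[of G] unfolding bad_def by (simp add: add_increasing2)
    next
      case 2
      then have "exp (- (10 * \<mu>)) \<le> H2 G" unfolding H2_def by (intro cyclic_component)
      then have "exp (10 * \<mu>) * exp (- (10 * \<mu>)) \<le> exp (10 * \<mu>) * H2 G" by (intro mult_left_mono) auto
      then have "1 \<le> exp (10 * \<mu>) * H2 G" by (simp add: exp_add[symmetric])
      moreover have "0 \<le> (1 / (real n)\<^sup>2) * H1 G" "0 \<le> (1 / (real n)\<^sup>2) * H3 G" using H0 by auto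
      ultimately show ?thesis using H0(4)[of G] unfolding bad_def by linarith
    next
      case 3
      then have "1 \<le> (1 / (real n)\<^sup>2) * H3 G" using n2 by (simp add: field_simps)
      moreover have "0 \<le> (1 / (real n)\<^sup>2) * H1 G" "0 \<le> exp (10 * \<mu>) * H2 G" using H0 by auto
      ultimately show ?thesis using H0(4)[of G] unfolding bad_def by linarith
    next
      case 4
      then have "1 \<le> H4 G" unfolding H4_def using many_light l0 by simp
      moreover have "0 \<le> (1 / (real n)\<^sup>2) * H1 G" "0 \<le> exp (10 * \<mu>) * H2 G" "0 \<le> (1 / (real n)\<^sup>2) * H3 G" using H0 by auto
      ultimately show ?thesis unfolding bad_def by linarith
    qed
    then show ?thesis using False by simp
  qed
  then have "gnp_mean n p (\<lambda>G. 1 + (-1) * bad G) \<le> gnp_prob n p (typical n \<gamma> t d S)"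
    unfolding gnp_prob_eq_mean by (intro gnp_mean_mono[OF p]) simp
  then have "1 - gnp_mean n p bad \<le> gnp_prob n p (typical n \<gamma> t d S)"
    unfolding gnp_mean_add gnp_mean_cmult gnp_mean_one by simp
  moreover have "gnp_mean n p bad = (1 / (real n)\<^sup>2) * gnp_mean n p H1 + exp (10 * \<mu>) * gnp_mean n p H2 + (1 / (real n)\<^sup>2) * gnp_mean n p H3 + gnp_mean n p H4"
    unfolding bad_def gnp_mean_add gnp_mean_cmult ..
  moreover have "(1 / (real n)\<^sup>2) * gnp_mean n p H1 \<le> (1 / (real n)\<^sup>2) * (real n / 2)"
    using gnp_mean_heavy unfolding H1_def by (intro mult_left_mono) auto
  moreover have "(1 / (real n)\<^sup>2) * gnp_mean n p H3 \<le> (1 / (real n)\<^sup>2) * (real n / 2)"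
    using gnp_mean_trees unfolding H3_def by (intro mult_left_mono) auto
  moreover have "(1 / (real n)\<^sup>2) * (real n / 2) = 1 / real n / 2" using n0 by (simp add: power2_eq_square)
  moreover have "exp (10 * \<mu>) * gnp_mean n p H2 \<le> exp (10 * \<mu>) * (9 * d\<^sup>2 / (2 * real n))"
    using gnp_mean_cyclic unfolding H2_def by (intro mult_left_mono) auto
  moreover have "gnp_mean n p H4 \<le> (2 * exp (- \<mu>)) ^ n"
    using gnp_mean_score[of "{}" "{..<n}"] by (simp add: H4_def[abs_def])
  ultimately show ?thesis unfolding S_def by (simp add: mult.assoc)
qed

end

section \<open>Typical graphs\<close>

text \<open>\<open>c1 / d\<close> is the weight per degree, \<tau> * d the threshold for light
  vertices, and \<open>a + D\<close> the number of colours, at least \<open>ac * d\<close> of them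
  spare at a light vertex. The influence per neighbour will be \<open>2 / (\<delta>1 * a)\<close>,
  the least value that \<open>aB\<close> allows.\<close>

locale typical_graph =
  fixes n a D :: nat and G :: "nat set set" and d \<tau> c1 \<kappa> ac \<delta>1 :: real
  assumes n0: "0 < n" and d1: "1 \<le> d" and tau: "1 \<le> \<tau>" "\<tau> \<le> 2"
    and c1: "2 \<le> c1" "2 / (\<delta>1 * ac) \<le> c1" and \<kappa>0: "0 < \<kappa>" and ac: "0 < ac" "ac * d \<le> real a"
    and \<delta>1: "0 < \<delta>1" "\<delta>1 \<le> 1" and four: "4 \<le> a" and D: "D = nat \<lfloor>\<tau> * d\<rfloor>"
    and small_B: "(1 + 2 * \<tau> / (\<delta>1 * ac)) / real a \<le> 1 / 2"
    and contr: "(real D / real (a + D) + 1 / real a) * exp ((1 + 1 / real a) * (real D / real (a + D))) \<le> 1 - \<delta>1"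
    and typG: "typical n (c1 / d) (\<tau> * d) d (2 * ln (real n) / (\<kappa> * d)) G"
begin

definition is_light :: "nat \<Rightarrow> bool" where "is_light x \<longleftrightarrow> real (gdeg n G x) \<le> \<tau> * d"
definition big_weight :: "nat \<Rightarrow> real" where "big_weight x = (if is_light x then 0 else c1 / d * real (gdeg n G x))"
definition light_weight :: "nat \<Rightarrow> real" where "light_weight x = (if is_light x then 1 else 0)"

lemma score_eq: "4 * sum big_weight W - sum light_weight W = score n (c1 / d) (\<tau> * d) G W"
  unfolding score_def sum_distrib_left sum_subtractf[symmetric]
  by (intro sum.cong refl) (auto simp: big_weight_def light_weight_def is_light_def)

lemma D_le: "real D \<le> \<tau> * d" "x \<le> D \<longleftrightarrow> real x \<le> \<tau> * d"
proof -
  have "0 \<le> \<tau> * d" using tau d1 by simp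
  then show "real D \<le> \<tau> * d" "x \<le> D \<longleftrightarrow> real x \<le> \<tau> * d"
    unfolding D by linarith+
qed

lemma DB_le: "real D * (2 / (\<delta>1 * real a)) \<le> 2 * \<tau> / (\<delta>1 * ac)"
proof -
  have "real D * (2 / (\<delta>1 * real a)) \<le> (\<tau> * d) * (2 / (\<delta>1 * (ac * d)))"
    using D_le ac d1 \<delta>1 tau four by (intro mult_mono divide_left_mono mult_left_mono mult_pos_pos) auto
  also have "\<dots> = 2 * \<tau> / (\<delta>1 * ac)" using d1 by simp
  finally show ?thesis .
qed

sublocale light_graph "{..<n}" "gadj n G" big_weight light_weight is_light a D "2 / (\<delta>1 * real a)" \<delta>1
proof -
  interpret g: sgraph "{..<n}" "gadj n G" by (rule sgraph_gadj)
  have Nb: "card (g.Nb v) = gdeg n G v" for v by (simp add: g.Nb_def gdeg_def)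
  show "light_graph {..<n} (gadj n G) big_weight light_weight is_light a D (2 / (\<delta>1 * real a)) \<delta>1"
  proof unfold_locales
    show "0 \<le> big_weight v" for v using c1 d1 by (simp add: big_weight_def)
    show "0 \<le> light_weight v" for v by (simp add: light_weight_def)
    show "g.excess W \<le> 0" if "W \<subseteq> {..<n}" "g.conn W" "-10 \<le> 4 * sum big_weight W - sum light_weight W" for W
      using typG that unfolding typical_def score_eq by blast
    show "card (g.Nb v) \<le> D" if "is_light v" for v using that D_le(2) by (simp add: Nb is_light_def)
    show "4 \<le> a" by (rule four)
    show "light_weight v = (if is_light v then 1 else 0)" for v by (simp add: light_weight_def)
    show "big_weight v = 0" if "is_light v" for v using that by (simp add: big_weight_def)
    show "2 \<le> big_weight v \<and> 2 / (\<delta>1 * real a) * real (card (g.Nb v)) \<le> big_weight v" if "\<not> is_light v" for v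
    proof
      have deg: "\<tau> * d < real (gdeg n G v)" using that by (simp add: is_light_def)
      have "2 * 1 \<le> c1 / d * (\<tau> * d)" using c1 tau d1 mult_mono[of 2 c1 1 \<tau>] by simp
      also have "\<dots> \<le> c1 / d * real (gdeg n G v)" using deg c1 d1 by (intro mult_left_mono) auto
      finally show "2 \<le> big_weight v" using that by (simp add: big_weight_def)
      have "2 / (\<delta>1 * real a) \<le> 2 / (\<delta>1 * (ac * d))"
        using ac d1 \<delta>1 four by (intro divide_left_mono mult_left_mono mult_pos_pos) auto
      also have "\<dots> = 2 / (\<delta>1 * ac) / d" by simp
      also have "\<dots> \<le> c1 / d" using c1 d1 by (intro divide_right_mono) auto
      finally show "2 / (\<delta>1 * real a) * real (card (g.Nb v)) \<le> big_weight v"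
        using that mult_right_mono[of "2 / (\<delta>1 * real a)" "c1 / d" "real (gdeg n G v)"] by (simp add: big_weight_def Nb)
    qed
    show "0 \<le> 2 / (\<delta>1 * real a)" "0 < \<delta>1" "\<delta>1 \<le> 1" using \<delta>1 by auto
    show "1 / real a \<le> \<delta>1 * (2 / (\<delta>1 * real a)) / 2" using \<delta>1 by simp
    show "(1 + real D * (2 / (\<delta>1 * real a))) / real a \<le> 1 / 2"
      using DB_le by (intro order_trans[OF divide_right_mono small_B]) auto
    show "(real D / real (a + D) + 1 / real a) * exp ((1 + 1 / real a) * (real D / real (a + D))) \<le> 1 - \<delta>1"
      by (rule contr)
  qed
qed

lemma Om_colorings: "Om = colorings n G (a + D)"
  unfolding Om_def lcol_def colorings_def k_def by (auto simp: gadj_def)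

lemma deg_Nb: "card (Nb v) = gdeg n G v"
  by (simp add: Nb_def gdeg_def)

abbreviation L :: real where "L \<equiv> ln (real n)"
abbreviation S :: real where "S \<equiv> 2 * L / (\<kappa> * d)"
abbreviation A :: "nat set" where "A \<equiv> {v \<in> {..<n}. is_light v}"

lemma L0: "0 \<le> L" using n0 by simp

lemma S0: "0 \<le> S" using L0 \<kappa>0 d1 by simp

lemma score_le_S: "W \<subseteq> {..<n} \<Longrightarrow> conn W \<Longrightarrow> 4 * sum big_weight W - sum light_weight W \<le> S"
  using typG unfolding typical_def score_eq by blast

text \<open>The score bound read backwards: up to \<open>S\<close>, the degrees of big vertices are
  limited by the light vertices of the same connected set.\<close>

lemma big_bounds:
  assumes "W \<subseteq> {..<n}" "conn W"
  shows "real (card (W - A)) \<le> S + real (card (W \<inter> A))"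
    and "(\<Sum>v\<in>W - A. real (gdeg n G v)) \<le> d * (S + real (card (W \<inter> A)))"
proof -
  have fW: "finite W" using assms(1) finite_subset by blast
  have "sum light_weight W = (\<Sum>v\<in>W \<inter> A. 1)"
    using fW assms(1) by (intro sum.mono_neutral_cong_right) (auto simp: light_weight_def)
  then have l: "sum light_weight W = real (card (W \<inter> A))" by simp
  have "sum big_weight W = (\<Sum>v\<in>W - A. big_weight v)"
    using fW assms(1) by (intro sum.mono_neutral_right) (auto simp: big_weight_def)
  also have "\<dots> = (\<Sum>v\<in>W - A. c1 / d * real (gdeg n G v))"
    using assms(1) by (intro sum.cong refl) (auto simp: big_weight_def)
  finally have g: "sum big_weight W = c1 / d * (\<Sum>v\<in>W - A. real (gdeg n G v))" by (simp add: sum_distrib_left)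
  have s: "4 * (c1 / d * (\<Sum>v\<in>W - A. real (gdeg n G v))) \<le> S + real (card (W \<inter> A))"
    using score_le_S[OF assms] by (simp only: g l)
  have s0: "0 \<le> (\<Sum>v\<in>W - A. real (gdeg n G v))" by (simp add: sum_nonneg)
  have "1 * (\<Sum>v\<in>W - A. real (gdeg n G v)) \<le> (4 * c1) * (\<Sum>v\<in>W - A. real (gdeg n G v))"
    using c1 s0 by (intro mult_right_mono) auto
  also have "\<dots> \<le> d * (S + real (card (W \<inter> A)))" using s d1 by (simp add: field_simps)
  finally show sd: "(\<Sum>v\<in>W - A. real (gdeg n G v)) \<le> d * (S + real (card (W \<inter> A)))" by simp
  have "(\<Sum>v\<in>W - A. d) \<le> (\<Sum>v\<in>W - A. real (gdeg n G v))"
  proof (rule sum_mono)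
    fix v assume "v \<in> W - A"
    then have "\<tau> * d < real (gdeg n G v)" using assms(1) by (auto simp: is_light_def)
    moreover have "1 * d \<le> \<tau> * d" using tau d1 by (intro mult_right_mono) auto
    ultimately show "d \<le> real (gdeg n G v)" by simp
  qed
  then have "d * real (card (W - A)) \<le> d * (S + real (card (W \<inter> A)))" using sd by (simp add: mult.commute)
  then show "real (card (W - A)) \<le> S + real (card (W \<inter> A))" using d1 by simp
qed

lemma card_split: "W \<subseteq> {..<n} \<Longrightarrow> card W = card (W \<inter> A) + card (W - A)"
  using card_Int_Diff[of W A] finite_subset[of W "{..<n}"] by simp

text \<open>Only a fraction \<open>\<theta>\<close> of the light vertices is kept; components of what remains then have at most
\<open>a0\<close> light vertices with high probability.\<close>

abbreviation a0 :: real where "a0 \<equiv> 8 * L / sqrt d"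
abbreviation \<theta> :: real where "\<theta> \<equiv> exp (- sqrt d)"

text \<open>Union bound over spanning trees. That m light vertices survive has probability at most
  (2 * \<theta>) ^ m; the set has at most 3 * m vertices, so even against the tree weight (4 * d) ^
  (3 * m) a factor exp (- m * sqrt d / 2) is left. For m above \<open>a0\<close> this is at most
  \<open>1 / n ^ 4\<close>, and the weighted tree count is at most \<open>n ^ 2\<close>.\<close>

lemma bad_prob:
  assumes S_a0: "S \<le> a0" and dl: "2 * \<theta> * (4 * d) ^ 3 \<le> exp (- (sqrt d / 2))"
    and j: "j \<le> card A" "real (card A - j) \<le> 2 * \<theta> * real (card A)" and A: "A \<noteq> {}"
  shows "deletion_avg j (\<lambda>Y. if \<exists>W \<subseteq> ({..<n} - A) \<union> Y. conn W \<and> a0 < real (card (W \<inter> A)) then 1 else 0) A \<le> 1 / (real n)\<^sup>2"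
proof -
  define RR where "RR v = {s \<in> rooted_trees n v. snd s \<subseteq> G \<and> conn (fst s) \<and> a0 < real (card (fst s \<inter> A))}" for v
  have fRR: "finite (RR v)" for v by (simp add: RR_def)
  have fA: "finite A" by simp
  have "deletion_avg j (\<lambda>Y. if \<exists>W \<subseteq> ({..<n} - A) \<union> Y. conn W \<and> a0 < real (card (W \<inter> A)) then 1 else 0) A
    \<le> deletion_avg j (\<lambda>Y. \<Sum>v<n. \<Sum>s\<in>RR v. if fst s \<inter> A \<subseteq> Y then 1 else 0) A"
  proof (rule deletion_avg_mono[OF fA _ j(1)])
    fix Y assume Y: "Y \<subseteq> A"
    show "(if \<exists>W \<subseteq> ({..<n} - A) \<union> Y. conn W \<and> a0 < real (card (W \<inter> A)) then 1 else 0)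
      \<le> (\<Sum>v<n. \<Sum>s\<in>RR v. if fst s \<inter> A \<subseteq> Y then 1 else (0::real))"
    proof (cases "\<exists>W \<subseteq> ({..<n} - A) \<union> Y. conn W \<and> a0 < real (card (W \<inter> A))")
      case True
      then obtain W where W: "W \<subseteq> ({..<n} - A) \<union> Y" "conn W" "a0 < real (card (W \<inter> A))" by blast
      have WV: "W \<subseteq> {..<n}" using W(1) Y by auto
      obtain v where v: "v \<in> W" using conn_ne[OF W(2)] by blast
      have fW: "finite W" using WV finite_subset by blast
      obtain F where F: "rooted_tree v W F" "\<forall>e\<in>F. \<exists>x y. gadj n G x y \<and> e = {x, y}" using conn_RT[OF W(2) fW v] by blast
      have s: "(W, F) \<in> RR v" using F WV W by (auto simp: RR_def rooted_trees_def gadj_def)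
      have "W \<inter> A \<subseteq> Y" using W(1) by blast
      then have "1 = (if fst (W, F) \<inter> A \<subseteq> Y then 1 else (0::real))" by simp
      also have "\<dots> \<le> (\<Sum>s\<in>RR v. if fst s \<inter> A \<subseteq> Y then 1 else (0::real))"
        by (rule member_le_sum[OF s, of "\<lambda>s. if fst s \<inter> A \<subseteq> Y then 1 else (0::real)"]) (auto simp: fRR)
      also have "\<dots> \<le> (\<Sum>v<n. \<Sum>s\<in>RR v. if fst s \<inter> A \<subseteq> Y then 1 else (0::real))"
        using v WV by (intro member_le_sum[of v _ "\<lambda>v. \<Sum>s\<in>RR v. if fst s \<inter> A \<subseteq> Y then 1 else (0::real)"]) (auto intro!: sum_nonneg)
      finally show ?thesis by (subst if_P[OF True])
    next
      case False
      show ?thesis by (subst if_not_P[OF False]) (simp add: sum_nonneg)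
    qed
  qed
  also have "\<dots> = (\<Sum>v<n. \<Sum>s\<in>RR v. deletion_avg j (\<lambda>Y. if fst s \<inter> A \<subseteq> Y then 1 else 0) A)"
    by (simp only: deletion_avg_sum)
  also have "\<dots> \<le> (\<Sum>v<n. \<Sum>s\<in>RR v. exp (- (4 * L)) * (1 / (4 * d)) ^ card (fst s))"
  proof (intro sum_mono)
    fix v s assume s: "s \<in> RR v"
    let ?W = "fst s"
    let ?m = "card (?W \<inter> A)"
    have W: "?W \<subseteq> {..<n}" "conn ?W" "a0 < real ?m" using s by (auto simp: RR_def rooted_trees_def)
    have "real (card ?W) \<le> real ?m + (S + real ?m)"
      using card_split[OF W(1)] big_bounds(1)[OF W(1,2)] by simp
    also have "\<dots> \<le> real (3 * ?m)" using S_a0 W(3) by simp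
    finally have cW: "card ?W \<le> 3 * ?m" by (simp only: of_nat_le_iff)
    have cA: "0 < real (card A)" using A by (simp add: card_gt_0_iff)
    have "deletion_avg j (\<lambda>Y. if ?W \<inter> A \<subseteq> Y then 1 else 0) A \<le> (real (card A - j) / real (card A)) ^ ?m"
      by (rule deletion_avg_contains[OF fA j(1)])
    also have "\<dots> \<le> (2 * \<theta>) ^ ?m" using j(2) cA by (intro power_mono) (simp_all add: divide_le_eq)
    also have "\<dots> = (2 * \<theta>) ^ ?m * ((4 * d) ^ card ?W * (1 / (4 * d)) ^ card ?W)"
      using d1 by (simp add: power_divide)
    also have "\<dots> \<le> (2 * \<theta>) ^ ?m * ((4 * d) ^ (3 * ?m) * (1 / (4 * d)) ^ card ?W)"
      using d1 cW by (intro mult_left_mono mult_right_mono power_increasing) auto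
    also have "\<dots> = (2 * \<theta> * (4 * d) ^ 3) ^ ?m * (1 / (4 * d)) ^ card ?W"
      by (simp only: power_mult_distrib power_mult mult.assoc)
    also have "\<dots> \<le> exp (- (sqrt d / 2)) ^ ?m * (1 / (4 * d)) ^ card ?W"
      using dl d1 by (intro mult_right_mono power_mono) auto
    also have "\<dots> \<le> exp (- (4 * L)) * (1 / (4 * d)) ^ card ?W"
    proof (rule mult_right_mono)
      have "a0 * (sqrt d / 2) \<le> real ?m * (sqrt d / 2)" using W(3) d1 by (intro mult_right_mono) auto
      moreover have "a0 * (sqrt d / 2) = 4 * L" using d1 by simp
      ultimately show "exp (- (sqrt d / 2)) ^ ?m \<le> exp (- (4 * L))" by (simp add: exp_of_nat_mult[symmetric])
    qed (use d1 in simp)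
    finally show "deletion_avg j (\<lambda>Y. if ?W \<inter> A \<subseteq> Y then 1 else 0) A \<le> exp (- (4 * L)) * (1 / (4 * d)) ^ card ?W" .
  qed
  also have "\<dots> = exp (- (4 * L)) * (\<Sum>v<n. \<Sum>s\<in>RR v. (1 / (4 * d)) ^ card (fst s))"
    by (simp only: sum_distrib_left)
  also have "\<dots> \<le> exp (- (4 * L)) * (real n)\<^sup>2"
  proof (rule mult_left_mono)
    have "(\<Sum>v<n. \<Sum>s\<in>RR v. (1 / (4 * d)) ^ card (fst s))
      \<le> (\<Sum>v<n. \<Sum>s\<in>rooted_trees n v. if snd s \<subseteq> G then (1 / (4 * d)) ^ card (fst s) else 0)"
    proof (rule sum_mono)
      fix v
      have "(\<Sum>s\<in>RR v. (1 / (4 * d)) ^ card (fst s)) = (\<Sum>s\<in>RR v. if snd s \<subseteq> G then (1 / (4 * d)) ^ card (fst s) else 0)"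
        by (intro sum.cong refl) (simp add: RR_def)
      also have "\<dots> \<le> (\<Sum>s\<in>rooted_trees n v. if snd s \<subseteq> G then (1 / (4 * d)) ^ card (fst s) else 0)"
        using d1 by (intro sum_mono2) (auto simp: RR_def)
      finally show "(\<Sum>s\<in>RR v. (1 / (4 * d)) ^ card (fst s))
        \<le> (\<Sum>s\<in>rooted_trees n v. if snd s \<subseteq> G then (1 / (4 * d)) ^ card (fst s) else 0)" .
    qed
    also have "\<dots> \<le> (real n)\<^sup>2" using typG unfolding typical_def by blast
    finally show "(\<Sum>v<n. \<Sum>s\<in>RR v. (1 / (4 * d)) ^ card (fst s)) \<le> (real n)\<^sup>2" .
  qed simp
  also have "exp (- (4 * L)) * (real n)\<^sup>2 = 1 / (real n)\<^sup>2"
  proof -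
    have "exp (4 * L) = exp L ^ 4" by (simp add: exp_of_nat_mult[symmetric])
    also have "\<dots> = (real n)\<^sup>2 * (real n)\<^sup>2" using n0 by (simp add: power_add[symmetric])
    finally show ?thesis using n0 by (simp add: exp_minus field_simps)
  qed
  finally show ?thesis .
qed


abbreviation C1 :: real where "C1 \<equiv> 2 * \<tau> / (\<delta>1 * ac)"
text \<open>The three summands are the exponents of the freezing loss, of the components left after
  freezing (\<open>T1\<close>), and of single big clusters (\<open>T2\<close>).\<close>

abbreviation \<psi> :: real where
  "\<psi> \<equiv> 4 / (\<kappa> * sqrt d) + 8 * (3 * ln (7 * real (a + D)) + 8 / ac) / sqrt d + 2 * (5 * ln (real (a + D)) + 4 / ac) / (\<kappa> * d)"
abbreviation K0 :: real where
  "K0 \<equiv> 2 * exp (sqrt d * (2 * (2 + C1))) * (7 * real (a + D) * (7 * real (a + D) * exp (4 / ac))\<^sup>2) * (real D + 2)"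

text \<open>By \<open>big_bounds\<close> a connected set with at most \<open>a0\<close> light
  vertices has at most \<open>3 * a0\<close> vertices and degree sum at most
  \<open>4 * a0 * d\<close>.\<close>

lemma T1_bound:
  assumes S_a0: "S \<le> a0" and W: "W \<subseteq> {..<n}" "conn W" "real (card (W \<inter> A)) \<le> a0"
  shows "(\<Prod>h\<in>W. vertex_cost h) \<le> exp (a0 * (3 * ln (7 * real (a + D)) + 8 / ac))"
proof -
  let ?m = "real (card (W \<inter> A))"
  have fW: "finite W" using W(1) finite_subset by blast
  have kk: "0 < real (a + D)" "1 \<le> 7 * real (a + D)" using four by auto
  have a00: "0 \<le> a0" using L0 d1 by simp
  have cW: "real (card W) \<le> 3 * a0"
    using card_split[OF W(1)] big_bounds(1)[OF W(1,2)] S_a0 W(3) by simp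
  have "(\<Sum>h\<in>W. real (gdeg n G h)) = (\<Sum>h\<in>W - A. real (gdeg n G h)) + (\<Sum>h\<in>W \<inter> A. real (gdeg n G h))"
    using sum.Int_Diff[OF fW, of "\<lambda>h. real (gdeg n G h)" A] by simp
  also have "\<dots> \<le> d * (S + ?m) + (\<Sum>h\<in>W \<inter> A. 2 * d)"
  proof (intro add_mono big_bounds(2)[OF W(1,2)] sum_mono)
    fix h assume "h \<in> W \<inter> A"
    then have "real (gdeg n G h) \<le> \<tau> * d" by (simp add: is_light_def)
    also have "\<dots> \<le> 2 * d" using tau d1 by (intro mult_right_mono) auto
    finally show "real (gdeg n G h) \<le> 2 * d" .
  qed
  also have "\<dots> = d * (S + 3 * ?m)" by (simp add: algebra_simps)
  also have "\<dots> \<le> d * (4 * a0)" using S_a0 W(3) d1 by (intro mult_left_mono) auto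
  finally have dW: "(\<Sum>h\<in>W. real (gdeg n G h)) \<le> d * (4 * a0)" .
  have "2 * (\<Sum>h\<in>W. real (gdeg n G h)) / real a \<le> 2 * (d * (4 * a0)) / (ac * d)"
    using dW ac d1 a00 four L0 by (intro frac_le mult_left_mono mult_nonneg_nonneg) auto
  also have "\<dots> = a0 * (8 / ac)" using d1 by (simp add: field_simps)
  finally have e: "2 * (\<Sum>h\<in>W. real (gdeg n G h)) / real a \<le> a0 * (8 / ac)" .
  have "(\<Prod>h\<in>W. vertex_cost h) = (7 * real (a + D)) ^ card W * exp (\<Sum>h\<in>W. 2 * real (gdeg n G h) / real a)"
    unfolding vertex_cost_def deg_Nb k_def prod.distrib prod_constant exp_sum[OF fW] by (simp only: power_mult_distrib)
  also have "(\<Sum>h\<in>W. 2 * real (gdeg n G h) / real a) = 2 * (\<Sum>h\<in>W. real (gdeg n G h)) / real a"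
    by (simp add: sum_distrib_left sum_divide_distrib)
  also have "(7 * real (a + D)) ^ card W = exp (real (card W) * ln (7 * real (a + D)))"
    using kk by (simp add: exp_of_nat_mult)
  also have "exp (real (card W) * ln (7 * real (a + D))) * exp (2 * (\<Sum>h\<in>W. real (gdeg n G h)) / real a)
    \<le> exp (3 * a0 * ln (7 * real (a + D))) * exp (a0 * (8 / ac))"
  proof (intro mult_mono)
    have "real (card W) * ln (7 * real (a + D)) \<le> 3 * a0 * ln (7 * real (a + D))"
      using cW ln_ge_zero[OF kk(2)] by (rule mult_right_mono)
    then show "exp (real (card W) * ln (7 * real (a + D))) \<le> exp (3 * a0 * ln (7 * real (a + D)))" by (simp only: exp_le_cancel_iff)
  qed (use e in simp_all)
  also have "\<dots> = exp (a0 * (3 * ln (7 * real (a + D)) + 8 / ac))"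
    unfolding exp_add[symmetric] by (rule arg_cong[of _ _ exp]) (simp add: algebra_simps)
  finally show ?thesis .
qed

text \<open>A big cluster contains no light vertex, so \<open>big_bounds\<close> limits its size to
  \<open>S\<close> and its degree sum to \<open>d * S\<close>.\<close>

lemma T2_bound:
  assumes v: "v < n" "\<not> is_light v"
  shows "7 * real k ^ (5 * card (cluster v) + 1) / (compat_bound (cluster v))\<^sup>2 * (7 * real k * exp (2 * real D / real a))\<^sup>2
    \<le> 7 * real (a + D) * (7 * real (a + D) * exp (4 / ac))\<^sup>2 * exp (S * (5 * ln (real (a + D)) + 4 / ac))"
proof -
  have KV: "cluster v \<subseteq> {..<n}" by (rule cluster_V) (use v in simp)
  have KA: "cluster v \<inter> A = {}" "cluster v - A = cluster v" using cluster_big_sub[OF v(2)] by auto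
  have cK: "real (card (cluster v)) \<le> S" and dK: "(\<Sum>h\<in>cluster v. real (gdeg n G h)) \<le> d * S"
    using big_bounds[OF KV conn_cl] unfolding KA by simp_all
  have kk: "1 \<le> real (a + D)" using four by auto
  have "real k ^ (5 * card (cluster v) + 1) = real (a + D) * exp (5 * real (card (cluster v)) * ln (real (a + D)))"
  proof -
    have "exp (5 * real (card (cluster v)) * ln (real (a + D))) = exp (real (5 * card (cluster v)) * ln (real (a + D)))" by simp
    also have "\<dots> = exp (ln (real (a + D))) ^ (5 * card (cluster v))" by (rule exp_of_nat_mult)
    finally show ?thesis using kk by (simp add: k_def)
  qed
  also have "\<dots> \<le> real (a + D) * exp (5 * S * ln (real (a + D)))"
  proof (rule mult_left_mono)
    have "5 * real (card (cluster v)) * ln (real (a + D)) \<le> 5 * S * ln (real (a + D))"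
      using cK ln_ge_zero[OF kk] by (intro mult_right_mono) auto
    then show "exp (5 * real (card (cluster v)) * ln (real (a + D))) \<le> exp (5 * S * ln (real (a + D)))" by (simp only: exp_le_cancel_iff)
  qed simp
  finally have p1: "real k ^ (5 * card (cluster v) + 1) \<le> real (a + D) * exp (5 * S * ln (real (a + D)))" .
  have "1 / (compat_bound (cluster v))\<^sup>2 = exp (4 * (\<Sum>h\<in>cluster v. real (gdeg n G h)) / real a)"
    by (simp add: compat_bound_def deg_Nb exp_minus power_inverse exp_of_nat_mult[symmetric] field_simps)
  also have "\<dots> \<le> exp (4 * (S / ac))"
  proof -
    have "4 * (\<Sum>h\<in>cluster v. real (gdeg n G h)) / real a \<le> 4 * (d * S) / (ac * d)"
      using dK ac d1 L0 \<kappa>0 four by (intro frac_le mult_left_mono mult_nonneg_nonneg) auto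
    also have "\<dots> = 4 * (S / ac)" using d1 by simp
    finally show ?thesis by simp
  qed
  finally have p2: "1 / (compat_bound (cluster v))\<^sup>2 \<le> exp (4 * (S / ac))" .
  have "2 * real D / real a \<le> 2 * (2 * d) / (ac * d)"
  proof (intro frac_le mult_left_mono)
    show "real D \<le> 2 * d" by (rule order_trans[OF D_le(1) mult_right_mono]) (use tau d1 in auto)
  qed (use ac d1 in auto)
  also have "\<dots> = 4 / ac" using d1 by simp
  finally have p3: "exp (2 * real D / real a) \<le> exp (4 / ac)" by simp
  have "7 * real k ^ (5 * card (cluster v) + 1) / (compat_bound (cluster v))\<^sup>2 * (7 * real k * exp (2 * real D / real a))\<^sup>2
    = 7 * (real k ^ (5 * card (cluster v) + 1)) * (1 / (compat_bound (cluster v))\<^sup>2) * (7 * real (a + D) * exp (2 * real D / real a))\<^sup>2"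
    by (simp add: k_def)
  also have "\<dots> \<le> 7 * (real (a + D) * exp (5 * S * ln (real (a + D)))) * exp (4 * (S / ac)) * (7 * real (a + D) * exp (4 / ac))\<^sup>2"
    using p1 p2 p3 by (intro mult_mono power_mono mult_nonneg_nonneg) auto
  also have "\<dots> = 7 * real (a + D) * (7 * real (a + D) * exp (4 / ac))\<^sup>2 * (exp (5 * S * ln (real (a + D))) * exp (4 * (S / ac)))"
    by (simp only: mult_ac)
  also have "exp (5 * S * ln (real (a + D))) * exp (4 * (S / ac)) = exp (S * (5 * ln (real (a + D)) + 4 / ac))"
    unfolding exp_add[symmetric] by (rule arg_cong[of _ _ exp]) (simp add: algebra_simps)
  finally show ?thesis .
qed

lemma Poincare_typical:
  assumes e1: "2 / (\<kappa> * d) \<le> 8 / sqrt d" and e2: "2 * \<theta> * (4 * d) ^ 3 \<le> exp (- (sqrt d / 2))"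
    and e3: "4 / (\<kappa> * sqrt d) \<le> 1"
    and n1: "2 \<le> \<theta> * real n" and n2: "4 * (2 + C1 + S) \<le> \<theta> * real n"
    and n3: "2 * exp (sqrt d * (2 * (2 + C1))) \<le> real n"
  shows "EV {..<n} f \<le> K0 * real n powr \<psi> * (\<Sum>u<n. EV {u} f)"
proof -
  define N where "N = card A"
  \<comment> \<open>The number of light vertices that stay free, rounded up. By \<open>n1\<close> it
    is positive and at most \<open>2 * \<theta> * N\<close>.\<close>
  define m where "m = nat \<lceil>\<theta> * real N\<rceil>"
  define j where "j = N - m"
  define \<Lambda> where "\<Lambda> = 2 * (2 + real D * (2 / (\<delta>1 * real a)) + S)"
  define T1 where "T1 = exp (a0 * (3 * ln (7 * real (a + D)) + 8 / ac))"
  define T2 where "T2 = 7 * real (a + D) * (7 * real (a + D) * exp (4 / ac))\<^sup>2 * exp (S * (5 * ln (real (a + D)) + 4 / ac))"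
  define loss where "loss = (real N / real (N - j)) powr \<Lambda>"
  have sd: "1 \<le> sqrt d" "sqrt d * sqrt d = d" using d1 by auto
  have kk: "1 \<le> real (a + D)" "1 \<le> 7 * real (a + D)" using four by auto
  have S_a0: "S \<le> a0" using mult_right_mono[OF e1 L0] by (simp add: mult.commute)
  have nN: "real n \<le> 2 * real N" using typG unfolding typical_def N_def is_light_def by simp
  have N0: "0 < N" using nN n0 by simp
  have "\<theta> * real n \<le> \<theta> * (2 * real N)" using nN by (intro mult_left_mono) auto
  then have tN: "\<theta> * real n \<le> 2 * (\<theta> * real N)" by (simp only: mult_ac)
  have th1: "\<theta> \<le> 1" using sd by simp
  have mN: "m \<le> N"
  proof -
    have "\<theta> * real N \<le> 1 * real N" using th1 by (intro mult_right_mono) auto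
    then show ?thesis unfolding m_def by linarith
  qed
  have tN0: "0 \<le> \<theta> * real N" by simp
  have mlow: "\<theta> * real N \<le> real m" and mup: "real m \<le> \<theta> * real N + 1"
    unfolding m_def using tN0 by linarith+
  have m2: "real m \<le> 2 * \<theta> * real N" using mup n1 tN unfolding mult.assoc by linarith
  have m0: "0 < m" using mlow n1 tN by (cases m) auto
  have Nj: "N - j = m" using mN by (simp add: j_def)
  have jN: "j < N" using m0 N0 by (simp add: j_def)
  have Lam: "\<Lambda> \<le> 2 * (2 + C1 + S)" "0 \<le> \<Lambda>" using DB_le S0 \<delta>1 by (auto simp: \<Lambda>_def)
  have loss_le: "loss \<le> exp (sqrt d * (2 * (2 + C1))) * real n powr (4 / (\<kappa> * sqrt d))"
  proof -
    have "real N / real m \<le> exp (sqrt d)"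
      using mlow m0 by (simp add: exp_minus field_simps)
    then have "loss \<le> exp (sqrt d) powr \<Lambda>" unfolding loss_def Nj using Lam by (intro powr_mono2) auto
    also have "\<dots> = exp (sqrt d * \<Lambda>)" by (simp add: powr_def mult.commute)
    also have "\<dots> \<le> exp (sqrt d * (2 * (2 + C1 + S)))" using Lam sd by simp
    also have "sqrt d * (2 * (2 + C1 + S)) = sqrt d * (2 * (2 + C1)) + 4 / (\<kappa> * sqrt d) * L"
    proof -
      have "sqrt d * (2 * S) = sqrt d * 4 * L / (\<kappa> * (sqrt d * sqrt d))" unfolding sd(2) by simp
      also have "\<dots> = 4 / (\<kappa> * sqrt d) * L" using sd(1) \<kappa>0 by (simp add: field_simps)
      finally have "sqrt d * (2 * S) = 4 / (\<kappa> * sqrt d) * L" .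
      moreover have "sqrt d * (2 * (2 + C1 + S)) = sqrt d * (2 * (2 + C1)) + sqrt d * (2 * S)"
        by (simp add: algebra_simps)
      ultimately show ?thesis by simp
    qed
    finally show ?thesis using n0 by (simp add: exp_add powr_def)
  qed
  \<comment> \<open>By \<open>e3\<close> the loss grows at most linearly in n, and the failure
    probability \<open>1 / n ^ 2\<close> compensates this once n is large.\<close>
  have half: "loss * (1 / (real n)\<^sup>2) \<le> 1 / 2"
  proof -
    have "real n powr (4 / (\<kappa> * sqrt d)) \<le> real n powr 1" using e3 n0 by (intro powr_mono) auto
    then have "loss \<le> exp (sqrt d * (2 * (2 + C1))) * real n"
      using n0 by (intro order_trans[OF loss_le] mult_left_mono) auto
    also have "\<dots> \<le> (real n / 2) * real n" using n3 by (intro mult_right_mono) auto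
    finally show ?thesis using n0 by (simp add: field_simps power2_eq_square)
  qed
  have T1: "1 \<le> T1" using L0 ac d1 kk by (simp add: T1_def)
  have T2: "1 \<le> T2"
  proof -
    have "0 \<le> S * (5 * ln (real (a + D)) + 4 / ac)"
      using S0 ac ln_ge_zero[OF kk(1)] by (intro mult_nonneg_nonneg) auto
    then have "1 * (1 * 1)\<^sup>2 * 1 \<le> T2" unfolding T2_def
      using kk ac by (intro mult_mono power_mono) auto
    then show ?thesis by simp
  qed
  have "EV {..<n} f \<le> 2 * (real (card A) / real (card A - j)) powr (2 * (2 + real D * (2 / (\<delta>1 * real a)) + S)) * T1 * T2 * (real D + 2) * (\<Sum>u\<in>{..<n}. EV {u} f)"
  proof (rule Poincare[where ?a0.0 = a0 and pb = "1 / (real n)\<^sup>2"])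
    show "4 * sum big_weight W - sum light_weight W \<le> S" if "W \<subseteq> {..<n}" "conn W" for W using that by (rule score_le_S)
    show "0 \<le> S" by (rule S0)
    show "j < card A" using jN by (simp only: N_def)
    have "\<Lambda> \<le> real m" using Lam n2 tN mlow by linarith
    then show "2 * (2 + real D * (2 / (\<delta>1 * real a)) + S) \<le> real (card A - j)"
      using Nj by (simp only: N_def \<Lambda>_def)
    show "deletion_avg j (\<lambda>Y. if \<exists>W\<subseteq>{..<n} - A \<union> Y. conn W \<and> a0 < real (card (W \<inter> A)) then 1 else 0) A \<le> 1 / (real n)\<^sup>2"
    proof (rule bad_prob[OF S_a0 e2])
      show "j \<le> card A" using jN by (simp add: N_def)
      show "real (card A - j) \<le> 2 * \<theta> * real (card A)" using m2 Nj by (simp only: N_def)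
      show "A \<noteq> {}" using N0 unfolding N_def by (metis card.empty less_irrefl)
    qed
    show "(real (card A) / real (card A - j)) powr (2 * (2 + real D * (2 / (\<delta>1 * real a)) + S)) * (1 / (real n)\<^sup>2) \<le> 1 / 2"
      using half by (simp only: loss_def N_def \<Lambda>_def)
    show "1 \<le> T1" by (rule T1)
    show "(\<Prod>h\<in>W. vertex_cost h) \<le> T1" if "W \<subseteq> {..<n}" "conn W" "real (card (W \<inter> A)) \<le> a0" for W
      unfolding T1_def by (rule T1_bound[OF S_a0 that])
    show "1 \<le> T2" by (rule T2)
    show "7 * real k ^ (5 * card (cluster v) + 1) / (compat_bound (cluster v))\<^sup>2 * (7 * real k * exp (2 * real D / real a))\<^sup>2 \<le> T2"
      if "v \<in> {..<n}" "\<not> is_light v" for v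
      unfolding T2_def by (rule T2_bound) (use that in auto)
  qed
  also have "\<dots> = (2 * loss * T1 * T2 * (real D + 2)) * (\<Sum>u<n. EV {u} f)"
    by (simp only: loss_def N_def \<Lambda>_def)
  also have "\<dots> \<le> (K0 * real n powr \<psi>) * (\<Sum>u<n. EV {u} f)"
  proof (rule mult_right_mono)
    have T1n: "T1 = real n powr (8 * (3 * ln (7 * real (a + D)) + 8 / ac) / sqrt d)"
      using n0 by (simp add: T1_def powr_def mult_ac)
    have T2n: "T2 = 7 * real (a + D) * (7 * real (a + D) * exp (4 / ac))\<^sup>2 * real n powr (2 * (5 * ln (real (a + D)) + 4 / ac) / (\<kappa> * d))"
      using n0 by (simp add: T2_def powr_def mult_ac)
    have "2 * loss * T1 * T2 * (real D + 2)
      \<le> 2 * (exp (sqrt d * (2 * (2 + C1))) * real n powr (4 / (\<kappa> * sqrt d))) * T1 * T2 * (real D + 2)"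
      using loss_le T1 T2 by (intro mult_right_mono mult_left_mono) auto
    also have "\<dots> = K0 * (real n powr (4 / (\<kappa> * sqrt d)) * real n powr (8 * (3 * ln (7 * real (a + D)) + 8 / ac) / sqrt d)
       * real n powr (2 * (5 * ln (real (a + D)) + 4 / ac) / (\<kappa> * d)))"
      unfolding T1n T2n by (simp only: mult_ac)
    finally show "2 * loss * T1 * T2 * (real D + 2) \<le> K0 * real n powr \<psi>"
      by (simp only: powr_add)
  qed (simp add: sum_nonneg EV_nonneg)
  finally show ?thesis .
qed

end

lemma (in typical_graph) mixing_typical:
  assumes e1: "2 / (\<kappa> * d) \<le> 8 / sqrt d" and e2: "2 * exp (- sqrt d) * (4 * d) ^ 3 \<le> exp (- (sqrt d / 2))"
    and e3: "4 / (\<kappa> * sqrt d) \<le> 1"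
    and n1: "2 \<le> exp (- sqrt d) * real n" and n2: "4 * (2 + C1 + S) \<le> exp (- sqrt d) * real n"
    and n3: "2 * exp (sqrt d * (2 * (2 + C1))) \<le> real n"
    and x: "\<psi> \<le> x"
  shows "\<exists>T. mixing_time n G (a + D) = enat T \<and> real T \<le> (K0 * (ln (real (a + D)) + 2) + 1) * real n powr (2 + x)"
proof -
  define l where "l = ln (real (a + D))"
  define T where "T = K0 * real n powr \<psi>"
  have k1: "1 \<le> real (a + D)" using four by auto
  have l0: "0 \<le> l" unfolding l_def by (rule ln_ge_zero[OF k1])
  have K0: "0 < K0" using k1 by (intro mult_pos_pos zero_less_power) auto
  have n1': "1 \<le> real n" using n0 by simp
  have T0: "0 < T" unfolding T_def by (rule mult_pos_pos[OF K0]) (use n0 in simp)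
  define X where "X = real n * T * (real n * l + 2)"
  have X0: "0 \<le> X" unfolding X_def using T0 l0 n1' by (intro mult_nonneg_nonneg add_nonneg_nonneg) auto
  have "mixes_by n G (a + D) (nat \<lceil>X\<rceil>)"
  proof (rule mixes_by_Poincare[OF n0 _ T0])
    show "1 \<le> a + D" using four by simp
    show "cspace.EV (colorings n G (a + D)) {..<n} f \<le> T * (\<Sum>v<n. cspace.EV (colorings n G (a + D)) {v} f)" for f
      using Poincare_typical[OF e1 e2 e3 n1 n2 n3, of f] unfolding Om_colorings T_def .
    show "real n * T * (real n * ln (real (a + D)) + 2) \<le> real (nat \<lceil>X\<rceil>)"
      unfolding l_def[symmetric] X_def[symmetric] by linarith
  qed
  then obtain T' where T': "mixing_time n G (a + D) = enat T'" "T' \<le> nat \<lceil>X\<rceil>" using mixing_time_le by blast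
  have "real T' \<le> X + 1" using T'(2) X0 by linarith
  also have "X \<le> real n * T * (real n * (l + 2))"
    unfolding X_def using T0 n1' l0 by (intro mult_left_mono) (simp_all add: distrib_left)
  also have "\<dots> = K0 * (l + 2) * real n powr (2 + \<psi>)"
    using n0 by (simp add: T_def powr_add powr_numeral power2_eq_square mult_ac)
  also have "K0 * (l + 2) * real n powr (2 + \<psi>) + 1 \<le> K0 * (l + 2) * real n powr (2 + x) + real n powr (2 + x)"
  proof (intro add_mono mult_left_mono)
    show "real n powr (2 + \<psi>) \<le> real n powr (2 + x)" using x n1' by (intro powr_mono) auto
    have "0 \<le> \<psi>"
      using \<kappa>0 d1 ac k1 ln_ge_zero[OF k1] by (intro add_nonneg_nonneg divide_nonneg_nonneg mult_nonneg_nonneg ln_ge_zero) auto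
    then show "1 \<le> real n powr (2 + x)" using x n1' by (intro ge_one_powr_ge_zero) auto
    show "0 \<le> K0 * (l + 2)" by (rule mult_nonneg_nonneg[OF less_imp_le[OF K0]]) (use l0 in simp)
  qed
  also have "\<dots> = (K0 * (l + 2) + 1) * real n powr (2 + x)" by (simp add: distrib_right)
  finally show ?thesis using T'(1) by (auto simp: l_def)
qed

section \<open>Transfer to the random graph and choice of the constants\<close>

lemma gnp_prob_mono:
  assumes "0 \<le> p" "p \<le> 1" "\<And>G. P G \<Longrightarrow> Q G"
  shows "gnp_prob n p P \<le> gnp_prob n p Q"
  unfolding gnp_prob_eq_mean using assms by (intro gnp_mean_mono) auto

lemma gnp_prob_le_1:
  assumes "0 \<le> p" "p \<le> 1"
  shows "gnp_prob n p P \<le> 1"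
proof -
  have "gnp_prob n p P \<le> gnp_mean n p (\<lambda>_. 1)" unfolding gnp_prob_eq_mean using assms by (intro gnp_mean_mono) auto
  also have "\<dots> = 1" using gnp_mean_prod[of "{}" n p "\<lambda>_. 1"] by simp
  finally show ?thesis .
qed

text \<open>The number of colours fixes a reference degree \<open>d\<close> by
  \<open>k = \<rho> * d\<close>, while the graph has parameter \<open>dd \<le> d\<close>. The random
  graph enters only through upper bounds on its edge probability, so surplus colours amount to a
  larger \<open>d\<close> for the same graph.\<close>

lemma whp_mixing:
  fixes \<rho> \<tau> \<delta>1 d dd x :: real and k :: nat
  defines "\<epsilon> \<equiv> \<tau> - 1" and "ac \<equiv> \<rho> - \<tau>"
  defines "c1 \<equiv> max 2 (2 / (\<delta>1 * ac))"
  defines "\<kappa> \<equiv> \<epsilon>\<^sup>2 / (256 * c1)"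
  assumes tau: "1 < \<tau>" "\<tau> \<le> 2" "\<tau> < \<rho>" and \<delta>1: "0 < \<delta>1" "\<delta>1 \<le> 1" and k: "real k = \<rho> * d" and dd: "0 \<le> dd" "dd \<le> d"
    and d1: "1 \<le> d" and d2: "4 \<le> ac * d" "2 * (1 + 2 * \<tau> / (\<delta>1 * ac)) \<le> ac * d"
    and d3: "(\<tau> / \<rho> + 1 / (ac * d)) * exp ((1 + 1 / (ac * d)) * (\<tau> / \<rho>)) \<le> 1 - \<delta>1"
    and d4: "96 * d * exp (- (\<kappa> * d)) \<le> 1 / 4"
    and e1: "2 / (\<kappa> * d) \<le> 8 / sqrt d" and e2: "2 * exp (- sqrt d) * (4 * d) ^ 3 \<le> exp (- (sqrt d / 2))"
    and e3: "4 / (\<kappa> * sqrt d) \<le> 1"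
    and x: "4 / (\<kappa> * sqrt d) + 8 * (3 * ln (7 * (\<rho> * d)) + 8 / ac) / sqrt d + 2 * (5 * ln (\<rho> * d) + 4 / ac) / (\<kappa> * d) \<le> x"
  shows "\<exists>C>0. (\<lambda>n. gnp_prob n (dd / real n) (\<lambda>G. \<exists>T. mixing_time n G k = enat T \<and> real T \<le> C * real n powr (2 + x))) \<longlonglongrightarrow> 1"
proof -
  define \<mu> where "\<mu> = \<kappa> * d"
  define D where "D = nat \<lfloor>\<tau> * d\<rfloor>"
  define a where "a = k - D"
  have ac0: "0 < ac" using tau by (simp add: ac_def)
  have eps: "0 < \<epsilon>" "\<epsilon> \<le> 1" using tau by (auto simp: \<epsilon>_def)
  have c1: "2 \<le> c1" "2 / (\<delta>1 * ac) \<le> c1" by (auto simp: c1_def)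
  have \<kappa>0: "0 < \<kappa>" using eps c1 by (simp add: \<kappa>_def)
  have td: "0 \<le> \<tau> * d" using tau d1 by simp
  have Dr: "real D \<le> \<tau> * d" using td unfolding D_def by linarith
  have tr: "\<tau> * d \<le> \<rho> * d" using tau d1 by (intro mult_right_mono) auto
  have "real D \<le> real k" using Dr tr k by linarith
  then have Dk: "D \<le> k" by simp
  have kaD: "a + D = k" using Dk by (simp add: a_def)
  have "real a = \<rho> * d - real D" using Dk k by (simp add: a_def of_nat_diff)
  then have ar: "ac * d \<le> real a" using Dr by (simp add: ac_def left_diff_distrib)
  have a0: "0 < real a" using ar d2 by linarith
  have acd: "0 < ac * d" using d2 by linarith
  have sb: "(1 + 2 * \<tau> / (\<delta>1 * ac)) / real a \<le> 1 / 2" using ar d2(2) a0 by (simp add: field_simps)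
  have contr: "(real D / real (a + D) + 1 / real a) * exp ((1 + 1 / real a) * (real D / real (a + D))) \<le> 1 - \<delta>1"
  proof -
    have "real D / real k \<le> (\<tau> * d) / (\<rho> * d)" unfolding k using Dr tau d1 by (intro divide_right_mono) auto
    also have "\<dots> = \<tau> / \<rho>" using d1 by simp
    finally have q: "real D / real k \<le> \<tau> / \<rho>" .
    have i: "1 / real a \<le> 1 / (ac * d)" using ar acd a0 by (intro divide_left_mono) auto
    have "(real D / real k + 1 / real a) * exp ((1 + 1 / real a) * (real D / real k))
      \<le> (\<tau> / \<rho> + 1 / (ac * d)) * exp ((1 + 1 / (ac * d)) * (\<tau> / \<rho>))"
      using q i a0 acd tau by (intro mult_mono add_mono iffD2[OF exp_le_cancel_iff] add_nonneg_nonneg) auto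
    also have "\<dots> \<le> 1 - \<delta>1" by (rule d3)
    finally show ?thesis unfolding kaD .
  qed
  define K where "K = 2 * exp (sqrt d * (2 * (2 + 2 * \<tau> / (\<delta>1 * ac)))) * (7 * real k * (7 * real k * exp (4 / ac))\<^sup>2) * (real D + 2)"
  define C where "C = K * (ln (real k) + 2) + 1"
  have k1: "1 \<le> real k" using kaD a0 by simp
  have K0: "0 < K" unfolding K_def using k1 by (intro mult_pos_pos zero_less_power) auto
  have C0: "0 < C" unfolding C_def using K0 ln_ge_zero[OF k1] by (intro add_nonneg_pos mult_nonneg_nonneg) auto
  define good where "good n G \<longleftrightarrow> (\<exists>T. mixing_time n G k = enat T \<and> real T \<le> C * real n powr (2 + x))" for n G
  define err where "err n = 1 / real n + exp (10 * \<mu>) * 9 * d\<^sup>2 / (2 * real n) + (2 * exp (- \<mu>)) ^ n" for n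
  have ev: "eventually (\<lambda>n. 1 \<le> n \<and> dd \<le> real n \<and> 2 \<le> exp (- sqrt d) * real n
      \<and> 4 * (2 + 2 * \<tau> / (\<delta>1 * ac) + 2 * ln (real n) / (\<kappa> * d)) \<le> exp (- sqrt d) * real n
      \<and> 2 * exp (sqrt d * (2 * (2 + 2 * \<tau> / (\<delta>1 * ac)))) \<le> real n) sequentially"
  proof (intro eventually_conj)
    show "\<forall>\<^sub>F n in sequentially. 1 \<le> n" by (rule eventually_ge_at_top)
    show "\<forall>\<^sub>F n in sequentially. dd \<le> real n" by real_asymp
    show "\<forall>\<^sub>F n in sequentially. 2 \<le> exp (- sqrt d) * real n" by real_asymp
    show "\<forall>\<^sub>F n in sequentially. 4 * (2 + 2 * \<tau> / (\<delta>1 * ac) + 2 * ln (real n) / (\<kappa> * d)) \<le> exp (- sqrt d) * real n"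
    proof -
      define u v w where "u = 4 * (2 + 2 * \<tau> / (\<delta>1 * ac))" and "v = 8 / (\<kappa> * d)" and "w = exp (- sqrt d)"
      have "0 < v" "0 < w" using \<kappa>0 d1 by (auto simp: v_def w_def)
      then have "\<forall>\<^sub>F n in sequentially. u + v * ln (real n) \<le> w * real n" by real_asymp
      moreover have "4 * (2 + 2 * \<tau> / (\<delta>1 * ac) + 2 * ln (real n) / (\<kappa> * d)) = u + v * ln (real n)" for n
        by (simp add: u_def v_def algebra_simps)
      ultimately show ?thesis by (simp only: w_def)
    qed
    show "\<forall>\<^sub>F n in sequentially. 2 * exp (sqrt d * (2 * (2 + 2 * \<tau> / (\<delta>1 * ac)))) \<le> real n"
    proof -
      define u where "u = 2 * exp (sqrt d * (2 * (2 + 2 * \<tau> / (\<delta>1 * ac))))"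
      have "\<forall>\<^sub>F n in sequentially. u \<le> real n" by real_asymp
      then show ?thesis by (simp only: u_def)
    qed
  qed
  have main: "1 - err n \<le> gnp_prob n (dd / real n) (good n) \<and> gnp_prob n (dd / real n) (good n) \<le> 1"
    if n: "1 \<le> n \<and> dd \<le> real n \<and> 2 \<le> exp (- sqrt d) * real n
      \<and> 4 * (2 + 2 * \<tau> / (\<delta>1 * ac) + 2 * ln (real n) / (\<kappa> * d)) \<le> exp (- sqrt d) * real n
      \<and> 2 * exp (sqrt d * (2 * (2 + 2 * \<tau> / (\<delta>1 * ac)))) \<le> real n" for n
  proof -
    have p: "0 \<le> dd / real n" "dd / real n \<le> 1" using n dd by (auto simp: divide_le_eq)
    have b: "4 * (c1 / d) * \<mu> = \<epsilon>\<^sup>2 / 64"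
      using c1 d1 by (simp add: \<mu>_def \<kappa>_def field_simps)
    have e2le: "\<epsilon>\<^sup>2 \<le> \<epsilon>" "\<epsilon>\<^sup>2 \<le> 1" using eps by (auto simp: power2_eq_square mult_le_one mult_left_le)
    interpret first_moment n "dd / real n" d \<mu> "c1 / d" "\<tau> * d" "\<epsilon> / 16"
    proof unfold_locales
      show "0 < n" "0 \<le> dd / real n" "dd / real n \<le> 1" "1 \<le> d" using n p d1 by auto
      show "real n * (dd / real n) \<le> d" using n dd by simp
      show "0 < \<mu>" "0 < c1 / d" "0 < \<epsilon> / 16" "0 \<le> \<tau> * d" using \<kappa>0 d1 c1 eps td by (auto simp: \<mu>_def)
      show "4 * (c1 / d) * \<mu> + \<epsilon> / 16 \<le> 1 / 2" using b eps e2le by simp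
      show "96 * d * exp (- \<mu>) \<le> 1 / 4" using d4 by (simp add: \<mu>_def)
      show "1 \<le> 4 * (c1 / d) * (\<tau> * d)" using c1 tau d1 mult_mono[of 1 c1 1 \<tau>] by simp
      \<comment> \<open>As \<tau> = 1 + \<epsilon>, the tilt \<epsilon> / 16 gains
        \<open>\<epsilon>\<^sup>2 / 16\<close>, and \<kappa> is chosen so small that the remaining
        terms of order \<open>\<epsilon>\<^sup>2\<close> stay below this gain.\<close>
      show "d * (4 * (c1 / d) * \<mu> + \<epsilon> / 16 + 2 * (4 * (c1 / d) * \<mu> + \<epsilon> / 16)\<^sup>2) - \<epsilon> / 16 * (\<tau> * d) \<le> - \<mu>"
      proof -
        have "\<epsilon>\<^sup>2 / 64 + \<epsilon> / 16 \<le> \<epsilon> * (5 / 64)" using e2le by simp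
        then have "(\<epsilon>\<^sup>2 / 64 + \<epsilon> / 16)\<^sup>2 \<le> (\<epsilon> * (5 / 64))\<^sup>2" using eps by (intro power_mono) auto
        also have "\<dots> = \<epsilon>\<^sup>2 * (25 / 4096)" by (simp add: power2_eq_square)
        finally have sq: "(\<epsilon>\<^sup>2 / 64 + \<epsilon> / 16)\<^sup>2 \<le> \<epsilon>\<^sup>2 * (25 / 4096)" .
        have "\<tau> = 1 + \<epsilon>" by (simp add: \<epsilon>_def)
        then have te: "\<epsilon> / 16 * \<tau> = \<epsilon> / 16 + \<epsilon>\<^sup>2 / 16" by (simp add: distrib_left power2_eq_square)
        have "\<kappa> \<le> \<epsilon>\<^sup>2 / 512" unfolding \<kappa>_def using c1 by (intro divide_left_mono) auto
        then have "\<epsilon>\<^sup>2 / 64 + \<epsilon> / 16 + 2 * (\<epsilon>\<^sup>2 / 64 + \<epsilon> / 16)\<^sup>2 - \<epsilon> / 16 * \<tau> + \<kappa> \<le> 0"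
          using sq zero_le_power2[of \<epsilon>] te by linarith
        then have "d * (\<epsilon>\<^sup>2 / 64 + \<epsilon> / 16 + 2 * (\<epsilon>\<^sup>2 / 64 + \<epsilon> / 16)\<^sup>2 - \<epsilon> / 16 * \<tau> + \<kappa>) \<le> 0"
          using d1 by (simp add: mult_nonneg_nonpos)
        then show ?thesis unfolding b by (simp add: \<mu>_def algebra_simps)
      qed
    qed
    have imp: "good n G" if typG: "typical n (c1 / d) (\<tau> * d) d (2 * ln (real n) / (\<kappa> * d)) G" for G
    proof -
      interpret typical_graph n a D G d \<tau> c1 \<kappa> ac \<delta>1
      proof unfold_locales
        show "4 \<le> a" using ar d2 by linarith
      qed (use n d1 tau c1 \<kappa>0 ac0 ar \<delta>1 D_def sb contr typG in auto)
      show ?thesis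
        unfolding good_def C_def K_def
        using mixing_typical[OF e1 e2 e3, of x] n x unfolding kaD k[symmetric] by blast
    qed
    have "1 - err n \<le> gnp_prob n (dd / real n) (typical n (c1 / d) (\<tau> * d) d (2 * ln (real n) / (\<kappa> * d)))"
      using gnp_typical unfolding err_def \<mu>_def by simp
    also have "\<dots> \<le> gnp_prob n (dd / real n) (good n)" by (rule gnp_prob_mono[OF p imp])
    finally show ?thesis using gnp_prob_le_1[OF p] by blast
  qed
  have "(\<lambda>n. gnp_prob n (dd / real n) (good n)) \<longlonglongrightarrow> 1"
  proof (rule tendsto_sandwich)
    show "\<forall>\<^sub>F n in sequentially. 1 - err n \<le> gnp_prob n (dd / real n) (good n)"
      using ev by eventually_elim (use main in blast)
    show "\<forall>\<^sub>F n in sequentially. gnp_prob n (dd / real n) (good n) \<le> 1"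
      using ev by eventually_elim (use main in blast)
    have "96 * 1 * exp (- \<mu>) \<le> 96 * d * exp (- \<mu>)" using d1 by (intro mult_right_mono) auto
    moreover have "96 * d * exp (- \<mu>) \<le> 1 / 4" using d4 by (simp add: \<mu>_def)
    ultimately have "2 * exp (- \<mu>) < 1" by linarith
    then have "(\<lambda>n. (2 * exp (- \<mu>)) ^ n) \<longlonglongrightarrow> 0" by (intro LIMSEQ_power_zero) simp
    moreover define c where "c = exp (10 * \<mu>) * 9 * d\<^sup>2 / 2"
    have "(\<lambda>n. 1 / real n + c / real n) \<longlonglongrightarrow> 0" by real_asymp
    ultimately have "(\<lambda>n. 1 - (1 / real n + c / real n + (2 * exp (- \<mu>)) ^ n)) \<longlonglongrightarrow> 1 - (0 + 0)"
      by (intro tendsto_diff tendsto_add tendsto_const)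
    then show "(\<lambda>n. 1 - err n) \<longlonglongrightarrow> 1" by (simp add: err_def c_def)
  qed simp
  then show ?thesis using C0 unfolding good_def by blast
qed

text \<open>With e = min \<epsilon> 1, the choice \<tau> = 1 + e / (2 * \<alpha>) leaves room on
  both sides: big vertices exceed the mean degree by a constant factor, yet \<tau> / \<rho> < 1 /
  \<alpha>. So y * exp y < 1 for y = \<tau> / \<rho>, and \<delta>1 is half of this gap. All
  conditions on d hold for large d; the decisive one compares an exponent of order ln d / sqrt d
  with 1 / ln d.\<close>

theorem theorem1p1:
  fixes \<alpha> :: real
  assumes "\<alpha> = exp (1 / \<alpha>)"
  shows "\<forall>\<epsilon>>0. \<exists>d0::real. \<forall>d>d0. \<forall>k::nat. real k \<ge> (\<alpha> + \<epsilon>) * d \<longrightarrow>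
           (\<exists>C>0. (\<lambda>n. gnp_prob n (d / real n)
                     (\<lambda>E. \<exists>T. mixing_time n E k = enat T \<and>
                             real T \<le> C * real n powr (2 + 1 / ln d)))
                   \<longlonglongrightarrow> 1)"
proof (intro allI impI)
  fix \<epsilon> :: real assume \<epsilon>: "0 < \<epsilon>"
  define e where "e = min \<epsilon> 1"
  have e: "0 < e" "e \<le> 1" "e \<le> \<epsilon>" using \<epsilon> by (auto simp: e_def)
  have \<alpha>0: "0 < \<alpha>" using assms by (metis exp_gt_zero)
  have "1 < exp (1 / \<alpha>)" using \<alpha>0 by simp
  then have \<alpha>1: "1 < \<alpha>" using assms by simp
  define \<tau> where "\<tau> = 1 + e / (2 * \<alpha>)"
  define \<rho> where "\<rho> = \<alpha> + e"
  define ac where "ac = \<rho> - \<tau>"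
  define y where "y = \<tau> / \<rho>"
  define \<delta>1 where "\<delta>1 = (1 - y * exp y) / 2"
  define c1 where "c1 = max 2 (2 / (\<delta>1 * ac))"
  define \<kappa> where "\<kappa> = (\<tau> - 1)\<^sup>2 / (256 * c1)"
  have small: "0 < e / (2 * \<alpha>)" "e / (2 * \<alpha>) < e" "e / (2 * \<alpha>) \<le> 1"
    using e \<alpha>1 by (auto simp: divide_less_eq divide_le_eq)
  have tau: "1 < \<tau>" "\<tau> \<le> 2" "\<tau> < \<rho>" using small e \<alpha>1 by (auto simp: \<tau>_def \<rho>_def)
  have \<rho>1: "1 < \<rho>" using tau by simp
  have ac0: "0 < ac" using tau by (simp add: ac_def)
  have y0: "0 < y" using tau by (simp add: y_def)
  have "y < 1 / \<alpha>"
  proof -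
    have "\<tau> * \<alpha> = \<alpha> + e / 2" using \<alpha>0 by (simp add: \<tau>_def field_simps)
    also have "\<dots> < \<rho>" using e by (simp add: \<rho>_def)
    finally show ?thesis using \<alpha>0 \<rho>1 by (simp add: y_def field_simps)
  qed
  then have "y * exp y < (1 / \<alpha>) * exp (1 / \<alpha>)" using y0 \<alpha>0 by (intro mult_strict_mono) auto
  also have "\<dots> = 1" using assms \<alpha>0 by simp
  finally have yy: "y * exp y < 1" .
  define w where "w = y * exp y"
  have "0 < w" "w < 1" using yy y0 by (auto simp: w_def)
  then have \<delta>1: "0 < \<delta>1" "\<delta>1 \<le> 1" by (auto simp: \<delta>1_def w_def[symmetric])
  have c1: "0 < c1" by (simp add: c1_def)
  have \<kappa>0: "0 < \<kappa>" using c1 tau by (simp add: \<kappa>_def)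
  define C1 where "C1 = 2 * (1 + 2 * \<tau> / (\<delta>1 * ac))"
  have "eventually (\<lambda>d. 1 < d \<and> 4 \<le> ac * d \<and> C1 \<le> ac * d
    \<and> (y + 1 / (ac * d)) * exp ((1 + 1 / (ac * d)) * y) < 1 - \<delta>1
    \<and> 96 * d * exp (- (\<kappa> * d)) \<le> 1 / 4
    \<and> 2 / (\<kappa> * d) \<le> 8 / sqrt d \<and> 2 * exp (- sqrt d) * (4 * d) ^ 3 \<le> exp (- (sqrt d / 2))
    \<and> 4 / (\<kappa> * sqrt d) \<le> 1
    \<and> 4 / (\<kappa> * sqrt d) + 8 * (3 * ln (7 * (\<rho> * d)) + 8 / ac) / sqrt d + 2 * (5 * ln (\<rho> * d) + 4 / ac) / (\<kappa> * d) \<le> 1 / ln d) at_top"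
  proof (intro eventually_conj)
    show "\<forall>\<^sub>F d::real in at_top. 1 < d" by real_asymp
    show "\<forall>\<^sub>F d in at_top. 4 \<le> ac * d" using ac0 by real_asymp
    show "\<forall>\<^sub>F d in at_top. C1 \<le> ac * d" using ac0 by real_asymp
    have "((\<lambda>d. (y + 1 / (ac * d)) * exp ((1 + 1 / (ac * d)) * y)) \<longlongrightarrow> y * exp y) at_top" using ac0 by real_asymp
    moreover have "y * exp y < 1 - \<delta>1" using \<open>w < 1\<close> by (simp add: \<delta>1_def w_def[symmetric] field_simps)
    ultimately show "\<forall>\<^sub>F d in at_top. (y + 1 / (ac * d)) * exp ((1 + 1 / (ac * d)) * y) < 1 - \<delta>1"
      by (rule order_tendstoD(2))
    show "\<forall>\<^sub>F d in at_top. 96 * d * exp (- (\<kappa> * d)) \<le> 1 / 4" using \<kappa>0 by real_asymp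
    show "\<forall>\<^sub>F d in at_top. 2 / (\<kappa> * d) \<le> 8 / sqrt d" using \<kappa>0 by real_asymp
    show "\<forall>\<^sub>F d::real in at_top. 2 * exp (- sqrt d) * (4 * d) ^ 3 \<le> exp (- (sqrt d / 2))" by real_asymp
    show "\<forall>\<^sub>F d in at_top. 4 / (\<kappa> * sqrt d) \<le> 1" using \<kappa>0 by real_asymp
    show "\<forall>\<^sub>F d in at_top. 4 / (\<kappa> * sqrt d) + 8 * (3 * ln (7 * (\<rho> * d)) + 8 / ac) / sqrt d + 2 * (5 * ln (\<rho> * d) + 4 / ac) / (\<kappa> * d) \<le> 1 / ln d"
      using \<kappa>0 ac0 \<rho>1 by real_asymp
  qed
  then obtain d0 where d0: "\<And>d. d0 \<le> d \<Longrightarrow> 1 < d \<and> 4 \<le> ac * d \<and> C1 \<le> ac * d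
    \<and> (y + 1 / (ac * d)) * exp ((1 + 1 / (ac * d)) * y) < 1 - \<delta>1
    \<and> 96 * d * exp (- (\<kappa> * d)) \<le> 1 / 4
    \<and> 2 / (\<kappa> * d) \<le> 8 / sqrt d \<and> 2 * exp (- sqrt d) * (4 * d) ^ 3 \<le> exp (- (sqrt d / 2))
    \<and> 4 / (\<kappa> * sqrt d) \<le> 1
    \<and> 4 / (\<kappa> * sqrt d) + 8 * (3 * ln (7 * (\<rho> * d)) + 8 / ac) / sqrt d + 2 * (5 * ln (\<rho> * d) + 4 / ac) / (\<kappa> * d) \<le> 1 / ln d"
    unfolding eventually_at_top_linorder by blast
  show "\<exists>d0::real. \<forall>d>d0. \<forall>k::nat. real k \<ge> (\<alpha> + \<epsilon>) * d \<longrightarrow>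
           (\<exists>C>0. (\<lambda>n. gnp_prob n (d / real n)
                     (\<lambda>E. \<exists>T. mixing_time n E k = enat T \<and>
                             real T \<le> C * real n powr (2 + 1 / ln d)))
                   \<longlonglongrightarrow> 1)"
  proof (rule exI[of _ d0], intro allI impI)
    fix d :: real and k :: nat
    assume d: "d0 < d" and k: "(\<alpha> + \<epsilon>) * d \<le> real k"
    have d1: "1 < d" using d0[of d] d by auto
    \<comment> \<open>Colours beyond \<rho> * d are turned into a larger reference degree. As 1 / ln
      is decreasing, the exponent obtained for \<open>d'\<close> also serves for
      \<open>d\<close>.\<close>
    define d' where "d' = real k / \<rho>"
    have "\<rho> * d \<le> (\<alpha> + \<epsilon>) * d" using e d1 by (intro mult_right_mono) (auto simp: \<rho>_def)
    then have dd: "d \<le> d'" using k \<rho>1 by (simp add: d'_def field_simps)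
    have kd: "real k = \<rho> * d'" using \<rho>1 by (simp add: d'_def)
    note D = d0[of d', unfolded y_def C1_def]
    have lnd: "1 / ln d' \<le> 1 / ln d" using dd d1 by (intro divide_left_mono) auto
    show "\<exists>C>0. (\<lambda>n. gnp_prob n (d / real n)
                     (\<lambda>E. \<exists>T. mixing_time n E k = enat T \<and>
                             real T \<le> C * real n powr (2 + 1 / ln d)))
                   \<longlonglongrightarrow> 1"
      using D dd d d1 lnd
      by (intro whp_mixing[OF tau \<delta>1 kd, folded ac_def, folded c1_def, folded \<kappa>_def]) auto
  qed
qed

end
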